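(* Restriction of scalars along the colax monad morphism $(\mathrm{Dom},\kappa)$ and the comparison isomorphism $\Gamma_{\mathrm n}\colon\mathbf{NClCoFib}\cong\mathbf{PsAlg}_{\mathrm n}(\mathbb C)$ determine a 2-functor $$\mathsf{Fact}_{\mathrm n}:=\kappa^*_{\mathrm{ps}}\Gamma_{\mathrm n}\colon\mathbf{NClCoFib}\longrightarrow\mathbf{PsAlg}_{\mathrm n}(\mathbb S).$$ For a normally cloven cofibration $P\colon E\to B$, its action is $F^P=L^P\kappa_P\colon E^{\mathbf 2}\to E$. It sends $f\colon x\to y$ to $(Pf)_!x$ and selects the normalized factorization $$x\xrightarrow{\ \delta^x_{Pf}\ }(Pf)_!x\xrightarrow{\ \nu_f\ }y,\qquad f=\nu_f\,\delta^x_{Pf}.$$ Under the isomorphism $\mathbf{PsAlg}_{\mathrm n}(\mathbb S)\cong\mathbf{OFS}_{\mathrm{ch}}$, this pseudoalgebra is the orthogonal factorization system $$\bigl(\mathrm{CoCart}(P),\,P^{-1}\mathrm{Iso}(B)\bigr)$$ equipped with the chosen factorizations just displayed. On a 1-cell $(T,S)\colon P\to Q$ of $\mathbf{NClCoFib}$, the pseudomorphism comparison at $f\colon x\to y$ is the unique vertical isomorphism $$\theta_f\colon(Q(Tf))_!Tx=(S(Pf))_!Tx\xrightarrow{\ \cong\ }T((Pf)_!x)$$ satisfying $\theta_f\,\delta^{Tx}_{Q(Tf)}=T\delta^x_{Pf}$. The 2-functor $\kappa^*\Gamma\colon\mathbf{SCoFib}\to\mathbf{Alg}_{\mathrm s}(\mathbb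 C)\to\mathbf{Alg}_{\mathrm s}(\mathbb S)$ is the restriction of this construction to split cleavages and strictly cleavage-preserving squares.
   Context: **Arrow 2-category.** $\mathbf{CAT}$ is the strict 2-category of locally small categories, functors and natural transformations. $\mathbf{CAT}^{\mathbf 2}$ is the strict arrow 2-category: objects are functors $P\colon E\to B$; a 1-cell (square) $(T,S)\colon P\to Q$, with $Q\colon F\to C$, is a pair of functors with $QT=SP$; a 2-cell $(\beta,\alpha)\colon(T,S)\Rightarrow(T',S')$ is a pair of natural transformations with $Q\beta=\alpha P$. $\mathrm{Dom}\colon\mathbf{CAT}^{\mathbf 2}\to\mathbf{CAT}$ is evaluation at the total category. **Cofibrations.** For $P\colon E\to B$, an arrow $e\colon x\to y$ of $E$ is $P$-cocartesian if for all $g\colon x\to z$ and $v\colon Py\to Pz$ with $Pg=v\,Pe$ there is a unique $h\colon y\to z$ with $he=g$, $Ph=v$; $\mathrm{CoCart}(P)$ is the class of these. $f$ is vertical if $Pf$ is an identity. $P^{-1}\mathrm{Iso}(B)$ is the class of arrows $f$ with $Pf$ invertible. A cleavage chooses, for each $x\in E$ and $u\colon Px\to b$, a $P$-cocartesian arrow $\delta^x_u\colon x\to u_!x$ over $u$; it is normal if $\delta^x_{1_{Px}}=1_x$, and split if moreover $(vu)_!=v_!u_!$ (as functors between fibres, where $u_!f$ is the vertical arrow with $(u_!f)\delta^x_u=\delta^y_uf$) and $\delta^x_{vu}=\delta^{u_!x}_v\delta^x_u$. $\nu_f$ is the unique vertical arrow with $\nu_f\delta^x_{Pf}=f$. $\mathbf{NClCoFib}$: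 normally cloven cofibrations, squares whose total functor preserves cocartesian arrows, all 2-cells of $\mathbf{CAT}^{\mathbf 2}$. $\mathbf{SCoFib}$: split cofibrations, squares with $T\delta^x_u=\delta^{Tx}_{Su}$ (strictly cleavage-preserving), all 2-cells. **Algebras.** For a strict 2-monad $\mathbb T=(\mathbb T,\eta,\mu)$: $\mathbf{Alg}_{\mathrm s}(\mathbb T)$ has strict algebras $a\colon\mathbb TX\to X$ ($a\eta_X=1$, $a\mu_X=a\,\mathbb Ta$), strict morphisms ($fa=b\,\mathbb Tf$), 2-cells with $\alpha a=b\,\mathbb T\alpha$. A normal pseudoalgebra is $a\colon\mathbb TX\to X$ with $a\eta_X=1_X$ and an invertible $\chi\colon a\,\mathbb Ta\Rightarrow a\mu_X$ with $\chi\,\mathbb T\eta_X=1_a=\chi\,\eta_{\mathbb TX}$ and $(\chi\,\mathbb T\mu_X)(a\,\mathbb T\chi)=(\chi\,\mu_{\mathbb TX})(\chi\,\mathbb T^2a)$. A pseudomorphism $(X,a,\chi^a)\to(Y,b,\chi^b)$ is $f$ with invertible comparison $\overline f\colon b\,\mathbb Tf\Rightarrow fa$ such that $\overline f\,\eta_X=1_f$ and $(\overline f\,\mu_X)(\chi^b\,\mathbb T^2f)=(f\chi^a)(\overline f\,\mathbb Ta)(b\,\mathbb T\overline f)$. An algebra transformation $\alpha\colon(f,\overline f)\Rightarrow(g,\overline g)$ satisfies $(\alpha a)\overline f=\overline g(b\,\mathbb T\alpha)$. These form $\mathbf{PsAlg}_{\mathrm n}(\mathbb T)$. **Comma 2-monad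 $\mathbb C$ on $\mathbf{CAT}^{\mathbf 2}$.** $P\downarrow B$ has objects $(x,u)$, $u\colon Px\to b$; arrows $(f,v)\colon(x,u)\to(y,w)$ with $vu=w\,Pf$. $\mathbb CP=\mathrm{Cod}_P\colon P\downarrow B\to B$, $(x,u)\mapsto b$, $(f,v)\mapsto v$; $\mathbb C(T,S)=(\overline T,S)$, $\overline T(x,u)=(Tx,Su)$, $\overline T(f,v)=(Tf,Sv)$; $\mathbb C(\beta,\alpha)=(\overline\beta,\alpha)$, $\overline\beta_{(x,u)}=(\beta_x,\alpha_b)$; unit $(H^P,1_B)$, $H^Px=(x,1_{Px})$, $H^Pf=(f,Pf)$; multiplication $(M^P,1_B)$, $M^P((x,u),v)=(x,vu)$, $M^P((f,r),s)=(f,s)$. $L^P\colon P\downarrow B\to E$ is the unique functor with $L^P(x,u)=u_!x$, $PL^P=\mathrm{Cod}_P$, $L^P(f,v)\delta^x_u=\delta^y_wf$. $\Gamma_{\mathrm n}$ sends $P$ to the action $(L^P,1_B)$ with multiplication cell the unique vertical isomorphisms $\chi^x_{v,u}\colon v_!u_!x\to(vu)_!x$ with $\chi^x_{v,u}\delta^{u_!x}_v\delta^x_u=\delta^x_{vu}$, and a square $(T,S)$ to the pseudomorphism with comparison the unique vertical isomorphisms $\theta_{x,u}\colon(Su)_!Tx\to T(u_!x)$ with $\theta_{x,u}\delta^{Tx}_{Su}=T\delta^x_u$. $\Gamma\colon\mathbf{SCoFib}\cong\mathbf{Alg}_{\mathrm s}(\mathbb C)$ sends $P$ to $(P,L^P)$.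 **Squaring 2-monad $\mathbb S$ on $\mathbf{CAT}$.** $\mathbb SE=E^{\mathbf 2}$ (arrows $(r,s)\colon f\to g$ are commutative squares $sf=gr$); unit $I_E$, $x\mapsto1_x$; multiplication $m_E$ sends a square to its diagonal (and a morphism of squares to its components at the initial and terminal vertices). The factors selected by a normal pseudo-$\mathbb S$-algebra $F$ at $f\colon x\to y$ are $e_f=F(1_x,f)$, $m_f=F(f,1_y)$, $f=m_fe_f$. $\mathbf{OFS}_{\mathrm{ch}}$: orthogonal factorization systems with chosen factorizations such that identities are factored as identity–identity ("normalized"); 1-cells are functors preserving both classes; 2-cells are natural transformations. The (known, Korostenski–Tholen) isomorphism $\mathbf{PsAlg}_{\mathrm n}(\mathbb S)\cong\mathbf{OFS}_{\mathrm{ch}}$ sends $F$ to the system with left class $\{f\mid m_f\text{ invertible}\}$, right class $\{f\mid e_f\text{ invertible}\}$, chosen factorizations $f=m_fe_f$. An orthogonal factorization system is a pair of classes closed under composition with isomorphisms, with (left, right)-factorizations of every arrow and unique diagonals for squares from a left-class arrow to a right-class arrow. **Restriction along $\kappa$.** $\kappa\colon\mathbb S\,\mathrm{Dom}\Rightarrow\mathrm{Dom}\,\mathbb C$ has components $\kappa_P\colon E^{\mathbf 2}\to P\downarrow B$, $\kappa_P(f\colon x\to y)=(x,Pf)$, $\kappa_P(r,s)=(r,Ps)$; it is a colax monad morphism: $\kappa_PI_E=H^P$, $\kappa_Pm_E=M^P\kappa_{\mathbb CP}(\kappa_P)^{\mathbf 2}$. $\kappa^*_{\mathrm{ps}}$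 sends an action $A$ to $A\kappa_P$, its multiplication cell $\chi$ to $\chi\,\kappa_{\mathbb CP}(\kappa_P)^{\mathbf 2}$, a pseudomorphism comparison $\theta$ to $\theta\kappa_P$ and a 2-cell $(\beta,\alpha)$ to $\beta$; $\kappa^*$ is its strict version. *)

theory Defs
  imports Main "HOL-Library.FuncSet"
begin

section \<open>Strict 2-categories\<close>

text \<open>Cells carry their boundary, so that equality of cells includes equality of sources and
  targets.  A 1-cell is a cell between 0-cells, a 2-cell is a cell between 1-cells.\<close>

datatype ('x, 'd) cell = Cell (src: 'x) (tgt: 'x) (dat: 'd)

type_synonym ('o, 'm, 'c) cell2 = "(('o, 'm) cell, 'c) cell"

text \<open>In \<open>comp1 K g f\<close>, \<open>vcomp K \<beta> \<alpha>\<close> and \<open>hcomp K \<beta> \<alpha>\<close> the last argument is applied first.\<close>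

record ('o, 'm, 'c) twocat =
  cells0 :: "'o set"
  cells1 :: "('o, 'm) cell set"
  cells2 :: "('o, 'm, 'c) cell2 set"
  id1 :: "'o \<Rightarrow> ('o, 'm) cell"
  comp1 :: "('o, 'm) cell \<Rightarrow> ('o, 'm) cell \<Rightarrow> ('o, 'm) cell"
  id2 :: "('o, 'm) cell \<Rightarrow> ('o, 'm, 'c) cell2"
  vcomp :: "('o, 'm, 'c) cell2 \<Rightarrow> ('o, 'm, 'c) cell2 \<Rightarrow> ('o, 'm, 'c) cell2"
  hcomp :: "('o, 'm, 'c) cell2 \<Rightarrow> ('o, 'm, 'c) cell2 \<Rightarrow> ('o, 'm, 'c) cell2"

definition strict_2_category :: "('o, 'm, 'c) twocat \<Rightarrow> bool" where
  "strict_2_category K \<longleftrightarrow>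
    (\<forall>f\<in>cells1 K. src f \<in> cells0 K \<and> tgt f \<in> cells0 K) \<and>
    (\<forall>x\<in>cells0 K. id1 K x \<in> cells1 K \<and> src (id1 K x) = x \<and> tgt (id1 K x) = x) \<and>
    (\<forall>f\<in>cells1 K. \<forall>g\<in>cells1 K. tgt f = src g \<longrightarrow>
       comp1 K g f \<in> cells1 K \<and> src (comp1 K g f) = src f \<and> tgt (comp1 K g f) = tgt g) \<and>
    (\<forall>f\<in>cells1 K. comp1 K f (id1 K (src f)) = f \<and> comp1 K (id1 K (tgt f)) f = f) \<and>
    (\<forall>f\<in>cells1 K. \<forall>g\<in>cells1 K. \<forall>h\<in>cells1 K. tgt f = src g \<and> tgt g = src h \<longrightarrow>
       comp1 K h (comp1 K g f) = comp1 K (comp1 K h g) f) \<and>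
    (\<forall>\<alpha>\<in>cells2 K. src \<alpha> \<in> cells1 K \<and> tgt \<alpha> \<in> cells1 K \<and>
       src (src \<alpha>) = src (tgt \<alpha>) \<and> tgt (src \<alpha>) = tgt (tgt \<alpha>)) \<and>
    (\<forall>f\<in>cells1 K. id2 K f \<in> cells2 K \<and> src (id2 K f) = f \<and> tgt (id2 K f) = f) \<and>
    (\<forall>\<alpha>\<in>cells2 K. \<forall>\<beta>\<in>cells2 K. tgt \<alpha> = src \<beta> \<longrightarrow>
       vcomp K \<beta> \<alpha> \<in> cells2 K \<and> src (vcomp K \<beta> \<alpha>) = src \<alpha> \<and> tgt (vcomp K \<beta> \<alpha>) = tgt \<beta>) \<and>
    (\<forall>\<alpha>\<in>cells2 K. vcomp K \<alpha> (id2 K (src \<alpha>)) = \<alpha> \<and> vcomp K (id2 K (tgt \<alpha>)) \<alpha> = \<alpha>) \<and>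
    (\<forall>\<alpha>\<in>cells2 K. \<forall>\<beta>\<in>cells2 K. \<forall>\<gamma>\<in>cells2 K. tgt \<alpha> = src \<beta> \<and> tgt \<beta> = src \<gamma> \<longrightarrow>
       vcomp K \<gamma> (vcomp K \<beta> \<alpha>) = vcomp K (vcomp K \<gamma> \<beta>) \<alpha>) \<and>
    (\<forall>\<alpha>\<in>cells2 K. \<forall>\<beta>\<in>cells2 K. tgt (src \<alpha>) = src (src \<beta>) \<longrightarrow>
       hcomp K \<beta> \<alpha> \<in> cells2 K \<and>
       src (hcomp K \<beta> \<alpha>) = comp1 K (src \<beta>) (src \<alpha>) \<and>
       tgt (hcomp K \<beta> \<alpha>) = comp1 K (tgt \<beta>) (tgt \<alpha>)) \<and>
    (\<forall>\<alpha>\<in>cells2 K. hcomp K \<alpha> (id2 K (id1 K (src (src \<alpha>)))) = \<alpha> \<and>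
       hcomp K (id2 K (id1 K (tgt (src \<alpha>)))) \<alpha> = \<alpha>) \<and>
    (\<forall>\<alpha>\<in>cells2 K. \<forall>\<beta>\<in>cells2 K. \<forall>\<gamma>\<in>cells2 K.
       tgt (src \<alpha>) = src (src \<beta>) \<and> tgt (src \<beta>) = src (src \<gamma>) \<longrightarrow>
       hcomp K \<gamma> (hcomp K \<beta> \<alpha>) = hcomp K (hcomp K \<gamma> \<beta>) \<alpha>) \<and>
    (\<forall>f\<in>cells1 K. \<forall>g\<in>cells1 K. tgt f = src g \<longrightarrow>
       hcomp K (id2 K g) (id2 K f) = id2 K (comp1 K g f)) \<and>
    (\<forall>\<alpha>\<in>cells2 K. \<forall>\<alpha>'\<in>cells2 K. \<forall>\<beta>\<in>cells2 K. \<forall>\<beta>'\<in>cells2 K.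
       tgt \<alpha> = src \<alpha>' \<and> tgt \<beta> = src \<beta>' \<and> tgt (src \<alpha>) = src (src \<beta>) \<longrightarrow>
       hcomp K (vcomp K \<beta>' \<beta>) (vcomp K \<alpha>' \<alpha>) = vcomp K (hcomp K \<beta>' \<alpha>') (hcomp K \<beta> \<alpha>))"

definition whisk_l :: "('o, 'm, 'c) twocat \<Rightarrow> ('o, 'm) cell \<Rightarrow> ('o, 'm, 'c) cell2 \<Rightarrow> ('o, 'm, 'c) cell2" where
  "whisk_l K g \<alpha> = hcomp K (id2 K g) \<alpha>"

definition whisk_r :: "('o, 'm, 'c) twocat \<Rightarrow> ('o, 'm, 'c) cell2 \<Rightarrow> ('o, 'm) cell \<Rightarrow> ('o, 'm, 'c) cell2" where
  "whisk_r K \<alpha> f = hcomp K \<alpha> (id2 K f)"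

definition invertible2 :: "('o, 'm, 'c) twocat \<Rightarrow> ('o, 'm, 'c) cell2 \<Rightarrow> bool" where
  "invertible2 K \<alpha> \<longleftrightarrow> \<alpha> \<in> cells2 K \<and>
    (\<exists>\<beta>\<in>cells2 K. src \<beta> = tgt \<alpha> \<and> tgt \<beta> = src \<alpha> \<and>
       vcomp K \<beta> \<alpha> = id2 K (src \<alpha>) \<and> vcomp K \<alpha> \<beta> = id2 K (tgt \<alpha>))"

datatype ('o, 'm, 'c, 'p, 'n, 'd) twofun =
  TwoFun (map0: "'o \<Rightarrow> 'p")
         (map1: "('o, 'm) cell \<Rightarrow> ('p, 'n) cell")
         (map2: "('o, 'm, 'c) cell2 \<Rightarrow> ('p, 'n, 'd) cell2")

definition two_functor ::
  "('o, 'm, 'c) twocat \<Rightarrow> ('p, 'n, 'd) twocat \<Rightarrow> ('o, 'm, 'c, 'p, 'n, 'd) twofun \<Rightarrow> bool" where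
  "two_functor K L \<Phi> \<longleftrightarrow>
    strict_2_category K \<and> strict_2_category L \<and>
    (\<forall>x\<in>cells0 K. map0 \<Phi> x \<in> cells0 L) \<and>
    (\<forall>f\<in>cells1 K. map1 \<Phi> f \<in> cells1 L \<and>
       src (map1 \<Phi> f) = map0 \<Phi> (src f) \<and> tgt (map1 \<Phi> f) = map0 \<Phi> (tgt f)) \<and>
    (\<forall>\<alpha>\<in>cells2 K. map2 \<Phi> \<alpha> \<in> cells2 L \<and>
       src (map2 \<Phi> \<alpha>) = map1 \<Phi> (src \<alpha>) \<and> tgt (map2 \<Phi> \<alpha>) = map1 \<Phi> (tgt \<alpha>)) \<and>
    (\<forall>x\<in>cells0 K. map1 \<Phi> (id1 K x) = id1 L (map0 \<Phi> x)) \<and>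
    (\<forall>f\<in>cells1 K. \<forall>g\<in>cells1 K. tgt f = src g \<longrightarrow>
       map1 \<Phi> (comp1 K g f) = comp1 L (map1 \<Phi> g) (map1 \<Phi> f)) \<and>
    (\<forall>f\<in>cells1 K. map2 \<Phi> (id2 K f) = id2 L (map1 \<Phi> f)) \<and>
    (\<forall>\<alpha>\<in>cells2 K. \<forall>\<beta>\<in>cells2 K. tgt \<alpha> = src \<beta> \<longrightarrow>
       map2 \<Phi> (vcomp K \<beta> \<alpha>) = vcomp L (map2 \<Phi> \<beta>) (map2 \<Phi> \<alpha>)) \<and>
    (\<forall>\<alpha>\<in>cells2 K. \<forall>\<beta>\<in>cells2 K. tgt (src \<alpha>) = src (src \<beta>) \<longrightarrow>
       map2 \<Phi> (hcomp K \<beta> \<alpha>) = hcomp L (map2 \<Phi> \<beta>) (map2 \<Phi> \<alpha>))"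

definition two_isomorphism ::
  "('o, 'm, 'c) twocat \<Rightarrow> ('p, 'n, 'd) twocat \<Rightarrow> ('o, 'm, 'c, 'p, 'n, 'd) twofun \<Rightarrow> bool" where
  "two_isomorphism K L \<Phi> \<longleftrightarrow> two_functor K L \<Phi> \<and>
    bij_betw (map0 \<Phi>) (cells0 K) (cells0 L) \<and>
    bij_betw (map1 \<Phi>) (cells1 K) (cells1 L) \<and>
    bij_betw (map2 \<Phi>) (cells2 K) (cells2 L)"

definition twofun_id :: "('o, 'm, 'c, 'o, 'm, 'c) twofun" where
  "twofun_id = TwoFun (\<lambda>x. x) (\<lambda>f. f) (\<lambda>\<alpha>. \<alpha>)"

definition twofun_comp ::
  "('p, 'n, 'd, 'q, 'k, 'e) twofun \<Rightarrow> ('o, 'm, 'c, 'p, 'n, 'd) twofun \<Rightarrow> ('o, 'm, 'c, 'q, 'k, 'e) twofun" where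
  "twofun_comp \<Psi> \<Phi> =
    TwoFun (\<lambda>x. map0 \<Psi> (map0 \<Phi> x)) (\<lambda>f. map1 \<Psi> (map1 \<Phi> f)) (\<lambda>\<alpha>. map2 \<Psi> (map2 \<Phi> \<alpha>))"

definition two_natural ::
  "('o, 'm, 'c) twocat \<Rightarrow> ('p, 'n, 'd) twocat \<Rightarrow> ('o, 'm, 'c, 'p, 'n, 'd) twofun \<Rightarrow>
   ('o, 'm, 'c, 'p, 'n, 'd) twofun \<Rightarrow> ('o \<Rightarrow> ('p, 'n) cell) \<Rightarrow> bool" where
  "two_natural K L \<Phi> \<Psi> t \<longleftrightarrow>
    two_functor K L \<Phi> \<and> two_functor K L \<Psi> \<and>
    (\<forall>x\<in>cells0 K. t x \<in> cells1 L \<and> src (t x) = map0 \<Phi> x \<and> tgt (t x) = map0 \<Psi> x) \<and>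
    (\<forall>f\<in>cells1 K. comp1 L (map1 \<Psi> f) (t (src f)) = comp1 L (t (tgt f)) (map1 \<Phi> f)) \<and>
    (\<forall>\<alpha>\<in>cells2 K. whisk_r L (map2 \<Psi> \<alpha>) (t (src (src \<alpha>))) =
       whisk_l L (t (tgt (src \<alpha>))) (map2 \<Phi> \<alpha>))"

text \<open>A 2-category of structured objects over \<open>K\<close>: 0-cells are the \<open>X \<in> Ob\<close>, with underlying
  0-cell \<open>U X\<close>; 1-cells and 2-cells are cells of \<open>K\<close> satisfying the conditions \<open>\<Phi>\<close> and \<open>\<Psi>\<close>.\<close>

definition structured ::
  "('o, 'm, 'c) twocat \<Rightarrow> 'x set \<Rightarrow> ('x \<Rightarrow> 'o) \<Rightarrow> ('x \<Rightarrow> 'x \<Rightarrow> ('o, 'm) cell \<Rightarrow> bool) \<Rightarrow>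
   ('x \<Rightarrow> 'x \<Rightarrow> ('o, 'm, 'c) cell2 \<Rightarrow> bool) \<Rightarrow>
   ('x, ('o, 'm) cell, ('o, 'm, 'c) cell2) twocat" where
  "structured K Ob U \<Phi> \<Psi> =
    (let hom1 = {Cell X Y f | X Y f. X \<in> Ob \<and> Y \<in> Ob \<and> f \<in> cells1 K \<and>
                   src f = U X \<and> tgt f = U Y \<and> \<Phi> X Y f};
         c1 = (\<lambda>g f. Cell (src f) (tgt g) (comp1 K (dat g) (dat f)))
     in \<lparr> cells0 = Ob,
          cells1 = hom1,
          cells2 = {Cell f g \<alpha> | f g \<alpha>. f \<in> hom1 \<and> g \<in> hom1 \<and> src f = src g \<and> tgt f = tgt g \<and>
                      \<alpha> \<in> cells2 K \<and> src \<alpha> = dat f \<and> tgt \<alpha> = dat g \<and> \<Psi> (src f) (tgt f) \<alpha>},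
          id1 = (\<lambda>X. Cell X X (id1 K (U X))),
          comp1 = c1,
          id2 = (\<lambda>f. Cell f f (id2 K (dat f))),
          vcomp = (\<lambda>\<beta> \<alpha>. Cell (src \<alpha>) (tgt \<beta>) (vcomp K (dat \<beta>) (dat \<alpha>))),
          hcomp = (\<lambda>\<beta> \<alpha>. Cell (c1 (src \<beta>) (src \<alpha>)) (c1 (tgt \<beta>) (tgt \<alpha>))
                               (hcomp K (dat \<beta>) (dat \<alpha>))) \<rparr>)"

section \<open>The arrow 2-category\<close>

definition top1 :: "('x, 'm \<times> 'm) cell \<Rightarrow> 'm" where "top1 s = fst (dat s)"
definition bot1 :: "('x, 'm \<times> 'm) cell \<Rightarrow> 'm" where "bot1 s = snd (dat s)"

definition arrow_squares ::
  "('o, 'm, 'c) twocat \<Rightarrow> (('o, 'm) cell, ('o, 'm) cell \<times> ('o, 'm) cell) cell set" where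
  "arrow_squares K = {Cell P Q (T, S) | P Q T S.
     P \<in> cells1 K \<and> Q \<in> cells1 K \<and> T \<in> cells1 K \<and> S \<in> cells1 K \<and>
     src T = src P \<and> tgt T = src Q \<and> src S = tgt P \<and> tgt S = tgt Q \<and>
     comp1 K Q T = comp1 K S P}"

definition arrow2 ::
  "('o, 'm, 'c) twocat \<Rightarrow>
   (('o, 'm) cell, ('o, 'm) cell \<times> ('o, 'm) cell, ('o, 'm, 'c) cell2 \<times> ('o, 'm, 'c) cell2) twocat" where
  "arrow2 K =
    (let c1 = (\<lambda>t s. Cell (src s) (tgt t) (comp1 K (top1 t) (top1 s), comp1 K (bot1 t) (bot1 s)))
     in \<lparr> cells0 = cells1 K,
          cells1 = arrow_squares K,
          cells2 = {Cell s t (\<beta>, \<alpha>) | s t \<beta> \<alpha>.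
             s \<in> arrow_squares K \<and> t \<in> arrow_squares K \<and> src s = src t \<and> tgt s = tgt t \<and>
             \<beta> \<in> cells2 K \<and> \<alpha> \<in> cells2 K \<and>
             src \<beta> = top1 s \<and> tgt \<beta> = top1 t \<and> src \<alpha> = bot1 s \<and> tgt \<alpha> = bot1 t \<and>
             whisk_l K (tgt s) \<beta> = whisk_r K \<alpha> (src s)},
          id1 = (\<lambda>P. Cell P P (id1 K (src P), id1 K (tgt P))),
          comp1 = c1,
          id2 = (\<lambda>s. Cell s s (id2 K (top1 s), id2 K (bot1 s))),
          vcomp = (\<lambda>\<tau> \<sigma>. Cell (src \<sigma>) (tgt \<tau>)
             (vcomp K (top1 \<tau>) (top1 \<sigma>), vcomp K (bot1 \<tau>) (bot1 \<sigma>))),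
          hcomp = (\<lambda>\<tau> \<sigma>. Cell (c1 (src \<tau>) (src \<sigma>)) (c1 (tgt \<tau>) (tgt \<sigma>))
             (hcomp K (top1 \<tau>) (top1 \<sigma>), hcomp K (bot1 \<tau>) (bot1 \<sigma>))) \<rparr>)"

section \<open>2-monads and their algebras\<close>

datatype ('o, 'm, 'c) twomonad =
  TwoMonad (mfun: "('o, 'm, 'c, 'o, 'm, 'c) twofun")
           (munit: "'o \<Rightarrow> ('o, 'm) cell")
           (mmult: "'o \<Rightarrow> ('o, 'm) cell")

definition two_monad :: "('o, 'm, 'c) twocat \<Rightarrow> ('o, 'm, 'c) twomonad \<Rightarrow> bool" where
  "two_monad K M \<longleftrightarrow>
    (let T = mfun M; \<eta> = munit M; \<mu> = mmult M in
      two_functor K K T \<and>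
      two_natural K K twofun_id T \<eta> \<and>
      two_natural K K (twofun_comp T T) T \<mu> \<and>
      (\<forall>X\<in>cells0 K.
         comp1 K (\<mu> X) (\<eta> (map0 T X)) = id1 K (map0 T X) \<and>
         comp1 K (\<mu> X) (map1 T (\<eta> X)) = id1 K (map0 T X) \<and>
         comp1 K (\<mu> X) (\<mu> (map0 T X)) = comp1 K (\<mu> X) (map1 T (\<mu> X))))"

type_synonym ('o, 'm) alg = "'o \<times> ('o, 'm) cell"

definition strict_algebra :: "('o, 'm, 'c) twocat \<Rightarrow> ('o, 'm, 'c) twomonad \<Rightarrow> ('o, 'm) alg \<Rightarrow> bool" where
  "strict_algebra K M A \<longleftrightarrow>
    (case A of (X, a) \<Rightarrow>
      X \<in> cells0 K \<and> a \<in> cells1 K \<and> src a = map0 (mfun M) X \<and> tgt a = X \<and>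
      comp1 K a (munit M X) = id1 K X \<and>
      comp1 K a (mmult M X) = comp1 K a (map1 (mfun M) a))"

definition Algs ::
  "('o, 'm, 'c) twocat \<Rightarrow> ('o, 'm, 'c) twomonad \<Rightarrow>
   (('o, 'm) alg, ('o, 'm) cell, ('o, 'm, 'c) cell2) twocat" where
  "Algs K M = structured K {A. strict_algebra K M A} fst
     (\<lambda>A B f. comp1 K f (snd A) = comp1 K (snd B) (map1 (mfun M) f))
     (\<lambda>A B \<alpha>. whisk_r K \<alpha> (snd A) = whisk_l K (snd B) (map2 (mfun M) \<alpha>))"

datatype ('o, 'm, 'c) psalg =
  PsAlg (ps_car: 'o) (ps_act: "('o, 'm) cell") (ps_mul: "('o, 'm, 'c) cell2")

definition normal_pseudoalgebra ::
  "('o, 'm, 'c) twocat \<Rightarrow> ('o, 'm, 'c) twomonad \<Rightarrow> ('o, 'm, 'c) psalg \<Rightarrow> bool" where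
  "normal_pseudoalgebra K M A \<longleftrightarrow>
    (let T = mfun M; \<eta> = munit M; \<mu> = mmult M; X = ps_car A; a = ps_act A; \<chi> = ps_mul A in
      X \<in> cells0 K \<and> a \<in> cells1 K \<and> src a = map0 T X \<and> tgt a = X \<and>
      comp1 K a (\<eta> X) = id1 K X \<and>
      invertible2 K \<chi> \<and> src \<chi> = comp1 K a (map1 T a) \<and> tgt \<chi> = comp1 K a (\<mu> X) \<and>
      whisk_r K \<chi> (map1 T (\<eta> X)) = id2 K a \<and>
      whisk_r K \<chi> (\<eta> (map0 T X)) = id2 K a \<and>
      vcomp K (whisk_r K \<chi> (map1 T (\<mu> X))) (whisk_l K a (map2 T \<chi>)) =
        vcomp K (whisk_r K \<chi> (\<mu> (map0 T X))) (whisk_r K \<chi> (map1 T (map1 T a))))"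

text \<open>The data of a pseudomorphism is the pair of its underlying 1-cell and its comparison 2-cell.\<close>

definition pseudomorphism ::
  "('o, 'm, 'c) twocat \<Rightarrow> ('o, 'm, 'c) twomonad \<Rightarrow>
   (('o, 'm, 'c) psalg, ('o, 'm) cell \<times> ('o, 'm, 'c) cell2) cell \<Rightarrow> bool" where
  "pseudomorphism K M F \<longleftrightarrow>
    (let T = mfun M; \<eta> = munit M; \<mu> = mmult M;
         X = ps_car (src F); a = ps_act (src F); \<chi>a = ps_mul (src F);
         Y = ps_car (tgt F); b = ps_act (tgt F); \<chi>b = ps_mul (tgt F);
         f = fst (dat F); f' = snd (dat F) in
      normal_pseudoalgebra K M (src F) \<and> normal_pseudoalgebra K M (tgt F) \<and>
      f \<in> cells1 K \<and> src f = X \<and> tgt f = Y \<and>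
      invertible2 K f' \<and> src f' = comp1 K b (map1 T f) \<and> tgt f' = comp1 K f a \<and>
      whisk_r K f' (\<eta> X) = id2 K f \<and>
      vcomp K (whisk_r K f' (\<mu> X)) (whisk_r K \<chi>b (map1 T (map1 T f))) =
        vcomp K (whisk_l K f \<chi>a)
          (vcomp K (whisk_r K f' (map1 T a)) (whisk_l K b (map2 T f'))))"

definition algebra_transformation ::
  "('o, 'm, 'c) twocat \<Rightarrow> ('o, 'm, 'c) twomonad \<Rightarrow>
   (('o, 'm, 'c) psalg, ('o, 'm) cell \<times> ('o, 'm, 'c) cell2, ('o, 'm, 'c) cell2) cell2 \<Rightarrow> bool" where
  "algebra_transformation K M A \<longleftrightarrow>
    (let F = src A; G = tgt A; \<alpha> = dat A in
      pseudomorphism K M F \<and> pseudomorphism K M G \<and> src F = src G \<and> tgt F = tgt G \<and>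
      \<alpha> \<in> cells2 K \<and> src \<alpha> = fst (dat F) \<and> tgt \<alpha> = fst (dat G) \<and>
      vcomp K (whisk_r K \<alpha> (ps_act (src F))) (snd (dat F)) =
        vcomp K (snd (dat G)) (whisk_l K (ps_act (tgt F)) (map2 (mfun M) \<alpha>)))"

definition PsAlgn ::
  "('o, 'm, 'c) twocat \<Rightarrow> ('o, 'm, 'c) twomonad \<Rightarrow>
   (('o, 'm, 'c) psalg, ('o, 'm) cell \<times> ('o, 'm, 'c) cell2, ('o, 'm, 'c) cell2) twocat" where
  "PsAlgn K M =
    (let c1 = (\<lambda>G F. Cell (src F) (tgt G)
                 (comp1 K (fst (dat G)) (fst (dat F)),
                  vcomp K (whisk_l K (fst (dat G)) (snd (dat F)))
                          (whisk_r K (snd (dat G)) (map1 (mfun M) (fst (dat F))))))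
     in \<lparr> cells0 = {A. normal_pseudoalgebra K M A},
          cells1 = {F. pseudomorphism K M F},
          cells2 = {A. algebra_transformation K M A},
          id1 = (\<lambda>A. Cell A A (id1 K (ps_car A), id2 K (ps_act A))),
          comp1 = c1,
          id2 = (\<lambda>F. Cell F F (id2 K (fst (dat F)))),
          vcomp = (\<lambda>B A. Cell (src A) (tgt B) (vcomp K (dat B) (dat A))),
          hcomp = (\<lambda>B A. Cell (c1 (src B) (src A)) (c1 (tgt B) (tgt A)) (hcomp K (dat B) (dat A))) \<rparr>)"

text \<open>Strict algebras and morphisms are the (normal) pseudo ones with identity structure cells.\<close>

definition strict_to_pseudo_alg ::
  "('o, 'm, 'c) twocat \<Rightarrow> ('o, 'm, 'c) twomonad \<Rightarrow> ('o, 'm) alg \<Rightarrow> ('o, 'm, 'c) psalg" where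
  "strict_to_pseudo_alg K M A = PsAlg (fst A) (snd A) (id2 K (comp1 K (snd A) (mmult M (fst A))))"

definition strict_to_pseudo_mor ::
  "('o, 'm, 'c) twocat \<Rightarrow> ('o, 'm, 'c) twomonad \<Rightarrow> (('o, 'm) alg, ('o, 'm) cell) cell \<Rightarrow>
   (('o, 'm, 'c) psalg, ('o, 'm) cell \<times> ('o, 'm, 'c) cell2) cell" where
  "strict_to_pseudo_mor K M F =
    Cell (strict_to_pseudo_alg K M (src F)) (strict_to_pseudo_alg K M (tgt F))
      (dat F, id2 K (comp1 K (dat F) (snd (src F))))"

definition strict_to_pseudo ::
  "('o, 'm, 'c) twocat \<Rightarrow> ('o, 'm, 'c) twomonad \<Rightarrow>
   (('o, 'm) alg, ('o, 'm) cell, ('o, 'm, 'c) cell2,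
    ('o, 'm, 'c) psalg, ('o, 'm) cell \<times> ('o, 'm, 'c) cell2, ('o, 'm, 'c) cell2) twofun" where
  "strict_to_pseudo K M = TwoFun (strict_to_pseudo_alg K M) (strict_to_pseudo_mor K M)
    (\<lambda>A. Cell (strict_to_pseudo_mor K M (src A)) (strict_to_pseudo_mor K M (tgt A)) (dat A))"

section \<open>Restriction of scalars along a colax monad morphism\<close>

text \<open>\<open>(D, \<kappa>)\<close> goes from the 2-monad \<open>M\<close> on \<open>K\<close> to the 2-monad \<open>N\<close> on \<open>L\<close>; here
  \<open>D : K \<rightarrow> L\<close> and \<open>\<kappa> : N D \<Rightarrow> D M\<close>.\<close>

definition colax_monad_morphism ::
  "('o, 'm, 'c) twocat \<Rightarrow> ('o, 'm, 'c) twomonad \<Rightarrow> ('p, 'n, 'd) twocat \<Rightarrow> ('p, 'n, 'd) twomonad \<Rightarrow>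
   ('o, 'm, 'c, 'p, 'n, 'd) twofun \<Rightarrow> ('o \<Rightarrow> ('p, 'n) cell) \<Rightarrow> bool" where
  "colax_monad_morphism K M L N D \<kappa> \<longleftrightarrow>
    two_monad K M \<and> two_monad L N \<and>
    two_natural K L (twofun_comp (mfun N) D) (twofun_comp D (mfun M)) \<kappa> \<and>
    (\<forall>X\<in>cells0 K.
       comp1 L (\<kappa> X) (munit N (map0 D X)) = map1 D (munit M X) \<and>
       comp1 L (\<kappa> X) (mmult N (map0 D X)) =
         comp1 L (map1 D (mmult M X)) (comp1 L (\<kappa> (map0 (mfun M) X)) (map1 (mfun N) (\<kappa> X))))"

definition restrict_ps_alg ::
  "('o, 'm, 'c) twomonad \<Rightarrow> ('p, 'n, 'd) twocat \<Rightarrow> ('p, 'n, 'd) twomonad \<Rightarrow>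
   ('o, 'm, 'c, 'p, 'n, 'd) twofun \<Rightarrow> ('o \<Rightarrow> ('p, 'n) cell) \<Rightarrow>
   ('o, 'm, 'c) psalg \<Rightarrow> ('p, 'n, 'd) psalg" where
  "restrict_ps_alg M L N D \<kappa> A =
    (let X = ps_car A in
      PsAlg (map0 D X) (comp1 L (map1 D (ps_act A)) (\<kappa> X))
        (whisk_r L (map2 D (ps_mul A))
          (comp1 L (\<kappa> (map0 (mfun M) X)) (map1 (mfun N) (\<kappa> X)))))"

definition restrict_ps_mor ::
  "('o, 'm, 'c) twomonad \<Rightarrow> ('p, 'n, 'd) twocat \<Rightarrow> ('p, 'n, 'd) twomonad \<Rightarrow>
   ('o, 'm, 'c, 'p, 'n, 'd) twofun \<Rightarrow> ('o \<Rightarrow> ('p, 'n) cell) \<Rightarrow>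
   (('o, 'm, 'c) psalg, ('o, 'm) cell \<times> ('o, 'm, 'c) cell2) cell \<Rightarrow>
   (('p, 'n, 'd) psalg, ('p, 'n) cell \<times> ('p, 'n, 'd) cell2) cell" where
  "restrict_ps_mor M L N D \<kappa> F =
    Cell (restrict_ps_alg M L N D \<kappa> (src F)) (restrict_ps_alg M L N D \<kappa> (tgt F))
      (map1 D (fst (dat F)), whisk_r L (map2 D (snd (dat F))) (\<kappa> (ps_car (src F))))"

definition restrict_ps ::
  "('o, 'm, 'c) twomonad \<Rightarrow> ('p, 'n, 'd) twocat \<Rightarrow> ('p, 'n, 'd) twomonad \<Rightarrow>
   ('o, 'm, 'c, 'p, 'n, 'd) twofun \<Rightarrow> ('o \<Rightarrow> ('p, 'n) cell) \<Rightarrow>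
   (('o, 'm, 'c) psalg, ('o, 'm) cell \<times> ('o, 'm, 'c) cell2, ('o, 'm, 'c) cell2,
    ('p, 'n, 'd) psalg, ('p, 'n) cell \<times> ('p, 'n, 'd) cell2, ('p, 'n, 'd) cell2) twofun" where
  "restrict_ps M L N D \<kappa> = TwoFun (restrict_ps_alg M L N D \<kappa>) (restrict_ps_mor M L N D \<kappa>)
    (\<lambda>A. Cell (restrict_ps_mor M L N D \<kappa> (src A)) (restrict_ps_mor M L N D \<kappa> (tgt A))
           (map2 D (dat A)))"

definition restrict_s_alg ::
  "('p, 'n, 'd) twocat \<Rightarrow> ('o, 'm, 'c, 'p, 'n, 'd) twofun \<Rightarrow> ('o \<Rightarrow> ('p, 'n) cell) \<Rightarrow>
   ('o, 'm) alg \<Rightarrow> ('p, 'n) alg" where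
  "restrict_s_alg L D \<kappa> A = (map0 D (fst A), comp1 L (map1 D (snd A)) (\<kappa> (fst A)))"

definition restrict_s_mor ::
  "('p, 'n, 'd) twocat \<Rightarrow> ('o, 'm, 'c, 'p, 'n, 'd) twofun \<Rightarrow> ('o \<Rightarrow> ('p, 'n) cell) \<Rightarrow>
   (('o, 'm) alg, ('o, 'm) cell) cell \<Rightarrow> (('p, 'n) alg, ('p, 'n) cell) cell" where
  "restrict_s_mor L D \<kappa> F =
    Cell (restrict_s_alg L D \<kappa> (src F)) (restrict_s_alg L D \<kappa> (tgt F)) (map1 D (dat F))"

definition restrict_s ::
  "('p, 'n, 'd) twocat \<Rightarrow> ('o, 'm, 'c, 'p, 'n, 'd) twofun \<Rightarrow> ('o \<Rightarrow> ('p, 'n) cell) \<Rightarrow>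
   (('o, 'm) alg, ('o, 'm) cell, ('o, 'm, 'c) cell2,
    ('p, 'n) alg, ('p, 'n) cell, ('p, 'n, 'd) cell2) twofun" where
  "restrict_s L D \<kappa> = TwoFun (restrict_s_alg L D \<kappa>) (restrict_s_mor L D \<kappa>)
    (\<lambda>A. Cell (restrict_s_mor L D \<kappa> (src A)) (restrict_s_mor L D \<kappa> (tgt A)) (map2 D (dat A)))"

section \<open>Categories, functors, natural transformations\<close>

text \<open>\<open>cmp C g f\<close> is \<open>g\<close> after \<open>f\<close>.  Operations are required to be \<open>undefined\<close> outside their
  domains, so that HOL equality of categories, functors and transformations is the mathematical one.\<close>

record 'e cat =
  obj :: "'e set"
  arr :: "'e set"
  dm :: "'e \<Rightarrow> 'e"
  cd :: "'e \<Rightarrow> 'e"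
  idn :: "'e \<Rightarrow> 'e"
  cmp :: "'e \<Rightarrow> 'e \<Rightarrow> 'e"

definition hom :: "'e cat \<Rightarrow> 'e \<Rightarrow> 'e \<Rightarrow> 'e set" where
  "hom C x y = {f \<in> arr C. dm C f = x \<and> cd C f = y}"

definition category :: "'e cat \<Rightarrow> bool" where
  "category C \<longleftrightarrow>
    (\<forall>f\<in>arr C. dm C f \<in> obj C \<and> cd C f \<in> obj C) \<and>
    (\<forall>x\<in>obj C. idn C x \<in> hom C x x) \<and>
    (\<forall>f\<in>arr C. \<forall>g\<in>arr C. cd C f = dm C g \<longrightarrow> cmp C g f \<in> hom C (dm C f) (cd C g)) \<and>
    (\<forall>f\<in>arr C. cmp C f (idn C (dm C f)) = f \<and> cmp C (idn C (cd C f)) f = f) \<and>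
    (\<forall>f\<in>arr C. \<forall>g\<in>arr C. \<forall>h\<in>arr C. cd C f = dm C g \<and> cd C g = dm C h \<longrightarrow>
       cmp C h (cmp C g f) = cmp C (cmp C h g) f) \<and>
    dm C \<in> extensional (arr C) \<and> cd C \<in> extensional (arr C) \<and> idn C \<in> extensional (obj C) \<and>
    (\<forall>g f. \<not> (f \<in> arr C \<and> g \<in> arr C \<and> cd C f = dm C g) \<longrightarrow> cmp C g f = undefined)"

definition isos :: "'e cat \<Rightarrow> 'e set" where
  "isos C = {f \<in> arr C. \<exists>g\<in>hom C (cd C f) (dm C f).
     cmp C g f = idn C (dm C f) \<and> cmp C f g = idn C (cd C f)}"

type_synonym 'e fctr = "('e cat, ('e \<Rightarrow> 'e) \<times> ('e \<Rightarrow> 'e)) cell"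
type_synonym 'e ntr = "('e fctr, 'e \<Rightarrow> 'e) cell"

definition fo :: "'e fctr \<Rightarrow> 'e \<Rightarrow> 'e" where "fo F = fst (dat F)"
definition fa :: "'e fctr \<Rightarrow> 'e \<Rightarrow> 'e" where "fa F = snd (dat F)"

definition mk_functor :: "'e cat \<Rightarrow> 'e cat \<Rightarrow> ('e \<Rightarrow> 'e) \<Rightarrow> ('e \<Rightarrow> 'e) \<Rightarrow> 'e fctr" where
  "mk_functor C D o' a = Cell C D (restrict o' (obj C), restrict a (arr C))"

definition mk_trans :: "'e fctr \<Rightarrow> 'e fctr \<Rightarrow> ('e \<Rightarrow> 'e) \<Rightarrow> 'e ntr" where
  "mk_trans F G t = Cell F G (restrict t (obj (src F)))"

definition is_functor :: "'e fctr \<Rightarrow> bool" where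
  "is_functor F \<longleftrightarrow>
    (let C = src F; D = tgt F in
      category C \<and> category D \<and>
      (\<forall>x\<in>obj C. fo F x \<in> obj D \<and> fa F (idn C x) = idn D (fo F x)) \<and>
      (\<forall>f\<in>arr C. fa F f \<in> hom D (fo F (dm C f)) (fo F (cd C f))) \<and>
      (\<forall>f\<in>arr C. \<forall>g\<in>arr C. cd C f = dm C g \<longrightarrow> fa F (cmp C g f) = cmp D (fa F g) (fa F f)) \<and>
      fo F \<in> extensional (obj C) \<and> fa F \<in> extensional (arr C))"

definition is_trans :: "'e ntr \<Rightarrow> bool" where
  "is_trans \<alpha> \<longleftrightarrow>
    (let F = src \<alpha>; G = tgt \<alpha>; C = src F; D = tgt F in
      is_functor F \<and> is_functor G \<and> src G = C \<and> tgt G = D \<and>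
      (\<forall>x\<in>obj C. dat \<alpha> x \<in> hom D (fo F x) (fo G x)) \<and>
      (\<forall>f\<in>arr C. cmp D (dat \<alpha> (cd C f)) (fa F f) = cmp D (fa G f) (dat \<alpha> (dm C f))) \<and>
      dat \<alpha> \<in> extensional (obj C))"

definition functor_comp :: "'e fctr \<Rightarrow> 'e fctr \<Rightarrow> 'e fctr" where
  "functor_comp G F = mk_functor (src F) (tgt G) (\<lambda>x. fo G (fo F x)) (\<lambda>f. fa G (fa F f))"

definition CAT :: "('e cat, ('e \<Rightarrow> 'e) \<times> ('e \<Rightarrow> 'e), 'e \<Rightarrow> 'e) twocat" where
  "CAT = \<lparr> cells0 = {C. category C},
           cells1 = {F. is_functor F},
           cells2 = {\<alpha>. is_trans \<alpha>},
           id1 = (\<lambda>C. mk_functor C C (\<lambda>x. x) (\<lambda>f. f)),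
           comp1 = functor_comp,
           id2 = (\<lambda>F. mk_trans F F (\<lambda>x. idn (tgt F) (fo F x))),
           vcomp = (\<lambda>\<beta> \<alpha>. mk_trans (src \<alpha>) (tgt \<beta>) (\<lambda>x. cmp (tgt (src \<beta>)) (dat \<beta> x) (dat \<alpha> x))),
           hcomp = (\<lambda>\<beta> \<alpha>. mk_trans (functor_comp (src \<beta>) (src \<alpha>)) (functor_comp (tgt \<beta>) (tgt \<alpha>))
             (\<lambda>x. cmp (tgt (src \<beta>)) (dat \<beta> (fo (tgt \<alpha>) x)) (fa (src \<beta>) (dat \<alpha> x)))) \<rparr>"

type_synonym 'e square = "('e fctr, 'e fctr \<times> 'e fctr) cell"
type_synonym 'e square2 = "('e square, 'e ntr \<times> 'e ntr) cell"

definition CAT2 :: "('e fctr, 'e fctr \<times> 'e fctr, 'e ntr \<times> 'e ntr) twocat" where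
  "CAT2 = arrow2 CAT"

definition Dom ::
  "('e fctr, 'e fctr \<times> 'e fctr, 'e ntr \<times> 'e ntr, 'e cat, ('e \<Rightarrow> 'e) \<times> ('e \<Rightarrow> 'e), 'e \<Rightarrow> 'e) twofun" where
  "Dom = TwoFun src top1 top1"

section \<open>Cofibrations\<close>

definition cocart :: "'e fctr \<Rightarrow> 'e set" where
  "cocart P = (let E = src P; B = tgt P in
    {e \<in> arr E. \<forall>g\<in>arr E. \<forall>v\<in>hom B (fo P (cd E e)) (fo P (cd E g)).
       dm E g = dm E e \<and> fa P g = cmp B v (fa P e) \<longrightarrow>
       (\<exists>!h. h \<in> hom E (cd E e) (cd E g) \<and> cmp E h e = g \<and> fa P h = v)})"

definition vertical :: "'e fctr \<Rightarrow> 'e set" where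
  "vertical P = {f \<in> arr (src P). \<exists>b\<in>obj (tgt P). fa P f = idn (tgt P) b}"

definition inv_image_isos :: "'e fctr \<Rightarrow> 'e set" where
  "inv_image_isos P = {f \<in> arr (src P). fa P f \<in> isos (tgt P)}"

text \<open>A functor with a choice of lifts; \<open>lift \<P> x u\<close> is \<open>\<delta>\<^sup>x\<^sub>u\<close>.\<close>

datatype 'e cloven = Cloven (prj: "'e fctr") (lift: "'e \<Rightarrow> 'e \<Rightarrow> 'e")

abbreviation tot :: "'e cloven \<Rightarrow> 'e cat" where "tot \<P> \<equiv> src (prj \<P>)"
abbreviation base :: "'e cloven \<Rightarrow> 'e cat" where "base \<P> \<equiv> tgt (prj \<P>)"

definition push :: "'e cloven \<Rightarrow> 'e \<Rightarrow> 'e \<Rightarrow> 'e" where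
  "push \<P> u x = cd (tot \<P>) (lift \<P> x u)"

definition liftable :: "'e cloven \<Rightarrow> 'e \<Rightarrow> 'e \<Rightarrow> bool" where
  "liftable \<P> x u \<longleftrightarrow> x \<in> obj (tot \<P>) \<and> u \<in> arr (base \<P>) \<and> dm (base \<P>) u = fo (prj \<P>) x"

definition cloven_cofibration :: "'e cloven \<Rightarrow> bool" where
  "cloven_cofibration \<P> \<longleftrightarrow>
    is_functor (prj \<P>) \<and>
    (\<forall>x u. liftable \<P> x u \<longrightarrow>
       lift \<P> x u \<in> cocart (prj \<P>) \<and> dm (tot \<P>) (lift \<P> x u) = x \<and> fa (prj \<P>) (lift \<P> x u) = u) \<and>
    (\<forall>x u. \<not> liftable \<P> x u \<longrightarrow> lift \<P> x u = undefined)"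

definition normal_cleavage :: "'e cloven \<Rightarrow> bool" where
  "normal_cleavage \<P> \<longleftrightarrow>
    (\<forall>x\<in>obj (tot \<P>). lift \<P> x (idn (base \<P>) (fo (prj \<P>) x)) = idn (tot \<P>) x)"

text \<open>\<open>u\<^sub>! f\<close> for a vertical arrow \<open>f : x \<rightarrow> y\<close>.\<close>

definition push_arr :: "'e cloven \<Rightarrow> 'e \<Rightarrow> 'e \<Rightarrow> 'e" where
  "push_arr \<P> u f = (let E = tot \<P>; x = dm E f; y = cd E f in
    THE h. h \<in> vertical (prj \<P>) \<and> h \<in> hom E (push \<P> u x) (push \<P> u y) \<and>
      cmp E h (lift \<P> x u) = cmp E (lift \<P> y u) f)"

definition split_cleavage :: "'e cloven \<Rightarrow> bool" where
  "split_cleavage \<P> \<longleftrightarrow>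
    normal_cleavage \<P> \<and>
    (\<forall>u\<in>arr (base \<P>). \<forall>v\<in>arr (base \<P>). cd (base \<P>) u = dm (base \<P>) v \<longrightarrow>
      (let vu = cmp (base \<P>) v u in
        (\<forall>x. liftable \<P> x u \<longrightarrow>
           push \<P> vu x = push \<P> v (push \<P> u x) \<and>
           lift \<P> x vu = cmp (tot \<P>) (lift \<P> (push \<P> u x) v) (lift \<P> x u)) \<and>
        (\<forall>f\<in>arr (tot \<P>). fa (prj \<P>) f = idn (base \<P>) (dm (base \<P>) u) \<longrightarrow>
           push_arr \<P> vu f = push_arr \<P> v (push_arr \<P> u f))))"

definition vert_part :: "'e cloven \<Rightarrow> 'e \<Rightarrow> 'e" where
  "vert_part \<P> f = (let E = tot \<P>; x = dm E f; u = fa (prj \<P>) f in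
    THE h. h \<in> vertical (prj \<P>) \<and> h \<in> hom E (push \<P> u x) (cd E f) \<and> cmp E h (lift \<P> x u) = f)"

type_synonym 'e cloven1 = "('e cloven, 'e square) cell"
type_synonym 'e cloven2 = "('e cloven1, 'e square2) cell"

definition NClCoFib :: "('e cloven, 'e square, 'e square2) twocat" where
  "NClCoFib = structured CAT2 {\<P>. cloven_cofibration \<P> \<and> normal_cleavage \<P>} prj
     (\<lambda>\<P> \<Q> s. \<forall>e\<in>cocart (prj \<P>). fa (top1 s) e \<in> cocart (prj \<Q>))
     (\<lambda>_ _ _. True)"

definition SCoFib :: "('e cloven, 'e square, 'e square2) twocat" where
  "SCoFib = structured CAT2 {\<P>. cloven_cofibration \<P> \<and> split_cleavage \<P>} prj
     (\<lambda>\<P> \<Q> s. \<forall>x u. liftable \<P> x u \<longrightarrow>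
        fa (top1 s) (lift \<P> x u) = lift \<Q> (fo (top1 s) x) (fa (bot1 s) u))
     (\<lambda>_ _ _. True)"

section \<open>A universe closed under pairing\<close>

text \<open>The arrow category and the comma category of a category must again be 0-cells of the same
  2-category \<open>CAT\<close>.  Therefore objects and arrows are taken from the free pairing structure over an
  arbitrary type \<open>'u\<close> of atoms.\<close>

datatype 'u ent = Atom 'u | Pr "'u ent" "'u ent"

fun lft :: "'u ent \<Rightarrow> 'u ent" where
  "lft (Pr a b) = a"
| "lft (Atom c) = undefined"

fun rgt :: "'u ent \<Rightarrow> 'u ent" where
  "rgt (Pr a b) = b"
| "rgt (Atom c) = undefined"

text \<open>\<open>mor a b p q\<close> is the arrow \<open>(p, q) : a \<rightarrow> b\<close> of an arrow or comma category.\<close>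

definition mor :: "'u ent \<Rightarrow> 'u ent \<Rightarrow> 'u ent \<Rightarrow> 'u ent \<Rightarrow> 'u ent" where
  "mor a b p q = Pr (Pr a b) (Pr p q)"

definition mor_src :: "'u ent \<Rightarrow> 'u ent" where "mor_src z = lft (lft z)"
definition mor_tgt :: "'u ent \<Rightarrow> 'u ent" where "mor_tgt z = rgt (lft z)"
definition mor_fst :: "'u ent \<Rightarrow> 'u ent" where "mor_fst z = lft (rgt z)"
definition mor_snd :: "'u ent \<Rightarrow> 'u ent" where "mor_snd z = rgt (rgt z)"

text \<open>The category with object set \<open>Ob\<close>, arrows \<open>(p, q) : a \<rightarrow> b\<close> those satisfying \<open>R a b p q\<close>,
  composed componentwise in \<open>C\<close> and \<open>D\<close>, and identities \<open>(i a, j a)\<close>.\<close>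

definition pair_cat ::
  "'u ent set \<Rightarrow> ('u ent \<Rightarrow> 'u ent \<Rightarrow> 'u ent \<Rightarrow> 'u ent \<Rightarrow> bool) \<Rightarrow> 'u ent cat \<Rightarrow> 'u ent cat \<Rightarrow>
   ('u ent \<Rightarrow> 'u ent) \<Rightarrow> ('u ent \<Rightarrow> 'u ent) \<Rightarrow> 'u ent cat" where
  "pair_cat Ob R C D i j =
    (let A = {mor a b p q | a b p q. a \<in> Ob \<and> b \<in> Ob \<and> R a b p q} in
     \<lparr> obj = Ob,
       arr = A,
       dm = restrict mor_src A,
       cd = restrict mor_tgt A,
       idn = restrict (\<lambda>a. mor a a (i a) (j a)) Ob,
       cmp = (\<lambda>g f. if f \<in> A \<and> g \<in> A \<and> mor_tgt f = mor_src g
                then mor (mor_src f) (mor_tgt g)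
                       (cmp C (mor_fst g) (mor_fst f)) (cmp D (mor_snd g) (mor_snd f))
                else undefined) \<rparr>)"

section \<open>The squaring 2-monad on \<open>CAT\<close>\<close>

definition sq_cat :: "'u ent cat \<Rightarrow> 'u ent cat" where
  "sq_cat E = pair_cat (arr E)
     (\<lambda>f g r s. r \<in> hom E (dm E f) (dm E g) \<and> s \<in> hom E (cd E f) (cd E g) \<and> cmp E s f = cmp E g r)
     E E (\<lambda>f. idn E (dm E f)) (\<lambda>f. idn E (cd E f))"

definition sq_functor :: "'u ent fctr \<Rightarrow> 'u ent fctr" where
  "sq_functor T = mk_functor (sq_cat (src T)) (sq_cat (tgt T)) (fa T)
     (\<lambda>z. mor (fa T (mor_src z)) (fa T (mor_tgt z)) (fa T (mor_fst z)) (fa T (mor_snd z)))"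

definition sq_trans :: "'u ent ntr \<Rightarrow> 'u ent ntr" where
  "sq_trans \<alpha> = (let E = src (src \<alpha>) in
     mk_trans (sq_functor (src \<alpha>)) (sq_functor (tgt \<alpha>))
       (\<lambda>f. mor (fa (src \<alpha>) f) (fa (tgt \<alpha>) f) (dat \<alpha> (dm E f)) (dat \<alpha> (cd E f))))"

definition sq_unit :: "'u ent cat \<Rightarrow> 'u ent fctr" where
  "sq_unit E = mk_functor E (sq_cat E) (idn E) (\<lambda>f. mor (idn E (dm E f)) (idn E (cd E f)) f f)"

text \<open>An object of \<open>sq_cat (sq_cat E)\<close> is a square \<open>z : f \<rightarrow> g\<close>, with diagonal
  \<open>mor_snd z \<circ> f\<close>; an arrow is a pair of arrows of \<open>sq_cat E\<close>, of which the first component of the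
  first and the second component of the second sit at the initial and terminal vertices.\<close>

definition sq_diag :: "'u ent cat \<Rightarrow> 'u ent \<Rightarrow> 'u ent" where
  "sq_diag E z = cmp E (mor_snd z) (mor_src z)"

definition sq_mult :: "'u ent cat \<Rightarrow> 'u ent fctr" where
  "sq_mult E = mk_functor (sq_cat (sq_cat E)) (sq_cat E) (sq_diag E)
     (\<lambda>w. mor (sq_diag E (mor_src w)) (sq_diag E (mor_tgt w))
            (mor_fst (mor_fst w)) (mor_snd (mor_snd w)))"

definition SqMonad ::
  "('u ent cat, ('u ent \<Rightarrow> 'u ent) \<times> ('u ent \<Rightarrow> 'u ent), 'u ent \<Rightarrow> 'u ent) twomonad" where
  "SqMonad = TwoMonad (TwoFun sq_cat sq_functor sq_trans) sq_unit sq_mult"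

section \<open>The comma 2-monad on \<open>CAT2\<close>\<close>

text \<open>An object \<open>Pr x u\<close> of \<open>comma P\<close> is the pair \<open>(x, u : P x \<rightarrow> b)\<close>.\<close>

definition comma :: "'u ent fctr \<Rightarrow> 'u ent cat" where
  "comma P = (let E = src P; B = tgt P in
     pair_cat {Pr x u | x u. x \<in> obj E \<and> u \<in> arr B \<and> dm B u = fo P x}
       (\<lambda>a b f v. f \<in> hom E (lft a) (lft b) \<and> v \<in> hom B (cd B (rgt a)) (cd B (rgt b)) \<and>
          cmp B v (rgt a) = cmp B (rgt b) (fa P f))
       E B (\<lambda>a. idn E (lft a)) (\<lambda>a. idn B (cd B (rgt a))))"

definition comma_cod :: "'u ent fctr \<Rightarrow> 'u ent fctr" where
  "comma_cod P = mk_functor (comma P) (tgt P) (\<lambda>a. cd (tgt P) (rgt a)) mor_snd"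

definition comma_map_obj :: "'u ent square \<Rightarrow> 'u ent \<Rightarrow> 'u ent" where
  "comma_map_obj s a = Pr (fo (top1 s) (lft a)) (fa (bot1 s) (rgt a))"

definition comma_map :: "'u ent square \<Rightarrow> 'u ent fctr" where
  "comma_map s = mk_functor (comma (src s)) (comma (tgt s)) (comma_map_obj s)
     (\<lambda>z. mor (comma_map_obj s (mor_src z)) (comma_map_obj s (mor_tgt z))
            (fa (top1 s) (mor_fst z)) (fa (bot1 s) (mor_snd z)))"

definition comma_square :: "'u ent square \<Rightarrow> 'u ent square" where
  "comma_square s = Cell (comma_cod (src s)) (comma_cod (tgt s)) (comma_map s, bot1 s)"

definition comma_square2 :: "'u ent square2 \<Rightarrow> 'u ent square2" where
  "comma_square2 \<sigma> = (let s = src \<sigma>; t = tgt \<sigma>; B = tgt (src s) in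
     Cell (comma_square s) (comma_square t)
       (mk_trans (comma_map s) (comma_map t)
          (\<lambda>a. mor (comma_map_obj s a) (comma_map_obj t a)
                 (dat (top1 \<sigma>) (lft a)) (dat (bot1 \<sigma>) (cd B (rgt a)))),
        bot1 \<sigma>))"

definition comma_H :: "'u ent fctr \<Rightarrow> 'u ent fctr" where
  "comma_H P = (let E = src P; B = tgt P; H = (\<lambda>x. Pr x (idn B (fo P x))) in
     mk_functor E (comma P) H (\<lambda>f. mor (H (dm E f)) (H (cd E f)) f (fa P f)))"

definition comma_M :: "'u ent fctr \<Rightarrow> 'u ent fctr" where
  "comma_M P = (let M = (\<lambda>a. Pr (lft (lft a)) (cmp (tgt P) (rgt a) (rgt (lft a)))) in
     mk_functor (comma (comma_cod P)) (comma P) M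
       (\<lambda>z. mor (M (mor_src z)) (M (mor_tgt z)) (mor_fst (mor_fst z)) (mor_snd z)))"

definition CommaMonad ::
  "('u ent fctr, 'u ent fctr \<times> 'u ent fctr, 'u ent ntr \<times> 'u ent ntr) twomonad" where
  "CommaMonad = TwoMonad (TwoFun comma_cod comma_square comma_square2)
     (\<lambda>P. Cell P (comma_cod P) (comma_H P, id1 CAT (tgt P)))
     (\<lambda>P. Cell (comma_cod (comma_cod P)) (comma_cod P) (comma_M P, id1 CAT (tgt P)))"

section \<open>The comparison \<open>\<Gamma>\<close> between cofibrations and algebras of the comma 2-monad\<close>

definition action_L :: "'u ent cloven \<Rightarrow> 'u ent fctr" where
  "action_L \<P> = (let P = prj \<P>; E = tot \<P>; L = (\<lambda>a. push \<P> (rgt a) (lft a)) in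
     mk_functor (comma P) E L
       (\<lambda>z. THE h. h \<in> hom E (L (mor_src z)) (L (mor_tgt z)) \<and> fa P h = mor_snd z \<and>
          cmp E h (lift \<P> (lft (mor_src z)) (rgt (mor_src z))) =
            cmp E (lift \<P> (lft (mor_tgt z)) (rgt (mor_tgt z))) (mor_fst z)))"

definition action_square :: "'u ent cloven \<Rightarrow> 'u ent square" where
  "action_square \<P> = Cell (comma_cod (prj \<P>)) (prj \<P>) (action_L \<P>, id1 CAT (base \<P>))"

definition chi_comp :: "'u ent cloven \<Rightarrow> 'u ent \<Rightarrow> 'u ent \<Rightarrow> 'u ent \<Rightarrow> 'u ent" where
  "chi_comp \<P> v u x = (let E = tot \<P>; vu = cmp (base \<P>) v u in
     THE h. h \<in> vertical (prj \<P>) \<and> h \<in> isos E \<and>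
       h \<in> hom E (push \<P> v (push \<P> u x)) (push \<P> vu x) \<and>
       cmp E h (cmp E (lift \<P> (push \<P> u x) v) (lift \<P> x u)) = lift \<P> x vu)"

definition chi_cell :: "'u ent cloven \<Rightarrow> 'u ent square2" where
  "chi_cell \<P> =
    (let a = action_square \<P>;
         s = comp1 CAT2 a (map1 (mfun CommaMonad) a);
         t = comp1 CAT2 a (mmult CommaMonad (prj \<P>))
     in Cell s t
          (mk_trans (top1 s) (top1 t) (\<lambda>a. chi_comp \<P> (rgt a) (rgt (lft a)) (lft (lft a))),
           id2 CAT (id1 CAT (base \<P>))))"

definition Gamma_n0 ::
  "'u ent cloven \<Rightarrow> ('u ent fctr, 'u ent fctr \<times> 'u ent fctr, 'u ent ntr \<times> 'u ent ntr) psalg" where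
  "Gamma_n0 \<P> = PsAlg (prj \<P>) (action_square \<P>) (chi_cell \<P>)"

definition theta_comp :: "'u ent cloven1 \<Rightarrow> 'u ent \<Rightarrow> 'u ent \<Rightarrow> 'u ent" where
  "theta_comp G u x =
    (let \<P> = src G; \<Q> = tgt G; T = top1 (dat G); S = bot1 (dat G); F = tot \<Q> in
     THE h. h \<in> vertical (prj \<Q>) \<and> h \<in> isos F \<and>
       h \<in> hom F (push \<Q> (fa S u) (fo T x)) (fo T (push \<P> u x)) \<and>
       cmp F h (lift \<Q> (fo T x) (fa S u)) = fa T (lift \<P> x u))"

definition theta_cell :: "'u ent cloven1 \<Rightarrow> 'u ent square2" where
  "theta_cell G =
    (let s = comp1 CAT2 (action_square (tgt G)) (map1 (mfun CommaMonad) (dat G));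
         t = comp1 CAT2 (dat G) (action_square (src G))
     in Cell s t
          (mk_trans (top1 s) (top1 t) (\<lambda>a. theta_comp G (rgt a) (lft a)), id2 CAT (bot1 (dat G))))"

definition Gamma_n1 ::
  "'u ent cloven1 \<Rightarrow>
   (('u ent fctr, 'u ent fctr \<times> 'u ent fctr, 'u ent ntr \<times> 'u ent ntr) psalg,
    'u ent square \<times> 'u ent square2) cell" where
  "Gamma_n1 G = Cell (Gamma_n0 (src G)) (Gamma_n0 (tgt G)) (dat G, theta_cell G)"

definition Gamma_n ::
  "('u ent cloven, 'u ent square, 'u ent square2,
    ('u ent fctr, 'u ent fctr \<times> 'u ent fctr, 'u ent ntr \<times> 'u ent ntr) psalg,
    'u ent square \<times> 'u ent square2, 'u ent square2) twofun" where
  "Gamma_n = TwoFun Gamma_n0 Gamma_n1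
     (\<lambda>A. Cell (Gamma_n1 (src A)) (Gamma_n1 (tgt A)) (dat A))"

definition Gamma_s0 :: "'u ent cloven \<Rightarrow> ('u ent fctr, 'u ent fctr \<times> 'u ent fctr) alg" where
  "Gamma_s0 \<P> = (prj \<P>, action_square \<P>)"

definition Gamma_s1 ::
  "'u ent cloven1 \<Rightarrow> (('u ent fctr, 'u ent fctr \<times> 'u ent fctr) alg, 'u ent square) cell" where
  "Gamma_s1 G = Cell (Gamma_s0 (src G)) (Gamma_s0 (tgt G)) (dat G)"

definition Gamma_s ::
  "('u ent cloven, 'u ent square, 'u ent square2,
    ('u ent fctr, 'u ent fctr \<times> 'u ent fctr) alg, 'u ent square, 'u ent square2) twofun" where
  "Gamma_s = TwoFun Gamma_s0 Gamma_s1
     (\<lambda>A. Cell (Gamma_s1 (src A)) (Gamma_s1 (tgt A)) (dat A))"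

section \<open>Restriction along \<open>\<kappa>\<close>\<close>

definition kappa :: "'u ent fctr \<Rightarrow> 'u ent fctr" where
  "kappa P = (let E = src P; k = (\<lambda>f. Pr (dm E f) (fa P f)) in
     mk_functor (sq_cat E) (comma P) k
       (\<lambda>z. mor (k (mor_src z)) (k (mor_tgt z)) (mor_fst z) (fa P (mor_snd z))))"

type_synonym 'u sq_psalg =
  "('u ent cat, ('u ent \<Rightarrow> 'u ent) \<times> ('u ent \<Rightarrow> 'u ent), 'u ent \<Rightarrow> 'u ent) psalg"

definition kappa_ps ::
  "(('u ent fctr, 'u ent fctr \<times> 'u ent fctr, 'u ent ntr \<times> 'u ent ntr) psalg,
    'u ent square \<times> 'u ent square2, 'u ent square2,
    'u sq_psalg, 'u ent fctr \<times> 'u ent ntr, 'u ent ntr) twofun" where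
  "kappa_ps = restrict_ps CommaMonad CAT SqMonad Dom kappa"

definition kappa_s ::
  "(('u ent fctr, 'u ent fctr \<times> 'u ent fctr) alg, 'u ent square, 'u ent square2,
    ('u ent cat, ('u ent \<Rightarrow> 'u ent) \<times> ('u ent \<Rightarrow> 'u ent)) alg, 'u ent fctr, 'u ent ntr) twofun" where
  "kappa_s = restrict_s CAT Dom kappa"

definition Fact_n ::
  "('u ent cloven, 'u ent square, 'u ent square2,
    'u sq_psalg, 'u ent fctr \<times> 'u ent ntr, 'u ent ntr) twofun" where
  "Fact_n = twofun_comp kappa_ps Gamma_n"

definition Fact_s ::
  "('u ent cloven, 'u ent square, 'u ent square2,
    ('u ent cat, ('u ent \<Rightarrow> 'u ent) \<times> ('u ent \<Rightarrow> 'u ent)) alg, 'u ent fctr, 'u ent ntr) twofun" where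
  "Fact_s = twofun_comp kappa_s Gamma_s"

section \<open>Orthogonal factorization systems with chosen factorizations\<close>

text \<open>\<open>fac_l O f\<close> and \<open>fac_r O f\<close> are the first and second factor of the chosen factorization.\<close>

datatype 'e ofs =
  OFS (ofs_cat: "'e cat") (l_class: "'e set") (r_class: "'e set")
      (fac_l: "'e \<Rightarrow> 'e") (fac_r: "'e \<Rightarrow> 'e")

definition orthogonal_fs :: "'e cat \<Rightarrow> 'e set \<Rightarrow> 'e set \<Rightarrow> bool" where
  "orthogonal_fs E L R \<longleftrightarrow>
    category E \<and> L \<subseteq> arr E \<and> R \<subseteq> arr E \<and>
    (\<forall>W\<in>{L, R}. \<forall>f\<in>W. \<forall>i\<in>isos E.
       (cd E f = dm E i \<longrightarrow> cmp E i f \<in> W) \<and> (cd E i = dm E f \<longrightarrow> cmp E f i \<in> W)) \<and>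
    (\<forall>f\<in>arr E. \<exists>e\<in>L. \<exists>m\<in>R. cd E e = dm E m \<and> cmp E m e = f) \<and>
    (\<forall>l\<in>L. \<forall>r\<in>R. \<forall>a\<in>hom E (dm E l) (dm E r). \<forall>b\<in>hom E (cd E l) (cd E r).
       cmp E r a = cmp E b l \<longrightarrow>
       (\<exists>!d. d \<in> hom E (cd E l) (dm E r) \<and> cmp E d l = a \<and> cmp E r d = b))"

definition OFSch0 :: "'e ofs set" where
  "OFSch0 = {OFS E L R e m | E L R e m.
     orthogonal_fs E L R \<and>
     (\<forall>f\<in>arr E. e f \<in> L \<and> m f \<in> R \<and> cd E (e f) = dm E (m f) \<and> cmp E (m f) (e f) = f) \<and>
     (\<forall>x\<in>obj E. e (idn E x) = idn E x \<and> m (idn E x) = idn E x) \<and>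
     e \<in> extensional (arr E) \<and> m \<in> extensional (arr E)}"

text \<open>The factors \<open>F(1\<^sub>x, f)\<close> and \<open>F(f, 1\<^sub>y)\<close> selected by an action \<open>F : sq_cat E \<rightarrow> E\<close>.\<close>

definition sel_e :: "'u sq_psalg \<Rightarrow> 'u ent \<Rightarrow> 'u ent" where
  "sel_e A f = (let E = ps_car A; i = idn E (dm E f) in fa (ps_act A) (mor i f i f))"

definition sel_m :: "'u sq_psalg \<Rightarrow> 'u ent \<Rightarrow> 'u ent" where
  "sel_m A f = (let E = ps_car A; i = idn E (cd E f) in fa (ps_act A) (mor f i f i))"

text \<open>The Korostenski--Tholen correspondence, on 0-cells.\<close>

definition KT :: "'u sq_psalg \<Rightarrow> 'u ent ofs" where
  "KT A = (let E = ps_car A in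
     OFS E {f \<in> arr E. sel_m A f \<in> isos E} {f \<in> arr E. sel_e A f \<in> isos E}
       (restrict (sel_e A) (arr E)) (restrict (sel_m A) (arr E)))"

end

theory Submission
  imports Defs
begin

text \<open>
  The lifts of a cleavage are recovered from the action \<open>L\<close> of the comma 2-monad as
  \<open>\<delta> = L(1, u)\<close>. Conversely, for a normal pseudoalgebra with action \<open>L\<close>, naturality of its
  multiplication cell at \<open>((1, u), 1)\<close> gives \<open>L(\<delta>, 1) = 1\<close>, so that any \<open>h\<close> out of the target
  of \<open>\<delta>\<close> satisfies \<open>h = L(h, Ph) L(\<delta>, 1) = L(h \<delta>, Ph)\<close> and is determined by \<open>h \<delta>\<close> and \<open>Ph\<close>;
  this makes \<open>\<delta>\<close> cocartesian. All multiplication and comparison cells are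
  forced by cocartesianness, hence coherence is automatic, a pseudomorphism is determined by its
  underlying square, and a cleavage is split iff its multiplication cell is an identity.
  Restriction along \<open>\<kappa>\<close> is then a formal computation in strict 2-categories. The right class is
  \<open>P\<^sup>-\<^sup>1 Iso(B)\<close> because \<open>\<delta>\<close>, being cocartesian, is invertible iff its image is, and the
  left class is \<open>CoCart(P)\<close> because \<open>\<nu>\<close> is the comparison of a
  factored arrow with the chosen lift.
\<close>

section \<open>Strict 2-categories, 2-functors and 2-monads\<close>

text \<open>Cells, functors and transformations carry their boundaries, so an equation of 2-cells
  can only hold once the composites of 1-cells at its ends have been proved equal. Hence the laws of
  algebras and of restriction are proved for an arbitrary strict 2-category and 2-monad, and only
  then specialised to \<open>CAT\<close> and \<open>CAT2\<close>, where equality is tested on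
  objects, arrows or components. Normality is what starts the reconstruction: the unit sends
  \<open>h\<close> to \<open>(h, P h)\<close> between pairs with identity second entry, and a strict
  unit law reads \<open>L(h, P h) = h\<close>. It also makes the base of every structure cell
  trivial, so these cells are vertical. Preservation of cocartesian arrows, which belongs to the
  definition of a 1-cell of \<open>NClCoFib\<close>, has to be extracted from a pseudomorphism:
  naturality of its comparison at \<open>(1, u)\<close> exhibits the image of a chosen lift as a
  lift followed by an isomorphism, and every cocartesian arrow is a chosen lift followed by an
  isomorphism.\<close>

locale twocat =
  fixes K :: "('o, 'm, 'c) twocat"
  assumes strict: "strict_2_category K"
begin

text \<open>The definition is one conjunction of fifteen clauses; splitting it once lets each axiom
  be applied alone, numbered in the order of the definition.\<close>

lemmas ax =
  strict[unfolded strict_2_category_def, THEN conjunct1]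
  strict[unfolded strict_2_category_def, THEN conjunct2, THEN conjunct1]
  strict[unfolded strict_2_category_def, THEN conjunct2, THEN conjunct2, THEN conjunct1]
  strict[unfolded strict_2_category_def, THEN conjunct2, THEN conjunct2, THEN conjunct2, THEN conjunct1]
  strict[unfolded strict_2_category_def, THEN conjunct2, THEN conjunct2, THEN conjunct2, THEN conjunct2, THEN conjunct1]
  strict[unfolded strict_2_category_def, THEN conjunct2, THEN conjunct2, THEN conjunct2, THEN conjunct2, THEN conjunct2, THEN conjunct1]
  strict[unfolded strict_2_category_def, THEN conjunct2, THEN conjunct2, THEN conjunct2, THEN conjunct2, THEN conjunct2, THEN conjunct2, THEN conjunct1]
  strict[unfolded strict_2_category_def, THEN conjunct2, THEN conjunct2, THEN conjunct2, THEN conjunct2, THEN conjunct2, THEN conjunct2, THEN conjunct2, THEN conjunct1]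
  strict[unfolded strict_2_category_def, THEN conjunct2, THEN conjunct2, THEN conjunct2, THEN conjunct2, THEN conjunct2, THEN conjunct2, THEN conjunct2, THEN conjunct2, THEN conjunct1]
  strict[unfolded strict_2_category_def, THEN conjunct2, THEN conjunct2, THEN conjunct2, THEN conjunct2, THEN conjunct2, THEN conjunct2, THEN conjunct2, THEN conjunct2, THEN conjunct2, THEN conjunct1]
  strict[unfolded strict_2_category_def, THEN conjunct2, THEN conjunct2, THEN conjunct2, THEN conjunct2, THEN conjunct2, THEN conjunct2, THEN conjunct2, THEN conjunct2, THEN conjunct2, THEN conjunct2, THEN conjunct1]
  strict[unfolded strict_2_category_def, THEN conjunct2, THEN conjunct2, THEN conjunct2, THEN conjunct2, THEN conjunct2, THEN conjunct2, THEN conjunct2, THEN conjunct2, THEN conjunct2, THEN conjunct2, THEN conjunct2, THEN conjunct1]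
  strict[unfolded strict_2_category_def, THEN conjunct2, THEN conjunct2, THEN conjunct2, THEN conjunct2, THEN conjunct2, THEN conjunct2, THEN conjunct2, THEN conjunct2, THEN conjunct2, THEN conjunct2, THEN conjunct2, THEN conjunct2, THEN conjunct1]
  strict[unfolded strict_2_category_def, THEN conjunct2, THEN conjunct2, THEN conjunct2, THEN conjunct2, THEN conjunct2, THEN conjunct2, THEN conjunct2, THEN conjunct2, THEN conjunct2, THEN conjunct2, THEN conjunct2, THEN conjunct2, THEN conjunct2, THEN conjunct1]
  strict[unfolded strict_2_category_def, THEN conjunct2, THEN conjunct2, THEN conjunct2, THEN conjunct2, THEN conjunct2, THEN conjunct2, THEN conjunct2, THEN conjunct2, THEN conjunct2, THEN conjunct2, THEN conjunct2, THEN conjunct2, THEN conjunct2, THEN conjunct2]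

lemma cell1_ends [simp]:
  assumes "f \<in> cells1 K" shows "src f \<in> cells0 K" "tgt f \<in> cells0 K"
  using ax(1) assms by auto

lemma id1_cell [simp]:
  assumes "x \<in> cells0 K" shows "id1 K x \<in> cells1 K" "src (id1 K x) = x" "tgt (id1 K x) = x"
  using ax(2) assms by auto

lemma comp1_cell [simp]:
  assumes "f \<in> cells1 K" "g \<in> cells1 K" "tgt f = src g"
  shows "comp1 K g f \<in> cells1 K" "src (comp1 K g f) = src f" "tgt (comp1 K g f) = tgt g"
  using ax(3) assms by auto

lemma comp1_id [simp]:
  "f \<in> cells1 K \<Longrightarrow> src f = x \<Longrightarrow> comp1 K f (id1 K x) = f"
  "f \<in> cells1 K \<Longrightarrow> tgt f = x \<Longrightarrow> comp1 K (id1 K x) f = f"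
  using ax(4) by auto

text \<open>Right-nested composites are the normal form throughout, for \<open>comp1\<close>,
  \<open>vcomp\<close> and \<open>hcomp\<close> alike. Equations that are to be used inside longer
  composites therefore get a version with a tail.\<close>

lemma comp1_assoc [simp]:
  assumes "f \<in> cells1 K" "g \<in> cells1 K" "h \<in> cells1 K" "tgt f = src g" "tgt g = src h"
  shows "comp1 K (comp1 K h g) f = comp1 K h (comp1 K g f)"
  using ax(5) assms by auto

lemma cell2_ends [simp]:
  assumes "\<alpha> \<in> cells2 K"
  shows "src \<alpha> \<in> cells1 K" "tgt \<alpha> \<in> cells1 K"
    "src (tgt \<alpha>) = src (src \<alpha>)" "tgt (tgt \<alpha>) = tgt (src \<alpha>)"
  using ax(6) assms by auto

lemma id2_cell [simp]:
  assumes "f \<in> cells1 K" shows "id2 K f \<in> cells2 K" "src (id2 K f) = f" "tgt (id2 K f) = f"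
  using ax(7) assms by auto

lemma vcomp_cell [simp]:
  assumes "\<alpha> \<in> cells2 K" "\<beta> \<in> cells2 K" "tgt \<alpha> = src \<beta>"
  shows "vcomp K \<beta> \<alpha> \<in> cells2 K" "src (vcomp K \<beta> \<alpha>) = src \<alpha>" "tgt (vcomp K \<beta> \<alpha>) = tgt \<beta>"
  using ax(8) assms by auto

lemma vcomp_id [simp]:
  "\<alpha> \<in> cells2 K \<Longrightarrow> src \<alpha> = f \<Longrightarrow> vcomp K \<alpha> (id2 K f) = \<alpha>"
  "\<alpha> \<in> cells2 K \<Longrightarrow> tgt \<alpha> = f \<Longrightarrow> vcomp K (id2 K f) \<alpha> = \<alpha>"
  using ax(9) by auto

lemma vcomp_assoc [simp]:
  assumes "\<alpha> \<in> cells2 K" "\<beta> \<in> cells2 K" "\<gamma> \<in> cells2 K" "tgt \<alpha> = src \<beta>" "tgt \<beta> = src \<gamma>"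
  shows "vcomp K (vcomp K \<gamma> \<beta>) \<alpha> = vcomp K \<gamma> (vcomp K \<beta> \<alpha>)"
  using ax(10) assms by auto

lemma hcomp_cell [simp]:
  assumes "\<alpha> \<in> cells2 K" "\<beta> \<in> cells2 K" "tgt (src \<alpha>) = src (src \<beta>)"
  shows "hcomp K \<beta> \<alpha> \<in> cells2 K" "src (hcomp K \<beta> \<alpha>) = comp1 K (src \<beta>) (src \<alpha>)"
    "tgt (hcomp K \<beta> \<alpha>) = comp1 K (tgt \<beta>) (tgt \<alpha>)"
  using ax(11) assms by auto

lemma hcomp_id [simp]:
  "\<alpha> \<in> cells2 K \<Longrightarrow> src (src \<alpha>) = x \<Longrightarrow> hcomp K \<alpha> (id2 K (id1 K x)) = \<alpha>"
  "\<alpha> \<in> cells2 K \<Longrightarrow> tgt (src \<alpha>) = x \<Longrightarrow> hcomp K (id2 K (id1 K x)) \<alpha> = \<alpha>"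
  using ax(12) by auto

lemma hcomp_assoc [simp]:
  assumes "\<alpha> \<in> cells2 K" "\<beta> \<in> cells2 K" "\<gamma> \<in> cells2 K"
    "tgt (src \<alpha>) = src (src \<beta>)" "tgt (src \<beta>) = src (src \<gamma>)"
  shows "hcomp K (hcomp K \<gamma> \<beta>) \<alpha> = hcomp K \<gamma> (hcomp K \<beta> \<alpha>)"
  using ax(13) assms by auto

lemma hcomp_id2 [simp]:
  "f \<in> cells1 K \<Longrightarrow> g \<in> cells1 K \<Longrightarrow> tgt f = src g \<Longrightarrow>
    hcomp K (id2 K g) (id2 K f) = id2 K (comp1 K g f)"
  using ax(14) by auto

lemma interchange:
  assumes "\<alpha> \<in> cells2 K" "\<alpha>' \<in> cells2 K" "\<beta> \<in> cells2 K" "\<beta>' \<in> cells2 K"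
    "tgt \<alpha> = src \<alpha>'" "tgt \<beta> = src \<beta>'" "tgt (src \<alpha>) = src (src \<beta>)"
  shows "hcomp K (vcomp K \<beta>' \<beta>) (vcomp K \<alpha>' \<alpha>) = vcomp K (hcomp K \<beta>' \<alpha>') (hcomp K \<beta> \<alpha>)"
  using ax(15) assms by auto

lemma whisk_l_cell [simp]:
  assumes "\<alpha> \<in> cells2 K" "g \<in> cells1 K" "tgt (src \<alpha>) = src g"
  shows "whisk_l K g \<alpha> \<in> cells2 K" "src (whisk_l K g \<alpha>) = comp1 K g (src \<alpha>)"
    "tgt (whisk_l K g \<alpha>) = comp1 K g (tgt \<alpha>)"
  using assms by (simp_all add: whisk_l_def)

lemma whisk_r_cell [simp]:
  assumes "\<alpha> \<in> cells2 K" "f \<in> cells1 K" "tgt f = src (src \<alpha>)"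
  shows "whisk_r K \<alpha> f \<in> cells2 K" "src (whisk_r K \<alpha> f) = comp1 K (src \<alpha>) f"
    "tgt (whisk_r K \<alpha> f) = comp1 K (tgt \<alpha>) f"
  using assms by (simp_all add: whisk_r_def)

lemma whisk_id1 [simp]:
  "\<alpha> \<in> cells2 K \<Longrightarrow> tgt (src \<alpha>) = x \<Longrightarrow> whisk_l K (id1 K x) \<alpha> = \<alpha>"
  "\<alpha> \<in> cells2 K \<Longrightarrow> src (src \<alpha>) = x \<Longrightarrow> whisk_r K \<alpha> (id1 K x) = \<alpha>"
  by (simp_all add: whisk_l_def whisk_r_def)

lemma whisk_id2 [simp]:
  assumes "f \<in> cells1 K" "g \<in> cells1 K" "tgt f = src g"
  shows "whisk_l K g (id2 K f) = id2 K (comp1 K g f)" "whisk_r K (id2 K g) f = id2 K (comp1 K g f)"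
  using assms by (simp_all add: whisk_l_def whisk_r_def)

lemma whisk_l_vcomp [simp]:
  assumes "\<alpha> \<in> cells2 K" "\<beta> \<in> cells2 K" "tgt \<alpha> = src \<beta>" "g \<in> cells1 K" "tgt (src \<alpha>) = src g"
  shows "whisk_l K g (vcomp K \<beta> \<alpha>) = vcomp K (whisk_l K g \<beta>) (whisk_l K g \<alpha>)"
  using assms interchange[of \<alpha> \<beta> "id2 K g" "id2 K g"] by (simp add: whisk_l_def)

lemma whisk_r_vcomp [simp]:
  assumes "\<alpha> \<in> cells2 K" "\<beta> \<in> cells2 K" "tgt \<alpha> = src \<beta>" "f \<in> cells1 K" "tgt f = src (src \<alpha>)"
  shows "whisk_r K (vcomp K \<beta> \<alpha>) f = vcomp K (whisk_r K \<beta> f) (whisk_r K \<alpha> f)"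
  using assms interchange[of "id2 K f" "id2 K f" \<alpha> \<beta>] by (simp add: whisk_r_def)

lemma whisk_l_whisk_l [simp]:
  assumes "\<alpha> \<in> cells2 K" "g \<in> cells1 K" "h \<in> cells1 K" "tgt (src \<alpha>) = src g" "tgt g = src h"
  shows "whisk_l K h (whisk_l K g \<alpha>) = whisk_l K (comp1 K h g) \<alpha>"
  using assms hcomp_assoc[of \<alpha> "id2 K g" "id2 K h"] by (simp add: whisk_l_def del: hcomp_assoc)

lemma whisk_r_whisk_r [simp]:
  assumes "\<alpha> \<in> cells2 K" "f \<in> cells1 K" "e \<in> cells1 K" "tgt f = src (src \<alpha>)" "tgt e = src f"
  shows "whisk_r K (whisk_r K \<alpha> f) e = whisk_r K \<alpha> (comp1 K f e)"
  using assms by (simp add: whisk_r_def)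

lemma whisk_r_whisk_l [simp]:
  assumes "\<alpha> \<in> cells2 K" "f \<in> cells1 K" "g \<in> cells1 K" "tgt f = src (src \<alpha>)" "tgt (src \<alpha>) = src g"
  shows "whisk_r K (whisk_l K g \<alpha>) f = whisk_l K g (whisk_r K \<alpha> f)"
  using assms by (simp add: whisk_r_def whisk_l_def)

text \<open>An identity cell is inserted on either side before the interchange law is applied; the
  two choices perform one factor before the other.\<close>

lemma hcomp_whisk:
  assumes "\<alpha> \<in> cells2 K" "\<beta> \<in> cells2 K" "tgt (src \<alpha>) = src (src \<beta>)"
  shows "hcomp K \<beta> \<alpha> = vcomp K (whisk_r K \<beta> (tgt \<alpha>)) (whisk_l K (src \<beta>) \<alpha>)"
    and "hcomp K \<beta> \<alpha> = vcomp K (whisk_l K (tgt \<beta>) \<alpha>) (whisk_r K \<beta> (src \<alpha>))"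
  using assms interchange[of \<alpha> "id2 K (tgt \<alpha>)" "id2 K (src \<beta>)" \<beta>]
    interchange[of "id2 K (src \<alpha>)" \<alpha> \<beta> "id2 K (tgt \<beta>)"] by (simp_all add: whisk_r_def whisk_l_def)

lemma whisk_interchange:
  assumes "\<alpha> \<in> cells2 K" "\<beta> \<in> cells2 K" "tgt (src \<alpha>) = src (src \<beta>)"
  shows "vcomp K (whisk_r K \<beta> (tgt \<alpha>)) (whisk_l K (src \<beta>) \<alpha>) =
    vcomp K (whisk_l K (tgt \<beta>) \<alpha>) (whisk_r K \<beta> (src \<alpha>))"
  using hcomp_whisk[OF assms] by simp

lemma invertible2_cell: "invertible2 K \<alpha> \<Longrightarrow> \<alpha> \<in> cells2 K"
  by (simp add: invertible2_def)

lemma invertible2_id2 [simp]: "f \<in> cells1 K \<Longrightarrow> invertible2 K (id2 K f)"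
  by (auto simp: invertible2_def intro!: bexI[of _ "id2 K f"])

lemma invertible2_vcomp [simp]:
  assumes "invertible2 K \<alpha>" "invertible2 K \<beta>" "tgt \<alpha> = src \<beta>"
  shows "invertible2 K (vcomp K \<beta> \<alpha>)"
proof -
  obtain \<alpha>' \<beta>' where i: "\<alpha> \<in> cells2 K" "\<beta> \<in> cells2 K" "\<alpha>' \<in> cells2 K" "\<beta>' \<in> cells2 K"
    "src \<alpha>' = tgt \<alpha>" "tgt \<alpha>' = src \<alpha>" "src \<beta>' = tgt \<beta>" "tgt \<beta>' = src \<beta>"
    "vcomp K \<alpha>' \<alpha> = id2 K (src \<alpha>)" "vcomp K \<alpha> \<alpha>' = id2 K (tgt \<alpha>)"
    "vcomp K \<beta>' \<beta> = id2 K (src \<beta>)" "vcomp K \<beta> \<beta>' = id2 K (tgt \<beta>)"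
    using assms unfolding invertible2_def by blast
  \<comment> \<open>Bracketing inward cancels the middle pair of inverse cells, which the
    right-nested normal form would hide.\<close>
  have "vcomp K \<beta>' (vcomp K \<beta> \<alpha>) = \<alpha>" "vcomp K \<alpha> (vcomp K \<alpha>' \<beta>') = \<beta>'"
    using i assms(3) by (simp_all add: vcomp_assoc[symmetric] del: vcomp_assoc)
  then show ?thesis using i assms(3)
    by (auto simp: invertible2_def intro!: bexI[of _ "vcomp K \<alpha>' \<beta>'"])
qed

lemma invertible2_whisk [simp]:
  "invertible2 K \<alpha> \<Longrightarrow> g \<in> cells1 K \<Longrightarrow> tgt (src \<alpha>) = src g \<Longrightarrow> invertible2 K (whisk_l K g \<alpha>)"
  "invertible2 K \<alpha> \<Longrightarrow> f \<in> cells1 K \<Longrightarrow> tgt f = src (src \<alpha>) \<Longrightarrow> invertible2 K (whisk_r K \<alpha> f)"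
proof -
  assume a: "invertible2 K \<alpha>"
  then obtain \<beta> where b: "\<alpha> \<in> cells2 K" "\<beta> \<in> cells2 K" "src \<beta> = tgt \<alpha>" "tgt \<beta> = src \<alpha>"
    "vcomp K \<beta> \<alpha> = id2 K (src \<alpha>)" "vcomp K \<alpha> \<beta> = id2 K (tgt \<alpha>)"
    unfolding invertible2_def by blast
  { assume "g \<in> cells1 K" "tgt (src \<alpha>) = src g"
    then show "invertible2 K (whisk_l K g \<alpha>)" using b
      by (auto simp: invertible2_def whisk_l_vcomp[symmetric] simp del: whisk_l_vcomp
          intro!: bexI[of _ "whisk_l K g \<beta>"]) }
  { assume "f \<in> cells1 K" "tgt f = src (src \<alpha>)"
    then show "invertible2 K (whisk_r K \<alpha> f)" using b
      by (auto simp: invertible2_def whisk_r_vcomp[symmetric] simp del: whisk_r_vcomp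
          intro!: bexI[of _ "whisk_r K \<beta> f"]) }
qed

end

locale twofunctor = K: twocat K + L: twocat L
  for K :: "('o, 'm, 'c) twocat" and L :: "('p, 'n, 'd) twocat" +
  fixes D :: "('o, 'm, 'c, 'p, 'n, 'd) twofun"
  assumes preserves: "two_functor K L D"
begin

lemma map0_cell [simp]: "x \<in> cells0 K \<Longrightarrow> map0 D x \<in> cells0 L"
  using preserves by (simp add: two_functor_def)

lemma map1_cell [simp]:
  "f \<in> cells1 K \<Longrightarrow> map1 D f \<in> cells1 L"
  "f \<in> cells1 K \<Longrightarrow> src (map1 D f) = map0 D (src f)"
  "f \<in> cells1 K \<Longrightarrow> tgt (map1 D f) = map0 D (tgt f)"
  using preserves by (simp_all add: two_functor_def)

lemma map2_cell [simp]:
  "\<alpha> \<in> cells2 K \<Longrightarrow> map2 D \<alpha> \<in> cells2 L"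
  "\<alpha> \<in> cells2 K \<Longrightarrow> src (map2 D \<alpha>) = map1 D (src \<alpha>)"
  "\<alpha> \<in> cells2 K \<Longrightarrow> tgt (map2 D \<alpha>) = map1 D (tgt \<alpha>)"
  using preserves by (simp_all add: two_functor_def)

lemma map1_id1 [simp]: "x \<in> cells0 K \<Longrightarrow> map1 D (id1 K x) = id1 L (map0 D x)"
  using preserves by (simp add: two_functor_def)

lemma map1_comp1 [simp]:
  "f \<in> cells1 K \<Longrightarrow> g \<in> cells1 K \<Longrightarrow> tgt f = src g \<Longrightarrow>
    map1 D (comp1 K g f) = comp1 L (map1 D g) (map1 D f)"
  using preserves by (simp add: two_functor_def)

lemma map2_id2 [simp]: "f \<in> cells1 K \<Longrightarrow> map2 D (id2 K f) = id2 L (map1 D f)"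
  using preserves by (simp add: two_functor_def)

lemma map2_vcomp [simp]:
  "\<alpha> \<in> cells2 K \<Longrightarrow> \<beta> \<in> cells2 K \<Longrightarrow> tgt \<alpha> = src \<beta> \<Longrightarrow>
    map2 D (vcomp K \<beta> \<alpha>) = vcomp L (map2 D \<beta>) (map2 D \<alpha>)"
  using preserves by (simp add: two_functor_def)

lemma map2_hcomp [simp]:
  "\<alpha> \<in> cells2 K \<Longrightarrow> \<beta> \<in> cells2 K \<Longrightarrow> tgt (src \<alpha>) = src (src \<beta>) \<Longrightarrow>
    map2 D (hcomp K \<beta> \<alpha>) = hcomp L (map2 D \<beta>) (map2 D \<alpha>)"
  using preserves by (simp add: two_functor_def)

lemma map2_whisk [simp]:
  "\<alpha> \<in> cells2 K \<Longrightarrow> g \<in> cells1 K \<Longrightarrow> tgt (src \<alpha>) = src g \<Longrightarrow>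
    map2 D (whisk_l K g \<alpha>) = whisk_l L (map1 D g) (map2 D \<alpha>)"
  "\<alpha> \<in> cells2 K \<Longrightarrow> f \<in> cells1 K \<Longrightarrow> tgt f = src (src \<alpha>) \<Longrightarrow>
    map2 D (whisk_r K \<alpha> f) = whisk_r L (map2 D \<alpha>) (map1 D f)"
  by (simp_all add: whisk_l_def whisk_r_def)

lemma invertible2_map2 [simp]:
  assumes "invertible2 K \<alpha>" shows "invertible2 L (map2 D \<alpha>)"
proof -
  from assms obtain \<beta> where b: "\<alpha> \<in> cells2 K" "\<beta> \<in> cells2 K" "src \<beta> = tgt \<alpha>" "tgt \<beta> = src \<alpha>"
    "vcomp K \<beta> \<alpha> = id2 K (src \<alpha>)" "vcomp K \<alpha> \<beta> = id2 K (tgt \<alpha>)"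
    unfolding invertible2_def by blast
  then show ?thesis
    by (auto simp: invertible2_def map2_vcomp[symmetric] simp del: map2_vcomp
        intro!: bexI[of _ "map2 D \<beta>"])
qed

end

lemma twofunctorI: "two_functor K L D \<Longrightarrow> twofunctor K L D"
  by (simp add: twofunctor_def twofunctor_axioms_def twocat_def two_functor_def)

text \<open>The extra premises about sources and targets hold in every strict 2-category. They are
  supplied here so that, for a horizontal composite of 2-cells, functoriality on 1-cells can be
  applied at both of its ends.\<close>

lemma two_functorI:
  assumes "strict_2_category K" "strict_2_category L"
    "\<And>x. x \<in> cells0 K \<Longrightarrow> map0 \<Phi> x \<in> cells0 L"
    "\<And>f. f \<in> cells1 K \<Longrightarrow> map1 \<Phi> f \<in> cells1 L \<and>
       src (map1 \<Phi> f) = map0 \<Phi> (src f) \<and> tgt (map1 \<Phi> f) = map0 \<Phi> (tgt f)"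
    "\<And>\<alpha>. \<alpha> \<in> cells2 K \<Longrightarrow> src \<alpha> \<in> cells1 K \<Longrightarrow> tgt \<alpha> \<in> cells1 K \<Longrightarrow>
       map2 \<Phi> \<alpha> \<in> cells2 L \<and> src (map2 \<Phi> \<alpha>) = map1 \<Phi> (src \<alpha>) \<and> tgt (map2 \<Phi> \<alpha>) = map1 \<Phi> (tgt \<alpha>)"
    "\<And>x. x \<in> cells0 K \<Longrightarrow> map1 \<Phi> (id1 K x) = id1 L (map0 \<Phi> x)"
    "\<And>f g. f \<in> cells1 K \<Longrightarrow> g \<in> cells1 K \<Longrightarrow> tgt f = src g \<Longrightarrow>
       map1 \<Phi> (comp1 K g f) = comp1 L (map1 \<Phi> g) (map1 \<Phi> f)"
    "\<And>f. f \<in> cells1 K \<Longrightarrow> map2 \<Phi> (id2 K f) = id2 L (map1 \<Phi> f)"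
    "\<And>\<alpha> \<beta>. \<alpha> \<in> cells2 K \<Longrightarrow> \<beta> \<in> cells2 K \<Longrightarrow> tgt \<alpha> = src \<beta> \<Longrightarrow>
       map2 \<Phi> (vcomp K \<beta> \<alpha>) = vcomp L (map2 \<Phi> \<beta>) (map2 \<Phi> \<alpha>)"
    "\<And>\<alpha> \<beta>. \<alpha> \<in> cells2 K \<Longrightarrow> \<beta> \<in> cells2 K \<Longrightarrow> tgt (src \<alpha>) = src (src \<beta>) \<Longrightarrow>
       src \<alpha> \<in> cells1 K \<Longrightarrow> tgt \<alpha> \<in> cells1 K \<Longrightarrow> src \<beta> \<in> cells1 K \<Longrightarrow> tgt \<beta> \<in> cells1 K \<Longrightarrow>
       tgt (tgt \<alpha>) = src (tgt \<beta>) \<Longrightarrow>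
       map2 \<Phi> (hcomp K \<beta> \<alpha>) = hcomp L (map2 \<Phi> \<beta>) (map2 \<Phi> \<alpha>)"
  shows "two_functor K L \<Phi>"
proof -
  interpret twocat K using assms(1) by unfold_locales
  show ?thesis unfolding two_functor_def using assms by simp
qed

lemma two_functor_id: "strict_2_category K \<Longrightarrow> two_functor K K twofun_id"
  by (simp add: two_functor_def twofun_id_def)

lemma two_functor_comp:
  assumes "two_functor K L \<Phi>" "two_functor L M \<Psi>"
  shows "two_functor K M (twofun_comp \<Psi> \<Phi>)"
proof -
  interpret F: twofunctor K L \<Phi> using assms(1) by (rule twofunctorI)
  interpret G: twofunctor L M \<Psi> using assms(2) by (rule twofunctorI)
  show ?thesis unfolding two_functor_def
    by (simp add: twofun_comp_def F.K.strict G.L.strict)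
qed

lemma two_natural_cell:
  assumes "two_natural K L \<Phi> \<Psi> t" "x \<in> cells0 K"
  shows "t x \<in> cells1 L" "src (t x) = map0 \<Phi> x" "tgt (t x) = map0 \<Psi> x"
  using assms by (simp_all add: two_natural_def)

lemma two_natural_nat1:
  assumes "two_natural K L \<Phi> \<Psi> t" "f \<in> cells1 K"
  shows "comp1 L (map1 \<Psi> f) (t (src f)) = comp1 L (t (tgt f)) (map1 \<Phi> f)"
  using assms by (simp add: two_natural_def)

lemma two_natural_nat2:
  assumes "two_natural K L \<Phi> \<Psi> t" "\<alpha> \<in> cells2 K"
  shows "whisk_r L (map2 \<Psi> \<alpha>) (t (src (src \<alpha>))) = whisk_l L (t (tgt (src \<alpha>))) (map2 \<Phi> \<alpha>)"
  using assms by (simp add: two_natural_def)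


lemma cell_eqI: "src s = src t \<Longrightarrow> tgt s = tgt t \<Longrightarrow> dat s = dat t \<Longrightarrow> s = t"
  by (cases s; cases t) simp

lemma strict_2_categoryI:
  assumes "\<And>f. f \<in> cells1 K \<Longrightarrow> src f \<in> cells0 K \<and> tgt f \<in> cells0 K"
    and "\<And>x. x \<in> cells0 K \<Longrightarrow> id1 K x \<in> cells1 K \<and> src (id1 K x) = x \<and> tgt (id1 K x) = x"
    and "\<And>f g. f \<in> cells1 K \<Longrightarrow> g \<in> cells1 K \<Longrightarrow> tgt f = src g \<Longrightarrow>
       comp1 K g f \<in> cells1 K \<and> src (comp1 K g f) = src f \<and> tgt (comp1 K g f) = tgt g"
    and "\<And>f. f \<in> cells1 K \<Longrightarrow>
       comp1 K f (id1 K (src f)) = f \<and> comp1 K (id1 K (tgt f)) f = f"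
    and "\<And>f g h. f \<in> cells1 K \<Longrightarrow> g \<in> cells1 K \<Longrightarrow> h \<in> cells1 K \<Longrightarrow> tgt f = src g \<Longrightarrow> tgt g = src h \<Longrightarrow>
       comp1 K h (comp1 K g f) = comp1 K (comp1 K h g) f"
    and "\<And>\<alpha>. \<alpha> \<in> cells2 K \<Longrightarrow> src \<alpha> \<in> cells1 K \<and> tgt \<alpha> \<in> cells1 K \<and>
       src (src \<alpha>) = src (tgt \<alpha>) \<and> tgt (src \<alpha>) = tgt (tgt \<alpha>)"
    and "\<And>f. f \<in> cells1 K \<Longrightarrow> id2 K f \<in> cells2 K \<and> src (id2 K f) = f \<and> tgt (id2 K f) = f"
    and "\<And>\<alpha> \<beta>. \<alpha> \<in> cells2 K \<Longrightarrow> \<beta> \<in> cells2 K \<Longrightarrow> tgt \<alpha> = src \<beta> \<Longrightarrow>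
       vcomp K \<beta> \<alpha> \<in> cells2 K \<and> src (vcomp K \<beta> \<alpha>) = src \<alpha> \<and> tgt (vcomp K \<beta> \<alpha>) = tgt \<beta>"
    and "\<And>\<alpha>. \<alpha> \<in> cells2 K \<Longrightarrow> vcomp K \<alpha> (id2 K (src \<alpha>)) = \<alpha> \<and> vcomp K (id2 K (tgt \<alpha>)) \<alpha> = \<alpha>"
    and "\<And>\<alpha> \<beta> \<gamma>. \<alpha> \<in> cells2 K \<Longrightarrow> \<beta> \<in> cells2 K \<Longrightarrow> \<gamma> \<in> cells2 K \<Longrightarrow> tgt \<alpha> = src \<beta> \<Longrightarrow> tgt \<beta> = src \<gamma> \<Longrightarrow>
       vcomp K \<gamma> (vcomp K \<beta> \<alpha>) = vcomp K (vcomp K \<gamma> \<beta>) \<alpha>"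
    and "\<And>\<alpha> \<beta>. \<alpha> \<in> cells2 K \<Longrightarrow> \<beta> \<in> cells2 K \<Longrightarrow> tgt (src \<alpha>) = src (src \<beta>) \<Longrightarrow>
       hcomp K \<beta> \<alpha> \<in> cells2 K \<and>
       src (hcomp K \<beta> \<alpha>) = comp1 K (src \<beta>) (src \<alpha>) \<and>
       tgt (hcomp K \<beta> \<alpha>) = comp1 K (tgt \<beta>) (tgt \<alpha>)"
    and "\<And>\<alpha>. \<alpha> \<in> cells2 K \<Longrightarrow> hcomp K \<alpha> (id2 K (id1 K (src (src \<alpha>)))) = \<alpha> \<and>
       hcomp K (id2 K (id1 K (tgt (src \<alpha>)))) \<alpha> = \<alpha>"
    and "\<And>\<alpha> \<beta> \<gamma>. \<alpha> \<in> cells2 K \<Longrightarrow> \<beta> \<in> cells2 K \<Longrightarrow> \<gamma> \<in> cells2 K \<Longrightarrow>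
       tgt (src \<alpha>) = src (src \<beta>) \<Longrightarrow> tgt (src \<beta>) = src (src \<gamma>) \<Longrightarrow>
       hcomp K \<gamma> (hcomp K \<beta> \<alpha>) = hcomp K (hcomp K \<gamma> \<beta>) \<alpha>"
    and "\<And>f g. f \<in> cells1 K \<Longrightarrow> g \<in> cells1 K \<Longrightarrow> tgt f = src g \<Longrightarrow>
       hcomp K (id2 K g) (id2 K f) = id2 K (comp1 K g f)"
    and "\<And>\<alpha> \<alpha>' \<beta> \<beta>'. \<alpha> \<in> cells2 K \<Longrightarrow> \<alpha>' \<in> cells2 K \<Longrightarrow> \<beta> \<in> cells2 K \<Longrightarrow> \<beta>' \<in> cells2 K \<Longrightarrow>
       tgt \<alpha> = src \<alpha>' \<Longrightarrow> tgt \<beta> = src \<beta>' \<Longrightarrow> tgt (src \<alpha>) = src (src \<beta>) \<Longrightarrow>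
       hcomp K (vcomp K \<beta>' \<beta>) (vcomp K \<alpha>' \<alpha>) = vcomp K (hcomp K \<beta>' \<alpha>') (hcomp K \<beta> \<alpha>)"
  shows "strict_2_category K"
  unfolding strict_2_category_def
  apply (intro conjI)
  subgoal using assms(1) by blast
  subgoal using assms(2) by blast
  subgoal using assms(3) by blast
  subgoal using assms(4) by blast
  subgoal using assms(5) by blast
  subgoal using assms(6) by blast
  subgoal using assms(7) by blast
  subgoal using assms(8) by blast
  subgoal using assms(9) by blast
  subgoal using assms(10) by blast
  subgoal using assms(11) by blast
  subgoal using assms(12) by blast
  subgoal using assms(13) by blast
  subgoal using assms(14) by blast
  subgoal using assms(15) by blast
  done

subsection \<open>The arrow 2-category and structured objects\<close>

lemma square_eqI:
  "src s = src t \<Longrightarrow> tgt s = tgt t \<Longrightarrow> top1 s = top1 t \<Longrightarrow> bot1 s = bot1 t \<Longrightarrow> s = t"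
  by (cases s; cases t) (simp add: top1_def bot1_def prod_eq_iff)

lemma top1_Cell [simp]: "top1 (Cell a b (x, y)) = x" "bot1 (Cell a b (x, y)) = y"
  by (simp_all add: top1_def bot1_def)

lemma arrow2_sel [simp]:
  "cells0 (arrow2 K) = cells1 K"
  "id1 (arrow2 K) P = Cell P P (id1 K (src P), id1 K (tgt P))"
  "comp1 (arrow2 K) t s = Cell (src s) (tgt t) (comp1 K (top1 t) (top1 s), comp1 K (bot1 t) (bot1 s))"
  "id2 (arrow2 K) s = Cell s s (id2 K (top1 s), id2 K (bot1 s))"
  "vcomp (arrow2 K) \<tau> \<sigma> = Cell (src \<sigma>) (tgt \<tau>)
     (vcomp K (top1 \<tau>) (top1 \<sigma>), vcomp K (bot1 \<tau>) (bot1 \<sigma>))"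
  "hcomp (arrow2 K) \<tau> \<sigma> =
     Cell (comp1 (arrow2 K) (src \<tau>) (src \<sigma>)) (comp1 (arrow2 K) (tgt \<tau>) (tgt \<sigma>))
       (hcomp K (top1 \<tau>) (top1 \<sigma>), hcomp K (bot1 \<tau>) (bot1 \<sigma>))"
  by (simp_all add: arrow2_def Let_def)

lemma arrow2_cells1 [simp]:
  "s \<in> cells1 (arrow2 K) \<longleftrightarrow>
     src s \<in> cells1 K \<and> tgt s \<in> cells1 K \<and> top1 s \<in> cells1 K \<and> bot1 s \<in> cells1 K \<and>
     src (top1 s) = src (src s) \<and> tgt (top1 s) = src (tgt s) \<and>
     src (bot1 s) = tgt (src s) \<and> tgt (bot1 s) = tgt (tgt s) \<and>
     comp1 K (tgt s) (top1 s) = comp1 K (bot1 s) (src s)"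
  by (cases s) (auto simp: arrow2_def arrow_squares_def Let_def top1_def bot1_def)

lemma arrow2_cells2 [simp]:
  "\<sigma> \<in> cells2 (arrow2 K) \<longleftrightarrow>
     src \<sigma> \<in> cells1 (arrow2 K) \<and> tgt \<sigma> \<in> cells1 (arrow2 K) \<and>
     src (src \<sigma>) = src (tgt \<sigma>) \<and> tgt (src \<sigma>) = tgt (tgt \<sigma>) \<and>
     top1 \<sigma> \<in> cells2 K \<and> bot1 \<sigma> \<in> cells2 K \<and>
     src (top1 \<sigma>) = top1 (src \<sigma>) \<and> tgt (top1 \<sigma>) = top1 (tgt \<sigma>) \<and>
     src (bot1 \<sigma>) = bot1 (src \<sigma>) \<and> tgt (bot1 \<sigma>) = bot1 (tgt \<sigma>) \<and>
     whisk_l K (tgt (src \<sigma>)) (top1 \<sigma>) = whisk_r K (bot1 \<sigma>) (src (src \<sigma>))"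
proof -
  have "arrow_squares K = cells1 (arrow2 K)" by (simp add: arrow2_def Let_def)
  then show ?thesis
    by (cases \<sigma>) (auto simp: arrow2_def Let_def top1_def bot1_def simp del: arrow2_cells1)
qed

lemma arrow2_cells1E:
  assumes "s \<in> cells1 (arrow2 K)"
  obtains P Q T S where "s = Cell P Q (T, S)" "P \<in> cells1 K" "Q \<in> cells1 K" "T \<in> cells1 K" "S \<in> cells1 K"
    "src T = src P" "tgt T = src Q" "src S = tgt P" "tgt S = tgt Q" "comp1 K Q T = comp1 K S P"
  using assms by (cases s; cases "dat s") auto

lemma arrow2_cells2E:
  assumes "\<sigma> \<in> cells2 (arrow2 K)"
  obtains P Q T S T' S' \<beta> \<alpha> where "\<sigma> = Cell (Cell P Q (T, S)) (Cell P Q (T', S')) (\<beta>, \<alpha>)"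
    "P \<in> cells1 K" "Q \<in> cells1 K" "T \<in> cells1 K" "S \<in> cells1 K" "T' \<in> cells1 K" "S' \<in> cells1 K"
    "src T = src P" "tgt T = src Q" "src S = tgt P" "tgt S = tgt Q" "comp1 K Q T = comp1 K S P"
    "src T' = src P" "tgt T' = src Q" "src S' = tgt P" "tgt S' = tgt Q" "comp1 K Q T' = comp1 K S' P"
    "\<beta> \<in> cells2 K" "\<alpha> \<in> cells2 K" "src \<beta> = T" "tgt \<beta> = T'" "src \<alpha> = S" "tgt \<alpha> = S'"
    "whisk_l K Q \<beta> = whisk_r K \<alpha> P"
proof -
  have 1: "src \<sigma> \<in> cells1 (arrow2 K)" "tgt \<sigma> \<in> cells1 (arrow2 K)" using assms by auto
  from 1(1) obtain P Q T S where 2: "src \<sigma> = Cell P Q (T, S)" "P \<in> cells1 K" "Q \<in> cells1 K" "T \<in> cells1 K" "S \<in> cells1 K"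
    "src T = src P" "tgt T = src Q" "src S = tgt P" "tgt S = tgt Q" "comp1 K Q T = comp1 K S P"
    by (rule arrow2_cells1E)
  from 1(2) obtain P' Q' T' S' where 3: "tgt \<sigma> = Cell P' Q' (T', S')" "P' \<in> cells1 K" "Q' \<in> cells1 K" "T' \<in> cells1 K" "S' \<in> cells1 K"
    "src T' = src P'" "tgt T' = src Q'" "src S' = tgt P'" "tgt S' = tgt Q'" "comp1 K Q' T' = comp1 K S' P'"
    by (rule arrow2_cells1E)
  have [simp]: "P' = P" "Q' = Q" using assms 2(1) 3(1) by auto
  show ?thesis
    by (rule that[of P Q T S T' S' "top1 \<sigma>" "bot1 \<sigma>"])
      (use assms 2 3 in \<open>auto intro!: square_eqI\<close>)
qed

context twocat
begin

abbreviation c1 (infixr "\<cdot>" 70) where "g \<cdot> f \<equiv> comp1 K g f"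
abbreviation wl (infixr "\<rhd>" 71) where "g \<rhd> \<alpha> \<equiv> whisk_l K g \<alpha>"
abbreviation wr (infixl "\<lhd>" 72) where "\<alpha> \<lhd> f \<equiv> whisk_r K \<alpha> f"
abbreviation vc (infixr "\<bullet>" 65) where "\<beta> \<bullet> \<alpha> \<equiv> vcomp K \<beta> \<alpha>"

text \<open>An equation of twofold composites no longer occurs literally in a longer right-nested
  one; this restores it in front of a tail \<open>e\<close>.\<close>

lemma comp1_reassoc:
  assumes "g \<cdot> f = g' \<cdot> f'" "f \<in> cells1 K" "g \<in> cells1 K" "f' \<in> cells1 K" "g' \<in> cells1 K"
    "tgt f = src g" "tgt f' = src g'" "e \<in> cells1 K" "tgt e = src f" "tgt e = src f'"
  shows "g \<cdot> f \<cdot> e = g' \<cdot> f' \<cdot> e"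
  using assms by (metis comp1_assoc)

lemma strict_arrow2: "strict_2_category (arrow2 K)"
proof (rule strict_2_categoryI, goal_cases)
  case (3 f g)
  then show ?case
    by simp (metis comp1_assoc)
next
  case (8 \<alpha> \<beta>)
  then show ?case by (elim arrow2_cells2E) simp
next
  case (11 \<alpha> \<beta>)
  from 11(1) obtain P Q T S T' S' a b where
    1: "\<alpha> = Cell (Cell P Q (T, S)) (Cell P Q (T', S')) (b, a)"
    "P \<in> cells1 K" "Q \<in> cells1 K" "T \<in> cells1 K" "S \<in> cells1 K" "T' \<in> cells1 K" "S' \<in> cells1 K"
    "src T = src P" "tgt T = src Q" "src S = tgt P" "tgt S = tgt Q" "comp1 K Q T = comp1 K S P"
    "src T' = src P" "tgt T' = src Q" "src S' = tgt P" "tgt S' = tgt Q" "comp1 K Q T' = comp1 K S' P"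
    "b \<in> cells2 K" "a \<in> cells2 K" "src b = T" "tgt b = T'" "src a = S" "tgt a = S'"
    "Q \<rhd> b = a \<lhd> P" by (rule arrow2_cells2E)
  from 11(2) obtain Q' R U V U' V' c d where
    2: "\<beta> = Cell (Cell Q' R (U, V)) (Cell Q' R (U', V')) (d, c)"
    "Q' \<in> cells1 K" "R \<in> cells1 K" "U \<in> cells1 K" "V \<in> cells1 K" "U' \<in> cells1 K" "V' \<in> cells1 K"
    "src U = src Q'" "tgt U = src R" "src V = tgt Q'" "tgt V = tgt R" "comp1 K R U = comp1 K V Q'"
    "src U' = src Q'" "tgt U' = src R" "src V' = tgt Q'" "tgt V' = tgt R" "comp1 K R U' = comp1 K V' Q'"
    "d \<in> cells2 K" "c \<in> cells2 K" "src d = U" "tgt d = U'" "src c = V" "tgt c = V'"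
    "R \<rhd> d = c \<lhd> Q'" by (rule arrow2_cells2E)
  have [simp]: "Q' = Q" using 1(1) 2(1) 11(3) by simp
  have 3: "hcomp K (id2 K R) d = hcomp K c (id2 K Q)" "hcomp K (id2 K Q) b = hcomp K a (id2 K P)"
    using 1(24) 2(24) by (simp_all add: whisk_l_def whisk_r_def)
  \<comment> \<open>Two prisms are pasted: \<open>R\<close> slides past \<open>d\<close>, leaving
    \<open>c\<close> with \<open>Q\<close> on its right, and then \<open>Q\<close> slides past
    \<open>b\<close>, leaving \<open>a\<close> with \<open>P\<close> on its right.\<close>
  have "hcomp K (id2 K R) (hcomp K d b) = hcomp K (hcomp K (id2 K R) d) b" using 1 2 by simp
  also have "\<dots> = hcomp K c (hcomp K (id2 K Q) b)" unfolding 3(1) using 1 2 by simp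
  finally have "R \<rhd> hcomp K d b = hcomp K c a \<lhd> P" unfolding 3(2) using 1 2 by (simp add: whisk_l_def whisk_r_def)
  moreover have "R \<cdot> U \<cdot> T = V \<cdot> S \<cdot> P" "R \<cdot> U' \<cdot> T' = V' \<cdot> S' \<cdot> P"
    using 1 2 by (metis \<open>Q' = Q\<close> comp1_assoc)+
  ultimately show ?case using 1 2 by simp
qed ((((elim arrow2_cells1E arrow2_cells2E)?)[1], simp add: interchange)+)

end

lemma structured_sel [simp]:
  "cells0 (structured K Ob U \<Phi> \<Psi>) = Ob"
  "id1 (structured K Ob U \<Phi> \<Psi>) X = Cell X X (id1 K (U X))"
  "comp1 (structured K Ob U \<Phi> \<Psi>) g f = Cell (src f) (tgt g) (comp1 K (dat g) (dat f))"
  "id2 (structured K Ob U \<Phi> \<Psi>) f' = Cell f' f' (id2 K (dat f'))"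
  "vcomp (structured K Ob U \<Phi> \<Psi>) \<beta> \<alpha> = Cell (src \<alpha>) (tgt \<beta>) (vcomp K (dat \<beta>) (dat \<alpha>))"
  "hcomp (structured K Ob U \<Phi> \<Psi>) \<beta> \<alpha> =
     Cell (comp1 (structured K Ob U \<Phi> \<Psi>) (src \<beta>) (src \<alpha>))
       (comp1 (structured K Ob U \<Phi> \<Psi>) (tgt \<beta>) (tgt \<alpha>)) (hcomp K (dat \<beta>) (dat \<alpha>))"
  by (simp_all add: structured_def Let_def)

lemma structured_cells1 [simp]:
  "f \<in> cells1 (structured K Ob U \<Phi> \<Psi>) \<longleftrightarrow>
     src f \<in> Ob \<and> tgt f \<in> Ob \<and> dat f \<in> cells1 K \<and> src (dat f) = U (src f) \<and>
     tgt (dat f) = U (tgt f) \<and> \<Phi> (src f) (tgt f) (dat f)"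
  by (cases f) (auto simp: structured_def Let_def)

lemma structured_cells2 [simp]:
  "\<alpha> \<in> cells2 (structured K Ob U \<Phi> \<Psi>) \<longleftrightarrow>
     src \<alpha> \<in> cells1 (structured K Ob U \<Phi> \<Psi>) \<and> tgt \<alpha> \<in> cells1 (structured K Ob U \<Phi> \<Psi>) \<and>
     src (src \<alpha>) = src (tgt \<alpha>) \<and> tgt (src \<alpha>) = tgt (tgt \<alpha>) \<and>
     dat \<alpha> \<in> cells2 K \<and> src (dat \<alpha>) = dat (src \<alpha>) \<and> tgt (dat \<alpha>) = dat (tgt \<alpha>) \<and>
     \<Psi> (src (src \<alpha>)) (tgt (src \<alpha>)) (dat \<alpha>)"
proof -
  let ?S = "structured K Ob U \<Phi> \<Psi>"
  have "cells2 ?S = {Cell f g \<alpha> | f g \<alpha>. f \<in> cells1 ?S \<and> g \<in> cells1 ?S \<and> src f = src g \<and> tgt f = tgt g \<and>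
    \<alpha> \<in> cells2 K \<and> src \<alpha> = dat f \<and> tgt \<alpha> = dat g \<and> \<Psi> (src f) (tgt f) \<alpha>}"
    by (simp add: structured_def Let_def)
  then show ?thesis by (cases \<alpha>) (auto simp del: structured_cells1)
qed

context twocat
begin

text \<open>All equations are equations of the underlying cells of \<open>K\<close>; what remains is
  that \<open>\<Phi>\<close> and \<open>\<Psi>\<close> are closed under identities and
  compositions.\<close>

lemma strict_structured:
  assumes U: "\<And>X. X \<in> Ob \<Longrightarrow> U X \<in> cells0 K"
    and "\<And>X. X \<in> Ob \<Longrightarrow> \<Phi> X X (id1 K (U X))"
    and "\<And>X Y Z f g. X \<in> Ob \<Longrightarrow> Y \<in> Ob \<Longrightarrow> Z \<in> Ob \<Longrightarrow> f \<in> cells1 K \<Longrightarrow> g \<in> cells1 K \<Longrightarrow>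
      src f = U X \<Longrightarrow> tgt f = U Y \<Longrightarrow> src g = U Y \<Longrightarrow> tgt g = U Z \<Longrightarrow> \<Phi> X Y f \<Longrightarrow> \<Phi> Y Z g \<Longrightarrow>
      \<Phi> X Z (g \<cdot> f)"
    and "\<And>X Y f. X \<in> Ob \<Longrightarrow> Y \<in> Ob \<Longrightarrow> f \<in> cells1 K \<Longrightarrow> src f = U X \<Longrightarrow> tgt f = U Y \<Longrightarrow>
      \<Phi> X Y f \<Longrightarrow> \<Psi> X Y (id2 K f)"
    and "\<And>X Y \<alpha> \<beta>. X \<in> Ob \<Longrightarrow> Y \<in> Ob \<Longrightarrow> \<alpha> \<in> cells2 K \<Longrightarrow> \<beta> \<in> cells2 K \<Longrightarrow>
      src (src \<alpha>) = U X \<Longrightarrow> tgt (src \<alpha>) = U Y \<Longrightarrow> tgt \<alpha> = src \<beta> \<Longrightarrow> \<Psi> X Y \<alpha> \<Longrightarrow> \<Psi> X Y \<beta> \<Longrightarrow>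
      \<Psi> X Y (\<beta> \<bullet> \<alpha>)"
    and "\<And>X Y Z \<alpha> \<beta>. X \<in> Ob \<Longrightarrow> Y \<in> Ob \<Longrightarrow> Z \<in> Ob \<Longrightarrow> \<alpha> \<in> cells2 K \<Longrightarrow> \<beta> \<in> cells2 K \<Longrightarrow>
      src (src \<alpha>) = U X \<Longrightarrow> tgt (src \<alpha>) = U Y \<Longrightarrow> src (src \<beta>) = U Y \<Longrightarrow> tgt (src \<beta>) = U Z \<Longrightarrow>
      \<Phi> X Y (src \<alpha>) \<Longrightarrow> \<Phi> X Y (tgt \<alpha>) \<Longrightarrow> \<Phi> Y Z (src \<beta>) \<Longrightarrow> \<Phi> Y Z (tgt \<beta>) \<Longrightarrow>
      \<Psi> X Y \<alpha> \<Longrightarrow> \<Psi> Y Z \<beta> \<Longrightarrow> \<Psi> X Z (hcomp K \<beta> \<alpha>)"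
  shows "strict_2_category (structured K Ob U \<Phi> \<Psi>)"
  by (rule strict_2_categoryI) (auto simp: interchange assms intro!: cell_eqI intro: assms)

end

section \<open>Algebras of a 2-monad\<close>

locale tmonad = twocat K for K :: "('o, 'm, 'c) twocat" +
  fixes M :: "('o, 'm, 'c) twomonad"
  assumes monad: "two_monad K M"
begin

abbreviation T where "T \<equiv> mfun M"
abbreviation \<eta> where "\<eta> \<equiv> munit M"
abbreviation \<mu> where "\<mu> \<equiv> mmult M"

lemma T_functor: "two_functor K K T"
  and unit_nat: "two_natural K K twofun_id T \<eta>"
  and mult_nat: "two_natural K K (twofun_comp T T) T \<mu>"
  using monad unfolding two_monad_def Let_def by auto

sublocale T: twofunctor K K T by (rule twofunctorI) (rule T_functor)

lemma monad_laws [simp]: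
  assumes "X \<in> cells0 K"
  shows "\<mu> X \<cdot> \<eta> (map0 T X) = id1 K (map0 T X)"
    "\<mu> X \<cdot> map1 T (\<eta> X) = id1 K (map0 T X)"
    "\<mu> X \<cdot> \<mu> (map0 T X) = \<mu> X \<cdot> map1 T (\<mu> X)"
  using monad assms unfolding two_monad_def Let_def by auto

lemma unit_cell [simp]:
  assumes "X \<in> cells0 K"
  shows "\<eta> X \<in> cells1 K" "src (\<eta> X) = X" "tgt (\<eta> X) = map0 T X"
  using two_natural_cell[OF unit_nat assms] by (simp_all add: twofun_id_def)

lemma mult_cell [simp]:
  assumes "X \<in> cells0 K"
  shows "\<mu> X \<in> cells1 K" "src (\<mu> X) = map0 T (map0 T X)" "tgt (\<mu> X) = map0 T X"
  using two_natural_cell[OF mult_nat assms] by (simp_all add: twofun_comp_def)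

lemma unit_nat1: "f \<in> cells1 K \<Longrightarrow> map1 T f \<cdot> \<eta> (src f) = \<eta> (tgt f) \<cdot> f"
  using two_natural_nat1[OF unit_nat] by (simp add: twofun_id_def)

lemma mult_nat1: "f \<in> cells1 K \<Longrightarrow> map1 T f \<cdot> \<mu> (src f) = \<mu> (tgt f) \<cdot> map1 T (map1 T f)"
  using two_natural_nat1[OF mult_nat] by (simp add: twofun_comp_def)

lemma pseudoalgebraD:
  assumes "normal_pseudoalgebra K M A"
  shows "ps_car A \<in> cells0 K" "ps_act A \<in> cells1 K" "src (ps_act A) = map0 T (ps_car A)"
    "tgt (ps_act A) = ps_car A" "ps_act A \<cdot> \<eta> (ps_car A) = id1 K (ps_car A)"
    "invertible2 K (ps_mul A)" "ps_mul A \<in> cells2 K"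
    "src (ps_mul A) = ps_act A \<cdot> map1 T (ps_act A)" "tgt (ps_mul A) = ps_act A \<cdot> \<mu> (ps_car A)"
    "ps_mul A \<lhd> map1 T (\<eta> (ps_car A)) = id2 K (ps_act A)"
    "ps_mul A \<lhd> \<eta> (map0 T (ps_car A)) = id2 K (ps_act A)"
    "(ps_mul A \<lhd> map1 T (\<mu> (ps_car A))) \<bullet> (ps_act A \<rhd> map2 T (ps_mul A)) =
     (ps_mul A \<lhd> \<mu> (map0 T (ps_car A))) \<bullet> (ps_mul A \<lhd> map1 T (map1 T (ps_act A)))"
  using assms unfolding normal_pseudoalgebra_def Let_def by (auto dest: invertible2_cell)

lemma pseudomorphismD:
  assumes "pseudomorphism K M F"
  shows "normal_pseudoalgebra K M (src F)" "normal_pseudoalgebra K M (tgt F)"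
    "fst (dat F) \<in> cells1 K" "src (fst (dat F)) = ps_car (src F)" "tgt (fst (dat F)) = ps_car (tgt F)"
    "invertible2 K (snd (dat F))" "snd (dat F) \<in> cells2 K"
    "src (snd (dat F)) = ps_act (tgt F) \<cdot> map1 T (fst (dat F))"
    "tgt (snd (dat F)) = fst (dat F) \<cdot> ps_act (src F)"
    "snd (dat F) \<lhd> \<eta> (ps_car (src F)) = id2 K (fst (dat F))"
    "(snd (dat F) \<lhd> \<mu> (ps_car (src F))) \<bullet> (ps_mul (tgt F) \<lhd> map1 T (map1 T (fst (dat F)))) =
     (fst (dat F) \<rhd> ps_mul (src F)) \<bullet> (snd (dat F) \<lhd> map1 T (ps_act (src F))) \<bullet>
       (ps_act (tgt F) \<rhd> map2 T (snd (dat F)))"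
  using assms unfolding pseudomorphism_def Let_def by (auto dest: invertible2_cell)

lemma algebra_transformationD:
  assumes "algebra_transformation K M A"
  shows "pseudomorphism K M (src A)" "pseudomorphism K M (tgt A)"
    "src (src A) = src (tgt A)" "tgt (src A) = tgt (tgt A)"
    "dat A \<in> cells2 K" "src (dat A) = fst (dat (src A))" "tgt (dat A) = fst (dat (tgt A))"
    "(dat A \<lhd> ps_act (src (src A))) \<bullet> snd (dat (src A)) =
     snd (dat (tgt A)) \<bullet> (ps_act (tgt (src A)) \<rhd> map2 T (dat A))"
  using assms unfolding algebra_transformation_def Let_def by auto

lemma PsAlgn_sel [simp]:
  "cells0 (PsAlgn K M) = {A. normal_pseudoalgebra K M A}"
  "cells1 (PsAlgn K M) = {F. pseudomorphism K M F}"
  "cells2 (PsAlgn K M) = {A. algebra_transformation K M A}"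
  "id1 (PsAlgn K M) A = Cell A A (id1 K (ps_car A), id2 K (ps_act A))"
  "comp1 (PsAlgn K M) G F = Cell (src F) (tgt G) (fst (dat G) \<cdot> fst (dat F),
     (fst (dat G) \<rhd> snd (dat F)) \<bullet> (snd (dat G) \<lhd> map1 T (fst (dat F))))"
  "id2 (PsAlgn K M) F = Cell F F (id2 K (fst (dat F)))"
  "vcomp (PsAlgn K M) B C = Cell (src C) (tgt B) (vcomp K (dat B) (dat C))"
  "hcomp (PsAlgn K M) B C = Cell (comp1 (PsAlgn K M) (src B) (src C))
     (comp1 (PsAlgn K M) (tgt B) (tgt C)) (hcomp K (dat B) (dat C))"
  by (simp_all add: PsAlgn_def Let_def)

lemma vcomp_reassoc:
  assumes "\<beta> \<bullet> \<alpha> = \<beta>' \<bullet> \<alpha>'" "\<alpha> \<in> cells2 K" "\<beta> \<in> cells2 K" "\<alpha>' \<in> cells2 K" "\<beta>' \<in> cells2 K"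
    "tgt \<alpha> = src \<beta>" "tgt \<alpha>' = src \<beta>'" "\<gamma> \<in> cells2 K" "tgt \<gamma> = src \<alpha>" "tgt \<gamma> = src \<alpha>'"
  shows "\<beta> \<bullet> \<alpha> \<bullet> \<gamma> = \<beta>' \<bullet> \<alpha>' \<bullet> \<gamma>"
  using assms by (metis vcomp_assoc)

lemma pseudomorphism_id:
  assumes "normal_pseudoalgebra K M A"
  shows "pseudomorphism K M (Cell A A (id1 K (ps_car A), id2 K (ps_act A)))"
proof -
  note [simp] = pseudoalgebraD[OF assms]
  show ?thesis using assms by (simp add: pseudomorphism_def)
qed

text \<open>The comparison of the composite is \<open>g' \<lhd> T f\<close> followed by
  \<open>g \<rhd> f'\<close>. Its multiplication law is pasted from the law of \<open>g\<close>,
  whiskered by \<open>T T f\<close>, and the law of \<open>f\<close>, whiskered by \<open>g\<close>;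
  between the two, \<open>g'\<close> and \<open>T f'\<close> have to change places.\<close>

lemma pseudomorphism_comp:
  assumes F: "pseudomorphism K M F" and G: "pseudomorphism K M G" and FG: "tgt F = src G"
  shows "pseudomorphism K M (comp1 (PsAlgn K M) G F)"
proof -
  obtain A B f f' where F_eq: "F = Cell A B (f, f')" by (metis cell.exhaust surj_pair)
  obtain C g g' where G_eq: "G = Cell B C (g, g')" using FG F_eq by (metis cell.exhaust cell.sel surj_pair)
  let ?X = "ps_car A" and ?Y = "ps_car B" and ?Z = "ps_car C"
  let ?a = "ps_act A" and ?b = "ps_act B" and ?c = "ps_act C"
  note F_facts = pseudomorphismD[OF F, unfolded F_eq, simplified]
  note G_facts = pseudomorphismD[OF G, unfolded G_eq, simplified]
  note [simp] = F_facts(3-10) G_facts(3-10) pseudoalgebraD[OF F_facts(1)] pseudoalgebraD[OF F_facts(2)]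
     pseudoalgebraD[OF G_facts(2)]
  have un: "map1 T f \<cdot> \<eta> ?X = \<eta> ?Y \<cdot> f" using unit_nat1[of f] by simp
  have mn: "map1 T f \<cdot> \<mu> ?X = \<mu> ?Y \<cdot> map1 T (map1 T f)" using mult_nat1[of f] by simp
  have mg [simp]: "map1 T g \<cdot> \<mu> ?Y = \<mu> ?Z \<cdot> map1 T (map1 T g)" using mult_nat1[of g] by simp
  have mg' [simp]: "map1 T g \<cdot> \<mu> ?Y \<cdot> e = \<mu> ?Z \<cdot> map1 T (map1 T g) \<cdot> e"
    if "e \<in> cells1 K" "tgt e = map0 T (map0 T ?Y)" for e
    by (rule comp1_reassoc[OF mg]) (use that in simp_all)
  have unit: "((g \<rhd> f') \<bullet> (g' \<lhd> map1 T f)) \<lhd> \<eta> ?X = id2 K (g \<cdot> f)"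
  proof -
    \<comment> \<open>Naturality of the unit replaces \<open>T f\<close> after the unit by the unit
      after \<open>f\<close>, so that the unit law of \<open>g\<close> applies.\<close>
    have "g' \<lhd> (\<eta> ?Y \<cdot> f) = (g' \<lhd> \<eta> ?Y) \<lhd> f" by (rule whisk_r_whisk_r[symmetric]) simp_all
    also have "\<dots> = id2 K (g \<cdot> f)" unfolding G_facts(10) by simp
    finally show ?thesis by (simp add: un)
  qed
  have "(((g \<rhd> f') \<bullet> (g' \<lhd> map1 T f)) \<lhd> \<mu> ?X) \<bullet> (ps_mul C \<lhd> map1 T (map1 T (g \<cdot> f))) =
    (g \<rhd> f' \<lhd> \<mu> ?X) \<bullet> (((g' \<lhd> \<mu> ?Y) \<bullet> (ps_mul C \<lhd> map1 T (map1 T g))) \<lhd> map1 T (map1 T f))"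
    by (simp add: mn)
  also have "\<dots> = (g \<rhd> f' \<lhd> \<mu> ?X) \<bullet> (g \<rhd> ps_mul B \<lhd> map1 T (map1 T f)) \<bullet>
      (g' \<lhd> (map1 T ?b \<cdot> map1 T (map1 T f))) \<bullet> (?c \<rhd> map2 T g' \<lhd> map1 T (map1 T f))"
    unfolding G_facts(11) by simp
  also have "\<dots> = (g \<rhd> ((f' \<lhd> \<mu> ?X) \<bullet> (ps_mul B \<lhd> map1 T (map1 T f)))) \<bullet>
      (g' \<lhd> (map1 T ?b \<cdot> map1 T (map1 T f))) \<bullet> (?c \<rhd> map2 T g' \<lhd> map1 T (map1 T f))"
    by (simp add: mn)
  also have "\<dots> = (g \<rhd> f \<rhd> ps_mul A) \<bullet> (g \<rhd> f' \<lhd> map1 T ?a) \<bullet> (g \<rhd> ?b \<rhd> map2 T f') \<bullet>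
      (g' \<lhd> (map1 T ?b \<cdot> map1 T (map1 T f))) \<bullet> (?c \<rhd> map2 T g' \<lhd> map1 T (map1 T f))"
    unfolding F_facts(11) by simp
  also have "\<dots> = (g \<rhd> f \<rhd> ps_mul A) \<bullet> (g \<rhd> f' \<lhd> map1 T ?a) \<bullet>
      (g' \<lhd> (map1 T f \<cdot> map1 T ?a)) \<bullet> (?c \<rhd> map1 T g \<rhd> map2 T f') \<bullet>
      (?c \<rhd> map2 T g' \<lhd> map1 T (map1 T f))"
  proof -
    \<comment> \<open>The cells \<open>g'\<close> and \<open>T f'\<close> act on different factors,
      hence can be performed in either order.\<close>
    have "((g \<cdot> ?b) \<rhd> map2 T f') \<bullet> (g' \<lhd> (map1 T ?b \<cdot> map1 T (map1 T f))) =
      (g' \<lhd> (map1 T f \<cdot> map1 T ?a)) \<bullet> ((?c \<cdot> map1 T g) \<rhd> map2 T f')"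
      using whisk_interchange[of "map2 T f'" g'] by simp
    from vcomp_reassoc[OF this, of "?c \<rhd> map2 T g' \<lhd> map1 T (map1 T f)"]
    show ?thesis by simp
  qed
  finally have mult: "(((g \<rhd> f') \<bullet> (g' \<lhd> map1 T f)) \<lhd> \<mu> ?X) \<bullet> (ps_mul C \<lhd> map1 T (map1 T (g \<cdot> f))) =
     ((g \<cdot> f) \<rhd> ps_mul A) \<bullet> (((g \<rhd> f') \<bullet> (g' \<lhd> map1 T f)) \<lhd> map1 T ?a) \<bullet>
      (?c \<rhd> map2 T ((g \<rhd> f') \<bullet> (g' \<lhd> map1 T f)))"
    by simp
  show ?thesis
    unfolding pseudomorphism_def Let_def using F_facts(1) G_facts(2) unit mult
    by (simp add: F_eq G_eq del: whisk_r_vcomp)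
qed

text \<open>With the horizontal composite written as \<open>\<alpha>\<close> followed by
  \<open>\<beta>\<close>, the law of \<open>\<alpha>\<close> is used inside \<open>g\<close> and the
  law of \<open>\<beta>\<close> in front of \<open>T f1\<close>. Two interchanges, of
  \<open>\<beta>\<close> with \<open>f1'\<close> and of \<open>T \<alpha>\<close> with
  \<open>g'\<close>, bring the cells next to each other.\<close>

lemma algebra_transformation_hcomp:
  assumes A: "algebra_transformation K M A" and B: "algebra_transformation K M B"
    and AB: "tgt (src A) = src (src B)"
  shows "algebra_transformation K M (hcomp (PsAlgn K M) B A)"
proof -
  obtain X Y f f' f1 f1' \<alpha> where A_eq: "A = Cell (Cell X Y (f, f')) (Cell X Y (f1, f1')) \<alpha>"
    using algebra_transformationD(3,4)[OF A] by (metis cell.exhaust cell.sel surj_pair)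
  obtain Z g g' g1 g1' \<beta> where B_eq: "B = Cell (Cell Y Z (g, g')) (Cell Y Z (g1, g1')) \<beta>"
    using algebra_transformationD(3,4)[OF B] AB A_eq by (metis cell.exhaust cell.sel surj_pair)
  note A_facts = algebra_transformationD[OF A, unfolded A_eq, simplified]
  note B_facts = algebra_transformationD[OF B, unfolded B_eq, simplified]
  note p1 = pseudomorphismD[OF A_facts(1), simplified] and p2 = pseudomorphismD[OF A_facts(2), simplified]
    and p3 = pseudomorphismD[OF B_facts(1), simplified] and p4 = pseudomorphismD[OF B_facts(2), simplified]
  note [simp] = p1 p2 p3 p4 pseudoalgebraD[OF p1(1)] pseudoalgebraD[OF p3(1)] pseudoalgebraD[OF p3(2)]
    A_facts(5-7) B_facts(5-7)
  let ?a = "ps_act X" and ?b = "ps_act Y" and ?c = "ps_act Z"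
  have h: "hcomp K \<beta> \<alpha> = (\<beta> \<lhd> f1) \<bullet> (g \<rhd> \<alpha>)" using hcomp_whisk(1)[of \<alpha> \<beta>] by simp
  have 1: "(\<beta> \<lhd> (f1 \<cdot> ?a)) \<bullet> (g \<rhd> f1') = (g1 \<rhd> f1') \<bullet> (\<beta> \<lhd> (?b \<cdot> map1 T f1))"
    using whisk_interchange[of f1' \<beta>] by simp
  have 2: "((g \<cdot> ?b) \<rhd> map2 T \<alpha>) \<bullet> (g' \<lhd> map1 T f) = (g' \<lhd> map1 T f1) \<bullet> ((?c \<cdot> map1 T g) \<rhd> map2 T \<alpha>)"
    using whisk_interchange[of "map2 T \<alpha>" g'] by simp
  have "(hcomp K \<beta> \<alpha> \<lhd> ?a) \<bullet> (g \<rhd> f') \<bullet> (g' \<lhd> map1 T f) =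
     (\<beta> \<lhd> (f1 \<cdot> ?a)) \<bullet> (g \<rhd> ((\<alpha> \<lhd> ?a) \<bullet> f')) \<bullet> (g' \<lhd> map1 T f)"
    unfolding h by simp
  also have "\<dots> = (\<beta> \<lhd> (f1 \<cdot> ?a)) \<bullet> (g \<rhd> f1') \<bullet> ((g \<cdot> ?b) \<rhd> map2 T \<alpha>) \<bullet> (g' \<lhd> map1 T f)"
    unfolding A_facts(8) by simp
  also have "\<dots> = ((\<beta> \<lhd> (f1 \<cdot> ?a)) \<bullet> (g \<rhd> f1')) \<bullet> (g' \<lhd> map1 T f1) \<bullet> ((?c \<cdot> map1 T g) \<rhd> map2 T \<alpha>)"
    unfolding 2 by simp
  also have "\<dots> = (g1 \<rhd> f1') \<bullet> (((\<beta> \<lhd> ?b) \<bullet> g') \<lhd> map1 T f1) \<bullet> ((?c \<cdot> map1 T g) \<rhd> map2 T \<alpha>)"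
    unfolding 1 by simp
  also have "\<dots> = ((g1 \<rhd> f1') \<bullet> (g1' \<lhd> map1 T f1)) \<bullet> (?c \<rhd> map2 T (hcomp K \<beta> \<alpha>))"
    unfolding B_facts(8) h by simp
  finally have eq: "(hcomp K \<beta> \<alpha> \<lhd> ?a) \<bullet> (g \<rhd> f') \<bullet> (g' \<lhd> map1 T f) =
     ((g1 \<rhd> f1') \<bullet> (g1' \<lhd> map1 T f1)) \<bullet> (?c \<rhd> map2 T (hcomp K \<beta> \<alpha>))" .
  show ?thesis
    using pseudomorphism_comp[OF A_facts(1) B_facts(1)] pseudomorphism_comp[OF A_facts(2) B_facts(2)] eq
    by (simp add: algebra_transformation_def A_eq B_eq)
qed

lemma algebra_transformation_vcomp:
  assumes A: "algebra_transformation K M A" and B: "algebra_transformation K M B"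
    and AB: "tgt A = src B"
  shows "algebra_transformation K M (vcomp (PsAlgn K M) B A)"
proof -
  obtain X Y f f' f1 f1' \<alpha> where A_eq: "A = Cell (Cell X Y (f, f')) (Cell X Y (f1, f1')) \<alpha>"
    using algebra_transformationD(3,4)[OF A] by (metis cell.exhaust cell.sel surj_pair)
  obtain g g' \<beta> where B_eq: "B = Cell (Cell X Y (f1, f1')) (Cell X Y (g, g')) \<beta>"
    using algebra_transformationD(3,4)[OF B] AB A_eq by (metis cell.exhaust cell.sel surj_pair)
  note A_facts = algebra_transformationD[OF A, unfolded A_eq, simplified]
  note B_facts = algebra_transformationD[OF B, unfolded B_eq, simplified]
  note p1 = pseudomorphismD[OF A_facts(1), simplified] and p2 = pseudomorphismD[OF A_facts(2), simplified]
    and p4 = pseudomorphismD[OF B_facts(2), simplified]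
  note [simp] = p1 p2 p4 pseudoalgebraD[OF p1(1)] pseudoalgebraD[OF p1(2)]
    A_facts(5-7) B_facts(5-7)
  have "((\<beta> \<bullet> \<alpha>) \<lhd> ps_act X) \<bullet> f' = (\<beta> \<lhd> ps_act X) \<bullet> ((\<alpha> \<lhd> ps_act X) \<bullet> f')" by simp
  also have "\<dots> = ((\<beta> \<lhd> ps_act X) \<bullet> f1') \<bullet> (ps_act Y \<rhd> map2 T \<alpha>)"
    unfolding A_facts(8) by simp
  also have "\<dots> = g' \<bullet> (ps_act Y \<rhd> map2 T (\<beta> \<bullet> \<alpha>))" unfolding B_facts(8) by simp
  finally show ?thesis using A_facts(1) B_facts(2)
    by (simp add: algebra_transformation_def A_eq B_eq)
qed

lemma algebra_transformation_id:
  assumes F: "pseudomorphism K M F"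
  shows "algebra_transformation K M (id2 (PsAlgn K M) F)"
proof -
  note [simp] = pseudomorphismD[OF F]
  note [simp] = pseudoalgebraD[OF pseudomorphismD(1)[OF F]] pseudoalgebraD[OF pseudomorphismD(2)[OF F]]
  show ?thesis using F by (simp add: algebra_transformation_def)
qed

lemma strict_PsAlgn: "strict_2_category (PsAlgn K M)"
proof (rule strict_2_categoryI, goal_cases)
  case (2 A)
  then show ?case using pseudomorphism_id[of A] by simp
next
  case (3 F G)
  then show ?case using pseudomorphism_comp[of F G] by simp
next
  case (4 F)
  then have F: "pseudomorphism K M F" by simp
  note [simp] = pseudomorphismD[OF F] pseudoalgebraD[OF pseudomorphismD(1)[OF F]]
    pseudoalgebraD[OF pseudomorphismD(2)[OF F]]
  show ?case by (auto intro!: cell_eqI)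
next
  case (5 F G H)
  then have F: "pseudomorphism K M F" and G: "pseudomorphism K M G" and H: "pseudomorphism K M H"
    by simp_all
  note [simp] = pseudomorphismD[OF F] pseudoalgebraD[OF pseudomorphismD(1)[OF F]]
    pseudomorphismD[OF G] pseudoalgebraD[OF pseudomorphismD(1)[OF G]]
    pseudomorphismD[OF H] pseudoalgebraD[OF pseudomorphismD(1)[OF H]]
    pseudoalgebraD[OF pseudomorphismD(2)[OF H]]
  show ?case using 5(4,5) by simp
next
  case (6 A)
  then show ?case by (simp add: algebra_transformationD)
next
  case (7 F)
  then show ?case using algebra_transformation_id[of F] by simp
next
  case (8 A B)
  then show ?case using algebra_transformation_vcomp[of A B] by simp
next
  case (9 A)
  then show ?case by (auto simp: algebra_transformationD intro!: cell_eqI)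
next
  case (10 A B C)
  then show ?case by (simp add: algebra_transformationD)
next
  case (11 A B)
  then show ?case using algebra_transformation_hcomp[of A B] by simp
next
  case (12 A)
  then have A: "algebra_transformation K M A" by simp
  note 1 = algebra_transformationD[OF A]
  note [simp] = 1(3-7) pseudomorphismD[OF 1(1)] pseudomorphismD[OF 1(2)]
    pseudoalgebraD[OF pseudomorphismD(1)[OF 1(1)]] pseudoalgebraD[OF pseudomorphismD(2)[OF 1(1)]]
    pseudoalgebraD[OF pseudomorphismD(1)[OF 1(2)]] pseudoalgebraD[OF pseudomorphismD(2)[OF 1(2)]]
  show ?case by (auto intro!: cell_eqI)
next
  case (13 A B C)
  then have A: "algebra_transformation K M A" and B: "algebra_transformation K M B"
    and C: "algebra_transformation K M C" by simp_all
  \<comment> \<open>Composites of 1-cells contain pasted comparisons, so associativity has to be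
    known for the sources and for the targets of the three 2-cells before their horizontal
    composites can be compared.\<close>
  have comp: "comp1 (PsAlgn K M) H (comp1 (PsAlgn K M) G F) = comp1 (PsAlgn K M) (comp1 (PsAlgn K M) H G) F"
    if F: "pseudomorphism K M F" and G: "pseudomorphism K M G" and H: "pseudomorphism K M H"
      and e: "tgt F = src G" "tgt G = src H" for F G H
  proof -
    note [simp] = pseudomorphismD[OF F] pseudoalgebraD[OF pseudomorphismD(1)[OF F]]
      pseudomorphismD[OF G] pseudoalgebraD[OF pseudomorphismD(1)[OF G]]
      pseudomorphismD[OF H] pseudoalgebraD[OF pseudomorphismD(1)[OF H]]
      pseudoalgebraD[OF pseudomorphismD(2)[OF H]]
    show ?thesis using e by simp
  qed
  note 1 = algebra_transformationD[OF A] and 2 = algebra_transformationD[OF B]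
    and 3 = algebra_transformationD[OF C]
  have "hcomp K (dat C) (hcomp K (dat B) (dat A)) = hcomp K (hcomp K (dat C) (dat B)) (dat A)"
    using 13(4,5) 1(5,6) 2(5,6) 3(5,6) pseudomorphismD(4,5)[OF 1(1)] pseudomorphismD(4,5)[OF 2(1)]
      pseudomorphismD(4,5)[OF 3(1)] by simp
  moreover have "tgt (tgt A) = src (tgt B)" "tgt (tgt B) = src (tgt C)" using 13(4,5) 1(3,4) 2(3,4) 3(3,4) by simp_all
  ultimately show ?case using comp[OF 1(1) 2(1) 3(1)] comp[OF 1(2) 2(2) 3(2)] 13(4,5)
    unfolding PsAlgn_sel(8) by (simp del: PsAlgn_sel)
next
  case (14 F G)
  then show ?case by (simp add: pseudomorphismD)
next
  case (15 A A' B B')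
  then have A: "algebra_transformation K M A" "algebra_transformation K M A'"
    and B: "algebra_transformation K M B" "algebra_transformation K M B'" by simp_all
  note 1 = algebra_transformationD[OF A(1)] algebra_transformationD[OF A(2)]
     algebra_transformationD[OF B(1)] algebra_transformationD[OF B(2)]
  show ?case using 15(5-7) 1(5-7,13-15,21-23,29-31) pseudomorphismD(4,5)[OF 1(1)] pseudomorphismD(4,5)[OF 1(17)]
    by (simp add: interchange)
qed (simp_all add: pseudomorphismD)

lemma strict_algebraD:
  assumes "strict_algebra K M A"
  shows "fst A \<in> cells0 K" "snd A \<in> cells1 K" "src (snd A) = map0 T (fst A)" "tgt (snd A) = fst A"
    "snd A \<cdot> \<eta> (fst A) = id1 K (fst A)" "snd A \<cdot> map1 T (snd A) = snd A \<cdot> \<mu> (fst A)"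
  using assms by (auto simp: strict_algebra_def split: prod.splits)

lemma strict_Algs: "strict_2_category (Algs K M)"
proof -
  have 1: "(g \<cdot> f) \<cdot> snd A = snd C \<cdot> map1 T (g \<cdot> f)"
    if "strict_algebra K M A" "strict_algebra K M B" "strict_algebra K M C"
      "f \<in> cells1 K" "g \<in> cells1 K" "src f = fst A" "tgt f = fst B" "src g = fst B" "tgt g = fst C"
      and f: "f \<cdot> snd A = snd B \<cdot> map1 T f" and g: "g \<cdot> snd B = snd C \<cdot> map1 T g" for A B C f g
  proof -
    note [simp] = that(4-9) strict_algebraD[OF that(1)] strict_algebraD[OF that(2)] strict_algebraD[OF that(3)]
    have "(g \<cdot> f) \<cdot> snd A = (g \<cdot> snd B) \<cdot> map1 T f" by (simp add: f)
    then show ?thesis unfolding g by simp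
  qed
  have 2: "(\<beta> \<bullet> \<alpha>) \<lhd> snd A = snd B \<rhd> map2 T (\<beta> \<bullet> \<alpha>)"
    if "strict_algebra K M A" "strict_algebra K M B" "\<alpha> \<in> cells2 K" "\<beta> \<in> cells2 K"
      "src (src \<alpha>) = fst A" "tgt (src \<alpha>) = fst B" "tgt \<alpha> = src \<beta>"
      "\<alpha> \<lhd> snd A = snd B \<rhd> map2 T \<alpha>" "\<beta> \<lhd> snd A = snd B \<rhd> map2 T \<beta>" for A B \<alpha> \<beta>
  proof -
    have "src (src \<beta>) = fst A" "tgt (src \<beta>) = fst B" using that by (metis cell2_ends(3,4))+
    then show ?thesis using that strict_algebraD[OF that(1)] strict_algebraD[OF that(2)] by simp
  qed
  \<comment> \<open>Both compatibility laws pass through \<open>hcomp\<close> by its associativity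
    alone, without splitting it into whiskerings.\<close>
  have 3: "hcomp K \<beta> \<alpha> \<lhd> snd A = snd C \<rhd> map2 T (hcomp K \<beta> \<alpha>)"
    if "strict_algebra K M A" "strict_algebra K M B" "strict_algebra K M C" "\<alpha> \<in> cells2 K" "\<beta> \<in> cells2 K"
      "src (src \<alpha>) = fst A" "tgt (src \<alpha>) = fst B" "src (src \<beta>) = fst B" "tgt (src \<beta>) = fst C"
      and a: "\<alpha> \<lhd> snd A = snd B \<rhd> map2 T \<alpha>" and b: "\<beta> \<lhd> snd B = snd C \<rhd> map2 T \<beta>" for A B C \<alpha> \<beta>
  proof -
    note [simp] = that(4-9) strict_algebraD[OF that(1)] strict_algebraD[OF that(2)] strict_algebraD[OF that(3)]
    have "hcomp K \<beta> \<alpha> \<lhd> snd A = hcomp K \<beta> (snd B \<rhd> map2 T \<alpha>)"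
      unfolding a[symmetric] by (simp add: whisk_r_def)
    also have "\<dots> = hcomp K (\<beta> \<lhd> snd B) (map2 T \<alpha>)" by (simp add: whisk_r_def whisk_l_def)
    also have "\<dots> = snd C \<rhd> map2 T (hcomp K \<beta> \<alpha>)" unfolding b by (simp add: whisk_l_def)
    finally show ?thesis .
  qed
  show ?thesis unfolding Algs_def
  proof (rule strict_structured, goal_cases)
    case (3 X Y Z f g)
    then show ?case using 1[of X Y Z f g] by blast
  next
    case (5 X Y \<alpha> \<beta>)
    then show ?case using 2[of X Y \<alpha> \<beta>] by blast
  next
    case (6 X Y Z \<alpha> \<beta>)
    then show ?case using 3[of X Y Z \<alpha> \<beta>] by blast
  qed (simp_all add: strict_algebraD)
qed

lemma Algs_sel [simp]:
  "cells0 (Algs K M) = {A. strict_algebra K M A}"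
  "id1 (Algs K M) A = Cell A A (id1 K (fst A))"
  "comp1 (Algs K M) g f = Cell (src f) (tgt g) (dat g \<cdot> dat f)"
  "id2 (Algs K M) f' = Cell f' f' (id2 K (dat f'))"
  "vcomp (Algs K M) \<beta> \<alpha> = Cell (src \<alpha>) (tgt \<beta>) (dat \<beta> \<bullet> dat \<alpha>)"
  "hcomp (Algs K M) \<beta> \<alpha> = Cell (comp1 (Algs K M) (src \<beta>) (src \<alpha>))
       (comp1 (Algs K M) (tgt \<beta>) (tgt \<alpha>)) (hcomp K (dat \<beta>) (dat \<alpha>))"
  by (simp_all add: Algs_def)

lemma Algs_cells1 [simp]:
  "f \<in> cells1 (Algs K M) \<longleftrightarrow>
     strict_algebra K M (src f) \<and> strict_algebra K M (tgt f) \<and> dat f \<in> cells1 K \<and>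
     src (dat f) = fst (src f) \<and> tgt (dat f) = fst (tgt f) \<and>
     dat f \<cdot> snd (src f) = snd (tgt f) \<cdot> map1 T (dat f)"
  by (simp add: Algs_def)

lemma Algs_cells2 [simp]:
  "\<alpha> \<in> cells2 (Algs K M) \<longleftrightarrow>
     src \<alpha> \<in> cells1 (Algs K M) \<and> tgt \<alpha> \<in> cells1 (Algs K M) \<and>
     src (src \<alpha>) = src (tgt \<alpha>) \<and> tgt (src \<alpha>) = tgt (tgt \<alpha>) \<and>
     dat \<alpha> \<in> cells2 K \<and> src (dat \<alpha>) = dat (src \<alpha>) \<and> tgt (dat \<alpha>) = dat (tgt \<alpha>) \<and>
     dat \<alpha> \<lhd> snd (src (src \<alpha>)) = snd (tgt (src \<alpha>)) \<rhd> map2 T (dat \<alpha>)"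
  unfolding Algs_def structured_cells2 by (rule refl)

text \<open>With an identity as multiplication cell each law compares identity 2-cells and so
  reduces to an equation of 1-cells; the associativity law then rests on naturality of
  \<open>\<mu>\<close> at the action.\<close>

lemma pseudoalgebra_strict:
  assumes "strict_algebra K M A"
  shows "normal_pseudoalgebra K M (strict_to_pseudo_alg K M A)"
proof -
  note [simp] = strict_algebraD[OF assms]
  have 1: "map1 T (snd A) \<cdot> \<mu> (map0 T (fst A)) = \<mu> (fst A) \<cdot> map1 T (map1 T (snd A))"
    using mult_nat1[of "snd A"] by simp
  have 2: "snd A \<cdot> map1 T (snd A) \<cdot> e = snd A \<cdot> \<mu> (fst A) \<cdot> e"
    if "e \<in> cells1 K" "tgt e = map0 T (map0 T (fst A))" for e
    by (rule comp1_reassoc) (use that in simp_all)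
  show ?thesis
    by (simp add: normal_pseudoalgebra_def strict_to_pseudo_alg_def 1[symmetric] 2)
qed

text \<open>An identity 2-cell has equal source and target, and for the multiplication cell this
  equality is the associativity law of a strict algebra.\<close>

lemma strict_algebra_if_identity:
  assumes "normal_pseudoalgebra K M (PsAlg X a (id2 K f))" "f \<in> cells1 K"
  shows "strict_algebra K M (X, a)"
  using pseudoalgebraD[OF assms(1)] assms(2) by (simp add: strict_algebra_def)

lemma pseudomorphism_strict:
  assumes "F \<in> cells1 (Algs K M)"
  shows "pseudomorphism K M (strict_to_pseudo_mor K M F)"
proof -
  have A: "strict_algebra K M (src F)" and B: "strict_algebra K M (tgt F)" using assms by simp_all
  note [simp] = strict_algebraD[OF A] strict_algebraD[OF B]
  have F [simp]: "dat F \<in> cells1 K" "src (dat F) = fst (src F)" "tgt (dat F) = fst (tgt F)"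
     and F': "dat F \<cdot> snd (src F) = snd (tgt F) \<cdot> map1 T (dat F)" using assms by simp_all
  have 1: "map1 T (dat F) \<cdot> \<mu> (fst (src F)) = \<mu> (fst (tgt F)) \<cdot> map1 T (map1 T (dat F))"
    using mult_nat1[of "dat F"] by simp
  have 2: "snd (tgt F) \<cdot> map1 T (dat F) \<cdot> e = dat F \<cdot> snd (src F) \<cdot> e"
    if "e \<in> cells1 K" "tgt e = map0 T (fst (src F))" for e
    by (rule comp1_reassoc[OF F'[symmetric]]) (use that in simp_all)
  have 3: "dat F \<cdot> snd (src F) \<cdot> map1 T (snd (src F)) = snd (tgt F) \<cdot> map1 T (snd (tgt F)) \<cdot> map1 T (map1 T (dat F))"
  proof -
    have "dat F \<cdot> snd (src F) \<cdot> map1 T (snd (src F)) = (dat F \<cdot> snd (src F)) \<cdot> map1 T (snd (src F))" by simp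
    also have "\<dots> = (snd (tgt F) \<cdot> map1 T (dat F)) \<cdot> map1 T (snd (src F))" unfolding F' ..
    also have "\<dots> = snd (tgt F) \<cdot> map1 T (dat F \<cdot> snd (src F))" by simp
    finally show ?thesis unfolding F' by simp
  qed
  show ?thesis using pseudoalgebra_strict[OF A] pseudoalgebra_strict[OF B]
    by (simp add: pseudomorphism_def strict_to_pseudo_mor_def strict_to_pseudo_alg_def F'[symmetric]
        1[symmetric] 2 3[symmetric])
qed

text \<open>Again the boundary of an identity cell is read off: for the comparison cell it is the
  law of a strict morphism.\<close>

lemma strict_if_identity:
  assumes "pseudomorphism K M (Cell (strict_to_pseudo_alg K M A) (strict_to_pseudo_alg K M B) (f, id2 K g))"
    and "strict_algebra K M A" "strict_algebra K M B" "g \<in> cells1 K"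
  shows "Cell A B f \<in> cells1 (Algs K M)"
  using pseudomorphismD[OF assms(1)] assms(2-) by (simp add: strict_to_pseudo_alg_def)

lemma algebra_transformation_strict:
  assumes "\<alpha> \<in> cells2 (Algs K M)"
  shows "algebra_transformation K M
    (Cell (strict_to_pseudo_mor K M (src \<alpha>)) (strict_to_pseudo_mor K M (tgt \<alpha>)) (dat \<alpha>))"
proof -
  have s: "src \<alpha> \<in> cells1 (Algs K M)" and t: "tgt \<alpha> \<in> cells1 (Algs K M)"
    and \<alpha>: "src (src \<alpha>) = src (tgt \<alpha>)" "tgt (src \<alpha>) = tgt (tgt \<alpha>)"
     "dat \<alpha> \<in> cells2 K" "src (dat \<alpha>) = dat (src \<alpha>)" "tgt (dat \<alpha>) = dat (tgt \<alpha>)"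
     "dat \<alpha> \<lhd> snd (src (src \<alpha>)) = snd (tgt (src \<alpha>)) \<rhd> map2 T (dat \<alpha>)"
    using assms unfolding Algs_cells2 by (auto simp only:)
  have A: "strict_algebra K M (src (src \<alpha>))" and B: "strict_algebra K M (tgt (src \<alpha>))" using s by simp_all
  note [simp] = strict_algebraD[OF A] strict_algebraD[OF B]
  have "tgt (dat \<alpha>) \<cdot> snd (src (src \<alpha>)) = snd (tgt (src \<alpha>)) \<cdot> map1 T (tgt (dat \<alpha>))"
    using t \<alpha> by simp
  then show ?thesis using pseudomorphism_strict[OF s] pseudomorphism_strict[OF t] s t \<alpha>(3,4,5,6)
      \<alpha>(1,2)[symmetric]
    by (simp add: algebra_transformation_def strict_to_pseudo_mor_def strict_to_pseudo_alg_def)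
qed

lemma two_functor_strict_to_pseudo: "two_functor (Algs K M) (PsAlgn K M) (strict_to_pseudo K M)"
proof -
  have 1: "comp1 (PsAlgn K M) (strict_to_pseudo_mor K M G) (strict_to_pseudo_mor K M F) =
      strict_to_pseudo_mor K M (comp1 (Algs K M) G F)"
    if F: "F \<in> cells1 (Algs K M)" and G: "G \<in> cells1 (Algs K M)" and e: "tgt F = src G" for F G
  proof -
    have A: "strict_algebra K M (src F)" and B: "strict_algebra K M (src G)" and C: "strict_algebra K M (tgt G)"
      using F G by simp_all
    note [simp] = strict_algebraD[OF A] strict_algebraD[OF B] strict_algebraD[OF C] e
    have "snd (tgt G) \<cdot> map1 T (dat G) \<cdot> map1 T (dat F) = dat G \<cdot> snd (src G) \<cdot> map1 T (dat F)"
      by (rule comp1_reassoc) (use F G in simp_all)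
    then show ?thesis using F G
      by (simp add: strict_to_pseudo_mor_def strict_to_pseudo_alg_def)
  qed
  have 2: "strict_to_pseudo_mor K M (id1 (Algs K M) A) = id1 (PsAlgn K M) (strict_to_pseudo_alg K M A)"
    if "strict_algebra K M A" for A
    using strict_algebraD[OF that] by (simp add: strict_to_pseudo_mor_def strict_to_pseudo_alg_def)
  show ?thesis
  proof (rule two_functorI, goal_cases)
    case (4 F)
    then show ?case using pseudomorphism_strict[OF 4] by (simp add: strict_to_pseudo_def strict_to_pseudo_mor_def)
  next
    case (5 \<alpha>)
    then show ?case using algebra_transformation_strict[OF 5(1)]
      by (simp add: strict_to_pseudo_def strict_to_pseudo_mor_def)
  next
    case (10 \<alpha> \<beta>)
    show ?case
      using 1[OF 10(4,6,3)] 1[OF 10(5,7,8)] unfolding Algs_sel(6) PsAlgn_sel(8)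
      by (simp add: strict_to_pseudo_def strict_to_pseudo_mor_def)
  qed (simp_all add: strict_Algs strict_PsAlgn strict_to_pseudo_def pseudoalgebra_strict 1[simplified] 2[simplified],
      simp_all add: strict_to_pseudo_mor_def)
qed

end

section \<open>Restriction of scalars along a colax monad morphism\<close>

locale colax = K: tmonad K M + L: tmonad L N + D: twofunctor K L D
  for K :: "('o, 'm, 'c) twocat" and M and L :: "('p, 'n, 'd) twocat" and N and D +
  fixes \<kappa> :: "'o \<Rightarrow> ('p, 'n) cell"
  assumes colax: "colax_monad_morphism K M L N D \<kappa>"
begin

lemma kappa_natural: "two_natural K L (twofun_comp N' D) (twofun_comp D K.T) \<kappa>" if "N' = mfun N"
  using colax that by (simp add: colax_monad_morphism_def)

lemma kappa_cell [simp]: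
  assumes "X \<in> cells0 K"
  shows "\<kappa> X \<in> cells1 L" "src (\<kappa> X) = map0 L.T (map0 D X)" "tgt (\<kappa> X) = map0 D (map0 K.T X)"
  using two_natural_cell[OF kappa_natural[OF refl] assms] by (simp_all add: twofun_comp_def)

lemma kappa_nat1:
  assumes "f \<in> cells1 K" "tgt f = Y"
  shows "comp1 L (\<kappa> Y) (map1 L.T (map1 D f)) = comp1 L (map1 D (map1 K.T f)) (\<kappa> (src f))"
  using two_natural_nat1[OF kappa_natural[OF refl] assms(1)] assms(2) by (simp add: twofun_comp_def)

lemma kappa_nat1' [simp]:
  assumes "f \<in> cells1 K" "tgt f = Y" "e \<in> cells1 L" "tgt e = map0 L.T (map0 D (src f))"
  shows "comp1 L (\<kappa> Y) (comp1 L (map1 L.T (map1 D f)) e) =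
    comp1 L (map1 D (map1 K.T f)) (comp1 L (\<kappa> (src f)) e)"
  by (rule L.comp1_reassoc[OF kappa_nat1]) (use assms in auto)

lemma kappa_nat2:
  assumes "\<alpha> \<in> cells2 K" "tgt (src \<alpha>) = Y"
  shows "whisk_l L (\<kappa> Y) (map2 L.T (map2 D \<alpha>)) = whisk_r L (map2 D (map2 K.T \<alpha>)) (\<kappa> (src (src \<alpha>)))"
  using two_natural_nat2[OF kappa_natural[OF refl] assms(1)] assms(2) by (simp add: twofun_comp_def)

lemma kappa_unit: "X \<in> cells0 K \<Longrightarrow> comp1 L (\<kappa> X) (L.\<eta> (map0 D X)) = map1 D (K.\<eta> X)"
  and kappa_mult: "X \<in> cells0 K \<Longrightarrow> comp1 L (\<kappa> X) (L.\<mu> (map0 D X)) =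
    comp1 L (map1 D (K.\<mu> X)) (comp1 L (\<kappa> (map0 K.T X)) (map1 L.T (\<kappa> X)))"
  using colax by (auto simp: colax_monad_morphism_def)

text \<open>\<open>V\<close> and \<open>W\<close> are the twofold and threefold iterates of
  \<open>\<kappa>\<close>, from \<open>N N D\<close> to \<open>D M M\<close> and from
  \<open>N N N D\<close> to \<open>D M M M\<close>. The equations carry every 1-cell that whiskers a
  multiplication cell in the algebra laws from the \<open>N\<close> side to the \<open>M\<close>
  side.\<close>

lemma restrict_alg_1cells:
  assumes X: "X \<in> cells0 K"
  defines "V \<equiv> comp1 L (\<kappa> (map0 K.T X)) (map1 L.T (\<kappa> X))"
    and "W \<equiv> comp1 L (\<kappa> (map0 K.T (map0 K.T X)))
      (comp1 L (map1 L.T (\<kappa> (map0 K.T X))) (map1 L.T (map1 L.T (\<kappa> X))))"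
  shows "comp1 L V (map1 L.T (L.\<eta> (map0 D X))) = comp1 L (map1 D (map1 K.T (K.\<eta> X))) (\<kappa> X)"
    "comp1 L V (L.\<eta> (map0 L.T (map0 D X))) = comp1 L (map1 D (K.\<eta> (map0 K.T X))) (\<kappa> X)"
    "comp1 L V (map1 L.T (L.\<mu> (map0 D X))) = comp1 L (map1 D (map1 K.T (K.\<mu> X))) W"
    "comp1 L V (L.\<mu> (map0 L.T (map0 D X))) = comp1 L (map1 D (K.\<mu> (map0 K.T X))) W"
    "a \<in> cells1 K \<Longrightarrow> src a = map0 K.T X \<Longrightarrow> tgt a = X \<Longrightarrow>
       comp1 L V (map1 L.T (map1 L.T (comp1 L (map1 D a) (\<kappa> X)))) = comp1 L (map1 D (map1 K.T (map1 K.T a))) W"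
    "f \<in> cells1 K \<Longrightarrow> tgt f = X \<Longrightarrow> comp1 L V (map1 L.T (map1 L.T (map1 D f))) =
      comp1 L (map1 D (map1 K.T (map1 K.T f))) (comp1 L (\<kappa> (map0 K.T (src f))) (map1 L.T (\<kappa> (src f))))"
proof -
  note [simp] = X
  have "comp1 L V (map1 L.T (L.\<eta> (map0 D X))) =
      comp1 L (\<kappa> (map0 K.T X)) (map1 L.T (comp1 L (\<kappa> X) (L.\<eta> (map0 D X))))" by (simp add: V_def)
  then show "comp1 L V (map1 L.T (L.\<eta> (map0 D X))) = comp1 L (map1 D (map1 K.T (K.\<eta> X))) (\<kappa> X)"
    by (simp add: kappa_unit kappa_nat1)
  have "comp1 L V (L.\<eta> (map0 L.T (map0 D X))) =
      comp1 L (comp1 L (\<kappa> (map0 K.T X)) (L.\<eta> (map0 D (map0 K.T X)))) (\<kappa> X)"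
    using L.unit_nat1[of "\<kappa> X"] by (simp add: V_def)
  then show "comp1 L V (L.\<eta> (map0 L.T (map0 D X))) = comp1 L (map1 D (K.\<eta> (map0 K.T X))) (\<kappa> X)"
    by (simp add: kappa_unit)
  have "comp1 L V (map1 L.T (L.\<mu> (map0 D X))) =
     comp1 L (\<kappa> (map0 K.T X)) (map1 L.T (comp1 L (\<kappa> X) (L.\<mu> (map0 D X))))" by (simp add: V_def)
  then show "comp1 L V (map1 L.T (L.\<mu> (map0 D X))) = comp1 L (map1 D (map1 K.T (K.\<mu> X))) W"
    by (simp add: kappa_mult W_def)
  have "comp1 L V (L.\<mu> (map0 L.T (map0 D X))) =
      comp1 L (comp1 L (\<kappa> (map0 K.T X)) (L.\<mu> (map0 D (map0 K.T X)))) (map1 L.T (map1 L.T (\<kappa> X)))"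
    using L.mult_nat1[of "\<kappa> X"] by (simp add: V_def)
  then show "comp1 L V (L.\<mu> (map0 L.T (map0 D X))) = comp1 L (map1 D (K.\<mu> (map0 K.T X))) W"
    by (simp add: kappa_mult W_def)
  show 6: "comp1 L V (map1 L.T (map1 L.T (map1 D f))) =
      comp1 L (map1 D (map1 K.T (map1 K.T f))) (comp1 L (\<kappa> (map0 K.T (src f))) (map1 L.T (\<kappa> (src f))))"
    if [simp]: "f \<in> cells1 K" "tgt f = X" for f
  proof -
    have "comp1 L V (map1 L.T (map1 L.T (map1 D f))) =
       comp1 L (\<kappa> (map0 K.T X)) (map1 L.T (comp1 L (\<kappa> X) (map1 L.T (map1 D f))))" by (simp add: V_def)
    also have "\<dots> = comp1 L (\<kappa> (map0 K.T X)) (map1 L.T (comp1 L (map1 D (map1 K.T f)) (\<kappa> (src f))))"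
      by (simp only: kappa_nat1 that)
    finally show ?thesis by simp
  qed
  show "comp1 L V (map1 L.T (map1 L.T (comp1 L (map1 D a) (\<kappa> X)))) = comp1 L (map1 D (map1 K.T (map1 K.T a))) W"
    if [simp]: "a \<in> cells1 K" "src a = map0 K.T X" "tgt a = X"
  proof -
    have "comp1 L V (map1 L.T (map1 L.T (comp1 L (map1 D a) (\<kappa> X)))) =
      comp1 L (comp1 L V (map1 L.T (map1 L.T (map1 D a)))) (map1 L.T (map1 L.T (\<kappa> X)))" by (simp add: V_def)
    then show ?thesis unfolding 6[of a, simplified] by (simp add: W_def)
  qed
qed

lemma D_mult_nat1:
  "f \<in> cells1 K \<Longrightarrow> comp1 L (map1 D (map1 K.T f)) (map1 D (K.\<mu> (src f))) =
    comp1 L (map1 D (K.\<mu> (tgt f))) (map1 D (map1 K.T (map1 K.T f)))"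
  using arg_cong[OF K.mult_nat1[of f], of "map1 D"] by simp

text \<open>Every law of the restricted algebra is the image under \<open>D\<close> of the same law
  of \<open>A\<close>, whiskered with \<open>\<kappa>\<close> for the normalization laws and with
  the threefold iterate \<open>W\<close> for associativity.\<close>

lemma pseudoalgebra_restrict:
  assumes A: "normal_pseudoalgebra K M A"
  shows "normal_pseudoalgebra L N (restrict_ps_alg M L N D \<kappa> A)"
proof -
  let ?X = "ps_car A" and ?a = "ps_act A" and ?\<chi> = "ps_mul A"
  note A_facts = K.pseudoalgebraD[OF A]
  note [simp] = A_facts(1-11)
  define V where "V = comp1 L (\<kappa> (map0 K.T ?X)) (map1 L.T (\<kappa> ?X))"
  define W where "W = comp1 L (\<kappa> (map0 K.T (map0 K.T ?X)))
      (comp1 L (map1 L.T (\<kappa> (map0 K.T ?X))) (map1 L.T (map1 L.T (\<kappa> ?X))))"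
  define b where "b = comp1 L (map1 D ?a) (\<kappa> ?X)"
  note r = restrict_alg_1cells[of ?X, folded V_def W_def, OF A_facts(1)]
  note rb = r(5)[OF A_facts(2-4), folded b_def]
  have [simp]: "V \<in> cells1 L" "src V = map0 L.T (map0 L.T (map0 D ?X))" "tgt V = map0 D (map0 K.T (map0 K.T ?X))"
    "W \<in> cells1 L" "src W = map0 L.T (map0 L.T (map0 L.T (map0 D ?X)))"
    "tgt W = map0 D (map0 K.T (map0 K.T (map0 K.T ?X)))"
    "b \<in> cells1 L" "src b = map0 L.T (map0 D ?X)" "tgt b = map0 D ?X"
    by (simp_all add: V_def W_def b_def)
  have e1: "comp1 L b (L.\<eta> (map0 D ?X)) = id1 L (map0 D ?X)"
    using D.map1_comp1[of "K.\<eta> ?X" ?a] by (simp add: b_def kappa_unit del: D.map1_comp1)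
  have e2: "comp1 L b (map1 L.T b) = comp1 L (map1 D (comp1 K ?a (map1 K.T ?a))) V"
    by (simp add: b_def V_def)
  have e3: "comp1 L b (L.\<mu> (map0 D ?X)) = comp1 L (map1 D (comp1 K ?a (K.\<mu> ?X))) V"
    by (simp add: b_def V_def kappa_mult)
  have e4: "whisk_r L (whisk_r L (map2 D ?\<chi>) V) (map1 L.T (L.\<eta> (map0 D ?X))) =
      whisk_r L (map2 D (whisk_r K ?\<chi> (map1 K.T (K.\<eta> ?X)))) (\<kappa> ?X)"
    using r(1) by (simp del: A_facts(10,11))
  have e5: "whisk_r L (whisk_r L (map2 D ?\<chi>) V) (L.\<eta> (map0 L.T (map0 D ?X))) =
      whisk_r L (map2 D (whisk_r K ?\<chi> (K.\<eta> (map0 K.T ?X)))) (\<kappa> ?X)"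
    using r(2) by (simp del: A_facts(10,11))
  \<comment> \<open>Here the multiplication cell sits under \<open>N\<close>; 2-naturality of
    \<open>\<kappa>\<close> turns \<open>N D \<chi>\<close> into \<open>D M \<chi>\<close>.\<close>
  have "whisk_l L b (map2 L.T (whisk_r L (map2 D ?\<chi>) V)) =
      whisk_l L (map1 D ?a) (whisk_r L (whisk_l L (\<kappa> ?X) (map2 L.T (map2 D ?\<chi>))) (map1 L.T V))"
    by (simp add: b_def)
  also have "\<dots> = whisk_r L (map2 D (whisk_l K ?a (map2 K.T ?\<chi>))) W"
    using kappa_nat2[of ?\<chi> ?X] by (simp add: V_def W_def)
  finally have "vcomp L (whisk_r L (whisk_r L (map2 D ?\<chi>) V) (map1 L.T (L.\<mu> (map0 D ?X))))
        (whisk_l L b (map2 L.T (whisk_r L (map2 D ?\<chi>) V))) =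
      whisk_r L (map2 D (vcomp K (whisk_r K ?\<chi> (map1 K.T (K.\<mu> ?X))) (whisk_l K ?a (map2 K.T ?\<chi>)))) W"
    using r(3) by simp
  also have "\<dots> = vcomp L (whisk_r L (whisk_r L (map2 D ?\<chi>) V) (L.\<mu> (map0 L.T (map0 D ?X))))
      (whisk_r L (whisk_r L (map2 D ?\<chi>) V) (map1 L.T (map1 L.T b)))"
    unfolding A_facts(12) using r(4) rb K.mult_nat1[of ?a] D_mult_nat1[of ?a] by simp
  finally show ?thesis using e1 e2 e3 e4 e5
    by (simp add: normal_pseudoalgebra_def restrict_ps_alg_def Let_def V_def[symmetric] b_def[symmetric])
qed

lemma restrict_alg_sel [simp]:
  "ps_car (restrict_ps_alg M L N D \<kappa> A) = map0 D (ps_car A)"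
  "ps_act (restrict_ps_alg M L N D \<kappa> A) = comp1 L (map1 D (ps_act A)) (\<kappa> (ps_car A))"
  "ps_mul (restrict_ps_alg M L N D \<kappa> A) = whisk_r L (map2 D (ps_mul A))
          (comp1 L (\<kappa> (map0 K.T (ps_car A))) (map1 L.T (\<kappa> (ps_car A))))"
  by (simp_all add: restrict_ps_alg_def Let_def)

lemma restrict_mor_sel [simp]:
  "src (restrict_ps_mor M L N D \<kappa> F) = restrict_ps_alg M L N D \<kappa> (src F)"
  "tgt (restrict_ps_mor M L N D \<kappa> F) = restrict_ps_alg M L N D \<kappa> (tgt F)"
  "fst (dat (restrict_ps_mor M L N D \<kappa> F)) = map1 D (fst (dat F))"
  "snd (dat (restrict_ps_mor M L N D \<kappa> F)) = whisk_r L (map2 D (snd (dat F))) (\<kappa> (ps_car (src F)))"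
  by (simp_all add: restrict_ps_mor_def)

text \<open>The multiplication law is the \<open>D\<close> image of the one for \<open>F\<close>,
  whiskered with the twofold iterate \<open>V\<close> of \<open>\<kappa>\<close>; \<open>e3\<close>,
  \<open>e4\<close> and \<open>e5\<close> rewrite the three terms that contain the
  comparison.\<close>

lemma pseudomorphism_restrict:
  assumes F: "pseudomorphism K M F"
  shows "pseudomorphism L N (restrict_ps_mor M L N D \<kappa> F)"
proof -
  obtain A B f f' where F_eq: "F = Cell A B (f, f')" by (metis cell.exhaust surj_pair)
  note F_facts = K.pseudomorphismD[OF F, unfolded F_eq, simplified]
  let ?X = "ps_car A" and ?a = "ps_act A" and ?\<chi>a = "ps_mul A"
    and ?Y = "ps_car B" and ?b = "ps_act B" and ?\<chi>b = "ps_mul B"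
  note A_facts = K.pseudoalgebraD[OF F_facts(1)] and B_facts = K.pseudoalgebraD[OF F_facts(2)]
  note [simp] = F_facts(3-10) A_facts(1-4,6-9) B_facts(1-4,6-9)
  define V where "V = comp1 L (\<kappa> (map0 K.T ?X)) (map1 L.T (\<kappa> ?X))"
  define V' where "V' = comp1 L (\<kappa> (map0 K.T ?Y)) (map1 L.T (\<kappa> ?Y))"
  have [simp]: "V \<in> cells1 L" "src V = map0 L.T (map0 L.T (map0 D ?X))" "tgt V = map0 D (map0 K.T (map0 K.T ?X))"
    "V' \<in> cells1 L" "src V' = map0 L.T (map0 L.T (map0 D ?Y))" "tgt V' = map0 D (map0 K.T (map0 K.T ?Y))"
    by (simp_all add: V_def V'_def)
  have V': "comp1 L V' (map1 L.T (map1 L.T (map1 D f))) = comp1 L (map1 D (map1 K.T (map1 K.T f))) V"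
    using restrict_alg_1cells(6)[of ?Y f] by (simp add: V_def V'_def)
  have e1: "whisk_r L (whisk_r L (map2 D f') (\<kappa> ?X)) (L.\<eta> (map0 D ?X)) = id2 L (map1 D f)"
    using D.map2_whisk(2)[of f' "K.\<eta> ?X"] by (simp add: kappa_unit del: D.map2_whisk)
  have e2: "comp1 L (comp1 L (map1 D ?b) (\<kappa> ?Y)) (map1 L.T (map1 D f)) = comp1 L (map1 D (comp1 K ?b (map1 K.T f))) (\<kappa> ?X)"
    by (simp add: kappa_nat1)
  have "whisk_l L (comp1 L (map1 D ?b) (\<kappa> ?Y)) (map2 L.T (whisk_r L (map2 D f') (\<kappa> ?X))) =
     whisk_l L (map1 D ?b) (whisk_r L (whisk_l L (\<kappa> ?Y) (map2 L.T (map2 D f'))) (map1 L.T (\<kappa> ?X)))"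
    by simp
  also have "\<dots> = whisk_r L (map2 D (whisk_l K ?b (map2 K.T f'))) V"
    using kappa_nat2[of f' ?Y] by (simp add: V_def)
  finally have e3: "whisk_l L (comp1 L (map1 D ?b) (\<kappa> ?Y)) (map2 L.T (whisk_r L (map2 D f') (\<kappa> ?X))) =
    whisk_r L (map2 D (whisk_l K ?b (map2 K.T f'))) V" .
  have e4: "whisk_r L (whisk_r L (map2 D f') (\<kappa> ?X)) (map1 L.T (comp1 L (map1 D ?a) (\<kappa> ?X))) =
    whisk_r L (map2 D (whisk_r K f' (map1 K.T ?a))) V"
    by (simp add: V_def)
  have e5: "whisk_r L (whisk_r L (map2 D f') (\<kappa> ?X)) (L.\<mu> (map0 D ?X)) = whisk_r L (map2 D (whisk_r K f' (K.\<mu> ?X))) V"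
    by (simp add: V_def kappa_mult)
  have "vcomp L (whisk_r L (whisk_r L (map2 D f') (\<kappa> ?X)) (L.\<mu> (map0 D ?X)))
      (whisk_r L (whisk_r L (map2 D ?\<chi>b) V') (map1 L.T (map1 L.T (map1 D f)))) =
     whisk_r L (map2 D (vcomp K (whisk_r K f' (K.\<mu> ?X)) (whisk_r K ?\<chi>b (map1 K.T (map1 K.T f))))) V"
    unfolding e5 using V' K.mult_nat1[of f] D_mult_nat1[of f] by simp
  also have "\<dots> = vcomp L (whisk_l L (map1 D f) (whisk_r L (map2 D ?\<chi>a) V))
     (vcomp L (whisk_r L (whisk_r L (map2 D f') (\<kappa> ?X)) (map1 L.T (comp1 L (map1 D ?a) (\<kappa> ?X))))
       (whisk_l L (comp1 L (map1 D ?b) (\<kappa> ?Y)) (map2 L.T (whisk_r L (map2 D f') (\<kappa> ?X)))))"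
    unfolding F_facts(11) e3 e4 by simp
  finally show ?thesis
    using e1 e2 pseudoalgebra_restrict[OF F_facts(1)] pseudoalgebra_restrict[OF F_facts(2)]
    by (simp add: pseudomorphism_def F_eq V_def[symmetric] V'_def[symmetric])
qed

text \<open>2-naturality of \<open>\<kappa>\<close> carries \<open>N D \<alpha>\<close> to
  \<open>D M \<alpha>\<close>, after which the law is the \<open>D\<close> image of that of
  \<open>A\<close>, whiskered with \<open>\<kappa>\<close>.\<close>

lemma algebra_transformation_restrict:
  assumes A: "algebra_transformation K M A"
  shows "algebra_transformation L N (Cell (restrict_ps_mor M L N D \<kappa> (src A))
    (restrict_ps_mor M L N D \<kappa> (tgt A)) (map2 D (dat A)))"
proof -
  note A_facts = K.algebra_transformationD[OF A]
  note p1 = K.pseudomorphismD[OF A_facts(1)] and p2 = K.pseudomorphismD[OF A_facts(2)]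
  let ?X = "src (src A)" and ?Y = "tgt (src A)" and ?\<alpha> = "dat A"
  note [simp] = A_facts(3)[symmetric] A_facts(4)[symmetric] A_facts(5-7)
  note [simp] = p1(3-9) p2(3-9)[simplified] K.pseudoalgebraD(1-4)[OF p1(1)] K.pseudoalgebraD(1-4)[OF p1(2)]
  have "whisk_l L (comp1 L (map1 D (ps_act ?Y)) (\<kappa> (ps_car ?Y))) (map2 L.T (map2 D ?\<alpha>)) =
      whisk_l L (map1 D (ps_act ?Y)) (whisk_l L (\<kappa> (ps_car ?Y)) (map2 L.T (map2 D ?\<alpha>)))" by simp
  also have "\<dots> = whisk_r L (map2 D (whisk_l K (ps_act ?Y) (map2 K.T ?\<alpha>))) (\<kappa> (ps_car ?X))"
    using kappa_nat2[of ?\<alpha> "ps_car ?Y"] by simp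
  finally have e1: "whisk_l L (comp1 L (map1 D (ps_act ?Y)) (\<kappa> (ps_car ?Y))) (map2 L.T (map2 D ?\<alpha>)) =
      whisk_r L (map2 D (whisk_l K (ps_act ?Y) (map2 K.T ?\<alpha>))) (\<kappa> (ps_car ?X))" .
  have "vcomp L (whisk_r L (map2 D ?\<alpha>) (comp1 L (map1 D (ps_act ?X)) (\<kappa> (ps_car ?X))))
      (whisk_r L (map2 D (snd (dat (src A)))) (\<kappa> (ps_car ?X))) =
      whisk_r L (map2 D (vcomp K (whisk_r K ?\<alpha> (ps_act ?X)) (snd (dat (src A))))) (\<kappa> (ps_car ?X))" by simp
  also have "\<dots> = vcomp L (whisk_r L (map2 D (snd (dat (tgt A)))) (\<kappa> (ps_car ?X)))
      (whisk_l L (comp1 L (map1 D (ps_act ?Y)) (\<kappa> (ps_car ?Y))) (map2 L.T (map2 D ?\<alpha>)))"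
    unfolding A_facts(8) e1 by simp
  finally show ?thesis using pseudomorphism_restrict[OF A_facts(1)] pseudomorphism_restrict[OF A_facts(2)]
    by (simp add: algebra_transformation_def)
qed

lemma two_functor_restrict_ps: "two_functor (PsAlgn K M) (PsAlgn L N) (restrict_ps M L N D \<kappa>)"
proof -
  have 1: "restrict_ps_mor M L N D \<kappa> (comp1 (PsAlgn K M) G F) =
      comp1 (PsAlgn L N) (restrict_ps_mor M L N D \<kappa> G) (restrict_ps_mor M L N D \<kappa> F)"
    if F: "pseudomorphism K M F" and G: "pseudomorphism K M G" and e: "tgt F = src G" for F G
  proof -
    note p1 = K.pseudomorphismD[OF F, unfolded e] and p2 = K.pseudomorphismD[OF G]
    note [simp] = p1(3-9) p2(3-9) K.pseudoalgebraD(1-4)[OF p1(1)] K.pseudoalgebraD(1-4)[OF p1(2)]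
       K.pseudoalgebraD(1-4)[OF p2(2)] e
    show ?thesis by (simp add: restrict_ps_mor_def kappa_nat1)
  qed
  have 2: "restrict_ps_mor M L N D \<kappa> (id1 (PsAlgn K M) A) = id1 (PsAlgn L N) (restrict_ps_alg M L N D \<kappa> A)"
    if "normal_pseudoalgebra K M A" for A
    using K.pseudoalgebraD[OF that] by (simp add: restrict_ps_mor_def)
  show ?thesis
  proof (rule two_functorI, goal_cases)
    case (4 F)
    then show ?case using pseudomorphism_restrict[of F] by (simp add: restrict_ps_def)
  next
    case (5 \<alpha>)
    then show ?case using algebra_transformation_restrict[of \<alpha>] by (simp add: restrict_ps_def)
  next
    case (6 A)
    then show ?case using 2[of A] by (simp add: restrict_ps_def)
  next
    case (7 F G)
    then show ?case using 1[of F G] by (simp add: restrict_ps_def)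
  next
    case (10 \<alpha> \<beta>)
    then have a: "algebra_transformation K M \<alpha>" and b: "algebra_transformation K M \<beta>" by simp_all
    note a = K.algebra_transformationD[OF a] and b = K.algebra_transformationD[OF b]
    have "tgt (src (dat \<alpha>)) = src (src (dat \<beta>))"
      using 10(3) a(6) b(6) K.pseudomorphismD(4,5)[OF a(1)] K.pseudomorphismD(4,5)[OF b(1)] by simp
    then show ?case
      using 1[OF a(1) b(1) 10(3)] 1[OF a(2) b(2) 10(8)] a(5) b(5)
      unfolding K.PsAlgn_sel(8) L.PsAlgn_sel(8)
      by (simp add: restrict_ps_def del: K.PsAlgn_sel(5) L.PsAlgn_sel(5))
  qed (simp_all add: K.strict_PsAlgn L.strict_PsAlgn restrict_ps_def pseudoalgebra_restrict
      K.pseudomorphismD K.algebra_transformationD)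
qed

lemma strict_algebra_restrict:
  assumes A: "strict_algebra K M A"
  shows "strict_algebra L N (restrict_s_alg L D \<kappa> A)"
proof -
  note A_facts = K.strict_algebraD[OF A]
  note [simp] = A_facts(1-4)
  have 1: "map1 D (comp1 K (snd A) (K.\<eta> (fst A))) = id1 L (map0 D (fst A))" unfolding A_facts(5) by simp
  have "comp1 L (comp1 L (map1 D (snd A)) (\<kappa> (fst A))) (map1 L.T (comp1 L (map1 D (snd A)) (\<kappa> (fst A)))) =
    comp1 L (map1 D (comp1 K (snd A) (map1 K.T (snd A)))) (comp1 L (\<kappa> (map0 K.T (fst A))) (map1 L.T (\<kappa> (fst A))))"
    by simp
  then show ?thesis unfolding A_facts(6)
    using 1 by (simp add: strict_algebra_def restrict_s_alg_def kappa_unit kappa_mult)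
qed

lemma strict_morphism_restrict:
  assumes F: "F \<in> cells1 (Algs K M)"
  shows "restrict_s_mor L D \<kappa> F \<in> cells1 (Algs L N)"
proof -
  have A: "strict_algebra K M (src F)" and B: "strict_algebra K M (tgt F)"
    and f [simp]: "dat F \<in> cells1 K" "src (dat F) = fst (src F)" "tgt (dat F) = fst (tgt F)"
    and e: "comp1 K (dat F) (snd (src F)) = comp1 K (snd (tgt F)) (map1 K.T (dat F))"
    using F by simp_all
  note [simp] = K.strict_algebraD(1-4)[OF A] K.strict_algebraD(1-4)[OF B]
  have "comp1 L (map1 D (comp1 K (dat F) (snd (src F)))) (\<kappa> (fst (src F))) =
    comp1 L (comp1 L (map1 D (snd (tgt F))) (\<kappa> (fst (tgt F)))) (map1 L.T (map1 D (dat F)))"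
    unfolding e by (simp add: kappa_nat1)
  then show ?thesis using strict_algebra_restrict[OF A] strict_algebra_restrict[OF B]
    by (simp add: restrict_s_mor_def) (simp add: restrict_s_alg_def)
qed

lemma strict_transformation_restrict:
  assumes A: "A \<in> cells2 (Algs K M)"
  shows "Cell (restrict_s_mor L D \<kappa> (src A)) (restrict_s_mor L D \<kappa> (tgt A)) (map2 D (dat A)) \<in> cells2 (Algs L N)"
proof -
  have s: "src A \<in> cells1 (Algs K M)" and t: "tgt A \<in> cells1 (Algs K M)"
    and a: "src (src A) = src (tgt A)" "tgt (src A) = tgt (tgt A)"
     "dat A \<in> cells2 K" "src (dat A) = dat (src A)" "tgt (dat A) = dat (tgt A)"
     and e: "whisk_r K (dat A) (snd (src (src A))) = whisk_l K (snd (tgt (src A))) (map2 K.T (dat A))"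
    using A unfolding K.Algs_cells2 by (auto simp only:)
  have X: "strict_algebra K M (src (src A))" and Y: "strict_algebra K M (tgt (src A))"
     and f: "src (dat (src A)) = fst (src (src A))" "tgt (dat (src A)) = fst (tgt (src A))"
       "dat (src A) \<in> cells1 K"
    using s by simp_all
  note [simp] = K.strict_algebraD(1-4)[OF X] K.strict_algebraD(1-4)[OF Y] a(3-5) f
  have "whisk_r L (map2 D (dat A)) (comp1 L (map1 D (snd (src (src A)))) (\<kappa> (fst (src (src A))))) =
      whisk_r L (map2 D (whisk_r K (dat A) (snd (src (src A))))) (\<kappa> (fst (src (src A))))" by simp
  also have "\<dots> = whisk_l L (map1 D (snd (tgt (src A)))) (whisk_l L (\<kappa> (fst (tgt (src A)))) (map2 L.T (map2 D (dat A))))"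
    unfolding e using kappa_nat2[of "dat A" "fst (tgt (src A))"] by simp
  also have "\<dots> = whisk_l L (comp1 L (map1 D (snd (tgt (src A)))) (\<kappa> (fst (tgt (src A))))) (map2 L.T (map2 D (dat A)))"
    by simp
  finally have 1: "whisk_r L (map2 D (dat A)) (comp1 L (map1 D (snd (src (src A)))) (\<kappa> (fst (src (src A))))) = \<dots>" .
  show ?thesis using strict_morphism_restrict[OF s] strict_morphism_restrict[OF t] 1 a(1,2)
    by (simp only: L.Algs_cells2) (simp add: restrict_s_mor_def restrict_s_alg_def)
qed

lemma two_functor_restrict_s: "two_functor (Algs K M) (Algs L N) (restrict_s L D \<kappa>)"
proof (rule two_functorI, goal_cases)
  case (4 F)
  then show ?case using strict_morphism_restrict[OF 4] by (simp add: restrict_s_def restrict_s_mor_def del: L.Algs_cells1)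
next
  case (5 \<alpha>)
  then show ?case using strict_transformation_restrict[OF 5(1)]
    by (simp add: restrict_s_def del: L.Algs_cells1 L.Algs_cells2)
qed (simp_all add: K.strict_Algs L.strict_Algs restrict_s_def strict_algebra_restrict restrict_s_mor_def,
    simp_all add: restrict_s_alg_def K.strict_algebraD)

text \<open>Both multiplications are identity 2-cells; the multiplication law of
  \<open>\<kappa>\<close> shows that they are identities of the same 1-cell.\<close>

lemma restrict_strict_alg:
  assumes A: "strict_algebra K M A"
  shows "restrict_ps_alg M L N D \<kappa> (strict_to_pseudo_alg K M A) = strict_to_pseudo_alg L N (restrict_s_alg L D \<kappa> A)"
  using K.strict_algebraD(1-4)[OF A]
  by (simp add: restrict_ps_alg_def strict_to_pseudo_alg_def restrict_s_alg_def kappa_mult Let_def)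

lemma restrict_strict_mor:
  assumes F: "F \<in> cells1 (Algs K M)"
  shows "restrict_ps_mor M L N D \<kappa> (strict_to_pseudo_mor K M F) = strict_to_pseudo_mor L N (restrict_s_mor L D \<kappa> F)"
proof -
  have A: "strict_algebra K M (src F)" and B: "strict_algebra K M (tgt F)" using F by simp_all
  have f [simp]: "dat F \<in> cells1 K" "src (dat F) = fst (src F)" "tgt (dat F) = fst (tgt F)"
    and e: "comp1 K (dat F) (snd (src F)) = comp1 K (snd (tgt F)) (map1 K.T (dat F))"
    using F by simp_all
  note [simp] = K.strict_algebraD(1-4)[OF A] K.strict_algebraD(1-4)[OF B]
  have "comp1 L (map1 D (snd (tgt F))) (comp1 L (map1 D (map1 K.T (dat F))) (\<kappa> (fst (src F)))) =
      comp1 L (map1 D (dat F)) (comp1 L (map1 D (snd (src F))) (\<kappa> (fst (src F))))"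
    using arg_cong[OF e, of "map1 D"] by (intro L.comp1_reassoc) simp_all
  moreover have "ps_car (strict_to_pseudo_alg K M (src F)) = fst (src F)" by (simp add: strict_to_pseudo_alg_def)
  ultimately show ?thesis
    using restrict_strict_alg[OF A] restrict_strict_alg[OF B]
    by (simp add: restrict_ps_mor_def strict_to_pseudo_mor_def restrict_s_mor_def)
       (simp add: restrict_s_alg_def)
qed

end

section \<open>The 2-category of categories\<close>

lemma in_hom [simp]: "f \<in> hom C x y \<longleftrightarrow> f \<in> arr C \<and> dm C f = x \<and> cd C f = y"
  by (simp add: hom_def)

lemmas category_ax =
  category_def[THEN iffD1, THEN conjunct1]
  category_def[THEN iffD1, THEN conjunct2, THEN conjunct1]
  category_def[THEN iffD1, THEN conjunct2, THEN conjunct2, THEN conjunct1]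
  category_def[THEN iffD1, THEN conjunct2, THEN conjunct2, THEN conjunct2, THEN conjunct1]
  category_def[THEN iffD1, THEN conjunct2, THEN conjunct2, THEN conjunct2, THEN conjunct2, THEN conjunct1]
  category_def[THEN iffD1, THEN conjunct2, THEN conjunct2, THEN conjunct2, THEN conjunct2, THEN conjunct2, THEN conjunct1]
  category_def[THEN iffD1, THEN conjunct2, THEN conjunct2, THEN conjunct2, THEN conjunct2, THEN conjunct2, THEN conjunct2, THEN conjunct1]
  category_def[THEN iffD1, THEN conjunct2, THEN conjunct2, THEN conjunct2, THEN conjunct2, THEN conjunct2, THEN conjunct2, THEN conjunct2, THEN conjunct1]
  category_def[THEN iffD1, THEN conjunct2, THEN conjunct2, THEN conjunct2, THEN conjunct2, THEN conjunct2, THEN conjunct2, THEN conjunct2, THEN conjunct2]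

lemma category_arr [simp]:
  assumes "category C" "f \<in> arr C" shows "dm C f \<in> obj C" "cd C f \<in> obj C"
  using category_ax(1)[OF assms(1)] assms(2) by auto

lemma category_idn [simp]:
  assumes "category C" "x \<in> obj C"
  shows "idn C x \<in> arr C" "dm C (idn C x) = x" "cd C (idn C x) = x"
  using category_ax(2)[OF assms(1)] assms(2) by auto

lemma category_cmp [simp]:
  assumes "category C" "f \<in> arr C" "g \<in> arr C" "cd C f = dm C g"
  shows "cmp C g f \<in> arr C" "dm C (cmp C g f) = dm C f" "cd C (cmp C g f) = cd C g"
  using category_ax(3)[OF assms(1)] assms(2-) by auto

lemma category_cmp_idn [simp]:
  assumes "category C" "f \<in> arr C"
  shows "dm C f = x \<Longrightarrow> cmp C f (idn C x) = f" "cd C f = x \<Longrightarrow> cmp C (idn C x) f = f"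
  using category_ax(4)[OF assms(1)] assms(2-) by auto

lemma category_assoc [simp]:
  assumes "category C" "f \<in> arr C" "g \<in> arr C" "h \<in> arr C" "cd C f = dm C g" "cd C g = dm C h"
  shows "cmp C (cmp C h g) f = cmp C h (cmp C g f)"
  using category_ax(5)[OF assms(1)] assms(2-) by metis

lemma category_reassoc:
  assumes "cmp C g f = cmp C g' f'" "category C" "f \<in> arr C" "g \<in> arr C" "f' \<in> arr C" "g' \<in> arr C"
    "cd C f = dm C g" "cd C f' = dm C g'" "e \<in> arr C" "cd C e = dm C f" "cd C e = dm C f'"
  shows "cmp C g (cmp C f e) = cmp C g' (cmp C f' e)"
  using assms by (metis category_assoc)

lemmas is_functor_ax =
  is_functor_def[unfolded Let_def, THEN iffD1, THEN conjunct1]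
  is_functor_def[unfolded Let_def, THEN iffD1, THEN conjunct2, THEN conjunct1]
  is_functor_def[unfolded Let_def, THEN iffD1, THEN conjunct2, THEN conjunct2, THEN conjunct1]
  is_functor_def[unfolded Let_def, THEN iffD1, THEN conjunct2, THEN conjunct2, THEN conjunct2, THEN conjunct1]
  is_functor_def[unfolded Let_def, THEN iffD1, THEN conjunct2, THEN conjunct2, THEN conjunct2, THEN conjunct2, THEN conjunct1]
  is_functor_def[unfolded Let_def, THEN iffD1, THEN conjunct2, THEN conjunct2, THEN conjunct2, THEN conjunct2, THEN conjunct2, THEN conjunct1]
  is_functor_def[unfolded Let_def, THEN iffD1, THEN conjunct2, THEN conjunct2, THEN conjunct2, THEN conjunct2, THEN conjunct2, THEN conjunct2]

lemma functor_src_tgt [simp]: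
  "is_functor F \<Longrightarrow> category (src F)" "is_functor F \<Longrightarrow> category (tgt F)"
  using is_functor_ax(1,2) by auto

lemma functor_cat:
  "is_functor F \<Longrightarrow> src F = C \<Longrightarrow> category C"
  "is_functor F \<Longrightarrow> tgt F = D \<Longrightarrow> category D"
  using is_functor_ax(1,2) by auto

lemma functor_fo [simp]:
  "is_functor F \<Longrightarrow> tgt F = D \<Longrightarrow> x \<in> obj (src F) \<Longrightarrow> fo F x \<in> obj D"
  using is_functor_ax(3) by auto

lemma functor_fa [simp]:
  assumes "is_functor F" "tgt F = D" "f \<in> arr (src F)"
  shows "fa F f \<in> arr D" "dm D (fa F f) = fo F (dm (src F) f)" "cd D (fa F f) = fo F (cd (src F) f)"
  using is_functor_ax(4)[OF assms(1)] assms(2-) by auto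

lemma functor_idn [simp]:
  "is_functor F \<Longrightarrow> src F = C \<Longrightarrow> x \<in> obj C \<Longrightarrow> fa F (idn C x) = idn (tgt F) (fo F x)"
  using is_functor_ax(3) by auto

lemma functor_cmp [simp]:
  "is_functor F \<Longrightarrow> src F = C \<Longrightarrow> f \<in> arr C \<Longrightarrow> g \<in> arr C \<Longrightarrow> cd C f = dm C g \<Longrightarrow>
    fa F (cmp C g f) = cmp (tgt F) (fa F g) (fa F f)"
  using is_functor_ax(5) by auto

text \<open>The extensionality clauses of \<open>is_functor\<close> fix the values off the domain,
  so agreement on objects and arrows is already equality in HOL.\<close>

lemma functor_eqI:
  assumes "is_functor F" "is_functor G" "src F = src G" "tgt F = tgt G"
    "\<And>x. x \<in> obj (src F) \<Longrightarrow> fo F x = fo G x" "\<And>f. f \<in> arr (src F) \<Longrightarrow> fa F f = fa G f"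
  shows "F = G"
proof -
  have "fo F \<in> extensional (obj (src F))" "fo G \<in> extensional (obj (src F))"
    "fa F \<in> extensional (arr (src F))" "fa G \<in> extensional (arr (src F))"
    using assms(3) is_functor_ax(6,7)[OF assms(1)] is_functor_ax(6,7)[OF assms(2)] by simp_all
  then have "fo F = fo G" "fa F = fa G" using assms(5,6) by (auto intro: extensionalityI)
  then show ?thesis using assms(3,4) by (cases F; cases G) (simp add: fo_def fa_def prod_eq_iff)
qed

lemma mk_functor_sel [simp]:
  "src (mk_functor C D u v) = C" "tgt (mk_functor C D u v) = D"
  "x \<in> obj C \<Longrightarrow> fo (mk_functor C D u v) x = u x"
  "f \<in> arr C \<Longrightarrow> fa (mk_functor C D u v) f = v f"
  by (auto simp: mk_functor_def fo_def fa_def)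

lemma is_functor_mk:
  assumes "category C" "category D" "\<And>x. x \<in> obj C \<Longrightarrow> u x \<in> obj D"
    "\<And>x. x \<in> obj C \<Longrightarrow> v (idn C x) = idn D (u x)"
    "\<And>f. f \<in> arr C \<Longrightarrow> v f \<in> arr D \<and> dm D (v f) = u (dm C f) \<and> cd D (v f) = u (cd C f)"
    "\<And>f g. f \<in> arr C \<Longrightarrow> g \<in> arr C \<Longrightarrow> cd C f = dm C g \<Longrightarrow> v (cmp C g f) = cmp D (v g) (v f)"
  shows "is_functor (mk_functor C D u v)"
  unfolding is_functor_def Let_def using assms by simp (simp add: mk_functor_def fo_def fa_def)

lemmas is_trans_ax =
  is_trans_def[unfolded Let_def, THEN iffD1, THEN conjunct1]
  is_trans_def[unfolded Let_def, THEN iffD1, THEN conjunct2, THEN conjunct1]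
  is_trans_def[unfolded Let_def, THEN iffD1, THEN conjunct2, THEN conjunct2, THEN conjunct1]
  is_trans_def[unfolded Let_def, THEN iffD1, THEN conjunct2, THEN conjunct2, THEN conjunct2, THEN conjunct1]
  is_trans_def[unfolded Let_def, THEN iffD1, THEN conjunct2, THEN conjunct2, THEN conjunct2, THEN conjunct2, THEN conjunct1]
  is_trans_def[unfolded Let_def, THEN iffD1, THEN conjunct2, THEN conjunct2, THEN conjunct2, THEN conjunct2, THEN conjunct2, THEN conjunct1]
  is_trans_def[unfolded Let_def, THEN iffD1, THEN conjunct2, THEN conjunct2, THEN conjunct2, THEN conjunct2, THEN conjunct2, THEN conjunct2]

lemma transD [simp]:
  assumes "is_trans \<alpha>"
  shows "is_functor (src \<alpha>)" "is_functor (tgt \<alpha>)" "src (tgt \<alpha>) = src (src \<alpha>)" "tgt (tgt \<alpha>) = tgt (src \<alpha>)"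
  using is_trans_ax(1-4)[OF assms] by simp_all

lemma trans_arr [simp]:
  assumes "is_trans \<alpha>" "tgt (src \<alpha>) = D" "x \<in> obj (src (src \<alpha>))"
  shows "dat \<alpha> x \<in> arr D" "dm D (dat \<alpha> x) = fo (src \<alpha>) x" "cd D (dat \<alpha> x) = fo (tgt \<alpha>) x"
  using is_trans_ax(5)[OF assms(1)] assms(2-) by auto

lemma trans_nat:
  assumes "is_trans \<alpha>" "src (src \<alpha>) = C" "tgt (src \<alpha>) = D" "f \<in> arr C"
  shows "cmp D (dat \<alpha> (cd C f)) (fa (src \<alpha>) f) = cmp D (fa (tgt \<alpha>) f) (dat \<alpha> (dm C f))"
  using is_trans_ax(6)[OF assms(1)] assms(2-) by auto

lemma trans_nat':
  assumes "is_trans \<alpha>" "tgt (src \<alpha>) = D" "f \<in> arr (src (src \<alpha>))" "cd (src (src \<alpha>)) f = y"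
  shows "cmp D (dat \<alpha> y) (fa (src \<alpha>) f) = cmp D (fa (tgt \<alpha>) f) (dat \<alpha> (dm (src (src \<alpha>)) f))"
  using trans_nat[OF assms(1) refl assms(2,3)] assms(4) by simp

lemma trans_eqI:
  assumes "is_trans \<alpha>" "is_trans \<beta>" "src \<alpha> = src \<beta>" "tgt \<alpha> = tgt \<beta>"
    "\<And>x. x \<in> obj (src (src \<alpha>)) \<Longrightarrow> dat \<alpha> x = dat \<beta> x"
  shows "\<alpha> = \<beta>"
proof -
  have "dat \<alpha> \<in> extensional (obj (src (src \<alpha>)))" "dat \<beta> \<in> extensional (obj (src (src \<alpha>)))"
    using assms(3) is_trans_ax(7)[OF assms(1)] is_trans_ax(7)[OF assms(2)] by simp_all
  then have "dat \<alpha> = dat \<beta>" using assms(5) by (auto intro: extensionalityI)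
  then show ?thesis using assms(3,4) by (rule cell_eqI[rotated 2])
qed

lemma mk_trans_sel [simp]:
  "src (mk_trans F G t) = F" "tgt (mk_trans F G t) = G"
  "x \<in> obj (src F) \<Longrightarrow> dat (mk_trans F G t) x = t x"
  by (auto simp: mk_trans_def)

lemma is_trans_mk:
  assumes "is_functor F" "is_functor G" "src F = C" "tgt F = D" "src G = C" "tgt G = D"
    "\<And>x. x \<in> obj C \<Longrightarrow> t x \<in> arr D \<and> dm D (t x) = fo F x \<and> cd D (t x) = fo G x"
    "\<And>f. f \<in> arr C \<Longrightarrow> cmp D (t (cd C f)) (fa F f) = cmp D (fa G f) (t (dm C f))"
  shows "is_trans (mk_trans F G t)"
proof -
  have "category C" "category D" using assms(1,3,4) by auto
  then show ?thesis unfolding is_trans_def Let_def using assms by simp (simp add: mk_trans_def)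
qed

lemma CAT_cells [simp]:
  "C \<in> cells0 CAT \<longleftrightarrow> category C" "F \<in> cells1 CAT \<longleftrightarrow> is_functor F" "\<alpha> \<in> cells2 CAT \<longleftrightarrow> is_trans \<alpha>"
  by (simp_all add: CAT_def)

lemma CAT_functor_sel [simp]:
  "src (id1 CAT C) = C" "tgt (id1 CAT C) = C"
  "x \<in> obj C \<Longrightarrow> fo (id1 CAT C) x = x" "f \<in> arr C \<Longrightarrow> fa (id1 CAT C) f = f"
  "src (comp1 CAT G F) = src F" "tgt (comp1 CAT G F) = tgt G"
  "x \<in> obj (src F) \<Longrightarrow> fo (comp1 CAT G F) x = fo G (fo F x)"
  "f \<in> arr (src F) \<Longrightarrow> fa (comp1 CAT G F) f = fa G (fa F f)"
  by (simp_all add: CAT_def functor_comp_def)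

lemma CAT_trans_sel [simp]:
  "src (id2 CAT F) = F" "tgt (id2 CAT F) = F"
  "x \<in> obj (src F) \<Longrightarrow> dat (id2 CAT F) x = idn (tgt F) (fo F x)"
  "src (vcomp CAT \<beta> \<alpha>) = src \<alpha>" "tgt (vcomp CAT \<beta> \<alpha>) = tgt \<beta>"
  "x \<in> obj (src (src \<alpha>)) \<Longrightarrow> dat (vcomp CAT \<beta> \<alpha>) x = cmp (tgt (src \<beta>)) (dat \<beta> x) (dat \<alpha> x)"
  "src (hcomp CAT \<beta> \<alpha>) = comp1 CAT (src \<beta>) (src \<alpha>)" "tgt (hcomp CAT \<beta> \<alpha>) = comp1 CAT (tgt \<beta>) (tgt \<alpha>)"
  "x \<in> obj (src (src \<alpha>)) \<Longrightarrow>
    dat (hcomp CAT \<beta> \<alpha>) x = cmp (tgt (src \<beta>)) (dat \<beta> (fo (tgt \<alpha>) x)) (fa (src \<beta>) (dat \<alpha> x))"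
  by (simp_all add: CAT_def functor_comp_def)

lemma is_functor_id [simp]: "category C \<Longrightarrow> is_functor (id1 CAT C)"
  unfolding CAT_def twocat.simps by (rule is_functor_mk) auto

lemma is_functor_comp [simp]:
  "is_functor F \<Longrightarrow> is_functor G \<Longrightarrow> tgt F = src G \<Longrightarrow> is_functor (comp1 CAT G F)"
  unfolding CAT_def twocat.simps functor_comp_def by (rule is_functor_mk) auto

lemma is_trans_id [simp]: "is_functor F \<Longrightarrow> is_trans (id2 CAT F)"
  unfolding CAT_def twocat.simps by (rule is_trans_mk[OF _ _ refl refl]) auto

lemma is_trans_vcomp [simp]:
  assumes \<alpha>: "is_trans \<alpha>" and \<beta>: "is_trans \<beta>" and e: "tgt \<alpha> = src \<beta>"
  shows "is_trans (vcomp CAT \<beta> \<alpha>)"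
proof -
  define C where "C = src (src \<alpha>)"
  define D where "D = tgt (src \<alpha>)"
  have [simp]: "src (src \<alpha>) = C" "tgt (src \<alpha>) = D" "src (src \<beta>) = C" "tgt (src \<beta>) = D"
    "is_functor (src \<alpha>)" "is_functor (src \<beta>)"
    using \<alpha> \<beta> e transD(3,4)[OF \<alpha>] by (simp_all add: C_def D_def)
  have [simp]: "category C" "category D" using \<alpha> by (auto intro: functor_cat[of "src \<alpha>"])
  note [simp] = \<alpha> \<beta>
  show ?thesis unfolding CAT_def twocat.simps
  proof (rule is_trans_mk)
    fix f assume f: "f \<in> arr C"
    have "cmp D (dat \<beta> (cd C f)) (cmp D (dat \<alpha> (cd C f)) (fa (src \<alpha>) f)) =
        cmp D (cmp D (dat \<beta> (cd C f)) (fa (src \<beta>) f)) (dat \<alpha> (dm C f))"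
      using f e trans_nat[OF \<alpha>, of C D f] by simp
    then show "cmp D (cmp (tgt (src \<beta>)) (dat \<beta> (cd C f)) (dat \<alpha> (cd C f))) (fa (src \<alpha>) f) =
       cmp D (fa (tgt \<beta>) f) (cmp (tgt (src \<beta>)) (dat \<beta> (dm C f)) (dat \<alpha> (dm C f)))"
      using f e trans_nat[OF \<beta>, of C D f] by simp
  qed (use e in auto)
qed

lemma is_trans_hcomp [simp]:
  assumes \<alpha>: "is_trans \<alpha>" and \<beta>: "is_trans \<beta>" and e: "tgt (src \<alpha>) = src (src \<beta>)"
  shows "is_trans (hcomp CAT \<beta> \<alpha>)"
proof -
  define C where "C = src (src \<alpha>)"
  define D where "D = tgt (src \<alpha>)"
  define E where "E = tgt (src \<beta>)"
  have [simp]: "src (src \<alpha>) = C" "tgt (src \<alpha>) = D" "src (src \<beta>) = D" "tgt (src \<beta>) = E"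
    "is_functor (src \<alpha>)" "is_functor (src \<beta>)"
    using \<alpha> \<beta> e by (simp_all add: C_def D_def E_def)
  have [simp]: "category C" "category D" "category E" using \<alpha> \<beta>
     by (auto intro: functor_cat[of "src \<alpha>"] functor_cat[of "src \<beta>"])
  note [simp] = \<alpha> \<beta>
  have f: "is_functor (comp1 CAT (src \<beta>) (src \<alpha>))" "is_functor (comp1 CAT (tgt \<beta>) (tgt \<alpha>))" by simp_all
  have h: "hcomp CAT \<beta> \<alpha> = mk_trans (comp1 CAT (src \<beta>) (src \<alpha>)) (comp1 CAT (tgt \<beta>) (tgt \<alpha>))
    (\<lambda>x. cmp (tgt (src \<beta>)) (dat \<beta> (fo (tgt \<alpha>) x)) (fa (src \<beta>) (dat \<alpha> x)))"
    by (simp add: CAT_def)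
  show ?thesis unfolding h
  proof (rule is_trans_mk[OF f])
    fix g assume g: "g \<in> arr C"
    have "cmp E (fa (src \<beta>) (dat \<alpha> (cd C g))) (fa (src \<beta>) (fa (src \<alpha>) g)) =
      cmp E (fa (src \<beta>) (fa (tgt \<alpha>) g)) (fa (src \<beta>) (dat \<alpha> (dm C g)))"
      using arg_cong[OF trans_nat[OF \<alpha>, of C D g], of "fa (src \<beta>)"] g by simp
    \<comment> \<open>Naturality of \<open>\<beta>\<close> is taken at the image of \<open>g\<close>
      under the target functor of \<open>\<alpha>\<close>.\<close>
    moreover have "cmp E (dat \<beta> (fo (tgt \<alpha>) (cd C g))) (cmp E (fa (src \<beta>) (fa (tgt \<alpha>) g)) (fa (src \<beta>) (dat \<alpha> (dm C g)))) =
      cmp E (fa (tgt \<beta>) (fa (tgt \<alpha>) g)) (cmp E (dat \<beta> (fo (tgt \<alpha>) (dm C g))) (fa (src \<beta>) (dat \<alpha> (dm C g))))"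
      by (rule category_reassoc) (use trans_nat[OF \<beta>, of D E "fa (tgt \<alpha>) g"] g in simp_all)
    ultimately show "cmp E (cmp (tgt (src \<beta>)) (dat \<beta> (fo (tgt \<alpha>) (cd C g))) (fa (src \<beta>) (dat \<alpha> (cd C g))))
          (fa (comp1 CAT (src \<beta>) (src \<alpha>)) g) =
         cmp E (fa (comp1 CAT (tgt \<beta>) (tgt \<alpha>)) g)
          (cmp (tgt (src \<beta>)) (dat \<beta> (fo (tgt \<alpha>) (dm C g))) (fa (src \<beta>) (dat \<alpha> (dm C g))))"
      using g by simp
  qed auto
qed

lemma strict_CAT: "strict_2_category CAT"
proof (rule strict_2_categoryI, goal_cases)
  case (4 F)
  then show ?case by (auto intro!: functor_eqI)
next
  case (5 F G H)
  then show ?case by (auto intro!: functor_eqI)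
next
  case (9 \<alpha>)
  then have "category (src (src \<alpha>))" "category (tgt (src \<alpha>))" by (auto intro: functor_cat[of "src \<alpha>"])
  with 9 show ?case by (auto intro!: trans_eqI)
next
  case (10 \<alpha> \<beta> \<gamma>)
  then have "category (src (src \<alpha>))" "category (tgt (src \<alpha>))" by (auto intro: functor_cat[of "src \<alpha>"])
  moreover have "src (src \<beta>) = src (src \<alpha>)" "tgt (src \<beta>) = tgt (src \<alpha>)"
    "src (src \<gamma>) = src (src \<alpha>)" "tgt (src \<gamma>) = tgt (src \<alpha>)"
    using 10 by (metis CAT_cells(3) transD(3,4))+
  ultimately show ?case using 10 by (auto intro!: trans_eqI)
next
  case (12 \<alpha>)
  then have "category (src (src \<alpha>))" "category (tgt (src \<alpha>))" by (auto intro: functor_cat[of "src \<alpha>"])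
  with 12 show ?case by (auto intro!: trans_eqI functor_eqI)
next
  case (13 \<alpha> \<beta> \<gamma>)
  then have "category (src (src \<alpha>))" "category (tgt (src \<alpha>))" "category (tgt (src \<beta>))" "category (tgt (src \<gamma>))"
    by (auto intro: functor_cat[of "src \<alpha>"] functor_cat[of "src \<beta>"] functor_cat[of "src \<gamma>"])
  with 13 show ?case by (auto intro!: trans_eqI functor_eqI)
next
  case (14 F G)
  then have "category (src F)" "category (tgt F)" "category (tgt G)" by auto
  with 14 show ?case by (auto intro!: trans_eqI functor_eqI)
next
  case (15 \<alpha> \<alpha>' \<beta> \<beta>')
  define C where "C = src (src \<alpha>)"
  define D where "D = tgt (src \<alpha>)"
  define E where "E = tgt (src \<beta>)"
  note \<alpha> = 15(1-4)[simplified]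
  have [simp]: "src (src \<alpha>) = C" "tgt (src \<alpha>) = D" "src (src \<beta>) = D" "tgt (src \<beta>) = E"
    "src (src \<alpha>') = C" "tgt (src \<alpha>') = D" "src (src \<beta>') = D" "tgt (src \<beta>') = E"
    using 15(5-) transD(3,4)[OF \<alpha>(1)] transD(3,4)[OF \<alpha>(3)]
    by (simp_all add: C_def D_def E_def)
  have [simp]: "is_functor (src \<alpha>)" "is_functor (src \<beta>)" "is_functor (src \<alpha>')" "is_functor (src \<beta>')"
    using \<alpha> by simp_all
  have [simp]: "category C" "category D" "category E" using \<alpha>
     by (auto intro: functor_cat[of "src \<alpha>"] functor_cat[of "src \<beta>"])
  note [simp] = \<alpha> 15(5,6)
  show ?case
  proof (rule trans_eqI)
    fix x assume "x \<in> obj (src (src (hcomp CAT (vcomp CAT \<beta>' \<beta>) (vcomp CAT \<alpha>' \<alpha>))))"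
    then have x: "x \<in> obj C" by simp
    \<comment> \<open>The interchange law comes down to naturality of \<open>\<beta>\<close> at the
      component of \<open>\<alpha>'\<close> at \<open>x\<close>.\<close>
    have "cmp E (dat \<beta> (fo (tgt \<alpha>') x)) (cmp E (fa (src \<beta>) (dat \<alpha>' x)) (fa (src \<beta>) (dat \<alpha> x))) =
      cmp E (fa (src \<beta>') (dat \<alpha>' x)) (cmp E (dat \<beta> (fo (src \<alpha>') x)) (fa (src \<beta>) (dat \<alpha> x)))"
      by (rule category_reassoc) (use trans_nat[OF \<alpha>(3), of D E "dat \<alpha>' x"] x in simp_all)
    then show "dat (hcomp CAT (vcomp CAT \<beta>' \<beta>) (vcomp CAT \<alpha>' \<alpha>)) x =
        dat (vcomp CAT (hcomp CAT \<beta>' \<alpha>') (hcomp CAT \<beta> \<alpha>)) x"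
      using x by simp
  qed simp_all
qed auto

interpretation CAT: twocat CAT
  by unfold_locales (rule strict_CAT)

lemma is_trans_whisk [simp]:
  "is_trans \<alpha> \<Longrightarrow> is_functor G \<Longrightarrow> tgt (src \<alpha>) = src G \<Longrightarrow> is_trans (whisk_l CAT G \<alpha>)"
  "is_trans \<alpha> \<Longrightarrow> is_functor F \<Longrightarrow> tgt F = src (src \<alpha>) \<Longrightarrow> is_trans (whisk_r CAT \<alpha> F)"
  using CAT.whisk_l_cell(1) CAT.whisk_r_cell(1) by simp_all

lemma whisk_l_dat [simp]:
  assumes "is_trans \<alpha>" "is_functor G" "tgt (src \<alpha>) = src G" "x \<in> obj (src (src \<alpha>))"
  shows "dat (whisk_l CAT G \<alpha>) x = fa G (dat \<alpha> x)"
  using assms functor_cat(2)[of G] by (simp add: whisk_l_def)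

lemma whisk_r_dat [simp]:
  assumes "is_trans \<alpha>" "is_functor F" "tgt F = src (src \<alpha>)" "x \<in> obj (src F)"
  shows "dat (whisk_r CAT \<alpha> F) x = dat \<alpha> (fo F x)"
proof -
  have "category (tgt (src \<alpha>))" using assms by (auto intro: functor_cat[of "src \<alpha>"])
  then show ?thesis using assms by (simp add: whisk_r_def)
qed

section \<open>The squaring 2-monad\<close>

lemma mor_sel [simp]:
  "mor_src (mor a b p q) = a" "mor_tgt (mor a b p q) = b"
  "mor_fst (mor a b p q) = p" "mor_snd (mor a b p q) = q"
  by (simp_all add: mor_def mor_src_def mor_tgt_def mor_fst_def mor_snd_def)

lemma mor_inject [simp]: "mor a b p q = mor a' b' p' q' \<longleftrightarrow> a = a' \<and> b = b' \<and> p = p' \<and> q = q'"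
  by (auto simp: mor_def)

lemma pair_cat_obj [simp]: "obj (pair_cat Ob R C D i j) = Ob"
  by (simp add: pair_cat_def Let_def)

lemma pair_cat_arr:
  "z \<in> arr (pair_cat Ob R C D i j) \<longleftrightarrow> (\<exists>a b p q. z = mor a b p q \<and> a \<in> Ob \<and> b \<in> Ob \<and> R a b p q)"
  by (simp add: pair_cat_def Let_def)

lemma pair_cat_mor [simp]:
  "mor a b p q \<in> arr (pair_cat Ob R C D i j) \<longleftrightarrow> a \<in> Ob \<and> b \<in> Ob \<and> R a b p q"
  by (auto simp: pair_cat_arr)

lemma pair_cat_dm_cd [simp]:
  assumes "mor a b p q \<in> arr (pair_cat Ob R C D i j)"
  shows "dm (pair_cat Ob R C D i j) (mor a b p q) = a" "cd (pair_cat Ob R C D i j) (mor a b p q) = b"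
  using assms by (auto simp: pair_cat_def Let_def)

lemma pair_cat_idn [simp]: "a \<in> Ob \<Longrightarrow> idn (pair_cat Ob R C D i j) a = mor a a (i a) (j a)"
  by (simp add: pair_cat_def Let_def)

lemma pair_cat_cmp [simp]:
  assumes "mor a b p q \<in> arr (pair_cat Ob R C D i j)" "mor b c p' q' \<in> arr (pair_cat Ob R C D i j)"
  shows "cmp (pair_cat Ob R C D i j) (mor b c p' q') (mor a b p q) = mor a c (cmp C p' p) (cmp D q' q)"
  using assms by (auto simp: pair_cat_def Let_def)

text \<open>Serves arrow categories and comma categories at once. The functions \<open>s\<close> and
  \<open>t\<close> give the objects of \<open>C\<close> and \<open>D\<close> between which the two
  components of an arrow run, so that associativity and the identity laws hold
  componentwise.\<close>

lemma category_pair_cat: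
  assumes C: "category C" and D: "category D"
    and Ob: "\<And>a. a \<in> Ob \<Longrightarrow> s a \<in> obj C \<and> t a \<in> obj D \<and> i a = idn C (s a) \<and> j a = idn D (t a)"
    and hom: "\<And>a b p q. R a b p q \<Longrightarrow> a \<in> Ob \<Longrightarrow> b \<in> Ob \<Longrightarrow> p \<in> hom C (s a) (s b) \<and> q \<in> hom D (t a) (t b)"
    and id: "\<And>a. a \<in> Ob \<Longrightarrow> R a a (i a) (j a)"
    and cmp: "\<And>a b c p q p' q'. R a b p q \<Longrightarrow> R b c p' q' \<Longrightarrow> a \<in> Ob \<Longrightarrow> b \<in> Ob \<Longrightarrow> c \<in> Ob \<Longrightarrow>
      R a c (cmp C p' p) (cmp D q' q)"
  shows "category (pair_cat Ob R C D i j)" (is "category ?P")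
  unfolding category_def
proof (intro conjI ballI impI allI; (elim conjE)?)
  show "dm ?P \<in> extensional (arr ?P)" "cd ?P \<in> extensional (arr ?P)" "idn ?P \<in> extensional (obj ?P)"
    by (simp_all add: pair_cat_def Let_def)
  \<comment> \<open>On arrows \<open>dm\<close> and \<open>cd\<close> agree with
    \<open>mor_src\<close> and \<open>mor_tgt\<close>, so a pair that is not composable also fails
    the test built into \<open>pair_cat\<close>.\<close>
  show "cmp ?P g f = undefined" if "\<not> (f \<in> arr ?P \<and> g \<in> arr ?P \<and> cd ?P f = dm ?P g)" for f g
  proof -
    have "mor_tgt f \<noteq> mor_src g" if "f \<in> arr ?P" "g \<in> arr ?P"
      using that \<open>\<not> _\<close> by (auto simp: pair_cat_arr)
    then show ?thesis by (auto simp: pair_cat_def Let_def)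
  qed
  fix f assume "f \<in> arr ?P"
  then obtain a b p q where f: "f = mor a b p q" "a \<in> Ob" "b \<in> Ob" "R a b p q" by (auto simp: pair_cat_arr)
  show "dm ?P f \<in> obj ?P" "cd ?P f \<in> obj ?P" using f by simp_all
  show "cmp ?P f (idn ?P (dm ?P f)) = f" "cmp ?P (idn ?P (cd ?P f)) f = f"
    using f id[of a] id[of b] hom[of a b p q] Ob[of a] Ob[of b] C D by simp_all
  fix g assume "g \<in> arr ?P" and fg: "cd ?P f = dm ?P g"
  then obtain c p' q' where g: "g = mor b c p' q'" "c \<in> Ob" "R b c p' q'" using f by (auto simp: pair_cat_arr)
  show "cmp ?P g f \<in> hom ?P (dm ?P f) (cd ?P g)" using f g cmp[of a b p q c p' q'] by simp
  fix h assume "h \<in> arr ?P" and gh: "cd ?P g = dm ?P h"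
  then obtain d p'' q'' where h: "h = mor c d p'' q''" "d \<in> Ob" "R c d p'' q''" using f g by (auto simp: pair_cat_arr)
  show "cmp ?P h (cmp ?P g f) = cmp ?P (cmp ?P h g) f"
    using f g h cmp[of a b p q c p' q'] cmp[of b c p' q' d p'' q''] hom[of a b p q] hom[of b c p' q'] hom[of c d p'' q''] C D
    by simp
next
  fix x assume x: "x \<in> obj ?P"
  then show "idn ?P x \<in> hom ?P x x" using id[of x] by simp
qed

text \<open>The endpoints of \<open>v f\<close> are prescribed by \<open>u\<close>, so functoriality
  is left to be checked on the two components only.\<close>

lemma functor_to_pair_cat:
  assumes X: "category X" and P: "category (pair_cat Ob R C D i j)" (is "category ?P")
    and o: "\<And>x. x \<in> obj X \<Longrightarrow> u x \<in> Ob"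
    and v: "\<And>f. f \<in> arr X \<Longrightarrow> v f = mor (u (dm X f)) (u (cd X f)) (p f) (q f)"
    and R: "\<And>f. f \<in> arr X \<Longrightarrow> R (u (dm X f)) (u (cd X f)) (p f) (q f)"
    and id: "\<And>x. x \<in> obj X \<Longrightarrow> p (idn X x) = i (u x) \<and> q (idn X x) = j (u x)"
    and cmp: "\<And>f g. f \<in> arr X \<Longrightarrow> g \<in> arr X \<Longrightarrow> cd X f = dm X g \<Longrightarrow>
      p (cmp X g f) = cmp C (p g) (p f) \<and> q (cmp X g f) = cmp D (q g) (q f)"
  shows "is_functor (mk_functor X ?P u v)"
proof (rule is_functor_mk[OF X P])
  fix f g assume f: "f \<in> arr X" and g: "g \<in> arr X" and e: "cd X f = dm X g"
  show "v (cmp X g f) = cmp ?P (v g) (v f)" using X f g e R[OF f] R[OF g] cmp[OF f g e] by (simp add: v o)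
qed (use X in \<open>simp_all add: v o R id\<close>)

lemma functor_commute:
  assumes "cmp C s f = cmp C g r" "is_functor T" "src T = C" "tgt T = D" "f \<in> arr C" "g \<in> arr C" "r \<in> arr C" "s \<in> arr C"
    "cd C f = dm C s" "cd C r = dm C g"
  shows "cmp D (fa T s) (fa T f) = cmp D (fa T g) (fa T r)"
  using assms functor_cmp[of T C f s] functor_cmp[of T C r g] by simp

text \<open>Phrased with \<open>True\<close> so that the whole image square stands on the left and
  is reduced to the square in the domain of \<open>T\<close>.\<close>

lemma functor_commute_simp [simp]:
  assumes "is_functor T" "tgt T = D" "f \<in> arr (src T)" "g \<in> arr (src T)" "r \<in> arr (src T)" "s \<in> arr (src T)"
    "dm (src T) s = cd (src T) f" "cd (src T) r = dm (src T) g" "cmp (src T) s f = cmp (src T) g r"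
  shows "(cmp D (fa T s) (fa T f) = cmp D (fa T g) (fa T r)) = True"
  using functor_commute[OF assms(9,1) refl assms(2)] assms by simp


lemma sq_obj [simp]: "obj (sq_cat E) = arr E"
  by (simp add: sq_cat_def)

lemma sq_mor [simp]:
  "mor f g r s \<in> arr (sq_cat E) \<longleftrightarrow> f \<in> arr E \<and> g \<in> arr E \<and> r \<in> arr E \<and> dm E r = dm E f \<and> cd E r = dm E g \<and>
     s \<in> arr E \<and> dm E s = cd E f \<and> cd E s = cd E g \<and> cmp E s f = cmp E g r"
  by (simp add: sq_cat_def)

lemma sq_arrE:
  assumes "z \<in> arr (sq_cat E)"
  obtains f g r s where "z = mor f g r s" "f \<in> arr E" "g \<in> arr E" "r \<in> arr E" "dm E r = dm E f" "cd E r = dm E g"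
     "s \<in> arr E" "dm E s = cd E f" "cd E s = cd E g" "cmp E s f = cmp E g r"
  using assms by (auto simp: sq_cat_def pair_cat_arr)

lemma sq_dm_cd [simp]:
  assumes "mor f g r s \<in> arr (sq_cat E)"
  shows "dm (sq_cat E) (mor f g r s) = f" "cd (sq_cat E) (mor f g r s) = g"
  using assms unfolding sq_cat_def by (rule pair_cat_dm_cd)+

lemma sq_idn [simp]: "f \<in> arr E \<Longrightarrow> idn (sq_cat E) f = mor f f (idn E (dm E f)) (idn E (cd E f))"
  by (simp add: sq_cat_def)

lemma sq_cmp [simp]:
  assumes "mor f g r s \<in> arr (sq_cat E)" "mor g h r' s' \<in> arr (sq_cat E)"
  shows "cmp (sq_cat E) (mor g h r' s') (mor f g r s) = mor f h (cmp E r' r) (cmp E s' s)"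
  using assms unfolding sq_cat_def by (rule pair_cat_cmp)

lemma category_sq [simp]:
  assumes "category E" shows "category (sq_cat E)"
  unfolding sq_cat_def
proof (rule category_pair_cat[OF assms assms, where s = "dm E" and t = "cd E"], goal_cases)
  case (4 a b c p q p' q')
  note [simp] = assms
  have "cmp E q' (cmp E b p) = cmp E c (cmp E p' p)"
    by (rule category_reassoc) (use 4 in simp_all)
  then show ?case using 4 by simp
qed (use assms in simp_all)

lemma sq_functor_sel [simp]:
  "src (sq_functor T) = sq_cat (src T)" "tgt (sq_functor T) = sq_cat (tgt T)"
  "f \<in> arr (src T) \<Longrightarrow> fo (sq_functor T) f = fa T f"
  "mor f g r s \<in> arr (sq_cat (src T)) \<Longrightarrow> fa (sq_functor T) (mor f g r s) = mor (fa T f) (fa T g) (fa T r) (fa T s)"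
  unfolding sq_functor_def by simp_all

lemma is_functor_sq [simp]:
  assumes T: "is_functor T" shows "is_functor (sq_functor T)"
  unfolding sq_functor_def unfolding sq_cat_def[of "tgt T"]
proof (rule functor_to_pair_cat[where p = "\<lambda>z. fa T (mor_fst z)" and q = "\<lambda>z. fa T (mor_snd z)"], goal_cases)
  case (2)
  then show ?case using category_sq[of "tgt T"] T by (simp add: sq_cat_def)
next
  case (5 z)
  then show ?case
  proof (rule sq_arrE)
    fix f g r s assume z: "z = mor f g r s" and zz: "f \<in> arr (src T)" "g \<in> arr (src T)" "r \<in> arr (src T)"
      "dm (src T) r = dm (src T) f" "cd (src T) r = dm (src T) g"
     "s \<in> arr (src T)" "dm (src T) s = cd (src T) f" "cd (src T) s = cd (src T) g" "cmp (src T) s f = cmp (src T) g r"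
    have "cmp (tgt T) (fa T s) (fa T f) = cmp (tgt T) (fa T g) (fa T r)"
      using arg_cong[OF zz(9), of "fa T"] zz T by simp
    then show ?thesis using z zz T by simp
  qed
qed (use T in \<open>auto elim!: sq_arrE\<close>)

lemma sq_functor_comp:
  assumes "is_functor F" "is_functor G" "tgt F = src G"
  shows "sq_functor (comp1 CAT G F) = comp1 CAT (sq_functor G) (sq_functor F)"
  by (rule functor_eqI) (use assms in \<open>auto elim!: sq_arrE\<close>)

lemma sq_functor_id:
  "category E \<Longrightarrow> sq_functor (id1 CAT E) = id1 CAT (sq_cat E)"
  by (rule functor_eqI) (auto elim!: sq_arrE)

lemma sq_trans_sel [simp]:
  "src (sq_trans \<alpha>) = sq_functor (src \<alpha>)" "tgt (sq_trans \<alpha>) = sq_functor (tgt \<alpha>)"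
  "f \<in> arr (src (src \<alpha>)) \<Longrightarrow> dat (sq_trans \<alpha>) f = mor (fa (src \<alpha>) f) (fa (tgt \<alpha>) f)
     (dat \<alpha> (dm (src (src \<alpha>)) f)) (dat \<alpha> (cd (src (src \<alpha>)) f))"
  unfolding sq_trans_def by (simp_all add: Let_def)

lemma is_trans_sq [simp]:
  assumes \<alpha>: "is_trans \<alpha>" shows "is_trans (sq_trans \<alpha>)"
  unfolding sq_trans_def Let_def
proof (rule is_trans_mk[OF _ _ refl refl])
  note [simp] = \<alpha>
  show "is_functor (sq_functor (src \<alpha>))" "is_functor (sq_functor (tgt \<alpha>))"
    "src (sq_functor (tgt \<alpha>)) = src (sq_functor (src \<alpha>))"
    "tgt (sq_functor (tgt \<alpha>)) = tgt (sq_functor (src \<alpha>))"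
    by simp_all
  let ?C = "src (src \<alpha>)"
  fix f assume "f \<in> arr (src (sq_functor (src \<alpha>)))"
  then show "cmp (tgt (sq_functor (src \<alpha>)))
          (mor (fa (src \<alpha>) (cd (src (sq_functor (src \<alpha>))) f))
            (fa (tgt \<alpha>) (cd (src (sq_functor (src \<alpha>))) f))
            (dat \<alpha> (dm ?C (cd (src (sq_functor (src \<alpha>))) f)))
            (dat \<alpha> (cd ?C (cd (src (sq_functor (src \<alpha>))) f))))
          (fa (sq_functor (src \<alpha>)) f) =
         cmp (tgt (sq_functor (src \<alpha>))) (fa (sq_functor (tgt \<alpha>)) f)
          (mor (fa (src \<alpha>) (dm (src (sq_functor (src \<alpha>))) f))
            (fa (tgt \<alpha>) (dm (src (sq_functor (src \<alpha>))) f))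
            (dat \<alpha> (dm ?C (dm (src (sq_functor (src \<alpha>))) f)))
            (dat \<alpha> (cd ?C (dm (src (sq_functor (src \<alpha>))) f))))"
    using trans_nat[OF \<alpha> refl refl] by (auto elim!: sq_arrE) metis+
qed (use \<alpha> trans_nat[OF \<alpha> refl refl] in auto)

lemma sq_two_functor: "two_functor CAT CAT (TwoFun sq_cat sq_functor sq_trans)"
proof (rule two_functorI, goal_cases)
  case (8 F)
  then show ?case by (auto intro!: trans_eqI)
next
  case (9 \<alpha> \<beta>)
  have "src (src \<beta>) = src (src \<alpha>)" "tgt (src \<beta>) = tgt (src \<alpha>)" using 9 by (metis CAT_cells(3) transD(3,4))+
  with 9 trans_nat[of \<alpha>, OF _ refl refl] trans_nat[of \<beta>, OF _ refl refl] show ?case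
    by (auto intro!: trans_eqI)
next
  case (10 \<alpha> \<beta>)
  then show ?case by (auto intro!: trans_eqI simp: sq_functor_comp trans_nat')
qed (auto simp: strict_CAT sq_functor_comp sq_functor_id)

lemma sq_unit_sel [simp]:
  "src (sq_unit E) = E" "tgt (sq_unit E) = sq_cat E"
  "x \<in> obj E \<Longrightarrow> fo (sq_unit E) x = idn E x"
  "f \<in> arr E \<Longrightarrow> fa (sq_unit E) f = mor (idn E (dm E f)) (idn E (cd E f)) f f"
  unfolding sq_unit_def by simp_all

lemma is_functor_sq_unit [simp]:
  assumes "category E" shows "is_functor (sq_unit E)"
  unfolding sq_unit_def by (rule is_functor_mk) (use assms in auto)

lemma sq_diag_mor [simp]: "sq_diag E (mor f g r s) = cmp E s f"
  by (simp add: sq_diag_def)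

lemma sq_mult_sel [simp]:
  "src (sq_mult E) = sq_cat (sq_cat E)" "tgt (sq_mult E) = sq_cat E"
  "z \<in> arr (sq_cat E) \<Longrightarrow> fo (sq_mult E) z = sq_diag E z"
  "mor z w p q \<in> arr (sq_cat (sq_cat E)) \<Longrightarrow>
     fa (sq_mult E) (mor z w p q) = mor (sq_diag E z) (sq_diag E w) (mor_fst p) (mor_snd q)"
  unfolding sq_mult_def by simp_all

text \<open>An arrow of \<open>sq_cat (sq_cat E)\<close> is a commutative cube. Commutation of a
  square of squares splits into the two final equations, one for the initial and one for the
  terminal ends of the four squares.\<close>

lemma sq_sq_arrE:
  assumes "w \<in> arr (sq_cat (sq_cat E))"
  obtains z z' p q where "w = mor z z' p q" "z \<in> arr (sq_cat E)" "z' \<in> arr (sq_cat E)"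
    "p \<in> arr (sq_cat E)" "q \<in> arr (sq_cat E)" "mor_src p = mor_src z" "mor_tgt p = mor_src z'"
    "mor_src q = mor_tgt z" "mor_tgt q = mor_tgt z'"
    "cmp E (mor_fst q) (mor_fst z) = cmp E (mor_fst z') (mor_fst p)"
    "cmp E (mor_snd q) (mor_snd z) = cmp E (mor_snd z') (mor_snd p)"
  using assms
proof (rule sq_arrE)
  fix z z' p q assume w: "w = mor z z' p q" and z: "z \<in> arr (sq_cat E)" "z' \<in> arr (sq_cat E)"
    "p \<in> arr (sq_cat E)" "q \<in> arr (sq_cat E)"
    and e: "dm (sq_cat E) p = dm (sq_cat E) z" "cd (sq_cat E) p = dm (sq_cat E) z'"
      "dm (sq_cat E) q = cd (sq_cat E) z" "cd (sq_cat E) q = cd (sq_cat E) z'"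
      "cmp (sq_cat E) q z = cmp (sq_cat E) z' p"
  from z e show thesis
    by (elim sq_arrE) (rule that[OF w z]; simp)
qed

lemma is_functor_sq_mult [simp]:
  assumes E: "category E" shows "is_functor (sq_mult E)"
  \<comment> \<open>Only the codomain is opened as a \<open>pair_cat\<close>; the double arrow
    category in the domain stays folded.\<close>
  unfolding sq_mult_def unfolding sq_cat_def[of E, THEN arg_cong, of "\<lambda>x. mk_functor (sq_cat (sq_cat E)) x a b" for a b]
proof (rule functor_to_pair_cat[where p = "\<lambda>z. mor_fst (mor_fst z)" and q = "\<lambda>z. mor_snd (mor_snd z)"], goal_cases)
  case 2
  then show ?case using category_sq[OF E] by (simp add: sq_cat_def)
next
  case (5 w)
  then obtain z z' p q where w: "w = mor z z' p q" "z \<in> arr (sq_cat E)" "z' \<in> arr (sq_cat E)"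
    "p \<in> arr (sq_cat E)" "q \<in> arr (sq_cat E)" "mor_src p = mor_src z" "mor_tgt p = mor_src z'"
    "mor_src q = mor_tgt z" "mor_tgt q = mor_tgt z'"
    "cmp E (mor_fst q) (mor_fst z) = cmp E (mor_fst z') (mor_fst p)"
    "cmp E (mor_snd q) (mor_snd z) = cmp E (mor_snd z') (mor_snd p)" by (rule sq_sq_arrE)
  \<comment> \<open>Two faces of the cube are pasted: the one between the terminal ends, which is
    the last equation above, and then the square \<open>p\<close> itself.\<close>
  have "cmp E (mor_snd q) (cmp E (mor_snd z) (mor_src z)) = cmp E (mor_snd z') (cmp E (mor_snd p) (mor_src z))"
    by (rule category_reassoc[OF w(11) E]) (use w in \<open>auto elim!: sq_arrE\<close>)
  also have "cmp E (mor_snd p) (mor_src z) = cmp E (mor_src z') (mor_fst p)"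
    using w(4,6,7) by (auto elim!: sq_arrE)
  also have "cmp E (mor_snd z') \<dots> = cmp E (cmp E (mor_snd z') (mor_src z')) (mor_fst p)"
    by (rule category_assoc[symmetric, OF E]) (use w in \<open>auto elim!: sq_arrE\<close>)
  finally have eq: "cmp E (mor_snd q) (sq_diag E z) = cmp E (sq_diag E z') (mor_fst p)"
    by (simp add: sq_diag_def)
  from w(2-9) have "mor_fst p \<in> arr E" "dm E (mor_fst p) = dm E (sq_diag E z)" "cd E (mor_fst p) = dm E (sq_diag E z')"
    "mor_snd q \<in> arr E" "dm E (mor_snd q) = cd E (sq_diag E z)" "cd E (mor_snd q) = cd E (sq_diag E z')"
    using E by (auto simp: sq_diag_def elim!: sq_arrE)
  then show ?case using w(1) 5 E eq by simp
next
  case (7 w w')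
  from 7(1) obtain z z' p q where "w = mor z z' p q" "p \<in> arr (sq_cat E)" "q \<in> arr (sq_cat E)" by (rule sq_sq_arrE)
  moreover from 7(2) obtain z1 z1' p' q' where "w' = mor z1 z1' p' q'" "p' \<in> arr (sq_cat E)" "q' \<in> arr (sq_cat E)" by (rule sq_sq_arrE)
  ultimately show ?case using 7 E by (auto elim!: sq_arrE)
qed (use E in \<open>auto simp: sq_diag_def elim!: sq_arrE\<close>)

text \<open>Formulated with selectors instead of an explicit \<open>mor\<close>, so that arrows of
  iterated arrow categories need to be opened one level at a time only.\<close>

lemma sq_mult_fa:
  "w \<in> arr (sq_cat (sq_cat E)) \<Longrightarrow> fa (sq_mult E) w =
    mor (sq_diag E (mor_src w)) (sq_diag E (mor_tgt w)) (mor_fst (mor_fst w)) (mor_snd (mor_snd w))"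
  unfolding sq_mult_def by simp

lemma sq_functor_fa:
  "z \<in> arr (sq_cat (src T)) \<Longrightarrow> fa (sq_functor T) z =
    mor (fa T (mor_src z)) (fa T (mor_tgt z)) (fa T (mor_fst z)) (fa T (mor_snd z))"
  unfolding sq_functor_def by simp

lemma sq_diag_arr:
  assumes "category E" "z \<in> arr (sq_cat E)" shows "sq_diag E z \<in> arr E"
  using functor_fo[OF is_functor_sq_mult[OF assms(1)], of "sq_cat E" z] assms by simp

lemma sq_diag_functor:
  "is_functor T \<Longrightarrow> z \<in> arr (sq_cat (src T)) \<Longrightarrow> sq_diag (tgt T) (fa (sq_functor T) z) = fa T (sq_diag (src T) z)"
  by (auto elim!: sq_arrE)

text \<open>This is associativity of the multiplication on objects: an arrow of
  \<open>sq_cat (sq_cat E)\<close> is a cube, and both sides are its main diagonal.\<close>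

lemma sq_diag_mult:
  assumes E: "category E" and z: "z \<in> arr (sq_cat (sq_cat E))"
  shows "sq_diag E (fa (sq_mult E) z) = sq_diag E (sq_diag (sq_cat E) z)"
proof -
  from z obtain a b p q where z': "z = mor a b p q" "a \<in> arr (sq_cat E)" "q \<in> arr (sq_cat E)" "mor_src q = mor_tgt a"
    by (rule sq_sq_arrE)
  then obtain f g r s h r' s' where a: "a = mor f g r s" "q = mor g h r' s'" by (auto elim!: sq_arrE)
  have "sq_diag E (fa (sq_mult E) z) = cmp E s' (cmp E s f)" using sq_mult_fa[OF z] z' a by (simp add: sq_diag_def)
  also have "\<dots> = cmp E (cmp E s' s) f" by (rule category_assoc[symmetric, OF E]) (use z'(2,3) a in simp_all)
  also have "\<dots> = sq_diag E (sq_diag (sq_cat E) z)" using z'(2,3) a by (simp add: z'(1))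
  finally show ?thesis .
qed

lemma SqMonad_sel [simp]:
  "map0 (mfun SqMonad) = sq_cat" "map1 (mfun SqMonad) = sq_functor" "map2 (mfun SqMonad) = sq_trans"
  "munit SqMonad = sq_unit" "mmult SqMonad = sq_mult"
  by (simp_all add: SqMonad_def)

text \<open>Functors preserve diagonals, by \<open>sq_diag_functor\<close>; on arrows this is needed
  at both ends, while the outer components are simply mapped.\<close>

lemma sq_mult_nat:
  assumes F: "is_functor F"
  shows "comp1 CAT (sq_functor F) (sq_mult (src F)) = comp1 CAT (sq_mult (tgt F)) (sq_functor (sq_functor F))"
proof (rule functor_eqI, goal_cases)
  case (6 w)
  then have w: "w \<in> arr (sq_cat (sq_cat (src F)))" by simp
  note f = F
  have 1: "fa (sq_mult (src F)) w \<in> arr (sq_cat (src F))"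
    "fa (sq_functor (sq_functor F)) w \<in> arr (sq_cat (sq_cat (tgt F)))" using f w by simp_all
  obtain z z' p q where w': "w = mor z z' p q" "z \<in> arr (sq_cat (src F))" "z' \<in> arr (sq_cat (src F))"
    "p \<in> arr (sq_cat (src F))" "q \<in> arr (sq_cat (src F))" using w by (rule sq_arrE)
  have u: "fa (sq_mult (src F)) w = mor (sq_diag (src F) z) (sq_diag (src F) z') (mor_fst p) (mor_snd q)"
    using sq_mult_fa[OF w] unfolding w'(1) mor_sel .
  have v: "fa (sq_functor (sq_functor F)) w = mor (fa (sq_functor F) z) (fa (sq_functor F) z')
      (fa (sq_functor F) p) (fa (sq_functor F) q)"
    using sq_functor_fa[of w "sq_functor F"] w by (simp only: w'(1) mor_sel sq_functor_sel)
  have "fa (sq_functor F) (fa (sq_mult (src F)) w) = fa (sq_mult (tgt F)) (fa (sq_functor (sq_functor F)) w)"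
    unfolding sq_functor_fa[OF 1(1)] sq_mult_fa[OF 1(2)] unfolding u v mor_sel sq_diag_functor[OF f w'(2)]
      sq_diag_functor[OF f w'(3)] sq_functor_fa[OF w'(4)] sq_functor_fa[OF w'(5)] ..
  then show ?case using w by simp
next
  case (5 z)
  then show ?case using F sq_diag_functor[of F z] by (auto simp: sq_diag_arr simp del: sq_mor)
qed (use F in \<open>auto elim!: sq_arrE\<close>)

lemma two_natural_sq_unit: "two_natural CAT CAT twofun_id (mfun SqMonad) sq_unit"
  unfolding two_natural_def
proof (intro conjI ballI)
  show "two_functor CAT CAT twofun_id" by (rule two_functor_id) (rule strict_CAT)
  show "two_functor CAT CAT (mfun SqMonad)" using sq_two_functor by (simp add: SqMonad_def)
next
  fix F :: "'a ent fctr" assume "F \<in> cells1 CAT"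
  then show "comp1 CAT (map1 (mfun SqMonad) F) (sq_unit (src F)) = comp1 CAT (sq_unit (tgt F)) (map1 twofun_id F)"
    by (auto intro!: functor_eqI simp: twofun_id_def)
next
  fix \<alpha> :: "'a ent ntr" assume "\<alpha> \<in> cells2 CAT"
  then show "whisk_r CAT (map2 (mfun SqMonad) \<alpha>) (sq_unit (src (src \<alpha>))) =
    whisk_l CAT (sq_unit (tgt (src \<alpha>))) (map2 twofun_id \<alpha>)"
    by (auto intro!: trans_eqI functor_eqI simp: twofun_id_def)
qed (auto simp: twofun_id_def)

lemma two_natural_sq_mult:
  "two_natural CAT CAT (twofun_comp (mfun SqMonad) (mfun SqMonad)) (mfun SqMonad) sq_mult"
  unfolding two_natural_def
proof (intro conjI ballI)
  show S: "two_functor CAT CAT (mfun SqMonad)" using sq_two_functor by (simp add: SqMonad_def)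
  then show "two_functor CAT CAT (twofun_comp (mfun SqMonad) (mfun SqMonad))" using two_functor_comp by blast
next
  fix F :: "'a ent fctr" assume "F \<in> cells1 CAT"
  then show "comp1 CAT (map1 (mfun SqMonad) F) (sq_mult (src F)) =
     comp1 CAT (sq_mult (tgt F)) (map1 (twofun_comp (mfun SqMonad) (mfun SqMonad)) F)"
    using sq_mult_nat by (simp add: twofun_comp_def)
next
  fix \<alpha> :: "'a ent ntr" assume "\<alpha> \<in> cells2 CAT"
  then show "whisk_r CAT (map2 (mfun SqMonad) \<alpha>) (sq_mult (src (src \<alpha>))) =
    whisk_l CAT (sq_mult (tgt (src \<alpha>))) (map2 (twofun_comp (mfun SqMonad) (mfun SqMonad)) \<alpha>)"
    using sq_mult_nat[of "src \<alpha>"] sq_mult_nat[of "tgt \<alpha>"]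
    by (auto intro!: trans_eqI simp: twofun_comp_def trans_nat' elim!: sq_arrE)
qed (auto simp: twofun_comp_def)

lemma two_monad_sq: "two_monad CAT SqMonad"
  unfolding two_monad_def Let_def
proof (intro conjI ballI)
  show "two_functor CAT CAT (mfun SqMonad)" using sq_two_functor by (simp add: SqMonad_def)
  show "two_natural CAT CAT twofun_id (mfun SqMonad) (munit SqMonad)"
    "two_natural CAT CAT (twofun_comp (mfun SqMonad) (mfun SqMonad)) (mfun SqMonad) (mmult SqMonad)"
    using two_natural_sq_unit two_natural_sq_mult by simp_all
next
  fix E :: "'a ent cat" assume E: "E \<in> cells0 CAT"
  show "comp1 CAT (mmult SqMonad E) (munit SqMonad (map0 (mfun SqMonad) E)) = id1 CAT (map0 (mfun SqMonad) E)"
    "comp1 CAT (mmult SqMonad E) (map1 (mfun SqMonad) (munit SqMonad E)) = id1 CAT (map0 (mfun SqMonad) E)"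
    using E by (auto intro!: functor_eqI elim!: sq_arrE)
  show "comp1 CAT (mmult SqMonad E) (mmult SqMonad (map0 (mfun SqMonad) E)) =
         comp1 CAT (mmult SqMonad E) (map1 (mfun SqMonad) (mmult SqMonad E))"
  proof (rule functor_eqI, goal_cases)
    case (5 z)
    then show ?case using E sq_diag_mult[of E z] by (simp add: sq_diag_arr del: sq_mor)
  next
    case (6 w)
    then have w: "w \<in> arr (sq_cat (sq_cat (sq_cat E)))" by simp
    then have "fa (sq_mult (sq_cat E)) w \<in> arr (sq_cat (sq_cat E))"
      "fa (sq_functor (sq_mult E)) w \<in> arr (sq_cat (sq_cat E))" using E by simp_all
    note 1 = this
    obtain z z' p q where w': "w = mor z z' p q" "z \<in> arr (sq_cat (sq_cat E))" "z' \<in> arr (sq_cat (sq_cat E))"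
      "p \<in> arr (sq_cat (sq_cat E))" "q \<in> arr (sq_cat (sq_cat E))" using w by (rule sq_arrE)
    have u: "fa (sq_mult (sq_cat E)) w = mor (sq_diag (sq_cat E) z) (sq_diag (sq_cat E) z') (mor_fst p) (mor_snd q)"
      using sq_mult_fa[OF w] unfolding w'(1) mor_sel .
    have v: "fa (sq_functor (sq_mult E)) w = mor (fa (sq_mult E) z) (fa (sq_mult E) z') (fa (sq_mult E) p) (fa (sq_mult E) q)"
      using sq_functor_fa[of w "sq_mult E"] w by (simp only: w'(1) mor_sel sq_mult_sel)
    have e: "category E" using E by simp
    have "fa (sq_mult E) (fa (sq_mult (sq_cat E)) w) = fa (sq_mult E) (fa (sq_functor (sq_mult E)) w)"
      unfolding sq_mult_fa[OF 1(1)] sq_mult_fa[OF 1(2)] unfolding u v mor_sel sq_diag_mult[OF e w'(2)]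
        sq_diag_mult[OF e w'(3)] sq_mult_fa[OF w'(4)] sq_mult_fa[OF w'(5)] ..
    then show ?case using w by simp
  qed (use E in auto)
qed

section \<open>The arrow 2-category of categories\<close>

lemma strict_CAT2: "strict_2_category CAT2"
  unfolding CAT2_def by (rule CAT.strict_arrow2)

interpretation CAT2: twocat CAT2
  by unfold_locales (rule strict_CAT2)

lemma CAT2_comp1_sel [simp]:
  "src (comp1 CAT2 t s) = src s" "tgt (comp1 CAT2 t s) = tgt t"
  "top1 (comp1 CAT2 t s) = comp1 CAT (top1 t) (top1 s)" "bot1 (comp1 CAT2 t s) = comp1 CAT (bot1 t) (bot1 s)"
  unfolding CAT2_def arrow2_sel by (simp_all only: cell.sel top1_Cell)

lemma CAT2_id1_sel [simp]:
  "src (id1 CAT2 P) = P" "tgt (id1 CAT2 P) = P"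
  "top1 (id1 CAT2 P) = id1 CAT (src P)" "bot1 (id1 CAT2 P) = id1 CAT (tgt P)"
  unfolding CAT2_def arrow2_sel by (simp_all only: cell.sel top1_Cell)

lemma CAT2_id2_sel [simp]:
  "src (id2 CAT2 s) = s" "tgt (id2 CAT2 s) = s"
  "top1 (id2 CAT2 s) = id2 CAT (top1 s)" "bot1 (id2 CAT2 s) = id2 CAT (bot1 s)"
  unfolding CAT2_def arrow2_sel by (simp_all only: cell.sel top1_Cell)

lemma CAT2_vcomp_sel [simp]:
  "src (vcomp CAT2 \<tau> \<sigma>) = src \<sigma>" "tgt (vcomp CAT2 \<tau> \<sigma>) = tgt \<tau>"
  "top1 (vcomp CAT2 \<tau> \<sigma>) = vcomp CAT (top1 \<tau>) (top1 \<sigma>)" "bot1 (vcomp CAT2 \<tau> \<sigma>) = vcomp CAT (bot1 \<tau>) (bot1 \<sigma>)"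
  unfolding CAT2_def arrow2_sel by (simp_all only: cell.sel top1_Cell)

lemma CAT2_hcomp_sel [simp]:
  "src (hcomp CAT2 \<tau> \<sigma>) = comp1 CAT2 (src \<tau>) (src \<sigma>)" "tgt (hcomp CAT2 \<tau> \<sigma>) = comp1 CAT2 (tgt \<tau>) (tgt \<sigma>)"
  "top1 (hcomp CAT2 \<tau> \<sigma>) = hcomp CAT (top1 \<tau>) (top1 \<sigma>)" "bot1 (hcomp CAT2 \<tau> \<sigma>) = hcomp CAT (bot1 \<tau>) (bot1 \<sigma>)"
  unfolding CAT2_def arrow2_sel by (simp_all only: cell.sel top1_Cell)

lemma CAT2_whisk_sel [simp]:
  "src (whisk_l CAT2 t \<sigma>) = comp1 CAT2 t (src \<sigma>)" "tgt (whisk_l CAT2 t \<sigma>) = comp1 CAT2 t (tgt \<sigma>)"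
  "src (whisk_r CAT2 \<sigma> t) = comp1 CAT2 (src \<sigma>) t" "tgt (whisk_r CAT2 \<sigma> t) = comp1 CAT2 (tgt \<sigma>) t"
  "top1 (whisk_l CAT2 t \<sigma>) = whisk_l CAT (top1 t) (top1 \<sigma>)" "bot1 (whisk_l CAT2 t \<sigma>) = whisk_l CAT (bot1 t) (bot1 \<sigma>)"
  "top1 (whisk_r CAT2 \<sigma> t) = whisk_r CAT (top1 \<sigma>) (top1 t)" "bot1 (whisk_r CAT2 \<sigma> t) = whisk_r CAT (bot1 \<sigma>) (bot1 t)"
  unfolding whisk_l_def whisk_r_def CAT2_hcomp_sel CAT2_id2_sel by (rule refl)+

lemma CAT2_cells0 [simp]: "P \<in> cells0 CAT2 \<longleftrightarrow> is_functor P"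
  by (simp add: CAT2_def)

lemma CAT2_cells1:
  "s \<in> cells1 CAT2 \<longleftrightarrow>
     is_functor (src s) \<and> is_functor (tgt s) \<and> is_functor (top1 s) \<and> is_functor (bot1 s) \<and>
     src (top1 s) = src (src s) \<and> tgt (top1 s) = src (tgt s) \<and>
     src (bot1 s) = tgt (src s) \<and> tgt (bot1 s) = tgt (tgt s) \<and>
     comp1 CAT (tgt s) (top1 s) = comp1 CAT (bot1 s) (src s)"
  by (simp add: CAT2_def)

lemma CAT2_cells2:
  "\<sigma> \<in> cells2 CAT2 \<longleftrightarrow>
     src \<sigma> \<in> cells1 CAT2 \<and> tgt \<sigma> \<in> cells1 CAT2 \<and>
     src (src \<sigma>) = src (tgt \<sigma>) \<and> tgt (src \<sigma>) = tgt (tgt \<sigma>) \<and>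
     is_trans (top1 \<sigma>) \<and> is_trans (bot1 \<sigma>) \<and>
     src (top1 \<sigma>) = top1 (src \<sigma>) \<and> tgt (top1 \<sigma>) = top1 (tgt \<sigma>) \<and>
     src (bot1 \<sigma>) = bot1 (src \<sigma>) \<and> tgt (bot1 \<sigma>) = bot1 (tgt \<sigma>) \<and>
     whisk_l CAT (tgt (src \<sigma>)) (top1 \<sigma>) = whisk_r CAT (bot1 \<sigma>) (src (src \<sigma>))"
  unfolding CAT2_def arrow2_cells2 by simp

lemma squareD [simp]:
  assumes "s \<in> cells1 CAT2"
  shows "is_functor (src s)" "is_functor (tgt s)" "is_functor (top1 s)" "is_functor (bot1 s)"
    "src (top1 s) = src (src s)" "tgt (top1 s) = src (tgt s)" "src (bot1 s) = tgt (src s)" "tgt (bot1 s) = tgt (tgt s)"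
  using assms unfolding CAT2_cells1 by simp_all

lemma square_comp:
  "s \<in> cells1 CAT2 \<Longrightarrow> comp1 CAT (tgt s) (top1 s) = comp1 CAT (bot1 s) (src s)"
  unfolding CAT2_cells1 by simp

lemma square_commute [simp]:
  assumes "s \<in> cells1 CAT2"
  shows "x \<in> obj (src (src s)) \<Longrightarrow> fo (tgt s) (fo (top1 s) x) = fo (bot1 s) (fo (src s) x)"
    "f \<in> arr (src (src s)) \<Longrightarrow> fa (tgt s) (fa (top1 s) f) = fa (bot1 s) (fa (src s) f)"
proof -
  note e = square_comp[OF assms]
  show "x \<in> obj (src (src s)) \<Longrightarrow> fo (tgt s) (fo (top1 s) x) = fo (bot1 s) (fo (src s) x)"
    using arg_cong[OF e, of "\<lambda>F. fo F x"] assms by simp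
  show "f \<in> arr (src (src s)) \<Longrightarrow> fa (tgt s) (fa (top1 s) f) = fa (bot1 s) (fa (src s) f)"
    using arg_cong[OF e, of "\<lambda>F. fa F f"] assms by simp
qed

lemma squareI:
  assumes "is_functor P" "is_functor Q" "is_functor T" "is_functor S"
    "src T = src P" "tgt T = src Q" "src S = tgt P" "tgt S = tgt Q"
    "\<And>x. x \<in> obj (src P) \<Longrightarrow> fo Q (fo T x) = fo S (fo P x)"
    "\<And>f. f \<in> arr (src P) \<Longrightarrow> fa Q (fa T f) = fa S (fa P f)"
  shows "Cell P Q (T, S) \<in> cells1 CAT2"
  unfolding CAT2_cells1 using assms by (auto intro!: functor_eqI)

lemma square2D [simp]:
  assumes "\<sigma> \<in> cells2 CAT2"
  shows "is_trans (top1 \<sigma>)" "is_trans (bot1 \<sigma>)"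
    "src (top1 \<sigma>) = top1 (src \<sigma>)" "tgt (top1 \<sigma>) = top1 (tgt \<sigma>)"
    "src (bot1 \<sigma>) = bot1 (src \<sigma>)" "tgt (bot1 \<sigma>) = bot1 (tgt \<sigma>)"
  using assms unfolding CAT2_cells2 by simp_all

lemma square2_comp:
  "\<sigma> \<in> cells2 CAT2 \<Longrightarrow> whisk_l CAT (tgt (src \<sigma>)) (top1 \<sigma>) = whisk_r CAT (bot1 \<sigma>) (src (src \<sigma>))"
  unfolding CAT2_cells2 by (elim conjE)

lemma square2_commute:
  assumes "\<sigma> \<in> cells2 CAT2" "x \<in> obj (src (src (src \<sigma>)))"
  shows "fa (tgt (src \<sigma>)) (dat (top1 \<sigma>) x) = dat (bot1 \<sigma>) (fo (src (src \<sigma>)) x)"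
proof -
  note e = square2_comp[OF assms(1)]
  show ?thesis using arg_cong[OF e, of "\<lambda>\<alpha>. dat \<alpha> x"] assms by simp
qed

text \<open>The equation between whiskered transformations is tested on components; their boundary
  functors agree because \<open>s\<close> and \<open>t\<close> commute.\<close>

lemma square2I:
  assumes "s \<in> cells1 CAT2" "t \<in> cells1 CAT2" "src t = src s" "tgt t = tgt s" "is_trans \<beta>" "is_trans \<alpha>"
    "src \<beta> = top1 s" "tgt \<beta> = top1 t" "src \<alpha> = bot1 s" "tgt \<alpha> = bot1 t"
    "\<And>x. x \<in> obj (src (src s)) \<Longrightarrow> fa (tgt s) (dat \<beta> x) = dat \<alpha> (fo (src s) x)"
  shows "Cell s t (\<beta>, \<alpha>) \<in> cells2 CAT2"
proof -
  have "whisk_l CAT (tgt s) \<beta> = whisk_r CAT \<alpha> (src s)"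
    using assms square_comp[OF assms(1)] square_comp[OF assms(2)] by (intro trans_eqI) simp_all
  then show ?thesis unfolding CAT2_cells2 using assms by simp
qed

lemma square2_eqI:
  "src \<sigma> = src \<tau> \<Longrightarrow> tgt \<sigma> = tgt \<tau> \<Longrightarrow> top1 \<sigma> = top1 \<tau> \<Longrightarrow> bot1 \<sigma> = bot1 \<tau> \<Longrightarrow> \<sigma> = \<tau>"
  by (rule square_eqI)

lemma two_functor_Dom: "two_functor CAT2 CAT Dom"
proof (rule two_functorI, goal_cases)
  case (4 s)
  then show ?case by (simp add: Dom_def)
next
  case (5 \<sigma>)
  then show ?case by (simp add: Dom_def)
qed (auto simp: strict_CAT strict_CAT2 Dom_def)

section \<open>The comma 2-monad\<close>

lemma comma_obj [simp]:
  "Pr x u \<in> obj (comma P) \<longleftrightarrow> x \<in> obj (src P) \<and> u \<in> arr (tgt P) \<and> dm (tgt P) u = fo P x"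
  by (simp add: comma_def Let_def)

lemma comma_objE:
  assumes "a \<in> obj (comma P)"
  obtains x u where "a = Pr x u" "x \<in> obj (src P)" "u \<in> arr (tgt P)" "dm (tgt P) u = fo P x"
  using assms by (auto simp: comma_def Let_def)

lemma comma_mor [simp]:
  "mor a b f v \<in> arr (comma P) \<longleftrightarrow> a \<in> obj (comma P) \<and> b \<in> obj (comma P) \<and>
     f \<in> arr (src P) \<and> dm (src P) f = lft a \<and> cd (src P) f = lft b \<and>
     v \<in> arr (tgt P) \<and> dm (tgt P) v = cd (tgt P) (rgt a) \<and> cd (tgt P) v = cd (tgt P) (rgt b) \<and>
     cmp (tgt P) v (rgt a) = cmp (tgt P) (rgt b) (fa P f)"
  by (simp add: comma_def Let_def)

lemma comma_arrE:
  assumes "z \<in> arr (comma P)"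
  obtains x u y w f v where "z = mor (Pr x u) (Pr y w) f v" "x \<in> obj (src P)" "u \<in> arr (tgt P)" "dm (tgt P) u = fo P x"
    "y \<in> obj (src P)" "w \<in> arr (tgt P)" "dm (tgt P) w = fo P y" "f \<in> arr (src P)" "dm (src P) f = x" "cd (src P) f = y"
     "v \<in> arr (tgt P)" "dm (tgt P) v = cd (tgt P) u" "cd (tgt P) v = cd (tgt P) w"
     "cmp (tgt P) v u = cmp (tgt P) w (fa P f)"
  using assms by (auto simp: comma_def Let_def pair_cat_arr)

lemma comma_dm_cd [simp]:
  assumes "z \<in> arr (comma P)"
  shows "dm (comma P) z = mor_src z" "cd (comma P) z = mor_tgt z"
proof -
  obtain a b p q where z: "z = mor a b p q"
    using assms by (auto simp: comma_def Let_def pair_cat_arr)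
  show "dm (comma P) z = mor_src z" "cd (comma P) z = mor_tgt z"
    using assms unfolding z comma_def Let_def mor_sel by (rule pair_cat_dm_cd)+
qed

lemma comma_idn [simp]:
  "a \<in> obj (comma P) \<Longrightarrow> idn (comma P) a = mor a a (idn (src P) (lft a)) (idn (tgt P) (cd (tgt P) (rgt a)))"
  by (auto simp: comma_def Let_def)

lemma comma_cmp [simp]:
  assumes "z \<in> arr (comma P)" "z' \<in> arr (comma P)" "mor_tgt z = mor_src z'"
  shows "cmp (comma P) z' z = mor (mor_src z) (mor_tgt z')
    (cmp (src P) (mor_fst z') (mor_fst z)) (cmp (tgt P) (mor_snd z') (mor_snd z))"
  using assms by (auto simp: comma_def Let_def pair_cat_def)

lemma comma_arrD:
  assumes "z \<in> arr (comma P)"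
  shows "mor_src z \<in> obj (comma P)" "mor_tgt z \<in> obj (comma P)" "mor_fst z \<in> arr (src P)"
    "dm (src P) (mor_fst z) = lft (mor_src z)" "cd (src P) (mor_fst z) = lft (mor_tgt z)"
    "mor_snd z \<in> arr (tgt P)" "dm (tgt P) (mor_snd z) = cd (tgt P) (rgt (mor_src z))"
    "cd (tgt P) (mor_snd z) = cd (tgt P) (rgt (mor_tgt z))"
  using assms by (auto elim!: comma_arrE)

lemma comma_arr_eqI:
  assumes "z \<in> arr (comma P)" "z' \<in> arr (comma P)" "dm (comma P) z = dm (comma P) z'"
    "cd (comma P) z = cd (comma P) z'" "mor_fst z = mor_fst z'" "mor_snd z = mor_snd z'"
  shows "z = z'"
  using assms by (auto elim!: comma_arrE)

text \<open>Arrows of a comma category record their endpoints, and those of an image arrow are fixed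
  by the values on objects; hence only the two components have to be compared.\<close>

lemma functor_to_comma_eqI:
  assumes "is_functor F" "is_functor G" "src F = src G" "tgt F = comma P" "tgt G = comma P"
    "\<And>x. x \<in> obj (src F) \<Longrightarrow> fo F x = fo G x"
    "\<And>f. f \<in> arr (src F) \<Longrightarrow> mor_fst (fa F f) = mor_fst (fa G f) \<and> mor_snd (fa F f) = mor_snd (fa G f)"
  shows "F = G"
proof (rule functor_eqI)
  fix f assume f: "f \<in> arr (src F)"
  have "category (src F)" using assms(1) by simp
  then have d: "dm (src F) f \<in> obj (src F)" "cd (src F) f \<in> obj (src F)" using f by auto
  show "fa F f = fa G f"
  proof (rule comma_arr_eqI[of _ P])
    show "fa F f \<in> arr (comma P)" "fa G f \<in> arr (comma P)" using f assms(1-5) by auto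
    have "dm (comma P) (fa F f) = fo F (dm (src F) f)" "cd (comma P) (fa F f) = fo F (cd (src F) f)"
      "dm (comma P) (fa G f) = fo G (dm (src F) f)" "cd (comma P) (fa G f) = fo G (cd (src F) f)"
      using functor_fa[OF assms(1,4), of f] functor_fa[OF assms(2,5), of f] f assms(3)
      by (simp_all del: comma_dm_cd)
    then show "dm (comma P) (fa F f) = dm (comma P) (fa G f)" "cd (comma P) (fa F f) = cd (comma P) (fa G f)"
      using assms(6) d by simp_all
  qed (use assms(7) f in auto)
qed (use assms in auto)

lemma trans_to_comma_eqI:
  assumes "is_trans \<alpha>" "is_trans \<beta>" "src \<alpha> = src \<beta>" "tgt \<alpha> = tgt \<beta>" "tgt (src \<alpha>) = comma P"
    "\<And>x. x \<in> obj (src (src \<alpha>)) \<Longrightarrow> mor_fst (dat \<alpha> x) = mor_fst (dat \<beta> x) \<and> mor_snd (dat \<alpha> x) = mor_snd (dat \<beta> x)"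
  shows "\<alpha> = \<beta>"
proof (rule trans_eqI)
  fix x assume x: "x \<in> obj (src (src \<alpha>))"
  show "dat \<alpha> x = dat \<beta> x"
  proof (rule comma_arr_eqI[of _ P])
    show "dat \<alpha> x \<in> arr (comma P)" "dat \<beta> x \<in> arr (comma P)" using x assms(1-5) by auto
    show "dm (comma P) (dat \<alpha> x) = dm (comma P) (dat \<beta> x)" "cd (comma P) (dat \<alpha> x) = cd (comma P) (dat \<beta> x)"
      using trans_arr[OF assms(1,5) x] trans_arr[OF assms(2), of "comma P" x] x assms(3,4,5) by (simp_all del: comma_dm_cd)
  qed (use assms(6) x in auto)
qed (use assms in auto)

lemma category_comma [simp]:
  assumes P: "is_functor P" shows "category (comma P)"
  unfolding comma_def Let_def
proof (rule category_pair_cat[where s = lft and t = "\<lambda>a. cd (tgt P) (rgt a)"], goal_cases)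
  case (6 a b c p q p' q')
  then have 1: "a = Pr (lft a) (rgt a)" "b = Pr (lft b) (rgt b)" "c = Pr (lft c) (rgt c)"
    "rgt a \<in> arr (tgt P)" "rgt b \<in> arr (tgt P)" "rgt c \<in> arr (tgt P)" "dm (tgt P) (rgt b) = fo P (lft b)"
    "dm (tgt P) (rgt c) = fo P (lft c)" "dm (tgt P) (rgt a) = fo P (lft a)" by auto
  have "cmp (tgt P) q' (cmp (tgt P) (rgt b) (fa P p)) = cmp (tgt P) (rgt c) (cmp (tgt P) (fa P p') (fa P p))"
    by (rule category_reassoc) (use 6 1 P in simp_all)
  then show ?case using 6 P 1 by simp
qed (use P in auto)

lemma comma_cod_sel [simp]:
  "src (comma_cod P) = comma P" "tgt (comma_cod P) = tgt P"
  "a \<in> obj (comma P) \<Longrightarrow> fo (comma_cod P) a = cd (tgt P) (rgt a)"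
  "z \<in> arr (comma P) \<Longrightarrow> fa (comma_cod P) z = mor_snd z"
  by (simp_all add: comma_cod_def)

lemma comma_cod_arr [simp]:
  "z \<in> arr (comma (comma_cod P)) \<Longrightarrow> mor_fst z \<in> arr (comma P)"
  "z \<in> arr (comma (comma_cod P)) \<Longrightarrow> mor_snd z \<in> arr (tgt P)"
  using comma_arrD(3,6)[of z "comma_cod P"] by simp_all

lemma is_functor_comma_cod [simp]: "is_functor P \<Longrightarrow> is_functor (comma_cod P)"
  unfolding comma_cod_def by (rule is_functor_mk) (auto elim!: comma_objE simp: comma_arrD)

lemma functor_to_comma:
  assumes "category X" "is_functor P"
    and "\<And>x. x \<in> obj X \<Longrightarrow> u x \<in> obj (comma P)"
    and "\<And>f. f \<in> arr X \<Longrightarrow> v f = mor (u (dm X f)) (u (cd X f)) (p f) (q f)"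
    and "\<And>f. f \<in> arr X \<Longrightarrow> mor (u (dm X f)) (u (cd X f)) (p f) (q f) \<in> arr (comma P)"
    and "\<And>x. x \<in> obj X \<Longrightarrow> p (idn X x) = idn (src P) (lft (u x)) \<and> q (idn X x) = idn (tgt P) (cd (tgt P) (rgt (u x)))"
    and "\<And>f g. f \<in> arr X \<Longrightarrow> g \<in> arr X \<Longrightarrow> cd X f = dm X g \<Longrightarrow>
      p (cmp X g f) = cmp (src P) (p g) (p f) \<and> q (cmp X g f) = cmp (tgt P) (q g) (q f)"
  shows "is_functor (mk_functor X (comma P) u v)"
  unfolding comma_def Let_def
proof (rule functor_to_pair_cat[where p = p and q = q])
  show "category (pair_cat {Pr x u |x u. x \<in> obj (src P) \<and> u \<in> arr (tgt P) \<and> dm (tgt P) u = fo P x}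
     (\<lambda>a b f v. f \<in> hom (src P) (lft a) (lft b) \<and>
         v \<in> hom (tgt P) (cd (tgt P) (rgt a)) (cd (tgt P) (rgt b)) \<and>
         cmp (tgt P) v (rgt a) = cmp (tgt P) (rgt b) (fa P f))
     (src P) (tgt P) (\<lambda>a. idn (src P) (lft a)) (\<lambda>a. idn (tgt P) (cd (tgt P) (rgt a))))"
    using category_comma[OF assms(2)] by (simp add: comma_def Let_def)
  show "\<And>x. x \<in> obj X \<Longrightarrow> u x \<in> {Pr x u |x u. x \<in> obj (src P) \<and> u \<in> arr (tgt P) \<and> dm (tgt P) u = fo P x}"
    using assms(3) by (simp add: comma_def Let_def)
qed (use assms in auto)

lemma comma_map_sel [simp]:
  "src (comma_map s) = comma (src s)" "tgt (comma_map s) = comma (tgt s)"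
  "a \<in> obj (comma (src s)) \<Longrightarrow> fo (comma_map s) a = Pr (fo (top1 s) (lft a)) (fa (bot1 s) (rgt a))"
  "z \<in> arr (comma (src s)) \<Longrightarrow> mor_fst (fa (comma_map s) z) = fa (top1 s) (mor_fst z)"
  "z \<in> arr (comma (src s)) \<Longrightarrow> mor_snd (fa (comma_map s) z) = fa (bot1 s) (mor_snd z)"
  "z \<in> arr (comma (src s)) \<Longrightarrow>
    mor_src (fa (comma_map s) z) = Pr (fo (top1 s) (lft (mor_src z))) (fa (bot1 s) (rgt (mor_src z)))"
  "z \<in> arr (comma (src s)) \<Longrightarrow>
    mor_tgt (fa (comma_map s) z) = Pr (fo (top1 s) (lft (mor_tgt z))) (fa (bot1 s) (rgt (mor_tgt z)))"
  by (simp_all add: comma_map_def comma_map_obj_def)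

lemma is_functor_comma_map [simp]:
  assumes s: "s \<in> cells1 CAT2" shows "is_functor (comma_map s)"
  unfolding comma_map_def
proof (rule functor_to_comma[where p = "\<lambda>z. fa (top1 s) (mor_fst z)" and q = "\<lambda>z. fa (bot1 s) (mor_snd z)"], goal_cases)
  case (5 z)
  then show ?case using s square_commute[OF s] by (auto elim!: comma_arrE simp: comma_map_obj_def)
qed (use s square_commute[OF s] in \<open>auto simp: comma_map_obj_def elim!: comma_objE comma_arrE\<close>)

lemma comma_square_sel [simp]:
  "src (comma_square s) = comma_cod (src s)" "tgt (comma_square s) = comma_cod (tgt s)"
  "top1 (comma_square s) = comma_map s" "bot1 (comma_square s) = bot1 s"
  by (simp_all add: comma_square_def)

lemma comma_square_cell [simp]:
  assumes s: "s \<in> cells1 CAT2" shows "comma_square s \<in> cells1 CAT2"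
  unfolding comma_square_def
  by (rule squareI) (use s square_commute[OF s] in \<open>auto elim!: comma_objE simp: comma_arrD\<close>)

lemma comma_square2_sel [simp]:
  "src (comma_square2 \<sigma>) = comma_square (src \<sigma>)" "tgt (comma_square2 \<sigma>) = comma_square (tgt \<sigma>)"
  "bot1 (comma_square2 \<sigma>) = bot1 \<sigma>"
  "src (top1 (comma_square2 \<sigma>)) = comma_map (src \<sigma>)" "tgt (top1 (comma_square2 \<sigma>)) = comma_map (tgt \<sigma>)"
  "a \<in> obj (comma (src (src \<sigma>))) \<Longrightarrow> mor_fst (dat (top1 (comma_square2 \<sigma>)) a) = dat (top1 \<sigma>) (lft a)"
  "a \<in> obj (comma (src (src \<sigma>))) \<Longrightarrow> mor_snd (dat (top1 (comma_square2 \<sigma>)) a) = dat (bot1 \<sigma>) (cd (tgt (src (src \<sigma>))) (rgt a))"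
  "a \<in> obj (comma (src (src \<sigma>))) \<Longrightarrow> mor_src (dat (top1 (comma_square2 \<sigma>)) a) =
     Pr (fo (top1 (src \<sigma>)) (lft a)) (fa (bot1 (src \<sigma>)) (rgt a))"
  "a \<in> obj (comma (src (src \<sigma>))) \<Longrightarrow> mor_tgt (dat (top1 (comma_square2 \<sigma>)) a) =
     Pr (fo (top1 (tgt \<sigma>)) (lft a)) (fa (bot1 (tgt \<sigma>)) (rgt a))"
  by (simp_all add: comma_square2_def Let_def comma_map_obj_def)

lemma trans_to_comma:
  assumes "is_functor F" "is_functor G" "src F = C" "src G = C" "tgt F = comma P" "tgt G = comma P"
    and t: "\<And>x. x \<in> obj C \<Longrightarrow> t x = mor (fo F x) (fo G x) (p x) (q x)"
    and arr: "\<And>x. x \<in> obj C \<Longrightarrow> mor (fo F x) (fo G x) (p x) (q x) \<in> arr (comma P)"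
    and P: "is_functor P"
    and nat: "\<And>f. f \<in> arr C \<Longrightarrow> cmp (src P) (p (cd C f)) (mor_fst (fa F f)) = cmp (src P) (mor_fst (fa G f)) (p (dm C f)) \<and>
       cmp (tgt P) (q (cd C f)) (mor_snd (fa F f)) = cmp (tgt P) (mor_snd (fa G f)) (q (dm C f))"
  shows "is_trans (mk_trans F G t)"
proof (rule is_trans_mk[OF assms(1,2,3,5,4,6)])
  have C: "category C" using assms(1,3) by auto
  fix f assume f: "f \<in> arr C"
  then have f': "dm C f \<in> obj C" "cd C f \<in> obj C" using C by auto
  have F: "fa F f \<in> arr (comma P)" "fa G f \<in> arr (comma P)" using f assms(1-6) by auto
  have d: "mor_src (fa F f) = fo F (dm C f)" "mor_tgt (fa F f) = fo F (cd C f)"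
    "mor_src (fa G f) = fo G (dm C f)" "mor_tgt (fa G f) = fo G (cd C f)"
    using functor_fa[OF assms(1,5), of f] functor_fa[OF assms(2,6), of f] f F assms(3,4) by simp_all
  show "cmp (comma P) (t (cd C f)) (fa F f) = cmp (comma P) (fa G f) (t (dm C f))"
    using F arr[OF f'(1)] arr[OF f'(2)] nat[OF f] f' d by (simp add: t del: comma_mor)
qed (simp_all add: t arr del: comma_mor)

lemma comma_square2_cell [simp]:
  assumes \<sigma>: "\<sigma> \<in> cells2 CAT2" shows "comma_square2 \<sigma> \<in> cells2 CAT2"
proof -
  define s where "s = src \<sigma>"
  define t where "t = tgt \<sigma>"
  have s [simp]: "s \<in> cells1 CAT2" "t \<in> cells1 CAT2" "src \<sigma> = s" "tgt \<sigma> = t"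
    using \<sigma> by (simp_all add: s_def t_def)
  have [simp]: "src t = src s" "tgt t = tgt s" using CAT2.cell2_ends(3,4)[OF \<sigma>] by simp_all
  note [simp] = square2D[OF \<sigma>]
  note c = square2_commute[OF \<sigma>, simplified] square_commute[OF s(1)] square_commute[OF s(2), simplified]
  let ?t = "mk_trans (comma_map s) (comma_map t) (\<lambda>a. mor (comma_map_obj s a) (comma_map_obj t a)
                 (dat (top1 \<sigma>) (lft a)) (dat (bot1 \<sigma>) (cd (tgt (src s)) (rgt a))))"
  have tr: "is_trans ?t"
  proof (rule trans_to_comma[where p = "\<lambda>a. dat (top1 \<sigma>) (lft a)" and q = "\<lambda>a. dat (bot1 \<sigma>) (cd (tgt (src s)) (rgt a))"
        and P = "tgt s" and C = "comma (src s)"], goal_cases)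
    \<comment> \<open>The pair of components is an arrow of the comma category by naturality of the
      bottom transformation at the second entry of \<open>a\<close>, because the top transformation
      lies over the bottom one.\<close>
    case (8 a)
    then show ?case using trans_nat'[of "bot1 \<sigma>" "tgt (tgt s)"] by (auto elim!: comma_objE simp: c)
  next
    case (10 z)
    then show ?case using trans_nat'[of "bot1 \<sigma>" "tgt (tgt s)" "mor_snd z"] trans_nat'[of "top1 \<sigma>" "src (tgt s)" "mor_fst z"]
      by (auto elim!: comma_arrE)
  qed (auto simp: comma_map_obj_def)
  show ?thesis unfolding comma_square2_def Let_def
  proof (rule square2I, goal_cases)
    case (11 a)
    then have "dat ?t a \<in> arr (comma (tgt s))" using trans_arr(1)[OF tr, of "comma (tgt s)" a] by simp
    then show ?case using 11 by (simp del: comma_mor)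
  qed (use \<sigma> tr in simp_all)
qed

lemma comma_H_sel [simp]:
  "src (comma_H P) = src P" "tgt (comma_H P) = comma P"
  "x \<in> obj (src P) \<Longrightarrow> fo (comma_H P) x = Pr x (idn (tgt P) (fo P x))"
  "f \<in> arr (src P) \<Longrightarrow> mor_fst (fa (comma_H P) f) = f" "f \<in> arr (src P) \<Longrightarrow> mor_snd (fa (comma_H P) f) = fa P f"
  by (simp_all add: comma_H_def Let_def)

lemma is_functor_comma_H [simp]: "is_functor P \<Longrightarrow> is_functor (comma_H P)"
  unfolding comma_H_def Let_def by (rule functor_to_comma[where p = "\<lambda>f. f" and q = "fa P"]) auto

lemma comma_M_sel [simp]:
  "src (comma_M P) = comma (comma_cod P)" "tgt (comma_M P) = comma P"
  "a \<in> obj (comma (comma_cod P)) \<Longrightarrow> fo (comma_M P) a = Pr (lft (lft a)) (cmp (tgt P) (rgt a) (rgt (lft a)))"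
  "z \<in> arr (comma (comma_cod P)) \<Longrightarrow> mor_fst (fa (comma_M P) z) = mor_fst (mor_fst z)"
  "z \<in> arr (comma (comma_cod P)) \<Longrightarrow> mor_snd (fa (comma_M P) z) = mor_snd z"
  by (simp_all add: comma_M_def Let_def)

lemma is_functor_comma_M [simp]:
  assumes P: "is_functor P" shows "is_functor (comma_M P)"
  unfolding comma_M_def Let_def
proof (rule functor_to_comma[where p = "\<lambda>z. mor_fst (mor_fst z)" and q = mor_snd], goal_cases)
  case (5 z)
  then show ?case
  proof (rule comma_arrE)
    fix a v b t q s
    assume z: "z = mor (Pr a v) (Pr b t) q s" "a \<in> obj (src (comma_cod P))" "v \<in> arr (tgt (comma_cod P))"
      "dm (tgt (comma_cod P)) v = fo (comma_cod P) a" "b \<in> obj (src (comma_cod P))" "t \<in> arr (tgt (comma_cod P))"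
      "dm (tgt (comma_cod P)) t = fo (comma_cod P) b" "q \<in> arr (src (comma_cod P))"
      "dm (src (comma_cod P)) q = a" "cd (src (comma_cod P)) q = b" "s \<in> arr (tgt (comma_cod P))"
      "dm (tgt (comma_cod P)) s = cd (tgt (comma_cod P)) v" "cd (tgt (comma_cod P)) s = cd (tgt (comma_cod P)) t"
      "cmp (tgt (comma_cod P)) s v = cmp (tgt (comma_cod P)) t (fa (comma_cod P) q)"
    from z(8) obtain x u y w f r where q: "q = mor (Pr x u) (Pr y w) f r" "x \<in> obj (src P)" "u \<in> arr (tgt P)" "dm (tgt P) u = fo P x"
      "y \<in> obj (src P)" "w \<in> arr (tgt P)" "dm (tgt P) w = fo P y" "f \<in> arr (src P)" "dm (src P) f = x" "cd (src P) f = y"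
      "r \<in> arr (tgt P)" "dm (tgt P) r = cd (tgt P) u" "cd (tgt P) r = cd (tgt P) w"
      "cmp (tgt P) r u = cmp (tgt P) w (fa P f)" by (auto elim: comma_arrE)
    have qa: "q \<in> arr (comma P)" using z(8) by simp
    then have ab: "a = Pr x u" "b = Pr y w" using comma_dm_cd[OF qa] z(9,10) q(1)
      by (simp_all del: comma_dm_cd comma_mor)
    note [simp] = P
    have zz: "v \<in> arr (tgt P)" "dm (tgt P) v = cd (tgt P) u" "t \<in> arr (tgt P)" "dm (tgt P) t = cd (tgt P) w"
      "s \<in> arr (tgt P)" "dm (tgt P) s = cd (tgt P) v" "cd (tgt P) s = cd (tgt P) t"
      using z(2-13) ab by simp_all
    \<comment> \<open>The functor \<open>comma_cod P\<close> reads off the base component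
      \<open>r\<close> of \<open>q\<close>, which turns the outer commutation into an equation in
      the base. Pasted with that of \<open>q\<close> it becomes the commutation for the composites
      \<open>v u\<close> and \<open>t w\<close>.\<close>
    have "cmp (tgt P) s v = cmp (tgt P) t r" using z(14) q(1) qa by simp
    then have "cmp (tgt P) s (cmp (tgt P) v u) = cmp (tgt P) t (cmp (tgt P) r u)"
      by (rule category_reassoc) (use zz q(2-13) in simp_all)
    then show ?thesis using zz q 5 ab by (simp add: z(1))
  qed
qed (use P in \<open>auto elim!: comma_objE comma_arrE\<close>)

lemma comma_map_comp:
  assumes s: "s \<in> cells1 CAT2" and t: "t \<in> cells1 CAT2" and e: "tgt s = src t"
  shows "comma_map (comp1 CAT2 t s) = comp1 CAT (comma_map t) (comma_map s)"
  by (rule functor_to_comma_eqI[where P = "tgt t"])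
    (use assms square_commute[OF s] in \<open>auto elim!: comma_objE comma_arrE\<close>)

lemma comma_map_id:
  assumes "is_functor P" shows "comma_map (id1 CAT2 P) = id1 CAT (comma P)"
  by (rule functor_to_comma_eqI[where P = P]) (use assms in \<open>auto elim!: comma_objE comma_arrE\<close>)

lemma comma_square_comp:
  assumes "s \<in> cells1 CAT2" "t \<in> cells1 CAT2" "tgt s = src t"
  shows "comma_square (comp1 CAT2 t s) = comp1 CAT2 (comma_square t) (comma_square s)"
  by (rule square_eqI) (use assms comma_map_comp in simp_all)

lemma comma_square_id:
  assumes "is_functor P" shows "comma_square (id1 CAT2 P) = id1 CAT2 (comma_cod P)"
  by (rule square_eqI) (use assms comma_map_id in simp_all)

lemma comma_two_functor: "two_functor CAT2 CAT2 (TwoFun comma_cod comma_square comma_square2)"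
proof (rule two_functorI, goal_cases)
  case (8 s)
  then have s: "s \<in> cells1 CAT2" by simp
  have "top1 (comma_square2 (id2 CAT2 s)) = id2 CAT (comma_map s)"
    by (rule trans_to_comma_eqI[where P = "tgt s"]) (use s square2D(1)[OF comma_square2_cell] in \<open>auto elim!: comma_objE\<close>)
  then show ?case by (auto intro: square2_eqI)
next
  case (9 \<sigma> \<tau>)
  have "src (src \<tau>) = src (src \<sigma>)" "tgt (src \<tau>) = tgt (src \<sigma>)" using 9 by (metis CAT2.cell2_ends(3,4))+
  then have "top1 (comma_square2 (vcomp CAT2 \<tau> \<sigma>)) = vcomp CAT (top1 (comma_square2 \<tau>)) (top1 (comma_square2 \<sigma>))"
    by (intro trans_to_comma_eqI[where P = "tgt (src \<sigma>)"]) (use 9 in \<open>auto elim!: comma_objE\<close>)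
  then show ?case by (auto intro: square2_eqI)
next
  case (10 \<sigma> \<tau>)
  note \<sigma>\<tau> = 10(1,2)
  have e: "tgt (src \<sigma>) = src (src \<tau>)" "tgt (tgt \<sigma>) = src (src \<tau>)" "src (tgt \<sigma>) = src (src \<sigma>)"
    "src (tgt \<tau>) = src (src \<tau>)" "tgt (tgt \<tau>) = tgt (src \<tau>)"
    and f: "src \<sigma> \<in> cells1 CAT2" "tgt \<sigma> \<in> cells1 CAT2" "src \<tau> \<in> cells1 CAT2" "tgt \<tau> \<in> cells1 CAT2"
    using 10 by simp_all
  note c = square_commute[OF f(1), unfolded e] square_commute[OF f(2), unfolded e]
  have "top1 (comma_square2 (hcomp CAT2 \<tau> \<sigma>)) = hcomp CAT (top1 (comma_square2 \<tau>)) (top1 (comma_square2 \<sigma>))"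
  proof (rule trans_to_comma_eqI[where P = "tgt (src \<tau>)"], goal_cases)
    case (6 a)
    then have "a \<in> obj (comma (src (src \<sigma>)))" by simp
    then obtain x u where a: "a = Pr x u" "x \<in> obj (src (src (src \<sigma>)))" "u \<in> arr (tgt (src (src \<sigma>)))"
      "dm (tgt (src (src \<sigma>))) u = fo (src (src \<sigma>)) x" by (rule comma_objE)
    show ?case using a \<sigma>\<tau> f e c by simp
  qed (use \<sigma>\<tau> f e in \<open>simp_all add: comma_map_comp\<close>)
  then show ?case using 10 by (auto intro: square2_eqI simp: comma_square_comp)
next
  case (3 P)
  then show ?case by simp
next
  case (4 s)
  then show ?case by simp
next
  case (5 \<sigma>)
  then show ?case by simp
next
  case (6 P)
  then show ?case using comma_square_id[of P] by simp
next
  case (7 s t)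
  then show ?case using comma_square_comp[of s t] by simp
qed (rule strict_CAT2)+

lemma CommaMonad_sel [simp]:
  "map0 (mfun CommaMonad) = comma_cod" "map1 (mfun CommaMonad) = comma_square" "map2 (mfun CommaMonad) = comma_square2"
  "munit CommaMonad P = Cell P (comma_cod P) (comma_H P, id1 CAT (tgt P))"
  "mmult CommaMonad P = Cell (comma_cod (comma_cod P)) (comma_cod P) (comma_M P, id1 CAT (tgt P))"
  by (simp_all add: CommaMonad_def)

lemma two_natural_comma_unit: "two_natural CAT2 CAT2 twofun_id (mfun CommaMonad) (munit CommaMonad)"
  unfolding two_natural_def
proof (intro conjI ballI)
  show "two_functor CAT2 CAT2 twofun_id" by (rule two_functor_id) (rule strict_CAT2)
  show "two_functor CAT2 CAT2 (mfun CommaMonad)" using comma_two_functor by (simp add: CommaMonad_def)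
next
  fix P :: "'a ent fctr" assume "P \<in> cells0 CAT2"
  then show "munit CommaMonad P \<in> cells1 CAT2" by (auto intro!: squareI)
next
  fix s :: "'a ent square" assume s: "s \<in> cells1 CAT2"
  have "comp1 CAT (comma_map s) (comma_H (src s)) = comp1 CAT (comma_H (tgt s)) (top1 s)"
    by (rule functor_to_comma_eqI[where P = "tgt s"]) (use s in auto)
  then show "comp1 CAT2 (map1 (mfun CommaMonad) s) (munit CommaMonad (src s)) =
      comp1 CAT2 (munit CommaMonad (tgt s)) (map1 twofun_id s)"
    using s by (auto intro!: square_eqI simp: twofun_id_def)
next
  fix \<sigma> :: "'a ent square2" assume \<sigma>: "\<sigma> \<in> cells2 CAT2"
  note [simp] = square2_commute[OF \<sigma>]
  have 1: "comp1 CAT (comma_map s) (comma_H (src s)) = comp1 CAT (comma_H (tgt s)) (top1 s)"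
    if s: "s \<in> cells1 CAT2" for s :: "'a ent square"
    by (rule functor_to_comma_eqI[where P = "tgt s"]) (use s in auto)
  have f: "src \<sigma> \<in> cells1 CAT2" "tgt \<sigma> \<in> cells1 CAT2" "src (tgt \<sigma>) = src (src \<sigma>)" "tgt (tgt \<sigma>) = tgt (src \<sigma>)"
    using \<sigma> by simp_all
  have "whisk_r CAT (top1 (comma_square2 \<sigma>)) (comma_H (src (src \<sigma>))) = whisk_l CAT (comma_H (tgt (src \<sigma>))) (top1 \<sigma>)"
    by (rule trans_to_comma_eqI[where P = "tgt (src \<sigma>)"]) (use \<sigma> f 1[OF f(1)] 1[OF f(2)] in auto)
  then show "whisk_r CAT2 (map2 (mfun CommaMonad) \<sigma>) (munit CommaMonad (src (src \<sigma>))) =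
    whisk_l CAT2 (munit CommaMonad (tgt (src \<sigma>))) (map2 twofun_id \<sigma>)"
    using \<sigma> f 1[OF f(1)] 1[OF f(2)] by (auto intro!: square_eqI simp: twofun_id_def)
qed (auto simp: twofun_id_def)

lemma comma_M_nat:
  assumes s: "s \<in> cells1 CAT2"
  shows "comp1 CAT (comma_map s) (comma_M (src s)) = comp1 CAT (comma_M (tgt s)) (comma_map (comma_square s))"
  by (rule functor_to_comma_eqI[where P = "tgt s"]) (use s in \<open>auto simp: comma_arrD elim!: comma_objE\<close>)

lemma two_natural_comma_mult:
  "two_natural CAT2 CAT2 (twofun_comp (mfun CommaMonad) (mfun CommaMonad)) (mfun CommaMonad) (mmult CommaMonad)"
  unfolding two_natural_def
proof (intro conjI ballI)
  show 1: "two_functor CAT2 CAT2 (mfun CommaMonad)" using comma_two_functor by (simp add: CommaMonad_def)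
  then show "two_functor CAT2 CAT2 (twofun_comp (mfun CommaMonad) (mfun CommaMonad))" using two_functor_comp by blast
next
  fix P :: "'a ent fctr" assume "P \<in> cells0 CAT2"
  then show "mmult CommaMonad P \<in> cells1 CAT2" by (auto intro!: squareI elim!: comma_objE simp: comma_arrD)
next
  fix s :: "'a ent square" assume s: "s \<in> cells1 CAT2"
  then show "comp1 CAT2 (map1 (mfun CommaMonad) s) (mmult CommaMonad (src s)) =
      comp1 CAT2 (mmult CommaMonad (tgt s)) (map1 (twofun_comp (mfun CommaMonad) (mfun CommaMonad)) s)"
    using comma_M_nat[OF s] by (auto intro!: square_eqI simp: twofun_comp_def)
next
  fix \<sigma> :: "'a ent square2" assume \<sigma>: "\<sigma> \<in> cells2 CAT2"
  have f: "src \<sigma> \<in> cells1 CAT2" "tgt \<sigma> \<in> cells1 CAT2" "src (tgt \<sigma>) = src (src \<sigma>)" "tgt (tgt \<sigma>) = tgt (src \<sigma>)"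
    using \<sigma> by simp_all
  have "whisk_r CAT (top1 (comma_square2 \<sigma>)) (comma_M (src (src \<sigma>))) =
      whisk_l CAT (comma_M (tgt (src \<sigma>))) (top1 (comma_square2 (comma_square2 \<sigma>)))"
    by (rule trans_to_comma_eqI[where P = "tgt (src \<sigma>)"])
      (use \<sigma> f comma_M_nat[OF f(1)] comma_M_nat[OF f(2)] in \<open>auto elim!: comma_objE\<close>)
  then show "whisk_r CAT2 (map2 (mfun CommaMonad) \<sigma>) (mmult CommaMonad (src (src \<sigma>))) =
    whisk_l CAT2 (mmult CommaMonad (tgt (src \<sigma>))) (map2 (twofun_comp (mfun CommaMonad) (mfun CommaMonad)) \<sigma>)"
    using \<sigma> f comma_M_nat[OF f(1)] comma_M_nat[OF f(2)] by (auto intro!: square_eqI simp: twofun_comp_def)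
qed (auto simp: twofun_comp_def)

lemma two_monad_comma: "two_monad CAT2 CommaMonad"
  unfolding two_monad_def Let_def
proof (intro conjI ballI)
  show "two_functor CAT2 CAT2 (mfun CommaMonad)" using comma_two_functor by (simp add: CommaMonad_def)
  show "two_natural CAT2 CAT2 twofun_id (mfun CommaMonad) (munit CommaMonad)"
    "two_natural CAT2 CAT2 (twofun_comp (mfun CommaMonad) (mfun CommaMonad)) (mfun CommaMonad) (mmult CommaMonad)"
    using two_natural_comma_unit two_natural_comma_mult by simp_all
next
  fix P :: "'a ent fctr" assume "P \<in> cells0 CAT2"
  then have P: "is_functor P" by simp
  have u: "munit CommaMonad P \<in> cells1 CAT2" "mmult CommaMonad P \<in> cells1 CAT2"
    using P two_natural_cell(1)[OF two_natural_comma_unit, of P] two_natural_cell(1)[OF two_natural_comma_mult, of P]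
    by simp_all
  note u = u[simplified]
  have "comp1 CAT (comma_M P) (comma_H (comma_cod P)) = id1 CAT (comma P)"
    by (rule functor_to_comma_eqI[where P = P]) (use P in \<open>auto elim!: comma_objE\<close>)
  then show "comp1 CAT2 (mmult CommaMonad P) (munit CommaMonad (map0 (mfun CommaMonad) P)) = id1 CAT2 (map0 (mfun CommaMonad) P)"
    using P by (auto intro!: square_eqI)
  have "comp1 CAT (comma_M P) (comma_map (Cell P (comma_cod P) (comma_H P, id1 CAT (tgt P)))) = id1 CAT (comma P)"
    by (rule functor_to_comma_eqI[where P = P]) (use P u in \<open>auto elim!: comma_objE simp: comma_arrD\<close>)
  then show "comp1 CAT2 (mmult CommaMonad P) (map1 (mfun CommaMonad) (munit CommaMonad P)) = id1 CAT2 (map0 (mfun CommaMonad) P)"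
    using P by (auto intro!: square_eqI)
  have "comp1 CAT (comma_M P) (comma_M (comma_cod P)) =
      comp1 CAT (comma_M P) (comma_map (Cell (comma_cod (comma_cod P)) (comma_cod P) (comma_M P, id1 CAT (tgt P))))"
    by (rule functor_to_comma_eqI[where P = P]) (use P u in \<open>auto elim!: comma_objE simp: comma_cod_arr(2)[of _ "comma_cod P", simplified] comma_arrD\<close>)
  then show "comp1 CAT2 (mmult CommaMonad P) (mmult CommaMonad (map0 (mfun CommaMonad) P)) =
         comp1 CAT2 (mmult CommaMonad P) (map1 (mfun CommaMonad) (mmult CommaMonad P))"
    using P by (auto intro!: square_eqI)
qed

section \<open>The transformation \<open>kappa\<close> and its colax monad laws\<close>

lemma kappa_sel [simp]:
  "src (kappa P) = sq_cat (src P)" "tgt (kappa P) = comma P"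
  "f \<in> arr (src P) \<Longrightarrow> fo (kappa P) f = Pr (dm (src P) f) (fa P f)"
  "z \<in> arr (sq_cat (src P)) \<Longrightarrow> mor_fst (fa (kappa P) z) = mor_fst z"
  "z \<in> arr (sq_cat (src P)) \<Longrightarrow> mor_snd (fa (kappa P) z) = fa P (mor_snd z)"
  by (simp_all add: kappa_def Let_def)

lemma is_functor_kappa [simp]:
  assumes P: "is_functor P" shows "is_functor (kappa P)"
  unfolding kappa_def Let_def
  by (rule functor_to_comma[where p = mor_fst and q = "\<lambda>z. fa P (mor_snd z)"]) (use P in \<open>auto elim!: sq_arrE\<close>)

text \<open>An object \<open>f\<close> is sent to a pair with second entry \<open>P f\<close>;
  commutation of \<open>s\<close> turns \<open>S (P f)\<close> into \<open>Q (T f)\<close>.\<close>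

lemma kappa_square:
  assumes s: "s \<in> cells1 CAT2"
  shows "comp1 CAT (comma_map s) (kappa (src s)) = comp1 CAT (kappa (tgt s)) (sq_functor (top1 s))"
  by (rule functor_to_comma_eqI[where P = "tgt s"]) (use s in \<open>auto elim!: sq_arrE\<close>)

lemma two_natural_kappa:
  "two_natural CAT2 CAT (twofun_comp (mfun SqMonad) Dom) (twofun_comp Dom (mfun CommaMonad)) kappa"
  unfolding two_natural_def
proof (intro conjI ballI)
  show "two_functor CAT2 CAT (twofun_comp (mfun SqMonad) Dom)"
    using two_functor_comp[OF two_functor_Dom] sq_two_functor by (auto simp: SqMonad_def)
  show "two_functor CAT2 CAT (twofun_comp Dom (mfun CommaMonad))"
    using two_functor_comp[OF _ two_functor_Dom] comma_two_functor by (auto simp: CommaMonad_def)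
next
  fix s :: "'a ent square" assume s: "s \<in> cells1 CAT2"
  then show "comp1 CAT (map1 (twofun_comp Dom (mfun CommaMonad)) s) (kappa (src s)) =
    comp1 CAT (kappa (tgt s)) (map1 (twofun_comp (mfun SqMonad) Dom) s)"
    using kappa_square by (simp add: twofun_comp_def Dom_def)
next
  fix \<sigma> :: "'a ent square2" assume \<sigma>: "\<sigma> \<in> cells2 CAT2"
  note [simp] = square2_commute[OF \<sigma>]
  have f: "src \<sigma> \<in> cells1 CAT2" "tgt \<sigma> \<in> cells1 CAT2" "src (tgt \<sigma>) = src (src \<sigma>)" "tgt (tgt \<sigma>) = tgt (src \<sigma>)"
    using \<sigma> by simp_all
  have "whisk_r CAT (top1 (comma_square2 \<sigma>)) (kappa (src (src \<sigma>))) =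
      whisk_l CAT (kappa (tgt (src \<sigma>))) (sq_trans (top1 \<sigma>))"
    by (rule trans_to_comma_eqI[where P = "tgt (src \<sigma>)"])
      (use \<sigma> f kappa_square[OF f(1)] kappa_square[OF f(2)] trans_arr(1)[OF is_trans_sq[of "top1 \<sigma>"] refl] in auto)
  then show "whisk_r CAT (map2 (twofun_comp Dom (mfun CommaMonad)) \<sigma>) (kappa (src (src \<sigma>))) =
    whisk_l CAT (kappa (tgt (src \<sigma>))) (map2 (twofun_comp (mfun SqMonad) Dom) \<sigma>)"
    by (simp add: twofun_comp_def Dom_def)
qed (auto simp: twofun_comp_def Dom_def)

text \<open>The multiplication law is functoriality of \<open>P\<close>: a square with source
  \<open>f\<close>, initial vertex \<open>x\<close> and second component \<open>s\<close> goes to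
  \<open>(x, P (s f))\<close> along its diagonal, and to \<open>(x, P s P f)\<close> along the
  iterated \<open>kappa\<close>.\<close>

lemma colax_kappa: "colax_monad_morphism CAT2 CommaMonad CAT SqMonad Dom kappa"
  unfolding colax_monad_morphism_def
proof (intro conjI ballI)
  fix P :: "'a ent fctr" assume "P \<in> cells0 CAT2"
  then have P: "is_functor P" by simp
  have "comp1 CAT (kappa P) (sq_unit (src P)) = comma_H P"
    by (rule functor_to_comma_eqI[where P = P]) (use P in auto)
  then show "comp1 CAT (kappa P) (munit SqMonad (map0 Dom P)) = map1 Dom (munit CommaMonad P)"
    by (simp add: Dom_def)
  have "comp1 CAT (kappa P) (sq_mult (src P)) = comp1 CAT (comma_M P) (comp1 CAT (kappa (comma_cod P)) (sq_functor (kappa P)))"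
  proof (rule functor_to_comma_eqI[where P = P])
    fix z assume "z \<in> obj (src (comp1 CAT (kappa P) (sq_mult (src P))))"
    then have z: "z \<in> arr (sq_cat (src P))" by simp
    then have "fa (kappa P) z \<in> arr (comma P)" "dm (comma P) (fa (kappa P) z) = fo (kappa P) (dm (sq_cat (src P)) z)"
      using P by (simp_all del: comma_dm_cd)
    then show "fo (comp1 CAT (kappa P) (sq_mult (src P))) z =
      fo (comp1 CAT (comma_M P) (comp1 CAT (kappa (comma_cod P)) (sq_functor (kappa P)))) z"
      using P z sq_diag_arr[OF _ z] by (auto elim!: sq_arrE simp: sq_diag_def simp del: comma_dm_cd)
  next
    fix w assume "w \<in> arr (src (comp1 CAT (kappa P) (sq_mult (src P))))"
    then have w: "w \<in> arr (sq_cat (sq_cat (src P)))" by simp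
    then have w2: "fa (sq_mult (src P)) w \<in> arr (sq_cat (src P))"
      "fa (sq_functor (kappa P)) w \<in> arr (sq_cat (comma P))" using P by simp_all
    have w3: "mor_fst w \<in> arr (sq_cat (src P))" "mor_snd w \<in> arr (sq_cat (src P))" using w by (auto elim: sq_arrE)
    have "mor_fst (fa (sq_mult (src P)) w) = mor_fst (mor_fst w)" "mor_snd (fa (sq_mult (src P)) w) = mor_snd (mor_snd w)"
      using sq_mult_fa[OF w] by simp_all
    moreover have "mor_fst (fa (sq_functor (kappa P)) w) = fa (kappa P) (mor_fst w)"
      "mor_snd (fa (sq_functor (kappa P)) w) = fa (kappa P) (mor_snd w)"
      using sq_functor_fa[of w "kappa P"] w by simp_all
    ultimately show "mor_fst (fa (comp1 CAT (kappa P) (sq_mult (src P))) w) =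
        mor_fst (fa (comp1 CAT (comma_M P) (comp1 CAT (kappa (comma_cod P)) (sq_functor (kappa P)))) w) \<and>
      mor_snd (fa (comp1 CAT (kappa P) (sq_mult (src P))) w) =
        mor_snd (fa (comp1 CAT (comma_M P) (comp1 CAT (kappa (comma_cod P)) (sq_functor (kappa P)))) w)"
      using w w2 w3 P by simp
  qed (use P in auto)
  then show "comp1 CAT (kappa P) (mmult SqMonad (map0 Dom P)) =
    comp1 CAT (map1 Dom (mmult CommaMonad P)) (comp1 CAT (kappa (map0 (mfun CommaMonad) P)) (map1 (mfun SqMonad) (kappa P)))"
    by (simp add: Dom_def)
qed (use two_monad_comma two_monad_sq two_natural_kappa in auto)

section \<open>Cocartesian arrows\<close>

lemma isosE:
  assumes "f \<in> isos C"
  obtains g where "f \<in> arr C" "g \<in> arr C" "dm C g = cd C f" "cd C g = dm C f"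
    "cmp C g f = idn C (dm C f)" "cmp C f g = idn C (cd C f)"
  using assms by (auto simp: isos_def)

lemma isosI:
  assumes "f \<in> arr C" "g \<in> arr C" "dm C g = cd C f" "cd C g = dm C f"
    "cmp C g f = idn C (dm C f)" "cmp C f g = idn C (cd C f)"
  shows "f \<in> isos C"
  using assms by (auto simp: isos_def)

lemma isos_arr [simp]: "f \<in> isos C \<Longrightarrow> f \<in> arr C"
  by (simp add: isos_def)

lemma idn_isos [simp]: "category C \<Longrightarrow> x \<in> obj C \<Longrightarrow> idn C x \<in> isos C"
  by (rule isosI[where g = "idn C x"]) auto

lemma isos_functor:
  assumes F: "is_functor F" and f: "f \<in> isos (src F)" shows "fa F f \<in> isos (tgt F)"
  using f
proof (rule isosE)
  fix g assume g: "f \<in> arr (src F)" "g \<in> arr (src F)" "dm (src F) g = cd (src F) f" "cd (src F) g = dm (src F) f"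
    "cmp (src F) g f = idn (src F) (dm (src F) f)" "cmp (src F) f g = idn (src F) (cd (src F) f)"
  show ?thesis
    using arg_cong[OF g(5), of "fa F"] arg_cong[OF g(6), of "fa F"] g(1-4) F
    by (intro isosI[where g = "fa F g"]) simp_all
qed

lemma cocartD:
  assumes "e \<in> cocart P"
  shows "e \<in> arr (src P)"
    and "g \<in> arr (src P) \<Longrightarrow> dm (src P) g = dm (src P) e \<Longrightarrow> v \<in> arr (tgt P) \<Longrightarrow> dm (tgt P) v = fo P (cd (src P) e) \<Longrightarrow>
      cd (tgt P) v = fo P (cd (src P) g) \<Longrightarrow> fa P g = cmp (tgt P) v (fa P e) \<Longrightarrow>
      \<exists>!h. h \<in> arr (src P) \<and> dm (src P) h = cd (src P) e \<and> cd (src P) h = cd (src P) g \<and> cmp (src P) h e = g \<and> fa P h = v"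
  using assms by (auto simp: cocart_def Let_def)

lemma cocartI:
  assumes "e \<in> arr (src P)"
    and "\<And>g v. g \<in> arr (src P) \<Longrightarrow> dm (src P) g = dm (src P) e \<Longrightarrow> v \<in> arr (tgt P) \<Longrightarrow> dm (tgt P) v = fo P (cd (src P) e) \<Longrightarrow>
      cd (tgt P) v = fo P (cd (src P) g) \<Longrightarrow> fa P g = cmp (tgt P) v (fa P e) \<Longrightarrow>
      \<exists>!h. h \<in> arr (src P) \<and> dm (src P) h = cd (src P) e \<and> cd (src P) h = cd (src P) g \<and> cmp (src P) h e = g \<and> fa P h = v"
  shows "e \<in> cocart P"
  using assms by (auto simp: cocart_def Let_def)

lemma cocart_unique:
  assumes P: "is_functor P" and e: "e \<in> cocart P" and "h \<in> arr (src P)" "h' \<in> arr (src P)"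
    "dm (src P) h = cd (src P) e" "dm (src P) h' = cd (src P) e" "cd (src P) h = cd (src P) h'"
    "cmp (src P) h e = cmp (src P) h' e" "fa P h = fa P h'"
  shows "h = h'"
proof -
  have "\<exists>!k. k \<in> arr (src P) \<and> dm (src P) k = cd (src P) e \<and> cd (src P) k = cd (src P) (cmp (src P) h e) \<and>
      cmp (src P) k e = cmp (src P) h e \<and> fa P k = fa P h"
    by (rule cocartD(2)[OF e]) (use assms cocartD(1)[OF e] in simp_all)
  then show ?thesis using assms cocartD(1)[OF e] by (metis functor_src_tgt(1) category_cmp(3))
qed

lemma cocart_lift:
  assumes P: "is_functor P" and e: "e \<in> cocart P" and "g \<in> arr (src P)" "dm (src P) g = dm (src P) e"
    "v \<in> arr (tgt P)" "dm (tgt P) v = fo P (cd (src P) e)" "cd (tgt P) v = fo P (cd (src P) g)" "fa P g = cmp (tgt P) v (fa P e)"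
  obtains h where "h \<in> arr (src P)" "dm (src P) h = cd (src P) e" "cd (src P) h = cd (src P) g"
    "cmp (src P) h e = g" "fa P h = v"
  using cocartD(2)[OF e assms(3-8)] by blast

lemma cocart_cmp:
  assumes P: "is_functor P" and e: "e \<in> cocart P" and d: "d \<in> cocart P" and de: "cd (src P) e = dm (src P) d"
  shows "cmp (src P) d e \<in> cocart P"
proof (rule cocartI)
  note [simp] = P de cocartD(1)[OF e] cocartD(1)[OF d]
  show "cmp (src P) d e \<in> arr (src P)" by simp
  fix g v assume "g \<in> arr (src P)" "dm (src P) g = dm (src P) (cmp (src P) d e)" "v \<in> arr (tgt P)"
     "dm (tgt P) v = fo P (cd (src P) (cmp (src P) d e))"
     "cd (tgt P) v = fo P (cd (src P) g)" "fa P g = cmp (tgt P) v (fa P (cmp (src P) d e))"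
  then have g: "g \<in> arr (src P)" "dm (src P) g = dm (src P) e" "v \<in> arr (tgt P)"
     "dm (tgt P) v = fo P (cd (src P) d)" "cd (tgt P) v = fo P (cd (src P) g)"
     "fa P g = cmp (tgt P) (cmp (tgt P) v (fa P d)) (fa P e)" by simp_all
  obtain k where k: "k \<in> arr (src P)" "dm (src P) k = cd (src P) e" "cd (src P) k = cd (src P) g"
    "cmp (src P) k e = g" "fa P k = cmp (tgt P) v (fa P d)"
    by (rule cocart_lift[OF P e, of g "cmp (tgt P) v (fa P d)"]) (use g in simp_all)
  obtain h where h: "h \<in> arr (src P)" "dm (src P) h = cd (src P) d" "cd (src P) h = cd (src P) g"
    "cmp (src P) h d = k" "fa P h = v"
    by (rule cocart_lift[OF P d, of k v]) (use g k in simp_all)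
  show "\<exists>!h. h \<in> arr (src P) \<and> dm (src P) h = cd (src P) (cmp (src P) d e) \<and> cd (src P) h = cd (src P) g \<and>
     cmp (src P) h (cmp (src P) d e) = g \<and> fa P h = v"
  proof (rule ex1I[of _ h])
    have "cmp (src P) h (cmp (src P) d e) = cmp (src P) (cmp (src P) h d) e"
      by (rule category_assoc[symmetric]) (use h in simp_all)
    then show "h \<in> arr (src P) \<and> dm (src P) h = cd (src P) (cmp (src P) d e) \<and> cd (src P) h = cd (src P) g \<and>
      cmp (src P) h (cmp (src P) d e) = g \<and> fa P h = v" using h k by simp
    fix h' assume h': "h' \<in> arr (src P) \<and> dm (src P) h' = cd (src P) (cmp (src P) d e) \<and> cd (src P) h' = cd (src P) g \<and>
      cmp (src P) h' (cmp (src P) d e) = g \<and> fa P h' = v"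
    have "cmp (src P) h' d = k"
      by (rule cocart_unique[OF P e]) (use h' h k g in simp_all)
    with h h' show "h' = h" by - (rule cocart_unique[OF P d], simp_all)
  qed
qed

text \<open>The only possible factorization of \<open>g\<close> through \<open>i\<close> is
  \<open>g j\<close> with \<open>j\<close> the inverse of \<open>i\<close>; it lies over
  \<open>v\<close> because \<open>fa P j\<close> cancels \<open>fa P i\<close>.\<close>

lemma isos_cocart:
  assumes P: "is_functor P" and i: "i \<in> isos (src P)" shows "i \<in> cocart P"
  using i
proof (rule isosE)
  fix j assume ij: "i \<in> arr (src P)" "j \<in> arr (src P)" "dm (src P) j = cd (src P) i" "cd (src P) j = dm (src P) i"
    "cmp (src P) j i = idn (src P) (dm (src P) i)" "cmp (src P) i j = idn (src P) (cd (src P) i)"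
  note [simp] = P ij(1-4)
  have r: "cmp (src P) (cmp (src P) h i) j = h" if "h \<in> arr (src P)" "dm (src P) h = cd (src P) i" for h
    using that by (simp add: ij(6))
  have l: "cmp (src P) (cmp (src P) g j) i = g" if "g \<in> arr (src P)" "dm (src P) g = dm (src P) i" for g
    using that by (simp add: ij(5))
  have Pij: "cmp (tgt P) (fa P i) (fa P j) = idn (tgt P) (fo P (cd (src P) i))"
    using arg_cong[OF ij(6), of "fa P"] by simp
  show ?thesis
  proof (rule cocartI)
    show "i \<in> arr (src P)" by simp
    fix g v assume g: "g \<in> arr (src P)" "dm (src P) g = dm (src P) i" "v \<in> arr (tgt P)"
     "dm (tgt P) v = fo P (cd (src P) i)" "cd (tgt P) v = fo P (cd (src P) g)" "fa P g = cmp (tgt P) v (fa P i)"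
    have "fa P (cmp (src P) g j) = v" using g Pij by simp
    moreover have "cmp (src P) (cmp (src P) g j) i = g" by (rule l) (use g in simp_all)
    moreover have "h = cmp (src P) g j" if "h \<in> arr (src P)" "dm (src P) h = cd (src P) i" "cmp (src P) h i = g" for h
      using r[OF that(1,2)] unfolding that(3) by (rule sym)
    ultimately show "\<exists>!h. h \<in> arr (src P) \<and> dm (src P) h = cd (src P) i \<and> cd (src P) h = cd (src P) g \<and> cmp (src P) h i = g \<and> fa P h = v"
      using g(1,2) by (intro ex1I[of _ "cmp (src P) g j"]) (simp_all del: category_assoc)
  qed
qed

text \<open>Each of the two arrows is lifted through the other over an identity, and uniqueness of
  lifts makes the results mutually inverse.\<close>

lemma cocart_comparison:
  assumes P: "is_functor P" and e: "e \<in> cocart P" and e': "e' \<in> cocart P"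
    and d: "dm (src P) e = dm (src P) e'" and f: "fa P e = fa P e'"
  obtains h where "h \<in> isos (src P)" "dm (src P) h = cd (src P) e" "cd (src P) h = cd (src P) e'"
    "cmp (src P) h e = e'" "fa P h = idn (tgt P) (fo P (cd (src P) e))"
proof -
  note [simp] = P cocartD(1)[OF e] cocartD(1)[OF e']
  have c: "fo P (cd (src P) e) = fo P (cd (src P) e')"
    using functor_fa(3)[OF P refl, of e] functor_fa(3)[OF P refl, of e'] f by simp
  have fe: "cmp (tgt P) (idn (tgt P) (fo P (cd (src P) e'))) (fa P e') = fa P e'" by simp
  obtain h where h: "h \<in> arr (src P)" "dm (src P) h = cd (src P) e" "cd (src P) h = cd (src P) e'"
    "cmp (src P) h e = e'" "fa P h = idn (tgt P) (fo P (cd (src P) e))"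
    by (rule cocart_lift[OF P e, of e' "idn (tgt P) (fo P (cd (src P) e))"]) (use d f c in simp_all)
  obtain k where k: "k \<in> arr (src P)" "dm (src P) k = cd (src P) e'" "cd (src P) k = cd (src P) e"
    "cmp (src P) k e' = e" "fa P k = idn (tgt P) (fo P (cd (src P) e))"
    by (rule cocart_lift[OF P e', of e "idn (tgt P) (fo P (cd (src P) e))"]) (use d f c in simp_all)
  have "cmp (src P) k h = idn (src P) (cd (src P) e)"
    by (rule cocart_unique[OF P e]) (use h k in simp_all)
  moreover have "cmp (src P) h k = idn (src P) (cd (src P) e')"
    by (rule cocart_unique[OF P e']) (use h k c in simp_all)
  ultimately have "h \<in> isos (src P)" using h k by (intro isosI[where g = k]) simp_all
  then show ?thesis using that h by blast
qed

text \<open>The arrow \<open>k\<close> lifts an identity over the inverse \<open>v\<close> of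
  \<open>fa P e\<close>, hence is a left inverse; that it is also a right inverse is uniqueness of
  lifts through \<open>e\<close>.\<close>

lemma cocart_fa_iso:
  assumes P: "is_functor P" and e: "e \<in> cocart P" and i: "fa P e \<in> isos (tgt P)"
  shows "e \<in> isos (src P)"
  using i
proof (rule isosE)
  note [simp] = P cocartD(1)[OF e]
  fix v assume v: "fa P e \<in> arr (tgt P)" "v \<in> arr (tgt P)" "dm (tgt P) v = cd (tgt P) (fa P e)"
    "cd (tgt P) v = dm (tgt P) (fa P e)" "cmp (tgt P) v (fa P e) = idn (tgt P) (dm (tgt P) (fa P e))"
    "cmp (tgt P) (fa P e) v = idn (tgt P) (cd (tgt P) (fa P e))"
  obtain k where k: "k \<in> arr (src P)" "dm (src P) k = cd (src P) e" "cd (src P) k = dm (src P) e"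
    "cmp (src P) k e = idn (src P) (dm (src P) e)" "fa P k = v"
    by (rule cocart_lift[OF P e, of "idn (src P) (dm (src P) e)" v]) (use v in simp_all)
  have "cmp (src P) e k = idn (src P) (cd (src P) e)"
    by (rule cocart_unique[OF P e]) (use k v in simp_all)
  then show ?thesis using k by (intro isosI[where g = k]) simp_all
qed

text \<open>The identity in the definition of \<open>vertical\<close> can only be the one at the
  image of the domain, which turns the existential condition into an equation.\<close>

lemma vertical_iff:
  assumes P: "is_functor P"
  shows "h \<in> vertical P \<longleftrightarrow> h \<in> arr (src P) \<and> fa P h = idn (tgt P) (fo P (dm (src P) h))"
proof
  assume h: "h \<in> vertical P"
  then obtain b where b: "h \<in> arr (src P)" "b \<in> obj (tgt P)" "fa P h = idn (tgt P) b" by (auto simp: vertical_def)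
  then have "fo P (dm (src P) h) = b" using functor_fa(2)[OF P refl, of h] P by simp
  then show "h \<in> arr (src P) \<and> fa P h = idn (tgt P) (fo P (dm (src P) h))" using b by simp
qed (use P in \<open>auto simp: vertical_def\<close>)

section \<open>Normally cloven cofibrations\<close>

locale ncloven =
  fixes \<P> :: "'u ent cloven"
  assumes cloven: "cloven_cofibration \<P>" and normal: "normal_cleavage \<P>"
begin

abbreviation P where "P \<equiv> prj \<P>"
abbreviation E where "E \<equiv> src P"
abbreviation B where "B \<equiv> tgt P"

lemma P_functor [simp]: "is_functor P"
  using cloven by (simp add: cloven_cofibration_def)

lemma liftable_iff: "liftable \<P> x u \<longleftrightarrow> x \<in> obj E \<and> u \<in> arr B \<and> dm B u = fo P x"
  by (simp add: liftable_def)

lemma lift_facts [simp]: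
  assumes "x \<in> obj E" "u \<in> arr B" "dm B u = fo P x"
  shows "lift \<P> x u \<in> cocart P" "lift \<P> x u \<in> arr E" "dm E (lift \<P> x u) = x" "cd E (lift \<P> x u) = push \<P> u x"
    "fa P (lift \<P> x u) = u"
  using cloven assms by (auto simp: cloven_cofibration_def liftable_iff push_def dest: cocartD(1))

lemma push_facts [simp]:
  assumes "x \<in> obj E" "u \<in> arr B" "dm B u = fo P x"
  shows "push \<P> u x \<in> obj E" "fo P (push \<P> u x) = cd B u"
  using lift_facts[OF assms] category_arr(2)[of E "lift \<P> x u"] functor_fa(3)[of P B "lift \<P> x u"] by simp_all

lemma lift_idn [simp]:
  assumes "x \<in> obj E" "b = fo P x" shows "lift \<P> x (idn B b) = idn E x" "push \<P> (idn B b) x = x"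
  using normal assms by (auto simp: normal_cleavage_def push_def)

text \<open>Cancellation of a chosen lift. Equations between structure arrows are settled by this
  rule, or by \<open>cocart_unique\<close> when a composite of lifts is to be cancelled.\<close>

lemma lift_eqI:
  assumes "x \<in> obj E" "u \<in> arr B" "dm B u = fo P x" "h \<in> arr E" "h' \<in> arr E" "dm E h = push \<P> u x" "dm E h' = push \<P> u x"
    "cd E h = cd E h'" "cmp E h (lift \<P> x u) = cmp E h' (lift \<P> x u)" "fa P h = fa P h'"
  shows "h = h'"
  by (rule cocart_unique[OF P_functor, of "lift \<P> x u"]) (use assms in simp_all)

text \<open>The arrow \<open>f\<close> followed by the lift at its target is factored through the
  lift at its source, over \<open>v\<close>; the commutation required of an arrow of the comma
  category is what makes its image factor.\<close>

lemma action_ex1: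
  assumes z: "z \<in> arr (comma P)"
  shows "\<exists>!h. h \<in> hom E (push \<P> (rgt (mor_src z)) (lft (mor_src z))) (push \<P> (rgt (mor_tgt z)) (lft (mor_tgt z))) \<and>
     fa P h = mor_snd z \<and> cmp E h (lift \<P> (lft (mor_src z)) (rgt (mor_src z))) =
     cmp E (lift \<P> (lft (mor_tgt z)) (rgt (mor_tgt z))) (mor_fst z)"
  using z
proof (rule comma_arrE)
  fix x u y w f v
  assume a: "z = mor (Pr x u) (Pr y w) f v" "x \<in> obj E" "u \<in> arr B" "dm B u = fo P x"
    "y \<in> obj E" "w \<in> arr B" "dm B w = fo P y" "f \<in> arr E" "dm E f = x" "cd E f = y"
    "v \<in> arr B" "dm B v = cd B u" "cd B v = cd B w" "cmp B v u = cmp B w (fa P f)"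
  obtain h where h: "h \<in> arr E" "dm E h = cd E (lift \<P> x u)" "cd E h = cd E (cmp E (lift \<P> y w) f)"
    "cmp E h (lift \<P> x u) = cmp E (lift \<P> y w) f" "fa P h = v"
    by (rule cocart_lift[OF P_functor, of "lift \<P> x u" "cmp E (lift \<P> y w) f" v]) (use a in simp_all)
  show ?thesis
  proof (rule ex1I[of _ h])
    fix h' assume "h' \<in> hom E (push \<P> (rgt (mor_src z)) (lft (mor_src z))) (push \<P> (rgt (mor_tgt z)) (lft (mor_tgt z))) \<and>
     fa P h' = mor_snd z \<and> cmp E h' (lift \<P> (lft (mor_src z)) (rgt (mor_src z))) =
     cmp E (lift \<P> (lft (mor_tgt z)) (rgt (mor_tgt z))) (mor_fst z)"
    with a h show "h' = h" by - (rule lift_eqI[of x u], simp_all)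
  qed (use a h in simp)
qed

lemma action_L_sel [simp]: "src (action_L \<P>) = comma P" "tgt (action_L \<P>) = E"
  "a \<in> obj (comma P) \<Longrightarrow> fo (action_L \<P>) a = push \<P> (rgt a) (lft a)"
  by (simp_all add: action_L_def Let_def)

lemma action_L_fa:
  assumes z: "z \<in> arr (comma P)"
  shows "fa (action_L \<P>) z \<in> arr E" "dm E (fa (action_L \<P>) z) = push \<P> (rgt (mor_src z)) (lft (mor_src z))"
    "cd E (fa (action_L \<P>) z) = push \<P> (rgt (mor_tgt z)) (lft (mor_tgt z))"
    "fa P (fa (action_L \<P>) z) = mor_snd z"
    "cmp E (fa (action_L \<P>) z) (lift \<P> (lft (mor_src z)) (rgt (mor_src z))) =
     cmp E (lift \<P> (lft (mor_tgt z)) (rgt (mor_tgt z))) (mor_fst z)"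
proof -
  have "fa (action_L \<P>) z = (THE h. h \<in> hom E (push \<P> (rgt (mor_src z)) (lft (mor_src z))) (push \<P> (rgt (mor_tgt z)) (lft (mor_tgt z))) \<and>
     fa P h = mor_snd z \<and> cmp E h (lift \<P> (lft (mor_src z)) (rgt (mor_src z))) =
     cmp E (lift \<P> (lft (mor_tgt z)) (rgt (mor_tgt z))) (mor_fst z))"
    using z by (simp add: action_L_def Let_def)
  from theI'[OF action_ex1[OF z], folded this]
  show "fa (action_L \<P>) z \<in> arr E" "dm E (fa (action_L \<P>) z) = push \<P> (rgt (mor_src z)) (lft (mor_src z))"
    "cd E (fa (action_L \<P>) z) = push \<P> (rgt (mor_tgt z)) (lft (mor_tgt z))"
    "fa P (fa (action_L \<P>) z) = mor_snd z"
    "cmp E (fa (action_L \<P>) z) (lift \<P> (lft (mor_src z)) (rgt (mor_src z))) =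
     cmp E (lift \<P> (lft (mor_tgt z)) (rgt (mor_tgt z))) (mor_fst z)" by simp_all
qed

lemma action_L_eqI:
  assumes z: "z \<in> arr (comma P)" and "h \<in> arr E" "dm E h = push \<P> (rgt (mor_src z)) (lft (mor_src z))"
    "cd E h = push \<P> (rgt (mor_tgt z)) (lft (mor_tgt z))" "fa P h = mor_snd z"
    "cmp E h (lift \<P> (lft (mor_src z)) (rgt (mor_src z))) =
     cmp E (lift \<P> (lft (mor_tgt z)) (rgt (mor_tgt z))) (mor_fst z)"
  shows "fa (action_L \<P>) z = h"
proof (rule lift_eqI)
  show "lft (mor_src z) \<in> obj E" "rgt (mor_src z) \<in> arr B" "dm B (rgt (mor_src z)) = fo P (lft (mor_src z))"
    using comma_arrD(1)[OF z] by (auto elim: comma_objE)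
qed (use assms action_L_fa[OF z] in simp_all)

lemma action_L_mor [simp]:
  assumes z: "mor (Pr x u) (Pr y w) f v \<in> arr (comma P)"
  shows "cmp E (fa (action_L \<P>) (mor (Pr x u) (Pr y w) f v)) (lift \<P> x u) = cmp E (lift \<P> y w) f"
    "fa P (fa (action_L \<P>) (mor (Pr x u) (Pr y w) f v)) = v"
  using action_L_fa(4,5)[OF z] by simp_all

lemma is_functor_action_L [simp]: "is_functor (action_L \<P>)"
proof -
  \<comment> \<open>\<open>action_L\<close> equals the functor rebuilt from its own values, so
    functoriality can be argued from \<open>action_L_fa\<close> instead of the description by
    \<open>THE\<close>.\<close>
  have "is_functor (mk_functor (comma P) E (fo (action_L \<P>)) (fa (action_L \<P>)))"
  proof (rule is_functor_mk)
    fix a assume "a \<in> obj (comma P)"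
    then obtain x u where a: "a = Pr x u" "x \<in> obj E" "u \<in> arr B" "dm B u = fo P x" by (rule comma_objE)
    then show "fo (action_L \<P>) a \<in> obj E" by simp
    show "fa (action_L \<P>) (idn (comma P) a) = idn E (fo (action_L \<P>) a)"
      by (rule action_L_eqI) (use a in simp_all)
  next
    fix z assume z: "z \<in> arr (comma P)"
    then show "fa (action_L \<P>) z \<in> arr E \<and> dm E (fa (action_L \<P>) z) = fo (action_L \<P>) (dm (comma P) z) \<and>
      cd E (fa (action_L \<P>) z) = fo (action_L \<P>) (cd (comma P) z)"
      using action_L_fa[OF z] comma_arrD[OF z] by simp
    fix z' assume z': "z' \<in> arr (comma P)" and e: "cd (comma P) z = dm (comma P) z'"
    show "fa (action_L \<P>) (cmp (comma P) z' z) = cmp E (fa (action_L \<P>) z') (fa (action_L \<P>) z)"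
    proof (rule action_L_eqI)
      show "cmp (comma P) z' z \<in> arr (comma P)" using category_cmp(1)[OF category_comma[OF P_functor] z z' e] .
      have s: "mor_tgt z = mor_src z'" using z z' e by simp
      have x: "lft (mor_src z) \<in> obj E" "rgt (mor_src z) \<in> arr B" "dm B (rgt (mor_src z)) = fo P (lft (mor_src z))"
        "lft (mor_tgt z) \<in> obj E" "rgt (mor_tgt z) \<in> arr B" "dm B (rgt (mor_tgt z)) = fo P (lft (mor_tgt z))"
        "lft (mor_tgt z') \<in> obj E" "rgt (mor_tgt z') \<in> arr B" "dm B (rgt (mor_tgt z')) = fo P (lft (mor_tgt z'))"
        using comma_arrD(1,2)[OF z] comma_arrD(2)[OF z'] by (auto elim!: comma_objE)
      note L = action_L_fa[OF z] action_L_fa[OF z'] comma_arrD(3-8)[OF z] comma_arrD(3-8)[OF z']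
      have "cmp E (fa (action_L \<P>) z') (cmp E (fa (action_L \<P>) z) (lift \<P> (lft (mor_src z)) (rgt (mor_src z)))) =
          cmp E (fa (action_L \<P>) z') (cmp E (lift \<P> (lft (mor_src z')) (rgt (mor_src z'))) (mor_fst z))"
        using L(5) s by simp
      also have "\<dots> = cmp E (lift \<P> (lft (mor_tgt z')) (rgt (mor_tgt z'))) (cmp E (mor_fst z') (mor_fst z))"
        by (rule category_reassoc[OF L(10)]) (use L x s in simp_all)
      finally show "cmp E (cmp E (fa (action_L \<P>) z') (fa (action_L \<P>) z))
          (lift \<P> (lft (mor_src (cmp (comma P) z' z))) (rgt (mor_src (cmp (comma P) z' z)))) =
        cmp E (lift \<P> (lft (mor_tgt (cmp (comma P) z' z))) (rgt (mor_tgt (cmp (comma P) z' z)))) (mor_fst (cmp (comma P) z' z))"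
        using L x s z z' by simp
    qed (use z z' e action_L_fa[OF z] action_L_fa[OF z'] in simp_all)
  qed simp_all
  moreover have "mk_functor (comma P) E (fo (action_L \<P>)) (fa (action_L \<P>)) = action_L \<P>"
    by (simp add: mk_functor_def action_L_def Let_def fo_def fa_def)
  ultimately show ?thesis by simp
qed

lemma action_square_sel [simp]:
  "src (action_square \<P>) = comma_cod P" "tgt (action_square \<P>) = P"
  "top1 (action_square \<P>) = action_L \<P>" "bot1 (action_square \<P>) = id1 CAT B"
  by (simp_all add: action_square_def)

lemma action_square_cell [simp]: "action_square \<P> \<in> cells1 CAT2"
  unfolding action_square_def
  by (rule squareI) (auto elim!: comma_objE simp: action_L_fa comma_arrD)

text \<open>Normality enters here: over identities the chosen lifts are identities, so the equation
  that defines \<open>L(f, P f)\<close> becomes \<open>h = f\<close>.\<close>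

lemma action_unit: "comp1 CAT2 (action_square \<P>) (munit CommaMonad P) = id1 CAT2 P"
proof -
  have "comp1 CAT (action_L \<P>) (comma_H P) = id1 CAT E"
  proof (rule functor_eqI)
    fix f assume "f \<in> arr (src (comp1 CAT (action_L \<P>) (comma_H P)))"
    then have f: "f \<in> arr E" by simp
    have "fa (comma_H P) f \<in> arr (comma P)" "mor_src (fa (comma_H P) f) = Pr (dm E f) (idn B (fo P (dm E f)))"
      "mor_tgt (fa (comma_H P) f) = Pr (cd E f) (idn B (fo P (cd E f)))"
      using f by (simp_all add: comma_H_def Let_def)
    then have "fa (action_L \<P>) (fa (comma_H P) f) = f"
      using f by (intro action_L_eqI) simp_all
    then show "fa (comp1 CAT (action_L \<P>) (comma_H P)) f = fa (id1 CAT E) f" using f by simp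
  qed auto
  then show ?thesis by (auto intro!: square_eqI)
qed

text \<open>A composite of two lifts is cocartesian over \<open>v u\<close>, and so is the lift over
  \<open>v u\<close>; the comparison of the two is the required arrow, and cancelling the composite
  gives uniqueness.\<close>

lemma chi_ex1:
  assumes x: "x \<in> obj E" "u \<in> arr B" "dm B u = fo P x" "v \<in> arr B" "dm B v = cd B u"
  shows "\<exists>!h. h \<in> vertical P \<and> h \<in> isos E \<and> h \<in> hom E (push \<P> v (push \<P> u x)) (push \<P> (cmp B v u) x) \<and>
       cmp E h (cmp E (lift \<P> (push \<P> u x) v) (lift \<P> x u)) = lift \<P> x (cmp B v u)"
proof -
  let ?d = "cmp E (lift \<P> (push \<P> u x) v) (lift \<P> x u)"
  have d: "?d \<in> cocart P" by (rule cocart_cmp) (use x in simp_all)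
  obtain h where h: "h \<in> isos E" "dm E h = cd E ?d" "cd E h = cd E (lift \<P> x (cmp B v u))"
    "cmp E h ?d = lift \<P> x (cmp B v u)" "fa P h = idn B (fo P (cd E ?d))"
    by (rule cocart_comparison[OF P_functor d, of "lift \<P> x (cmp B v u)"]) (use x in simp_all)
  show ?thesis
    by (rule ex1I[of _ h]; (rule cocart_unique[OF P_functor d])?) (use h x in \<open>simp_all add: vertical_iff\<close>)
qed

lemma chi_facts [simp]:
  assumes x: "x \<in> obj E" "u \<in> arr B" "dm B u = fo P x" "v \<in> arr B" "dm B v = cd B u"
  shows "chi_comp \<P> v u x \<in> isos E" "chi_comp \<P> v u x \<in> arr E" "dm E (chi_comp \<P> v u x) = push \<P> v (push \<P> u x)"
    "cd E (chi_comp \<P> v u x) = push \<P> (cmp B v u) x" "fa P (chi_comp \<P> v u x) = idn B (cd B v)"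
    "cmp E (chi_comp \<P> v u x) (cmp E (lift \<P> (push \<P> u x) v) (lift \<P> x u)) = lift \<P> x (cmp B v u)"
  using theI'[OF chi_ex1[OF assms]] x unfolding chi_comp_def Let_def by (auto simp: vertical_iff)

lemma chi_eqI:
  assumes x: "x \<in> obj E" "u \<in> arr B" "dm B u = fo P x" "v \<in> arr B" "dm B v = cd B u"
    and h: "h \<in> arr E" "dm E h = push \<P> v (push \<P> u x)" "cd E h = push \<P> (cmp B v u) x" "fa P h = idn B (cd B v)"
    "cmp E h (cmp E (lift \<P> (push \<P> u x) v) (lift \<P> x u)) = lift \<P> x (cmp B v u)"
  shows "h = chi_comp \<P> v u x"
proof (rule cocart_unique[OF P_functor])
  show "cmp E (lift \<P> (push \<P> u x) v) (lift \<P> x u) \<in> cocart P" by (rule cocart_cmp) (use x in simp_all)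
qed (use x h in simp_all)

end

section \<open>Componentwise criteria in the arrow 2-category and iterated comma categories\<close>

interpretation Comma: tmonad CAT2 CommaMonad
  by unfold_locales (rule two_monad_comma)

lemma square2_componentI:
  assumes "\<sigma> \<in> cells2 CAT2" "\<tau> \<in> cells2 CAT2" "src \<sigma> = src \<tau>" "tgt \<sigma> = tgt \<tau>" "bot1 \<sigma> = bot1 \<tau>"
    "\<And>x. x \<in> obj (src (src (src \<sigma>))) \<Longrightarrow> dat (top1 \<sigma>) x = dat (top1 \<tau>) x"
  shows "\<sigma> = \<tau>"
proof (rule square2_eqI)
  show "top1 \<sigma> = top1 \<tau>" by (rule trans_eqI) (use assms in simp_all)
qed (use assms in simp_all)

text \<open>The inverses of the components are collected into a transformation. Since the bottom
  cell is an identity the components are vertical, hence so are their inverses, and the inverse is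
  again a 2-cell over an identity.\<close>

lemma invertible_CAT2I:
  assumes \<sigma>: "\<sigma> \<in> cells2 CAT2" and b: "bot1 \<sigma> = id2 CAT (bot1 (src \<sigma>))"
    and i: "\<And>x. x \<in> obj (src (src (src \<sigma>))) \<Longrightarrow> dat (top1 \<sigma>) x \<in> isos (src (tgt (src \<sigma>)))"
  shows "invertible2 CAT2 \<sigma>"
proof -
  define C where "C = src (src (src \<sigma>))"
  define D where "D = src (tgt (src \<sigma>))"
  define s where "s = src \<sigma>"
  define t where "t = tgt \<sigma>"
  have s: "s \<in> cells1 CAT2" "t \<in> cells1 CAT2" and st [simp]: "src \<sigma> = s" "tgt \<sigma> = t" "src t = src s" "tgt t = tgt s"
    using \<sigma> by (simp_all add: s_def t_def)
  have CD [simp]: "src (src s) = C" "src (tgt s) = D"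
    unfolding C_def D_def s_def by (rule refl)+
  note [simp] = \<sigma> s
  have [simp]: "category C" "category D" "category (tgt (tgt s))"
    using functor_cat(1)[OF squareD(1)[OF s(1)] CD(1)] functor_cat(1)[OF squareD(2)[OF s(1)] CD(2)]
    by simp_all
  have bt: "bot1 t = bot1 s" using square2D(6)[OF \<sigma>] b by simp
  \<comment> \<open>Inverses are picked pointwise; naturality is then inherited from
    \<open>\<sigma>\<close>.\<close>
  define g where "g x = (SOME g. g \<in> arr D \<and> dm D g = cd D (dat (top1 \<sigma>) x) \<and> cd D g = dm D (dat (top1 \<sigma>) x) \<and>
    cmp D g (dat (top1 \<sigma>) x) = idn D (dm D (dat (top1 \<sigma>) x)) \<and> cmp D (dat (top1 \<sigma>) x) g = idn D (cd D (dat (top1 \<sigma>) x)))" for x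
  have \<sigma>x: "dat (top1 \<sigma>) x \<in> arr D" "dm D (dat (top1 \<sigma>) x) = fo (top1 s) x" "cd D (dat (top1 \<sigma>) x) = fo (top1 t) x"
    if "x \<in> obj C" for x
    using trans_arr[of "top1 \<sigma>" D x] that by simp_all
  have g: "g x \<in> arr D" "dm D (g x) = fo (top1 t) x" "cd D (g x) = fo (top1 s) x"
    "cmp D (g x) (dat (top1 \<sigma>) x) = idn D (fo (top1 s) x)" "cmp D (dat (top1 \<sigma>) x) (g x) = idn D (fo (top1 t) x)"
    if x: "x \<in> obj C" for x
  proof -
    have "dat (top1 \<sigma>) x \<in> isos D" using i x by simp
    then have "\<exists>g. g \<in> arr D \<and> dm D g = cd D (dat (top1 \<sigma>) x) \<and> cd D g = dm D (dat (top1 \<sigma>) x) \<and>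
    cmp D g (dat (top1 \<sigma>) x) = idn D (dm D (dat (top1 \<sigma>) x)) \<and> cmp D (dat (top1 \<sigma>) x) g = idn D (cd D (dat (top1 \<sigma>) x))"
      by (rule isosE) auto
    from someI_ex[OF this, folded g_def]
    show "g x \<in> arr D" "dm D (g x) = fo (top1 t) x" "cd D (g x) = fo (top1 s) x"
    "cmp D (g x) (dat (top1 \<sigma>) x) = idn D (fo (top1 s) x)" "cmp D (dat (top1 \<sigma>) x) (g x) = idn D (fo (top1 t) x)"
      using \<sigma>x[OF x] by auto
  qed
  have tr: "is_trans (mk_trans (top1 t) (top1 s) g)"
  proof (rule is_trans_mk[where C = C and D = D])
    fix f assume f: "f \<in> arr C"
    then have d: "dm C f \<in> obj C" "cd C f \<in> obj C" by simp_all
    have F: "fa (top1 t) f \<in> arr D" "dm D (fa (top1 t) f) = fo (top1 t) (dm C f)" "cd D (fa (top1 t) f) = fo (top1 t) (cd C f)"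
      "fa (top1 s) f \<in> arr D" "dm D (fa (top1 s) f) = fo (top1 s) (dm C f)" "cd D (fa (top1 s) f) = fo (top1 s) (cd C f)"
      using f functor_fa[of "top1 t" D f] functor_fa[of "top1 s" D f] by simp_all
    have n: "cmp D (dat (top1 \<sigma>) (cd C f)) (fa (top1 s) f) = cmp D (fa (top1 t) f) (dat (top1 \<sigma>) (dm C f))"
      using trans_nat[of "top1 \<sigma>" C D f] f by simp
    note ty = F g(1-3)[OF d(1)] g(1-3)[OF d(2)] \<sigma>x[OF d(1)] \<sigma>x[OF d(2)]
    \<comment> \<open>The naturality square of \<open>\<sigma>\<close> is conjugated by the chosen
      inverses.\<close>
    have "cmp D (g (cd C f)) (fa (top1 t) f) = cmp D (g (cd C f)) (cmp D (cmp D (fa (top1 t) f) (dat (top1 \<sigma>) (dm C f))) (g (dm C f)))"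
      using ty g(5)[OF d(1)] by simp
    also have "\<dots> = cmp D (cmp D (g (cd C f)) (dat (top1 \<sigma>) (cd C f))) (cmp D (fa (top1 s) f) (g (dm C f)))"
      unfolding n[symmetric] using ty by simp
    also have "\<dots> = cmp D (fa (top1 s) f) (g (dm C f))" unfolding g(4)[OF d(2)] using ty by simp
    finally show "cmp D (g (cd C f)) (fa (top1 t) f) = cmp D (fa (top1 s) f) (g (dm C f))" .
  qed (use g in simp_all)
  have c: "Cell t s (mk_trans (top1 t) (top1 s) g, id2 CAT (bot1 s)) \<in> cells2 CAT2"
  proof (rule square2I)
    fix x assume "x \<in> obj (src (src t))"
    then have x: "x \<in> obj C" by simp
    have "cmp (tgt (tgt s)) (fa (tgt s) (g x)) (fa (tgt s) (dat (top1 \<sigma>) x)) = idn (tgt (tgt s)) (fo (tgt s) (fo (top1 s) x))"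
      using arg_cong[OF g(4)[OF x], of "fa (tgt s)"] g(1-3)[OF x] \<sigma>x[OF x] functor_fo[of "top1 s" D x] x by simp
    moreover have "fa (tgt s) (dat (top1 \<sigma>) x) = idn (tgt (tgt s)) (fo (bot1 s) (fo (src s) x))"
      using square2_commute[OF \<sigma>, of x] x b by simp
    moreover have "fo (tgt s) (fo (top1 s) x) = fo (bot1 s) (fo (src s) x)" "fo (tgt s) (fo (top1 t) x) = fo (bot1 s) (fo (src s) x)"
      using square_commute(1)[OF s(1), of x] square_commute(1)[OF s(2), of x] x bt by simp_all
    ultimately show "fa (tgt t) (dat (mk_trans (top1 t) (top1 s) g) x) = dat (id2 CAT (bot1 s)) (fo (src t) x)"
      using functor_fa[of "tgt s" "tgt (tgt s)" "g x"] g(1-3)[OF x] x by simp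
  qed (use tr bt in simp_all)
  have e: "vcomp CAT2 (Cell t s (mk_trans (top1 t) (top1 s) g, id2 CAT (bot1 s))) \<sigma> = id2 CAT2 s"
    "vcomp CAT2 \<sigma> (Cell t s (mk_trans (top1 t) (top1 s) g, id2 CAT (bot1 s))) = id2 CAT2 t"
    using c by (intro square2_componentI, simp_all add: b bt g)+
  show ?thesis unfolding invertible2_def
    by (intro conjI bexI[OF _ c]) (use e in simp_all)
qed

lemma invertible_CAT2D:
  assumes i: "invertible2 CAT2 \<sigma>" and x: "x \<in> obj (src (src (src \<sigma>)))"
  shows "dat (top1 \<sigma>) x \<in> isos (src (tgt (src \<sigma>)))"
proof -
  obtain \<tau> where t: "\<sigma> \<in> cells2 CAT2" "\<tau> \<in> cells2 CAT2" "src \<tau> = tgt \<sigma>" "tgt \<tau> = src \<sigma>"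
    "vcomp CAT2 \<tau> \<sigma> = id2 CAT2 (src \<sigma>)" "vcomp CAT2 \<sigma> \<tau> = id2 CAT2 (tgt \<sigma>)"
    using i unfolding invertible2_def by blast
  have e: "src (tgt \<sigma>) = src (src \<sigma>)" "tgt (tgt \<sigma>) = tgt (src \<sigma>)" and c: "src \<sigma> \<in> cells1 CAT2" "tgt \<sigma> \<in> cells1 CAT2"
    using t(1) by simp_all
  have 1: "cmp (src (tgt (src \<sigma>))) (dat (top1 \<tau>) x) (dat (top1 \<sigma>) x) = idn (src (tgt (src \<sigma>))) (fo (top1 (src \<sigma>)) x)"
    using arg_cong[OF t(5), of "\<lambda>\<sigma>. dat (top1 \<sigma>) x"] x t(1-4) e c by simp
  have 2: "cmp (src (tgt (src \<sigma>))) (dat (top1 \<sigma>) x) (dat (top1 \<tau>) x) = idn (src (tgt (src \<sigma>))) (fo (top1 (tgt \<sigma>)) x)"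
    using arg_cong[OF t(6), of "\<lambda>\<sigma>. dat (top1 \<sigma>) x"] x t(1-4) e c by simp
  show ?thesis
    by (rule isosI[where g = "dat (top1 \<tau>) x"]) (use 1 2 t(1-4) x e c in simp_all)
qed

lemma comma_map_fa:
  "z \<in> arr (comma (src s)) \<Longrightarrow> fa (comma_map s) z =
    mor (comma_map_obj s (mor_src z)) (comma_map_obj s (mor_tgt z)) (fa (top1 s) (mor_fst z)) (fa (bot1 s) (mor_snd z))"
  by (simp add: comma_map_def)

lemma comma_M_fa:
  "z \<in> arr (comma (comma_cod P)) \<Longrightarrow> fa (comma_M P) z =
    mor (Pr (lft (lft (mor_src z))) (cmp (tgt P) (rgt (mor_src z)) (rgt (lft (mor_src z)))))
      (Pr (lft (lft (mor_tgt z))) (cmp (tgt P) (rgt (mor_tgt z)) (rgt (lft (mor_tgt z)))))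
      (mor_fst (mor_fst z)) (mor_snd z)"
  by (simp add: comma_M_def Let_def)

lemma comma_H_fa:
  "f \<in> arr (src P) \<Longrightarrow> fa (comma_H P) f =
    mor (Pr (dm (src P) f) (idn (tgt P) (fo P (dm (src P) f)))) (Pr (cd (src P) f) (idn (tgt P) (fo P (cd (src P) f)))) f (fa P f)"
  by (simp add: comma_H_def Let_def)

lemma comma_square2_dat:
  "a \<in> obj (comma (src (src \<sigma>))) \<Longrightarrow> dat (top1 (comma_square2 \<sigma>)) a =
    mor (comma_map_obj (src \<sigma>) a) (comma_map_obj (tgt \<sigma>) a) (dat (top1 \<sigma>) (lft a)) (dat (bot1 \<sigma>) (cd (tgt (src (src \<sigma>))) (rgt a)))"
  by (simp add: comma_square2_def Let_def)

lemma comma2_objE: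
  assumes "a \<in> obj (comma (comma_cod P))"
  obtains x u v where "a = Pr (Pr x u) v" "x \<in> obj (src P)" "u \<in> arr (tgt P)" "dm (tgt P) u = fo P x"
    "v \<in> arr (tgt P)" "dm (tgt P) v = cd (tgt P) u"
  using assms by (auto elim!: comma_objE)

lemma comma3_objE:
  assumes "a \<in> obj (comma (comma_cod (comma_cod P)))"
  obtains x u v w where "a = Pr (Pr (Pr x u) v) w" "x \<in> obj (src P)" "u \<in> arr (tgt P)" "dm (tgt P) u = fo P x"
    "v \<in> arr (tgt P)" "dm (tgt P) v = cd (tgt P) u" "w \<in> arr (tgt P)" "dm (tgt P) w = cd (tgt P) v"
  using assms by (auto elim!: comma_objE)

text \<open>The final equation is pasted from the two before it. It says that \<open>(f, s)\<close>
  is an arrow between the composites \<open>v u\<close> and \<open>t w\<close>, which is what the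
  multiplication \<open>comma_M\<close> needs.\<close>

lemma comma2_arrE:
  assumes P: "is_functor P" and z: "z \<in> arr (comma (comma_cod P))"
  obtains x u v y w t f r s where "z = mor (Pr (Pr x u) v) (Pr (Pr y w) t) (mor (Pr x u) (Pr y w) f r) s"
    "x \<in> obj (src P)" "u \<in> arr (tgt P)" "dm (tgt P) u = fo P x" "v \<in> arr (tgt P)" "dm (tgt P) v = cd (tgt P) u"
    "y \<in> obj (src P)" "w \<in> arr (tgt P)" "dm (tgt P) w = fo P y" "t \<in> arr (tgt P)" "dm (tgt P) t = cd (tgt P) w"
    "f \<in> arr (src P)" "dm (src P) f = x" "cd (src P) f = y"
    "r \<in> arr (tgt P)" "dm (tgt P) r = cd (tgt P) u" "cd (tgt P) r = cd (tgt P) w"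
    "s \<in> arr (tgt P)" "dm (tgt P) s = cd (tgt P) v" "cd (tgt P) s = cd (tgt P) t"
    "cmp (tgt P) r u = cmp (tgt P) w (fa P f)" "cmp (tgt P) s v = cmp (tgt P) t r"
    "cmp (tgt P) s (cmp (tgt P) v u) = cmp (tgt P) t (cmp (tgt P) w (fa P f))"
proof -
  have src: "mor_src z \<in> obj (comma (comma_cod P))" and tgt: "mor_tgt z \<in> obj (comma (comma_cod P))"
    using comma_arrD(1,2)[OF z] by auto
  from src obtain x u v where a: "mor_src z = Pr (Pr x u) v" "x \<in> obj (src P)" "u \<in> arr (tgt P)" "dm (tgt P) u = fo P x"
    "v \<in> arr (tgt P)" "dm (tgt P) v = cd (tgt P) u" by (rule comma2_objE)
  from tgt obtain y w t where b: "mor_tgt z = Pr (Pr y w) t" "y \<in> obj (src P)" "w \<in> arr (tgt P)" "dm (tgt P) w = fo P y"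
    "t \<in> arr (tgt P)" "dm (tgt P) t = cd (tgt P) w" by (rule comma2_objE)
  have q: "mor_fst z \<in> arr (comma P)" using z by simp
  have qd: "mor_src (mor_fst z) = Pr x u" "mor_tgt (mor_fst z) = Pr y w"
    using comma_arrD(4,5)[OF z] q a(1) b(1) by simp_all
  obtain f r where q': "mor_fst z = mor (Pr x u) (Pr y w) f r" "f \<in> arr (src P)" "dm (src P) f = x" "cd (src P) f = y"
    "r \<in> arr (tgt P)" "dm (tgt P) r = cd (tgt P) u" "cd (tgt P) r = cd (tgt P) w" "cmp (tgt P) r u = cmp (tgt P) w (fa P f)"
    using q qd by (auto elim!: comma_arrE)
  have z1: "z = mor (Pr (Pr x u) v) (Pr (Pr y w) t) (mor (Pr x u) (Pr y w) f r) (mor_snd z)"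
    using z a(1) b(1) q'(1) by (auto elim!: comma_arrE)
  have s: "mor_snd z \<in> arr (tgt P)" "dm (tgt P) (mor_snd z) = cd (tgt P) v" "cd (tgt P) (mor_snd z) = cd (tgt P) t"
    using comma_arrD(6-8)[OF z] a(1) b(1) by simp_all
  have e: "cmp (tgt P) (mor_snd z) v = cmp (tgt P) t r"
    using z q unfolding z1[THEN arg_cong, of "\<lambda>z. z \<in> arr (comma (comma_cod P))"] q'(1) by simp
  have "cmp (tgt P) (mor_snd z) (cmp (tgt P) v u) = cmp (tgt P) t (cmp (tgt P) r u)"
    by (rule category_reassoc[OF e]) (use P a b q' s in simp_all)
  then show ?thesis using that[OF z1 a(2-6) b(2-6) q'(2-7) s q'(8) e] q'(8) by simp
qed

section \<open>The normal pseudoalgebra of a normally cloven cofibration\<close>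

context ncloven
begin

text \<open>The defining equation of the action in front of a tail \<open>e\<close>, as right-nested
  composites require; \<open>chi_chain\<close> does the same for the multiplication cell. Together
  they evaluate any structure arrow on a string of lifts.\<close>

lemma L_chain [simp]:
  assumes z: "mor (Pr x u) (Pr y w) f v \<in> arr (comma P)" and e: "e \<in> arr E" "cd E e = x"
  shows "cmp E (fa (action_L \<P>) (mor (Pr x u) (Pr y w) f v)) (cmp E (lift \<P> x u) e) = cmp E (lift \<P> y w) (cmp E f e)"
  by (rule category_reassoc[OF action_L_mor(1)[OF z]]) (use z e action_L_fa(1-3)[OF z] in simp_all)

lemma chi_chain [simp]:
  assumes x: "x \<in> obj E" "u \<in> arr B" "dm B u = fo P x" "v \<in> arr B" "dm B v = cd B u" and e: "e \<in> arr E" "cd E e = x"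
  shows "cmp E (chi_comp \<P> v u x) (cmp E (lift \<P> (push \<P> u x) v) (cmp E (lift \<P> x u) e)) = cmp E (lift \<P> x (cmp B v u)) e"
proof -
  have "cmp E (chi_comp \<P> v u x) (cmp E (cmp E (lift \<P> (push \<P> u x) v) (lift \<P> x u)) e) =
      cmp E (cmp E (chi_comp \<P> v u x) (cmp E (lift \<P> (push \<P> u x) v) (lift \<P> x u))) e"
    by (rule category_assoc[symmetric]) (use x e in simp_all)
  then show ?thesis unfolding chi_facts(6)[OF x] using x e by simp
qed

lemma chi_cell_sel [simp]:
  "src (chi_cell \<P>) = comp1 CAT2 (action_square \<P>) (map1 (mfun CommaMonad) (action_square \<P>))"
  "tgt (chi_cell \<P>) = comp1 CAT2 (action_square \<P>) (mmult CommaMonad P)"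
  "bot1 (chi_cell \<P>) = id2 CAT (id1 CAT B)"
  "src (top1 (chi_cell \<P>)) = comp1 CAT (action_L \<P>) (comma_map (action_square \<P>))"
  "tgt (top1 (chi_cell \<P>)) = comp1 CAT (action_L \<P>) (comma_M P)"
  "Pr (Pr x u) v \<in> obj (comma (comma_cod P)) \<Longrightarrow> dat (top1 (chi_cell \<P>)) (Pr (Pr x u) v) = chi_comp \<P> v u x"
  by (simp_all add: chi_cell_def Let_def)

lemma mult_cell [simp]: "Cell (comma_cod (comma_cod P)) (comma_cod P) (comma_M P, id1 CAT B) \<in> cells1 CAT2"
  using Comma.mult_cell(1)[of P] by simp

lemma unit_cell [simp]: "Cell P (comma_cod P) (comma_H P, id1 CAT B) \<in> cells1 CAT2"
  using Comma.unit_cell(1)[of P] by simp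

text \<open>After precomposition with the composite of the two lifts, both ways around the
  naturality square become \<open>f\<close> followed by the lift of \<open>y\<close> over
  \<open>t w\<close>.\<close>

lemma chi_trans: "is_trans (top1 (chi_cell \<P>))"
  unfolding chi_cell_def Let_def top1_Cell
proof (rule is_trans_mk)
  fix a assume "a \<in> obj (comma (comma_cod P))"
  then show "chi_comp \<P> (rgt a) (rgt (lft a)) (lft (lft a)) \<in> arr E \<and>
         dm E (chi_comp \<P> (rgt a) (rgt (lft a)) (lft (lft a))) =
         fo (top1 (comp1 CAT2 (action_square \<P>) (map1 (mfun CommaMonad) (action_square \<P>)))) a \<and>
         cd E (chi_comp \<P> (rgt a) (rgt (lft a)) (lft (lft a))) =
         fo (top1 (comp1 CAT2 (action_square \<P>) (mmult CommaMonad P))) a"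
    by (auto elim!: comma2_objE)
next
  fix z assume z: "z \<in> arr (comma (comma_cod P))"
  then obtain x u v y w t f r s where z': "z = mor (Pr (Pr x u) v) (Pr (Pr y w) t) (mor (Pr x u) (Pr y w) f r) s"
    and [simp]: "x \<in> obj E" "u \<in> arr B" "dm B u = fo P x" "v \<in> arr B" "dm B v = cd B u"
    "y \<in> obj E" "w \<in> arr B" "dm B w = fo P y" "t \<in> arr B" "dm B t = cd B w"
    "f \<in> arr E" "dm E f = x" "cd E f = y" "r \<in> arr B" "dm B r = cd B u" "cd B r = cd B w"
    "s \<in> arr B" "dm B s = cd B v" "cd B s = cd B t"
    "cmp B r u = cmp B w (fa P f)" "cmp B s v = cmp B t r"
    "cmp B s (cmp B v u) = cmp B t (cmp B w (fa P f))" by (rule comma2_arrE[OF P_functor])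
  let ?z1 = "mor (Pr (push \<P> u x) v) (Pr (push \<P> w y) t) (fa (action_L \<P>) (mor (Pr x u) (Pr y w) f r)) s"
  let ?z2 = "mor (Pr x (cmp B v u)) (Pr y (cmp B t w)) f s"
  have L: "fa (comma_map (action_square \<P>)) z = ?z1" "fa (comma_M P) z = ?z2"
    using comma_map_fa[of z "action_square \<P>"] comma_M_fa[OF z] z unfolding z' by (simp_all add: comma_map_obj_def)
  have z12: "?z1 \<in> arr (comma P)" "?z2 \<in> arr (comma P)" by simp_all
  have "cmp E (chi_comp \<P> t w y) (fa (action_L \<P>) ?z1) = cmp E (fa (action_L \<P>) ?z2) (chi_comp \<P> v u x)"
  proof (rule cocart_unique[OF P_functor, of "cmp E (lift \<P> (push \<P> u x) v) (lift \<P> x u)"])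
    show "cmp E (lift \<P> (push \<P> u x) v) (lift \<P> x u) \<in> cocart P" by (rule cocart_cmp) simp_all
  qed simp_all
  then show "cmp E (chi_comp \<P> (rgt (cd (comma (comma_cod P)) z)) (rgt (lft (cd (comma (comma_cod P)) z)))
            (lft (lft (cd (comma (comma_cod P)) z))))
          (fa (top1 (comp1 CAT2 (action_square \<P>) (map1 (mfun CommaMonad) (action_square \<P>)))) z) =
         cmp E (fa (top1 (comp1 CAT2 (action_square \<P>) (mmult CommaMonad P))) z)
          (chi_comp \<P> (rgt (dm (comma (comma_cod P)) z)) (rgt (lft (dm (comma (comma_cod P)) z)))
            (lft (lft (dm (comma (comma_cod P)) z))))"
    using z L by (simp add: z' del: comma_mor)
qed simp_all

lemma chi_cell_cell [simp]: "chi_cell \<P> \<in> cells2 CAT2"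
proof -
  have "chi_cell \<P> = Cell (src (chi_cell \<P>)) (tgt (chi_cell \<P>)) (top1 (chi_cell \<P>), bot1 (chi_cell \<P>))"
    by (simp add: chi_cell_def Let_def)
  moreover have "\<dots> \<in> cells2 CAT2"
    by (rule square2I) (auto simp: chi_trans elim!: comma2_objE)
  ultimately show ?thesis by simp
qed

lemma chi_invertible: "invertible2 CAT2 (chi_cell \<P>)"
  by (rule invertible_CAT2I) (auto elim!: comma2_objE)

text \<open>By normality one of the two lifts is an identity, so an identity arrow satisfies the
  equation that characterises \<open>chi_comp\<close>.\<close>

lemma chi_idn:
  assumes x: "x \<in> obj E" "u \<in> arr B" "dm B u = fo P x"
  shows "chi_comp \<P> u (idn B (fo P x)) x = idn E (push \<P> u x)" "chi_comp \<P> (idn B (cd B u)) u x = idn E (push \<P> u x)"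
  by (rule chi_eqI[symmetric]; use x in simp)+

text \<open>Both sides lie over an identity and send the composite of the three lifts to the single
  lift over \<open>w v u\<close>; that composite is cocartesian, so it can be cancelled.\<close>

lemma chi_assoc:
  assumes x: "x \<in> obj E" "u \<in> arr B" "dm B u = fo P x" "v \<in> arr B" "dm B v = cd B u" "w \<in> arr B" "dm B w = cd B v"
  shows "cmp E (chi_comp \<P> w (cmp B v u) x) (fa (action_L \<P>)
      (mor (Pr (push \<P> v (push \<P> u x)) w) (Pr (push \<P> (cmp B v u) x) w) (chi_comp \<P> v u x) (idn B (cd B w)))) =
    cmp E (chi_comp \<P> (cmp B w v) u x) (chi_comp \<P> w v (push \<P> u x))"
proof (rule cocart_unique[OF P_functor])
  show "cmp E (lift \<P> (push \<P> v (push \<P> u x)) w) (cmp E (lift \<P> (push \<P> u x) v) (lift \<P> x u)) \<in> cocart P"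
    by (intro cocart_cmp) (use x in simp_all)
qed (use x in simp_all)

abbreviation A where "A \<equiv> action_square \<P>"
abbreviation \<eta>P where "\<eta>P \<equiv> Cell P (comma_cod P) (comma_H P, id1 CAT B)"
abbreviation \<eta>C where "\<eta>C \<equiv> Cell (comma_cod P) (comma_cod (comma_cod P)) (comma_H (comma_cod P), id1 CAT B)"
abbreviation \<mu>P where "\<mu>P \<equiv> Cell (comma_cod (comma_cod P)) (comma_cod P) (comma_M P, id1 CAT B)"
abbreviation \<mu>C where "\<mu>C \<equiv> Cell (comma_cod (comma_cod (comma_cod P))) (comma_cod (comma_cod P)) (comma_M (comma_cod P), id1 CAT B)"

lemma structure_cells [simp]: "\<eta>C \<in> cells1 CAT2" "\<mu>C \<in> cells1 CAT2"
  using Comma.unit_cell(1)[of "comma_cod P"] Comma.mult_cell(1)[of "comma_cod P"] by simp_all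

text \<open>These equations of 1-cells identify the boundaries of the 2-cells that occur in the
  pseudoalgebra laws; without them the two sides would not even be parallel.\<close>

lemma structure_laws:
  "comp1 CAT2 A \<eta>P = id1 CAT2 P"
  "comp1 CAT2 (comma_square A) (comma_square \<eta>P) = id1 CAT2 (comma_cod P)"
  "comp1 CAT2 (comma_square A) \<eta>C = comp1 CAT2 \<eta>P A"
  "comp1 CAT2 \<mu>P (comma_square \<eta>P) = id1 CAT2 (comma_cod P)" "comp1 CAT2 \<mu>P \<eta>C = id1 CAT2 (comma_cod P)"
  "comp1 CAT2 \<mu>P (comma_square \<mu>P) = comp1 CAT2 \<mu>P \<mu>C"
  "comp1 CAT2 (comma_square A) \<mu>C = comp1 CAT2 \<mu>P (comma_square (comma_square A))"
proof -
  show 1: "comp1 CAT2 A \<eta>P = id1 CAT2 P" using action_unit by simp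
  show "comp1 CAT2 (comma_square A) (comma_square \<eta>P) = id1 CAT2 (comma_cod P)"
    using arg_cong[OF 1, of comma_square] by (simp add: comma_square_comp comma_square_id)
  show "comp1 CAT2 (comma_square A) \<eta>C = comp1 CAT2 \<eta>P A" using Comma.unit_nat1[of A] by simp
  show "comp1 CAT2 \<mu>P (comma_square \<eta>P) = id1 CAT2 (comma_cod P)" "comp1 CAT2 \<mu>P \<eta>C = id1 CAT2 (comma_cod P)"
    "comp1 CAT2 \<mu>P (comma_square \<mu>P) = comp1 CAT2 \<mu>P \<mu>C" using Comma.monad_laws[of P] by simp_all
  show "comp1 CAT2 (comma_square A) \<mu>C = comp1 CAT2 \<mu>P (comma_square (comma_square A))"
    using Comma.mult_nat1[of A] by simp
qed

text \<open>On components \<open>chi_idn\<close> gives the two normalization laws and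
  \<open>chi_assoc\<close> the associativity law.\<close>

lemma pseudoalgebra_Gamma: "normal_pseudoalgebra CAT2 CommaMonad (Gamma_n0 \<P>)"
proof -
  have c [simp]: "comp1 CAT2 A (comp1 CAT2 \<eta>P A) = A"
  proof -
    have "comp1 CAT2 A (comp1 CAT2 \<eta>P A) = comp1 CAT2 (comp1 CAT2 A \<eta>P) A" by simp
    then show ?thesis unfolding structure_laws by simp
  qed
  have u1: "whisk_r CAT2 (chi_cell \<P>) (comma_square \<eta>P) = id2 CAT2 A"
  proof (rule square2_componentI)
    fix a assume "a \<in> obj (src (src (src (whisk_r CAT2 (chi_cell \<P>) (comma_square \<eta>P)))))"
    then show "dat (top1 (whisk_r CAT2 (chi_cell \<P>) (comma_square \<eta>P))) a = dat (top1 (id2 CAT2 A)) a"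
      by (auto elim!: comma_objE simp: chi_idn)
  qed (simp_all add: structure_laws)
  have u2: "whisk_r CAT2 (chi_cell \<P>) \<eta>C = id2 CAT2 A"
  proof (rule square2_componentI)
    fix a assume "a \<in> obj (src (src (src (whisk_r CAT2 (chi_cell \<P>) \<eta>C))))"
    then show "dat (top1 (whisk_r CAT2 (chi_cell \<P>) \<eta>C)) a = dat (top1 (id2 CAT2 A)) a"
      by (auto elim!: comma_objE simp: chi_idn)
  qed (simp_all add: structure_laws)
  have law: "vcomp CAT2 (whisk_r CAT2 (chi_cell \<P>) (comma_square \<mu>P)) (whisk_l CAT2 A (comma_square2 (chi_cell \<P>))) =
    vcomp CAT2 (whisk_r CAT2 (chi_cell \<P>) \<mu>C) (whisk_r CAT2 (chi_cell \<P>) (comma_square (comma_square A)))"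
      (is "?l = ?r")
  proof (rule square2_componentI)
    fix a assume "a \<in> obj (src (src (src ?l)))"
    then have a: "a \<in> obj (comma (comma_cod (comma_cod P)))" by simp
    then obtain x u v w where a': "a = Pr (Pr (Pr x u) v) w" "x \<in> obj (src P)" "u \<in> arr (tgt P)" "dm (tgt P) u = fo P x"
    "v \<in> arr (tgt P)" "dm (tgt P) v = cd (tgt P) u" "w \<in> arr (tgt P)" "dm (tgt P) w = cd (tgt P) v" by (rule comma3_objE)
    have m: "mor (Pr (push \<P> v (push \<P> u x)) w) (Pr (push \<P> (cmp B v u) x) w) (chi_comp \<P> v u x) (idn B (cd B w)) \<in> arr (comma P)"
      using a' by simp
    show "dat (top1 ?l) a = dat (top1 ?r) a"
      using a' chi_assoc[of x u v w] by (simp add: comma_square2_dat comma_map_obj_def)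
  qed (simp_all add: structure_laws comma_square_comp)
  show ?thesis unfolding normal_pseudoalgebra_def Let_def Gamma_n0_def
    using u1 u2 law chi_invertible by (simp add: structure_laws)
qed

end

section \<open>Reconstructing a cleavage from a pseudoalgebra\<close>

text \<open>At the source \<open>(x, 1)\<close> the chosen lift is an identity by normality, so the
  equation that defines \<open>L(1, u)\<close> leaves only the lift at the target.\<close>

lemma (in ncloven) lift_action:
  assumes x: "x \<in> obj E" "u \<in> arr B" "dm B u = fo P x"
  shows "fa (action_L \<P>) (mor (Pr x (idn B (fo P x))) (Pr x u) (idn E x) u) = lift \<P> x u"
  by (rule action_L_eqI) (use x in simp_all)

lemma Gamma_n0_inject:
  assumes p: "ncloven \<P>" and q: "ncloven \<Q>" and e: "Gamma_n0 \<P> = Gamma_n0 \<Q>"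
  shows "\<P> = \<Q>"
proof -
  interpret P: ncloven \<P> by fact
  interpret Q: ncloven \<Q> by fact
  have prj: "prj \<P> = prj \<Q>" and "action_square \<P> = action_square \<Q>" using e by (simp_all add: Gamma_n0_def)
  then have L: "action_L \<P> = action_L \<Q>" by (metis P.action_square_sel(3) Q.action_square_sel(3))
  have "lift \<P> x u = lift \<Q> x u" for x u
  proof (cases "liftable \<P> x u")
    case True
    then show ?thesis using P.lift_action[of x u] Q.lift_action[of x u] L prj by (simp add: liftable_def)
  next
    \<comment> \<open>Off the liftable pairs both cleavages are \<open>undefined\<close> by
      convention, so they agree there as well.\<close>
    case False
    then have "\<not> liftable \<Q> x u" using prj by (simp add: liftable_def)
    then show ?thesis using False P.cloven Q.cloven by (simp add: cloven_cofibration_def)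
  qed
  then show ?thesis using prj by (cases \<P>; cases \<Q>) auto
qed

locale comma_psalg =
  fixes A :: "('u ent fctr, 'u ent fctr \<times> 'u ent fctr, 'u ent ntr \<times> 'u ent ntr) psalg"
  assumes psalg: "normal_pseudoalgebra CAT2 CommaMonad A"
begin

abbreviation P where "P \<equiv> ps_car A"
abbreviation E where "E \<equiv> src P"
abbreviation B where "B \<equiv> tgt P"
abbreviation L where "L \<equiv> top1 (ps_act A)"
abbreviation X where "X \<equiv> top1 (ps_mul A)"

lemma P_functor [simp]: "is_functor P"
  using Comma.pseudoalgebraD(1)[OF psalg] by simp

lemma act [simp]: "ps_act A \<in> cells1 CAT2" "src (ps_act A) = comma_cod P" "tgt (ps_act A) = P"
  using Comma.pseudoalgebraD(2-4)[OF psalg] by simp_all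

lemma mul [simp]: "ps_mul A \<in> cells2 CAT2" "src (ps_mul A) = comp1 CAT2 (ps_act A) (comma_square (ps_act A))"
  "tgt (ps_mul A) = comp1 CAT2 (ps_act A) (mmult CommaMonad P)"
  using Comma.pseudoalgebraD(7-9)[OF psalg] by simp_all

lemma act_unit: "comp1 CAT2 (ps_act A) (munit CommaMonad P) = id1 CAT2 P"
  using Comma.pseudoalgebraD(5)[OF psalg] .

text \<open>The unit of the comma 2-monad has identity base, so the unit law in the base leaves the
  base of the action alone on one side.\<close>

lemma bot_act [simp]: "bot1 (ps_act A) = id1 CAT B"
  using arg_cong[OF act_unit, of bot1] by simp

lemma L_functor [simp]: "is_functor L" "src L = comma P" "tgt L = E"
  using squareD[OF act(1)] by simp_all

lemma L_H: "comp1 CAT L (comma_H P) = id1 CAT E"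
  using arg_cong[OF act_unit, of top1] by simp

lemma L_unit [simp]:
  "x \<in> obj E \<Longrightarrow> b = fo P x \<Longrightarrow> fo L (Pr x (idn B b)) = x"
  "f \<in> arr E \<Longrightarrow> fa L (fa (comma_H P) f) = f"
  using arg_cong[OF L_H, of "\<lambda>F. fo F x"] arg_cong[OF L_H, of "\<lambda>F. fa F f"] by simp_all

lemma P_L [simp]:
  "a \<in> obj (comma P) \<Longrightarrow> fo P (fo L a) = cd B (rgt a)"
  "z \<in> arr (comma P) \<Longrightarrow> fa P (fa L z) = mor_snd z"
  using square_commute(1)[OF act(1), of a] square_commute(2)[OF act(1), of z]
  by (auto simp: comma_arrD elim!: comma_objE)

lemma unit_cells [simp]:
  "Cell P (comma_cod P) (comma_H P, id1 CAT B) \<in> cells1 CAT2"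
  "Cell (comma_cod P) (comma_cod (comma_cod P)) (comma_H (comma_cod P), id1 CAT B) \<in> cells1 CAT2"
  using Comma.unit_cell(1)[of P] Comma.unit_cell(1)[of "comma_cod P"] by simp_all

lemma X_trans [simp]: "is_trans X" "src X = comp1 CAT L (comma_map (ps_act A))" "tgt X = comp1 CAT L (comma_M P)"
  using square2D(1,3,4)[OF mul(1)] by simp_all

lemma X_unit [simp]:
  assumes x: "x \<in> obj E" "u \<in> arr B" "dm B u = fo P x"
  shows "dat X (Pr (Pr x (idn B (fo P x))) u) = idn E (fo L (Pr x u))"
    "dat X (Pr (Pr x u) (idn B (cd B u))) = idn E (fo L (Pr x u))"
  using arg_cong[OF Comma.pseudoalgebraD(10)[OF psalg], of "\<lambda>\<sigma>. dat (top1 \<sigma>) (Pr x u)"]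
    arg_cong[OF Comma.pseudoalgebraD(11)[OF psalg], of "\<lambda>\<sigma>. dat (top1 \<sigma>) (Pr x u)"] x
  by simp_all

text \<open>Likewise the base of a normalization law is the base of the multiplication cell itself;
  hence that cell is vertical.\<close>

lemma bot_mul: "bot1 (ps_mul A) = id2 CAT (id1 CAT B)"
proof -
  have "is_trans (bot1 (ps_mul A))" "src (src (bot1 (ps_mul A))) = B"
    using square2D(2,5)[OF mul(1)] by simp_all
  then show ?thesis
    using arg_cong[OF Comma.pseudoalgebraD(11)[OF psalg], of bot1] by simp
qed

lemma L_cmp:
  assumes "mor a b f v \<in> arr (comma P)" "mor b c g w \<in> arr (comma P)"
  shows "cmp E (fa L (mor b c g w)) (fa L (mor a b f v)) = fa L (mor a c (cmp E g f) (cmp B w v))"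
  using functor_cmp[of L "comma P" "mor a b f v" "mor b c g w"] assms by (simp del: comma_mor)

text \<open>The action at \<open>(1, u) : (x, 1) -> (x, u)\<close>. Elsewhere the value is
  \<open>undefined\<close>, as \<open>cloven_cofibration\<close> demands of a choice of
  lifts.\<close>

definition cleave where
  "cleave x u = (if x \<in> obj E \<and> u \<in> arr B \<and> dm B u = fo P x
     then fa L (mor (Pr x (idn B (fo P x))) (Pr x u) (idn E x) u) else undefined)"

lemma cleave_arr [simp]:
  assumes x: "x \<in> obj E" "u \<in> arr B" "dm B u = fo P x"
  shows "cleave x u \<in> arr E" "dm E (cleave x u) = x" "cd E (cleave x u) = fo L (Pr x u)" "fa P (cleave x u) = u"
  using x functor_fa[of L E "mor (Pr x (idn B (fo P x))) (Pr x u) (idn E x) u"] by (simp_all add: cleave_def)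

text \<open>The naturality square of the multiplication cell at \<open>((1, u), 1) : ((x, 1), u) \<rightarrow> ((x, u), 1)\<close>
  has identity components, so \<open>L(\<delta>, 1) = 1\<close>.\<close>

lemma L_cleave:
  assumes x: "x \<in> obj E" "u \<in> arr B" "dm B u = fo P x"
  shows "fa L (mor (Pr x u) (Pr (fo L (Pr x u)) (idn B (cd B u))) (cleave x u) (idn B (cd B u))) = idn E (fo L (Pr x u))"
proof -
  let ?i = "idn B (fo P x)" and ?j = "idn B (cd B u)"
  let ?q = "mor (Pr x ?i) (Pr x u) (idn E x) u"
  let ?z = "mor (Pr (Pr x ?i) u) (Pr (Pr x u) ?j) ?q ?j"
  have z: "?z \<in> arr (comma (comma_cod P))" using x by simp
  have "fa (comma_map (ps_act A)) ?z = mor (Pr x u) (Pr (fo L (Pr x u)) ?j) (cleave x u) ?j"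
    using comma_map_fa[of ?z "ps_act A"] z x by (simp add: comma_map_obj_def cleave_def)
  moreover have "fa (comma_M P) ?z = idn (comma P) (Pr x u)"
    using comma_M_fa[OF z] x by simp
  moreover have "fa L (mor (Pr x u) (Pr (fo L (Pr x u)) ?j) (cleave x u) ?j) \<in> arr E"
    "cd E (fa L (mor (Pr x u) (Pr (fo L (Pr x u)) ?j) (cleave x u) ?j)) = fo L (Pr x u)"
    using x by simp_all
  ultimately show ?thesis
    using trans_nat[OF X_trans(1), of "comma (comma_cod P)" E ?z] z x
    by (simp del: comma_mor comma_idn)
qed

lemma cleave_cocart:
  assumes x: "x \<in> obj E" "u \<in> arr B" "dm B u = fo P x"
  shows "cleave x u \<in> cocart P"
proof (rule cocartI)
  show "cleave x u \<in> arr E" using x by simp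
  fix g v assume "g \<in> arr E" "dm E g = dm E (cleave x u)" "v \<in> arr B" "dm B v = fo P (cd E (cleave x u))"
    "cd B v = fo P (cd E g)" "fa P g = cmp B v (fa P (cleave x u))"
  then have g: "g \<in> arr E" "dm E g = x" "v \<in> arr B" "dm B v = cd B u" "cd B v = fo P (cd E g)" "fa P g = cmp B v u"
    using x by simp_all
  let ?k = "idn B (fo P (cd E g))" and ?i = "idn B (fo P x)" and ?j = "idn B (cd B u)"
  \<comment> \<open>The factor is \<open>L(g, v)\<close> with \<open>(g, v)\<close> viewed as an
    arrow into \<open>(z, 1)\<close>, where \<open>z\<close> is the codomain of \<open>g\<close>;
    the unit law sends that pair back to \<open>z\<close>.\<close>
  let ?h = "fa L (mor (Pr x u) (Pr (cd E g) ?k) g v)"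
  have m: "mor (Pr x u) (Pr (cd E g) ?k) g v \<in> arr (comma P)" using x g by simp
  have h: "?h \<in> arr E" "dm E ?h = fo L (Pr x u)" "cd E ?h = cd E g" "fa P ?h = v"
    using functor_fa[OF L_functor(1,3), of "mor (Pr x u) (Pr (cd E g) ?k) g v"] m g by (simp_all del: comma_mor)
  \<comment> \<open>Functoriality of \<open>L\<close> merges the two arrows into
    \<open>L(g, v u)\<close>, which is \<open>L(g, P g)\<close> and hence \<open>g\<close> by the
    unit law.\<close>
  have "cmp E ?h (cleave x u) = fa L (mor (Pr x ?i) (Pr (cd E g) ?k) (cmp E g (idn E x)) (cmp B v u))"
    using x g by (simp add: cleave_def L_cmp)
  also have "\<dots> = g" using L_unit(2)[OF g(1)] comma_H_fa[of g P] g x by simp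
  finally have hg: "cmp E ?h (cleave x u) = g" .
  show "\<exists>!h. h \<in> arr E \<and> dm E h = cd E (cleave x u) \<and> cd E h = cd E g \<and> cmp E h (cleave x u) = g \<and> fa P h = v"
  proof (rule ex1I[of _ ?h])
    fix h' assume "h' \<in> arr E \<and> dm E h' = cd E (cleave x u) \<and> cd E h' = cd E g \<and> cmp E h' (cleave x u) = g \<and> fa P h' = v"
    then have h': "h' \<in> arr E" "dm E h' = fo L (Pr x u)" "cd E h' = cd E g" "cmp E h' (cleave x u) = g" "fa P h' = v"
      using x by simp_all
    have p: "fo P (fo L (Pr x u)) = cd B u" using x by simp
    have "h' = cmp E h' (fa L (mor (Pr x u) (Pr (fo L (Pr x u)) ?j) (cleave x u) ?j))"
      unfolding L_cleave[OF x] using h' by simp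
    also have "\<dots> = cmp E (fa L (mor (Pr (fo L (Pr x u)) ?j) (Pr (cd E g) ?k) h' v))
        (fa L (mor (Pr x u) (Pr (fo L (Pr x u)) ?j) (cleave x u) ?j))"
      using L_unit(2)[OF h'(1)] comma_H_fa[of h' P] h' p by simp
    also have "\<dots> = ?h" using x g h' by (simp add: L_cmp)
    finally show "h' = ?h" .
  qed (use h hg x in simp)
qed

definition cloven_of where "cloven_of = Cloven P cleave"

lemma ncloven_of: "ncloven cloven_of"
proof
  show "cloven_cofibration cloven_of"
    by (auto simp: cloven_of_def cloven_cofibration_def liftable_def cleave_cocart) (simp_all add: cleave_def)
  have "fa L (idn (comma P) (Pr x (idn B (fo P x)))) = idn E x" if "x \<in> obj E" for x
    using that by (simp del: comma_idn)
  then show "normal_cleavage cloven_of"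
    by (simp add: cloven_of_def normal_cleavage_def cleave_def)
qed

lemma cloven_of_sel [simp]: "prj cloven_of = P" "lift cloven_of = cleave"
  by (simp_all add: cloven_of_def)

lemma push_of: "x \<in> obj E \<Longrightarrow> u \<in> arr B \<Longrightarrow> dm B u = fo P x \<Longrightarrow> push cloven_of u x = fo L (Pr x u)"
  by (simp add: push_def)

text \<open>The given \<open>L\<close> satisfies the equation that determines the action of the new
  cleavage: \<open>L(f, v) L(1, u) = L(f, v u) = L(f, w P f) = L(1, w) L(f, P f)\<close>, where the
  last factor is \<open>f\<close>.\<close>

lemma action_of: "action_L cloven_of = L"
proof -
  interpret Q: ncloven cloven_of by (rule ncloven_of)
  show ?thesis
  proof (rule functor_eqI)
    fix a assume "a \<in> obj (src (action_L cloven_of))"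
    then show "fo (action_L cloven_of) a = fo L a" by (auto simp: push_of elim!: comma_objE)
  next
    fix z assume "z \<in> arr (src (action_L cloven_of))"
    then have z: "z \<in> arr (comma P)" by simp
    then obtain x u y w f v where z': "z = mor (Pr x u) (Pr y w) f v" "x \<in> obj E" "u \<in> arr B" "dm B u = fo P x"
      "y \<in> obj E" "w \<in> arr B" "dm B w = fo P y" "f \<in> arr E" "dm E f = x" "cd E f = y"
      "v \<in> arr B" "dm B v = cd B u" "cd B v = cd B w" "cmp B v u = cmp B w (fa P f)" by (rule comma_arrE)
    have "cmp E (fa L z) (cleave x u) = fa L (mor (Pr x (idn B (fo P x))) (Pr y w) f (cmp B v u))"
      using z' by (simp add: cleave_def L_cmp)
    moreover have "cmp E (cleave y w) f = cmp E (cleave y w) (fa L (fa (comma_H P) f))" using z' by simp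
    then have "cmp E (cleave y w) f = fa L (mor (Pr x (idn B (fo P x))) (Pr y w) f (cmp B w (fa P f)))"
      using z' by (simp only: comma_H_fa) (simp add: cleave_def L_cmp)
    ultimately have "cmp E (fa L z) (cleave x u) = cmp E (cleave y w) f" using z' by simp
    then show "fa (action_L cloven_of) z = fa L z"
      using z' z by (intro Q.action_L_eqI) (simp_all add: push_of)
  qed simp_all
qed

lemma Gamma_of: "Gamma_n0 cloven_of = A"
proof -
  interpret Q: ncloven cloven_of by (rule ncloven_of)
  have a: "action_square cloven_of = ps_act A"
    by (rule square_eqI) (simp_all add: action_of)
  have "chi_cell cloven_of = ps_mul A"
  proof (rule square2_componentI)
    fix a assume "a \<in> obj (src (src (src (chi_cell cloven_of))))"
    then have "a \<in> obj (comma (comma_cod P))" by simp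
    then obtain x u v where a: "a = Pr (Pr x u) v" and x: "x \<in> obj E" "u \<in> arr B" "dm B u = fo P x"
      "v \<in> arr B" "dm B v = cd B u" by (rule comma2_objE)
    have ao: "a \<in> obj (comma (comma_cod P))" using a x by simp
    have X: "dat X a \<in> arr E" "dm E (dat X a) = fo L (Pr (fo L (Pr x u)) v)" "cd E (dat X a) = fo L (Pr x (cmp B v u))"
      "fa P (dat X a) = idn B (cd B v)"
      using trans_arr[OF X_trans(1), of E a] square2_commute[OF mul(1), of a] ao x a by (simp_all add: bot_mul)
    let ?i = "idn B (fo P x)"
    \<comment> \<open>The arrow \<open>((1, u), v u)\<close> leads from \<open>((x, 1), 1)\<close>,
      where the multiplication cell is an identity, to \<open>((x, u), v)\<close>. Naturality along
      it yields the equation that characterises \<open>chi_comp\<close>.\<close>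
    let ?z = "mor (Pr (Pr x ?i) ?i) (Pr (Pr x u) v) (mor (Pr x ?i) (Pr x u) (idn E x) u) (cmp B v u)"
    have z: "?z \<in> arr (comma (comma_cod P))" using x by simp
    have "fa (comma_map (ps_act A)) ?z = mor (Pr x ?i) (Pr (fo L (Pr x u)) v) (cleave x u) (cmp B v u)"
      using comma_map_fa[of ?z "ps_act A"] z x by (simp add: comma_map_obj_def cleave_def)
    moreover have "fa (comma_M P) ?z = mor (Pr x ?i) (Pr x (cmp B v u)) (idn E x) (cmp B v u)"
      using comma_M_fa[OF z] x by simp
    moreover have "dat X (Pr (Pr x ?i) ?i) = idn E x" using X_unit(1)[of x ?i] x by simp
    ultimately have "cmp E (dat X a) (fa L (mor (Pr x ?i) (Pr (fo L (Pr x u)) v) (cleave x u) (cmp B v u))) = cleave x (cmp B v u)"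
      using trans_nat[OF X_trans(1), of "comma (comma_cod P)" E ?z] z x a
      by (simp add: cleave_def del: comma_mor) (simp add: cleave_def)
    \<comment> \<open>The arrow \<open>(\<delta>, v u)\<close> is
      \<open>(\<delta>, P \<delta>)\<close>, between pairs with identity second entry, followed by
      \<open>(1, v)\<close>; by the unit law \<open>L\<close> sends the first of them to the lift
      \<open>\<delta>\<close> itself.\<close>
    moreover have "fa L (mor (Pr x ?i) (Pr (fo L (Pr x u)) v) (cleave x u) (cmp B v u)) =
        cmp E (cleave (fo L (Pr x u)) v) (fa L (fa (comma_H P) (cleave x u)))"
      using x by (simp only: comma_H_fa cleave_arr) (simp add: cleave_def[of "fo L (Pr x u)"] L_cmp)
    then have "fa L (mor (Pr x ?i) (Pr (fo L (Pr x u)) v) (cleave x u) (cmp B v u)) =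
        cmp E (cleave (fo L (Pr x u)) v) (cleave x u)" using x by simp
    ultimately have "dat X a = chi_comp cloven_of v u x"
      using X x by (intro Q.chi_eqI) (simp_all add: push_of)
    then show "dat (top1 (chi_cell cloven_of)) a = dat X a" using a ao by simp
  qed (simp_all add: a bot_mul)
  then show ?thesis using a by (intro psalg.expand) (simp add: Gamma_n0_def)
qed

end

section \<open>The comparison on 1-cells\<close>

text \<open>Reduces statements about all cocartesian arrows to chosen lifts and
  isomorphisms.\<close>

lemma (in ncloven) cocart_factor:
  assumes e: "e \<in> cocart P"
  obtains k where "k \<in> isos E" "dm E k = push \<P> (fa P e) (dm E e)" "cd E k = cd E e"
    "cmp E k (lift \<P> (dm E e) (fa P e)) = e"
  by (rule cocart_comparison[OF P_functor _ e, of "lift \<P> (dm E e) (fa P e)"])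
    (use cocartD(1)[OF e] that in simp_all)

locale ncloven_square = P: ncloven \<P> + Q: ncloven \<Q> for \<P> \<Q> :: "'u ent cloven" +
  fixes s :: "'u ent square"
  assumes s_cell [simp]: "s \<in> cells1 CAT2" and s_src [simp]: "src s = prj \<P>" and s_tgt [simp]: "tgt s = prj \<Q>"
    and s_cocart: "\<And>e. e \<in> cocart (prj \<P>) \<Longrightarrow> fa (top1 s) e \<in> cocart (prj \<Q>)"
begin

abbreviation T where "T \<equiv> top1 s"
abbreviation S where "S \<equiv> bot1 s"
abbreviation G where "G \<equiv> Cell \<P> \<Q> s"

lemma TS [simp]: "is_functor T" "src T = P.E" "tgt T = Q.E" "is_functor S" "src S = P.B" "tgt S = Q.B"
  using squareD[OF s_cell] by simp_all

lemma QT [simp]: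
  "x \<in> obj P.E \<Longrightarrow> fo Q.P (fo T x) = fo S (fo P.P x)" "f \<in> arr P.E \<Longrightarrow> fa Q.P (fa T f) = fa S (fa P.P f)"
  using square_commute(1)[OF s_cell, of x] square_commute(2)[OF s_cell, of f] by simp_all

text \<open>As \<open>T\<close> preserves cocartesian arrows, the image of a lift is cocartesian
  over \<open>fa S u\<close>, and so is the chosen lift in \<open>\<Q>\<close>; the arrow sought is
  their comparison.\<close>

lemma theta_ex1:
  assumes x: "x \<in> obj P.E" "u \<in> arr P.B" "dm P.B u = fo P.P x"
  shows "\<exists>!h. h \<in> vertical Q.P \<and> h \<in> isos Q.E \<and> h \<in> hom Q.E (push \<Q> (fa S u) (fo T x)) (fo T (push \<P> u x)) \<and>
       cmp Q.E h (lift \<Q> (fo T x) (fa S u)) = fa T (lift \<P> x u)"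
proof -
  have y: "fo T x \<in> obj Q.E" "fa S u \<in> arr Q.B" "dm Q.B (fa S u) = fo Q.P (fo T x)" using x by simp_all
  obtain h where h: "h \<in> isos Q.E" "dm Q.E h = cd Q.E (lift \<Q> (fo T x) (fa S u))" "cd Q.E h = cd Q.E (fa T (lift \<P> x u))"
    "cmp Q.E h (lift \<Q> (fo T x) (fa S u)) = fa T (lift \<P> x u)" "fa Q.P h = idn Q.B (fo Q.P (cd Q.E (lift \<Q> (fo T x) (fa S u))))"
    by (rule cocart_comparison[OF Q.P_functor Q.lift_facts(1)[OF y], of "fa T (lift \<P> x u)"])
      (use x y s_cocart in simp_all)
  show ?thesis
  proof (rule ex1I[of _ h])
    fix h' assume "h' \<in> vertical Q.P \<and> h' \<in> isos Q.E \<and> h' \<in> hom Q.E (push \<Q> (fa S u) (fo T x)) (fo T (push \<P> u x)) \<and>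
       cmp Q.E h' (lift \<Q> (fo T x) (fa S u)) = fa T (lift \<P> x u)"
    with h x y show "h' = h" by - (rule Q.lift_eqI[OF y], simp_all add: vertical_iff)
  qed (use h x y in \<open>simp add: vertical_iff\<close>)
qed

lemma theta_facts [simp]:
  assumes x: "x \<in> obj P.E" "u \<in> arr P.B" "dm P.B u = fo P.P x"
  shows "theta_comp G u x \<in> isos Q.E" "theta_comp G u x \<in> arr Q.E"
    "dm Q.E (theta_comp G u x) = push \<Q> (fa S u) (fo T x)" "cd Q.E (theta_comp G u x) = fo T (push \<P> u x)"
    "fa Q.P (theta_comp G u x) = idn Q.B (fo S (cd P.B u))"
    "cmp Q.E (theta_comp G u x) (lift \<Q> (fo T x) (fa S u)) = fa T (lift \<P> x u)"
  using theI'[OF theta_ex1[OF assms]] x unfolding theta_comp_def Let_def by (auto simp: vertical_iff)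

lemma theta_eqI:
  assumes x: "x \<in> obj P.E" "u \<in> arr P.B" "dm P.B u = fo P.P x"
    and h: "h \<in> arr Q.E" "dm Q.E h = push \<Q> (fa S u) (fo T x)" "cd Q.E h = fo T (push \<P> u x)"
    "fa Q.P h = idn Q.B (fo S (cd P.B u))" "cmp Q.E h (lift \<Q> (fo T x) (fa S u)) = fa T (lift \<P> x u)"
  shows "h = theta_comp G u x"
  by (rule Q.lift_eqI[of "fo T x" "fa S u"]) (use x h in simp_all)

lemma theta_chain [simp]:
  assumes x: "x \<in> obj P.E" "u \<in> arr P.B" "dm P.B u = fo P.P x" and e: "e \<in> arr Q.E" "cd Q.E e = fo T x"
  shows "cmp Q.E (theta_comp G u x) (cmp Q.E (lift \<Q> (fo T x) (fa S u)) e) = cmp Q.E (fa T (lift \<P> x u)) e"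
proof -
  have "cmp Q.E (theta_comp G u x) (cmp Q.E (lift \<Q> (fo T x) (fa S u)) e) =
      cmp Q.E (cmp Q.E (theta_comp G u x) (lift \<Q> (fo T x) (fa S u))) e"
    by (rule category_assoc[symmetric]) (use x e in simp_all)
  then show ?thesis unfolding theta_facts(6)[OF x] .
qed

lemma theta_cell_sel [simp]:
  "src (theta_cell G) = comp1 CAT2 (action_square \<Q>) (comma_square s)"
  "tgt (theta_cell G) = comp1 CAT2 s (action_square \<P>)"
  "bot1 (theta_cell G) = id2 CAT S"
  "src (top1 (theta_cell G)) = comp1 CAT (action_L \<Q>) (comma_map s)"
  "tgt (top1 (theta_cell G)) = comp1 CAT T (action_L \<P>)"
  "Pr x u \<in> obj (comma P.P) \<Longrightarrow> dat (top1 (theta_cell G)) (Pr x u) = theta_comp G u x"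
  by (simp_all add: theta_cell_def Let_def)

text \<open>After precomposition with the lift over \<open>S u\<close>, both ways around the square
  become the image under \<open>T\<close> of \<open>f\<close> followed by the lift over
  \<open>w\<close>.\<close>

lemma theta_trans: "is_trans (top1 (theta_cell G))"
  unfolding theta_cell_def Let_def top1_Cell
proof (rule is_trans_mk)
  fix a assume "a \<in> obj (comma P.P)"
  then show "theta_comp G (rgt a) (lft a) \<in> arr Q.E \<and>
         dm Q.E (theta_comp G (rgt a) (lft a)) =
         fo (top1 (comp1 CAT2 (action_square (tgt G)) (map1 (mfun CommaMonad) (dat G)))) a \<and>
         cd Q.E (theta_comp G (rgt a) (lft a)) = fo (top1 (comp1 CAT2 (dat G) (action_square (src G)))) a"
    by (auto elim!: comma_objE)
next
  fix z assume z: "z \<in> arr (comma P.P)"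
  then obtain x u y w f v where z': "z = mor (Pr x u) (Pr y w) f v"
    and [simp]: "x \<in> obj P.E" "u \<in> arr P.B" "dm P.B u = fo P.P x"
      "y \<in> obj P.E" "w \<in> arr P.B" "dm P.B w = fo P.P y" "f \<in> arr P.E" "dm P.E f = x" "cd P.E f = y"
      "v \<in> arr P.B" "dm P.B v = cd P.B u" "cd P.B v = cd P.B w" "cmp P.B v u = cmp P.B w (fa P.P f)"
    by (rule comma_arrE)
  let ?z = "mor (Pr (fo T x) (fa S u)) (Pr (fo T y) (fa S w)) (fa T f) (fa S v)"
  have L: "fa (comma_map s) z = ?z"
    using comma_map_fa[of z s] z unfolding z' by (simp add: comma_map_obj_def)
  have "?z = fa (comma_map s) z" using L ..
  then have z1: "?z \<in> arr (comma Q.P)" using z functor_fa(1)[OF is_functor_comma_map[OF s_cell], of "comma Q.P" z] by simp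
  have Lz': "fa (action_L \<P>) z \<in> arr P.E" "dm P.E (fa (action_L \<P>) z) = push \<P> u x"
    "cd P.E (fa (action_L \<P>) z) = push \<P> w y" "fa P.P (fa (action_L \<P>) z) = v"
    "cmp P.E (fa (action_L \<P>) z) (lift \<P> x u) = cmp P.E (lift \<P> y w) f"
    using P.action_L_fa[OF z] by (simp_all add: z')
  have Lz1: "fa (action_L \<Q>) ?z \<in> arr Q.E" "dm Q.E (fa (action_L \<Q>) ?z) = push \<Q> (fa S u) (fo T x)"
    "cd Q.E (fa (action_L \<Q>) ?z) = push \<Q> (fa S w) (fo T y)" "fa Q.P (fa (action_L \<Q>) ?z) = fa S v"
    "cmp Q.E (fa (action_L \<Q>) ?z) (lift \<Q> (fo T x) (fa S u)) = cmp Q.E (lift \<Q> (fo T y) (fa S w)) (fa T f)"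
    using Q.action_L_fa[OF z1] by simp_all
  have T: "cmp Q.E (fa T (fa (action_L \<P>) z)) (fa T (lift \<P> x u)) = cmp Q.E (fa T (lift \<P> y w)) (fa T f)"
    by (rule functor_commute[where C = P.E]) (simp_all add: Lz')
  have "cmp Q.E (theta_comp G w y) (fa (action_L \<Q>) ?z) = cmp Q.E (fa T (fa (action_L \<P>) z)) (theta_comp G u x)"
  proof (rule Q.lift_eqI[of "fo T x" "fa S u"])
    have "cmp Q.E (cmp Q.E (theta_comp G w y) (fa (action_L \<Q>) ?z)) (lift \<Q> (fo T x) (fa S u)) =
        cmp Q.E (theta_comp G w y) (cmp Q.E (fa (action_L \<Q>) ?z) (lift \<Q> (fo T x) (fa S u)))"
      by (rule category_assoc) (simp_all add: Lz1)
    also have "\<dots> = cmp Q.E (fa T (fa (action_L \<P>) z)) (cmp Q.E (theta_comp G u x) (lift \<Q> (fo T x) (fa S u)))"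
      unfolding Lz1(5) using T by simp
    also have "\<dots> = cmp Q.E (cmp Q.E (fa T (fa (action_L \<P>) z)) (theta_comp G u x)) (lift \<Q> (fo T x) (fa S u))"
      by (rule category_assoc[symmetric]) (simp_all add: Lz')
    finally show "cmp Q.E (cmp Q.E (theta_comp G w y) (fa (action_L \<Q>) ?z)) (lift \<Q> (fo T x) (fa S u)) =
        cmp Q.E (cmp Q.E (fa T (fa (action_L \<P>) z)) (theta_comp G u x)) (lift \<Q> (fo T x) (fa S u))" .
  qed (simp_all add: Lz1(1-4) Lz')
  then show "cmp Q.E (theta_comp G (rgt (cd (comma P.P) z)) (lft (cd (comma P.P) z)))
          (fa (top1 (comp1 CAT2 (action_square (tgt G)) (map1 (mfun CommaMonad) (dat G)))) z) =
         cmp Q.E (fa (top1 (comp1 CAT2 (dat G) (action_square (src G)))) z)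
          (theta_comp G (rgt (dm (comma P.P) z)) (lft (dm (comma P.P) z)))"
    using z L by (simp add: z' del: comma_mor)
qed simp_all

lemma theta_cell_cell [simp]: "theta_cell G \<in> cells2 CAT2"
proof -
  have "theta_cell G = Cell (src (theta_cell G)) (tgt (theta_cell G)) (top1 (theta_cell G), bot1 (theta_cell G))"
    by (simp add: theta_cell_def Let_def)
  moreover have "\<dots> \<in> cells2 CAT2"
    by (rule square2I) (auto simp: theta_trans elim!: comma_objE)
  ultimately show ?thesis by simp
qed

lemma theta_invertible: "invertible2 CAT2 (theta_cell G)"
  by (rule invertible_CAT2I) (auto elim!: comma_objE)

lemma theta_idn: "x \<in> obj P.E \<Longrightarrow> theta_comp G (idn P.B (fo P.P x)) x = idn Q.E (fo T x)"
  by (rule theta_eqI[symmetric]) (simp_all)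

text \<open>The composite of the lifts over \<open>S u\<close> and \<open>S v\<close> is cancelled:
  both sides send it to the image under \<open>T\<close> of the lift over
  \<open>v u\<close>.\<close>

lemma theta_chi:
  assumes x: "x \<in> obj P.E" "u \<in> arr P.B" "dm P.B u = fo P.P x" "v \<in> arr P.B" "dm P.B v = cd P.B u"
  shows "cmp Q.E (theta_comp G (cmp P.B v u) x) (chi_comp \<Q> (fa S v) (fa S u) (fo T x)) =
    cmp Q.E (fa T (chi_comp \<P> v u x)) (cmp Q.E (theta_comp G v (push \<P> u x))
      (fa (action_L \<Q>) (mor (Pr (push \<Q> (fa S u) (fo T x)) (fa S v)) (Pr (fo T (push \<P> u x)) (fa S v))
        (theta_comp G u x) (idn Q.B (fo S (cd P.B v))))))"
proof (rule cocart_unique[OF Q.P_functor])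
  show "cmp Q.E (lift \<Q> (push \<Q> (fa S u) (fo T x)) (fa S v)) (lift \<Q> (fo T x) (fa S u)) \<in> cocart Q.P"
    by (intro cocart_cmp) (use x in simp_all)
  have T: "cmp Q.E (fa T (chi_comp \<P> v u x)) (cmp Q.E (fa T (lift \<P> (push \<P> u x) v)) (fa T (lift \<P> x u))) =
      fa T (lift \<P> x (cmp P.B v u))"
    using arg_cong[OF P.chi_facts(6)[OF x], of "fa T"] x by (simp del: P.chi_facts(6))
  have t: "theta_comp G (cmp P.B v u) x \<in> arr Q.E"
    "dm Q.E (theta_comp G (cmp P.B v u) x) = push \<Q> (cmp Q.B (fa S v) (fa S u)) (fo T x)"
    "cd Q.E (theta_comp G (cmp P.B v u) x) = fo T (push \<P> (cmp P.B v u) x)"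
    "fa Q.P (theta_comp G (cmp P.B v u) x) = idn Q.B (fo S (cd P.B v))"
    "cmp Q.E (theta_comp G (cmp P.B v u) x) (lift \<Q> (fo T x) (cmp Q.B (fa S v) (fa S u))) = fa T (lift \<P> x (cmp P.B v u))"
    using theta_facts[of x "cmp P.B v u"] x by simp_all
  show "cmp Q.E (cmp Q.E (theta_comp G (cmp P.B v u) x) (chi_comp \<Q> (fa S v) (fa S u) (fo T x)))
      (cmp Q.E (lift \<Q> (push \<Q> (fa S u) (fo T x)) (fa S v)) (lift \<Q> (fo T x) (fa S u))) =
    cmp Q.E (cmp Q.E (fa T (chi_comp \<P> v u x)) (cmp Q.E (theta_comp G v (push \<P> u x))
      (fa (action_L \<Q>) (mor (Pr (push \<Q> (fa S u) (fo T x)) (fa S v)) (Pr (fo T (push \<P> u x)) (fa S v))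
        (theta_comp G u x) (idn Q.B (fo S (cd P.B v)))))))
     (cmp Q.E (lift \<Q> (push \<Q> (fa S u) (fo T x)) (fa S v)) (lift \<Q> (fo T x) (fa S u)))"
    using x T t by simp
qed (use x theta_facts[of x "cmp P.B v u"] in simp_all)

text \<open>On components the unit law is \<open>theta_idn\<close> and the multiplication law is
  \<open>theta_chi\<close>; naturality of unit and multiplication at \<open>s\<close> matches the
  boundaries.\<close>

lemma pseudomorphism_Gamma: "pseudomorphism CAT2 CommaMonad (Gamma_n1 G)"
proof -
  have u: "comp1 CAT2 (comma_square s) P.\<eta>P = comp1 CAT2 Q.\<eta>P s" using Comma.unit_nat1[of s] by simp
  have u': "comp1 CAT2 (action_square \<Q>) (comp1 CAT2 Q.\<eta>P s) = s"
  proof -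
    have "comp1 CAT2 (action_square \<Q>) (comp1 CAT2 Q.\<eta>P s) = comp1 CAT2 (comp1 CAT2 (action_square \<Q>) Q.\<eta>P) s" by simp
    then show ?thesis unfolding Q.structure_laws by simp
  qed
  have m: "comp1 CAT2 (comma_square s) P.\<mu>P = comp1 CAT2 Q.\<mu>P (comma_square (comma_square s))"
    using Comma.mult_nat1[of s] by simp
  have unit: "whisk_r CAT2 (theta_cell G) P.\<eta>P = id2 CAT2 s"
  proof (rule square2_componentI)
    fix x assume "x \<in> obj (src (src (src (whisk_r CAT2 (theta_cell G) P.\<eta>P))))"
    then show "dat (top1 (whisk_r CAT2 (theta_cell G) P.\<eta>P)) x = dat (top1 (id2 CAT2 s)) x"
      by (simp add: theta_idn)
  qed (simp_all add: P.structure_laws u u')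
  have law: "vcomp CAT2 (whisk_r CAT2 (theta_cell G) P.\<mu>P) (whisk_r CAT2 (chi_cell \<Q>) (comma_square (comma_square s))) =
    vcomp CAT2 (whisk_l CAT2 s (chi_cell \<P>))
      (vcomp CAT2 (whisk_r CAT2 (theta_cell G) (comma_square P.A)) (whisk_l CAT2 Q.A (comma_square2 (theta_cell G))))"
     (is "?l = ?r")
  proof (rule square2_componentI)
    fix a assume "a \<in> obj (src (src (src ?l)))"
    then have a: "a \<in> obj (comma (comma_cod P.P))" by simp
    then obtain x u v where a': "a = Pr (Pr x u) v" "x \<in> obj P.E" "u \<in> arr P.B" "dm P.B u = fo P.P x"
      "v \<in> arr P.B" "dm P.B v = cd P.B u" by (rule comma2_objE)
    show "dat (top1 ?l) a = dat (top1 ?r) a"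
      using a' theta_chi[of x u v] by (simp add: comma_square2_dat comma_map_obj_def)
  qed (simp_all add: m comma_square_comp)
  show ?thesis
    using P.pseudoalgebra_Gamma Q.pseudoalgebra_Gamma unit law theta_invertible
    by (simp add: pseudomorphism_def Gamma_n1_def) (simp add: Gamma_n0_def)
qed

end

section \<open>The comparison isomorphisms\<close>

text \<open>The comparison is read off from naturality at \<open>(1, u) : (x, 1) -> (x, u)\<close>.
  Its component at \<open>(x, 1)\<close> is an identity by the unit law, and what is left is the
  equation that characterises \<open>theta_comp\<close>.\<close>

lemma pseudomorphism_determined:
  assumes p: "ncloven \<P>" and q: "ncloven \<Q>" and F: "pseudomorphism CAT2 CommaMonad F"
    and sF: "src F = Gamma_n0 \<P>" and tF: "tgt F = Gamma_n0 \<Q>"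
  shows "ncloven_square \<P> \<Q> (fst (dat F))" "F = Gamma_n1 (Cell \<P> \<Q> (fst (dat F)))"
proof -
  interpret P: ncloven \<P> by fact
  interpret Q: ncloven \<Q> by fact
  define s where "s = fst (dat F)"
  define \<theta> where "\<theta> = snd (dat F)"
  have G [simp]: "ps_car (Gamma_n0 \<P>) = P.P" "ps_act (Gamma_n0 \<P>) = P.A" "ps_car (Gamma_n0 \<Q>) = Q.P" "ps_act (Gamma_n0 \<Q>) = Q.A"
    by (simp_all add: Gamma_n0_def)
  note D = Comma.pseudomorphismD[OF F, unfolded sF tF, folded s_def \<theta>_def]
  have s [simp]: "s \<in> cells1 CAT2" "src s = P.P" "tgt s = Q.P" using D(3-5) by simp_all
  have \<theta> [simp]: "\<theta> \<in> cells2 CAT2" "src \<theta> = comp1 CAT2 Q.A (comma_square s)" "tgt \<theta> = comp1 CAT2 s P.A"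
    using D(7-9) by simp_all
  have tr: "is_trans (top1 \<theta>)" "src (top1 \<theta>) = comp1 CAT (action_L \<Q>) (comma_map s)" "tgt (top1 \<theta>) = comp1 CAT (top1 s) (action_L \<P>)"
    using square2D(1,3,4)[OF \<theta>(1)] by simp_all
  have unit: "whisk_r CAT2 \<theta> P.\<eta>P = id2 CAT2 s" using D(10) by simp
  have TS [simp]: "is_functor (top1 s)" "src (top1 s) = P.E" "tgt (top1 s) = Q.E"
    "is_functor (bot1 s)" "src (bot1 s) = P.B" "tgt (bot1 s) = Q.B" using squareD[OF s(1)] by simp_all
  have QT [simp]: "x \<in> obj P.E \<Longrightarrow> fo Q.P (fo (top1 s) x) = fo (bot1 s) (fo P.P x)" for x
    using square_commute(1)[OF s(1), of x] by simp
  \<comment> \<open>The unit law, read in the base, makes the comparison vertical.\<close>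
  have bot: "bot1 \<theta> = id2 CAT (bot1 s)"
  proof -
    have "is_trans (bot1 \<theta>)" "src (src (bot1 \<theta>)) = P.B" using square2D(2,5)[OF \<theta>(1)] by simp_all
    then show ?thesis using arg_cong[OF unit, of bot1] by simp
  qed
  have \<theta>1: "dat (top1 \<theta>) (Pr x (idn P.B (fo P.P x))) = idn Q.E (fo (top1 s) x)" if "x \<in> obj P.E" for x
    using arg_cong[OF unit, of "\<lambda>\<sigma>. dat (top1 \<sigma>) x"] that tr by simp
  have \<theta>u: "dat (top1 \<theta>) (Pr x u) \<in> isos Q.E" "dm Q.E (dat (top1 \<theta>) (Pr x u)) = push \<Q> (fa (bot1 s) u) (fo (top1 s) x)"
    "cd Q.E (dat (top1 \<theta>) (Pr x u)) = fo (top1 s) (push \<P> u x)" "fa Q.P (dat (top1 \<theta>) (Pr x u)) = idn Q.B (fo (bot1 s) (cd P.B u))"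
    "cmp Q.E (dat (top1 \<theta>) (Pr x u)) (lift \<Q> (fo (top1 s) x) (fa (bot1 s) u)) = fa (top1 s) (lift \<P> x u)"
    if x: "x \<in> obj P.E" "u \<in> arr P.B" "dm P.B u = fo P.P x" for x u
  proof -
    show i: "dat (top1 \<theta>) (Pr x u) \<in> isos Q.E" using invertible_CAT2D[OF D(6), of "Pr x u"] x by simp
    show "dm Q.E (dat (top1 \<theta>) (Pr x u)) = push \<Q> (fa (bot1 s) u) (fo (top1 s) x)"
      "cd Q.E (dat (top1 \<theta>) (Pr x u)) = fo (top1 s) (push \<P> u x)"
      using trans_arr[OF tr(1), of Q.E "Pr x u"] tr(2,3) x by simp_all
    show "fa Q.P (dat (top1 \<theta>) (Pr x u)) = idn Q.B (fo (bot1 s) (cd P.B u))"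
      using square2_commute[OF \<theta>(1), of "Pr x u"] x bot by simp
    let ?z = "mor (Pr x (idn P.B (fo P.P x))) (Pr x u) (idn P.E x) u"
    have z: "?z \<in> arr (comma P.P)" using x by simp
    have L: "fa (action_L \<Q>) (fa (comma_map s) ?z) = lift \<Q> (fo (top1 s) x) (fa (bot1 s) u)"
      using comma_map_fa[of ?z s] z x Q.lift_action[of "fo (top1 s) x" "fa (bot1 s) u"] by (simp add: comma_map_obj_def)
    then have "cmp Q.E (dat (top1 \<theta>) (Pr x u)) (lift \<Q> (fo (top1 s) x) (fa (bot1 s) u)) =
        cmp Q.E (fa (top1 s) (lift \<P> x u)) (idn Q.E (fo (top1 s) x))"
      using trans_nat[OF tr(1), of "comma P.P" Q.E ?z] tr(2,3) x z \<theta>1[OF x(1)] P.lift_action[OF x] by simp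
    then show "cmp Q.E (dat (top1 \<theta>) (Pr x u)) (lift \<Q> (fo (top1 s) x) (fa (bot1 s) u)) = fa (top1 s) (lift \<P> x u)"
      using x by simp
  qed
  \<comment> \<open>The arrow \<open>e\<close> is a lift followed by an isomorphism, and the image
    of the lift is a lift in \<open>\<Q>\<close> followed by the comparison. So the image of
    \<open>e\<close> is a lift followed by two isomorphisms.\<close>
  have co: "fa (top1 s) e \<in> cocart Q.P" if e: "e \<in> cocart P.P" for e
    using e
  proof (rule P.cocart_factor)
    fix k assume k: "k \<in> isos P.E" "dm P.E k = push \<P> (fa P.P e) (dm P.E e)" "cmp P.E k (lift \<P> (dm P.E e) (fa P.P e)) = e"
    note [simp] = cocartD(1)[OF e]
    let ?x = "dm P.E e" and ?u = "fa P.P e"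
    have x: "?x \<in> obj P.E" "?u \<in> arr P.B" "dm P.B ?u = fo P.P ?x" by simp_all
    have "fa (top1 s) e = cmp Q.E (fa (top1 s) k) (fa (top1 s) (lift \<P> ?x ?u))"
      using arg_cong[OF k(3)[symmetric], of "fa (top1 s)"] functor_cmp[OF TS(1,2), of "lift \<P> ?x ?u" k] k(1,2) x by simp
    also have "\<dots> = cmp Q.E (fa (top1 s) k) (cmp Q.E (dat (top1 \<theta>) (Pr ?x ?u)) (lift \<Q> (fo (top1 s) ?x) (fa (bot1 s) ?u)))"
      using \<theta>u(5)[OF x] by simp
    also have "\<dots> \<in> cocart Q.P"
    proof (rule cocart_cmp[OF Q.P_functor cocart_cmp[OF Q.P_functor Q.lift_facts(1) isos_cocart] isos_cocart])
      show "fa (top1 s) k \<in> isos Q.E" using isos_functor[OF TS(1), of k] k by simp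
    qed (use \<theta>u[OF x] k x in simp_all)
    finally show ?thesis .
  qed
  show sq: "ncloven_square \<P> \<Q> (fst (dat F))"
    unfolding s_def[symmetric] by unfold_locales (use co in simp_all)
  then interpret R: ncloven_square \<P> \<Q> s by (simp add: s_def)
  have "\<theta> = theta_cell R.G"
  proof (rule square2_componentI)
    fix a assume "a \<in> obj (src (src (src \<theta>)))"
    then have "a \<in> obj (comma P.P)" by simp
    then obtain x u where a: "a = Pr x u" "x \<in> obj P.E" "u \<in> arr P.B" "dm P.B u = fo P.P x" by (rule comma_objE)
    have "dat (top1 \<theta>) a = theta_comp R.G u x"
      unfolding a(1) by (rule R.theta_eqI) (use a \<theta>u[OF a(2-4)] in simp_all)
    then show "dat (top1 \<theta>) a = dat (top1 (theta_cell R.G)) a" using a by simp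
  qed (simp_all add: bot)
  then show "F = Gamma_n1 (Cell \<P> \<Q> (fst (dat F)))"
    by (intro cell_eqI) (simp_all add: Gamma_n1_def sF tF s_def \<theta>_def prod_eq_iff)
qed

text \<open>Any 2-cell of squares qualifies: once the lift over \<open>S u\<close> is cancelled, the
  law is naturality of the top transformation at the lift over \<open>u\<close>.\<close>

lemma (in ncloven_square) transformation_Gamma:
  assumes r: "ncloven_square \<P> \<Q> r" and \<alpha>: "\<alpha> \<in> cells2 CAT2" and e: "src \<alpha> = s" "tgt \<alpha> = r"
  shows "algebra_transformation CAT2 CommaMonad (Cell (Gamma_n1 (Cell \<P> \<Q> s)) (Gamma_n1 (Cell \<P> \<Q> r)) \<alpha>)"
proof -
  interpret R: ncloven_square \<P> \<Q> r by fact
  note [simp] = \<alpha> e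
  have tr: "is_trans (top1 \<alpha>)" "src (top1 \<alpha>) = T" "tgt (top1 \<alpha>) = R.T" "is_trans (bot1 \<alpha>)" "src (bot1 \<alpha>) = S" "tgt (bot1 \<alpha>) = R.S"
    using square2D[OF \<alpha>] by simp_all
  have law: "vcomp CAT2 (whisk_r CAT2 \<alpha> P.A) (theta_cell G) =
    vcomp CAT2 (theta_cell R.G) (whisk_l CAT2 Q.A (comma_square2 \<alpha>))" (is "?l = ?r")
  proof (rule square2_componentI)
    fix a assume "a \<in> obj (src (src (src ?l)))"
    then have a0: "a \<in> obj (comma P.P)" by simp
    then obtain x u where a: "a = Pr x u" "x \<in> obj P.E" "u \<in> arr P.B" "dm P.B u = fo P.P x" by (rule comma_objE)
    let ?z = "mor (Pr (fo T x) (fa S u)) (Pr (fo R.T x) (fa R.S u)) (dat (top1 \<alpha>) x) (dat (bot1 \<alpha>) (cd P.B u))"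
    have z: "?z \<in> arr (comma Q.P)"
      using trans_arr(1)[of "top1 (comma_square2 \<alpha>)" "comma Q.P" a] a0 a square2D(1)[OF comma_square2_cell[OF \<alpha>]]
      by (simp add: comma_square2_dat comma_map_obj_def del: comma_mor)
    have x: "dat (top1 \<alpha>) x \<in> arr Q.E" "dm Q.E (dat (top1 \<alpha>) x) = fo T x" "cd Q.E (dat (top1 \<alpha>) x) = fo R.T x"
      "dat (top1 \<alpha>) (push \<P> u x) \<in> arr Q.E" "dm Q.E (dat (top1 \<alpha>) (push \<P> u x)) = fo T (push \<P> u x)"
      "cd Q.E (dat (top1 \<alpha>) (push \<P> u x)) = fo R.T (push \<P> u x)"
      "dat (bot1 \<alpha>) (cd P.B u) \<in> arr Q.B" "dm Q.B (dat (bot1 \<alpha>) (cd P.B u)) = fo S (cd P.B u)"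
      "cd Q.B (dat (bot1 \<alpha>) (cd P.B u)) = fo R.S (cd P.B u)"
      "fa Q.P (dat (top1 \<alpha>) (push \<P> u x)) = dat (bot1 \<alpha>) (cd P.B u)"
      using trans_arr[OF tr(1), of Q.E x] trans_arr[OF tr(1), of Q.E "push \<P> u x"] trans_arr[OF tr(4), of Q.B "cd P.B u"]
        square2_commute[OF \<alpha>, of "push \<P> u x"] tr a by simp_all
    have n: "cmp Q.E (dat (top1 \<alpha>) (push \<P> u x)) (fa T (lift \<P> x u)) = cmp Q.E (fa R.T (lift \<P> x u)) (dat (top1 \<alpha>) x)"
      using trans_nat[OF tr(1), of P.E Q.E "lift \<P> x u"] tr(2,3) a by simp
    note Lz = Q.action_L_fa[OF z, simplified]
    have "cmp Q.E (dat (top1 \<alpha>) (push \<P> u x)) (theta_comp G u x) = cmp Q.E (theta_comp R.G u x) (fa (action_L \<Q>) ?z)"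
    proof (rule Q.lift_eqI[of "fo T x" "fa S u"])
      have "cmp Q.E (cmp Q.E (dat (top1 \<alpha>) (push \<P> u x)) (theta_comp G u x)) (lift \<Q> (fo T x) (fa S u)) =
        cmp Q.E (fa R.T (lift \<P> x u)) (dat (top1 \<alpha>) x)" using a x n by simp
      also have "\<dots> = cmp Q.E (theta_comp R.G u x) (cmp Q.E (fa (action_L \<Q>) ?z) (lift \<Q> (fo T x) (fa S u)))"
        unfolding Lz(5) using a x by simp
      also have "\<dots> = cmp Q.E (cmp Q.E (theta_comp R.G u x) (fa (action_L \<Q>) ?z)) (lift \<Q> (fo T x) (fa S u))"
        by (rule category_assoc[symmetric]) (use a x in \<open>simp_all add: Lz(1-3)\<close>)
      finally show "cmp Q.E (cmp Q.E (dat (top1 \<alpha>) (push \<P> u x)) (theta_comp G u x)) (lift \<Q> (fo T x) (fa S u)) =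
        cmp Q.E (cmp Q.E (theta_comp R.G u x) (fa (action_L \<Q>) ?z)) (lift \<Q> (fo T x) (fa S u))" .
    qed (use a x in \<open>simp_all add: Lz(1-4)\<close>)
    then show "dat (top1 ?l) a = dat (top1 ?r) a"
      using a a0 tr by (simp add: comma_square2_dat comma_map_obj_def)
  next
    show "?l \<in> cells2 CAT2" "?r \<in> cells2 CAT2" "src ?l = src ?r" "tgt ?l = tgt ?r" by simp_all
    show "bot1 ?l = bot1 ?r" using tr by simp
  qed
  then show ?thesis
    using pseudomorphism_Gamma R.pseudomorphism_Gamma tr
    by (simp add: algebra_transformation_def Gamma_n1_def) (simp add: Gamma_n0_def)
qed

subsection \<open>Normal cleavages and normal pseudoalgebras\<close>

lemma NClCoFib_cells0 [simp]: "\<P> \<in> cells0 NClCoFib \<longleftrightarrow> ncloven \<P>"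
  by (simp add: NClCoFib_def ncloven_def)

lemma NClCoFib_cells1: "G \<in> cells1 NClCoFib \<longleftrightarrow> ncloven_square (src G) (tgt G) (dat G)"
  by (auto simp: NClCoFib_def ncloven_square_def ncloven_square_axioms_def ncloven_def)

lemma NClCoFib_cells2:
  "\<alpha> \<in> cells2 NClCoFib \<longleftrightarrow> src \<alpha> \<in> cells1 NClCoFib \<and> tgt \<alpha> \<in> cells1 NClCoFib \<and>
     src (src \<alpha>) = src (tgt \<alpha>) \<and> tgt (src \<alpha>) = tgt (tgt \<alpha>) \<and>
     dat \<alpha> \<in> cells2 CAT2 \<and> src (dat \<alpha>) = dat (src \<alpha>) \<and> tgt (dat \<alpha>) = dat (tgt \<alpha>)"
  unfolding NClCoFib_def structured_cells2 by blast

lemma NClCoFib_sel [simp]: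
  "id1 NClCoFib \<P> = Cell \<P> \<P> (id1 CAT2 (prj \<P>))"
  "comp1 NClCoFib H G = Cell (src G) (tgt H) (comp1 CAT2 (dat H) (dat G))"
  "id2 NClCoFib G = Cell G G (id2 CAT2 (dat G))"
  "vcomp NClCoFib \<beta> \<alpha> = Cell (src \<alpha>) (tgt \<beta>) (vcomp CAT2 (dat \<beta>) (dat \<alpha>))"
  "hcomp NClCoFib \<beta> \<alpha> = Cell (comp1 NClCoFib (src \<beta>) (src \<alpha>)) (comp1 NClCoFib (tgt \<beta>) (tgt \<alpha>))
     (hcomp CAT2 (dat \<beta>) (dat \<alpha>))"
  by (simp_all add: NClCoFib_def)

lemma strict_NClCoFib: "strict_2_category NClCoFib"
  unfolding NClCoFib_def
proof (rule CAT2.strict_structured, goal_cases)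
  case (1 \<P>)
  then show ?case by (simp add: cloven_cofibration_def)
next
  case (2 \<P>)
  then show ?case by (simp add: cocartD(1))
next
  case (3 \<P> \<Q> \<R> f g)
  then show ?case by (simp add: cocartD(1))
qed simp_all

interpretation NCl: twocat NClCoFib
  by unfold_locales (rule strict_NClCoFib)

interpretation CommaAlg: twocat "PsAlgn CAT2 CommaMonad"
  by unfold_locales (rule Comma.strict_PsAlgn)

lemma Gamma_n1_sel [simp]: "src (Gamma_n1 G) = Gamma_n0 (src G)" "tgt (Gamma_n1 G) = Gamma_n0 (tgt G)"
  "fst (dat (Gamma_n1 G)) = dat G" "snd (dat (Gamma_n1 G)) = theta_cell G"
  by (simp_all add: Gamma_n1_def)

lemma pseudomorphism_Gamma_n1: "G \<in> cells1 NClCoFib \<Longrightarrow> pseudomorphism CAT2 CommaMonad (Gamma_n1 G)"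
  using ncloven_square.pseudomorphism_Gamma[of "src G" "tgt G" "dat G"] by (simp add: NClCoFib_cells1)

text \<open>Makes \<open>Gamma_n\<close> functorial without computing pasted comparisons: both sides
  of a functoriality equation are pseudomorphisms with the same ends and the same underlying
  square.\<close>

lemma pseudomorphism_eqI:
  assumes "ncloven \<P>" "ncloven \<Q>" "pseudomorphism CAT2 CommaMonad F" "pseudomorphism CAT2 CommaMonad F'"
    "src F = Gamma_n0 \<P>" "tgt F = Gamma_n0 \<Q>" "src F' = Gamma_n0 \<P>" "tgt F' = Gamma_n0 \<Q>" "fst (dat F) = fst (dat F')"
  shows "F = F'"
  using pseudomorphism_determined(2)[of \<P> \<Q> F] pseudomorphism_determined(2)[of \<P> \<Q> F'] assms by metis

lemma transformation_Gamma_n1: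
  assumes "\<alpha> \<in> cells2 NClCoFib"
  shows "algebra_transformation CAT2 CommaMonad (Cell (Gamma_n1 (src \<alpha>)) (Gamma_n1 (tgt \<alpha>)) (dat \<alpha>))"
proof -
  have e: "src (src \<alpha>) = src (tgt \<alpha>)" "tgt (src \<alpha>) = tgt (tgt \<alpha>)"
    and n: "ncloven_square (src (src \<alpha>)) (tgt (src \<alpha>)) (dat (src \<alpha>))"
    "ncloven_square (src (tgt \<alpha>)) (tgt (tgt \<alpha>)) (dat (tgt \<alpha>))"
    and d: "dat \<alpha> \<in> cells2 CAT2" "src (dat \<alpha>) = dat (src \<alpha>)" "tgt (dat \<alpha>) = dat (tgt \<alpha>)"
    using assms unfolding NClCoFib_cells2 NClCoFib_cells1 by (auto simp only:)
  note a = n(1) n(2)[folded e] d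
  have "Cell (src (src \<alpha>)) (tgt (src \<alpha>)) (dat (src \<alpha>)) = src \<alpha>" "Cell (src (src \<alpha>)) (tgt (src \<alpha>)) (dat (tgt \<alpha>)) = tgt \<alpha>"
    using e by (auto intro: cell_eqI)
  then show ?thesis using ncloven_square.transformation_Gamma[OF a] by simp
qed

lemma two_functor_Gamma_n: "two_functor NClCoFib (PsAlgn CAT2 CommaMonad) Gamma_n"
proof (rule two_functorI, goal_cases)
  case (3 \<P>)
  then show ?case by (simp add: Gamma_n_def ncloven.pseudoalgebra_Gamma)
next
  case (4 G)
  then show ?case by (simp add: Gamma_n_def pseudomorphism_Gamma_n1)
next
  case (5 \<alpha>)
  then show ?case using transformation_Gamma_n1[OF 5(1)] by (simp add: Gamma_n_def)
next
  case (6 \<P>)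
  then have p: "ncloven \<P>" by simp
  have "Gamma_n1 (id1 NClCoFib \<P>) = id1 (PsAlgn CAT2 CommaMonad) (Gamma_n0 \<P>)"
    by (rule pseudomorphism_eqI[OF p p])
      (use NCl.id1_cell(1)[OF 6] CommaAlg.id1_cell(1)[of "Gamma_n0 \<P>"] ncloven.pseudoalgebra_Gamma[OF p] in
        \<open>simp_all add: pseudomorphism_Gamma_n1 Gamma_n0_def\<close>)
  then show ?case by (simp add: Gamma_n_def)
next
  case (7 G H)
  then have p: "ncloven (src G)" "ncloven (tgt H)" by (simp_all add: NClCoFib_cells1 ncloven_square_def)
  have "Gamma_n1 (comp1 NClCoFib H G) = comp1 (PsAlgn CAT2 CommaMonad) (Gamma_n1 H) (Gamma_n1 G)"
    by (rule pseudomorphism_eqI[OF p])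
      (use NCl.comp1_cell(1)[OF 7] Comma.pseudomorphism_comp[of "Gamma_n1 G" "Gamma_n1 H"] 7 in
        \<open>simp_all add: pseudomorphism_Gamma_n1\<close>)
  then show ?case by (simp add: Gamma_n_def)
next
  case (10 \<alpha> \<beta>)
  have c: "Gamma_n1 (comp1 NClCoFib H G) = comp1 (PsAlgn CAT2 CommaMonad) (Gamma_n1 H) (Gamma_n1 G)"
    if "G \<in> cells1 NClCoFib" "H \<in> cells1 NClCoFib" "tgt G = src H" for G H
  proof -
    have p: "ncloven (src G)" "ncloven (tgt H)" using that by (simp_all add: NClCoFib_cells1 ncloven_square_def)
    show ?thesis
      by (rule pseudomorphism_eqI[OF p])
        (use NCl.comp1_cell(1)[OF that] Comma.pseudomorphism_comp[of "Gamma_n1 G" "Gamma_n1 H"] that in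
        \<open>simp_all add: pseudomorphism_Gamma_n1\<close>)
  qed
  show ?case using c[OF 10(4,6,3)] c[OF 10(5,7,8)] unfolding NClCoFib_sel(5) Comma.PsAlgn_sel(8)
    by (simp add: Gamma_n_def del: Comma.PsAlgn_sel(5) NClCoFib_sel(2))
qed (simp_all add: strict_NClCoFib Comma.strict_PsAlgn Gamma_n_def)

lemma normal_pseudoalgebra_cloven:
  assumes "normal_pseudoalgebra CAT2 CommaMonad A"
  obtains \<P> where "ncloven \<P>" "Gamma_n0 \<P> = A"
proof -
  interpret comma_psalg A by unfold_locales fact
  show thesis using that ncloven_of Gamma_of by blast
qed

text \<open>Surjectivity on 1-cells and 2-cells starts by reconstructing cleavages at the ends;
  injectivity on 0-cells then shows that the two reconstructed 1-cells bounding a 2-cell are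
  parallel.\<close>

lemma two_isomorphism_Gamma_n: "two_isomorphism NClCoFib (PsAlgn CAT2 CommaMonad)
  (Gamma_n :: ('u ent cloven, 'u ent square, 'u ent square2, _, _, _) twofun)"
  unfolding two_isomorphism_def
proof (intro conjI)
  show "two_functor NClCoFib (PsAlgn CAT2 CommaMonad) (Gamma_n :: ('u ent cloven, 'u ent square, 'u ent square2, _, _, _) twofun)" by (rule two_functor_Gamma_n)
  interpret F: twofunctor NClCoFib "PsAlgn CAT2 CommaMonad" "Gamma_n :: ('u ent cloven, 'u ent square, 'u ent square2, _, _, _) twofun"
    by (rule twofunctorI) (rule two_functor_Gamma_n)
  have 1: "\<exists>G\<in>cells1 NClCoFib. Gamma_n1 G = F" if F: "pseudomorphism CAT2 CommaMonad F" for F :: "(_, 'u ent square \<times> _) cell"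
  proof -
    obtain \<P> where p: "ncloven \<P>" "Gamma_n0 \<P> = src F"
      using normal_pseudoalgebra_cloven[OF Comma.pseudomorphismD(1)[OF F]] by metis
    obtain \<Q> where q: "ncloven \<Q>" "Gamma_n0 \<Q> = tgt F"
      using normal_pseudoalgebra_cloven[OF Comma.pseudomorphismD(2)[OF F]] by metis
    note d = pseudomorphism_determined[OF p(1) q(1) F p(2)[symmetric] q(2)[symmetric]]
    show ?thesis using d by (intro bexI[of _ "Cell \<P> \<Q> (fst (dat F))"]) (simp_all add: NClCoFib_cells1)
  qed
  have inj1: "G = H" if "G \<in> cells1 NClCoFib" "H \<in> cells1 NClCoFib" "Gamma_n1 G = Gamma_n1 H" for G H :: "'u ent cloven1"
  proof (rule cell_eqI)
    have n: "ncloven (src G)" "ncloven (tgt G)" "ncloven (src H)" "ncloven (tgt H)"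
      using that by (simp_all add: NClCoFib_cells1 ncloven_square_def)
    have e: "Gamma_n0 (src G) = Gamma_n0 (src H)" "Gamma_n0 (tgt G) = Gamma_n0 (tgt H)" "dat G = dat H"
      using that(3) by (metis Gamma_n1_sel)+
    show "src G = src H" "tgt G = tgt H" "dat G = dat H" using Gamma_n0_inject n e by blast+
  qed
  show "bij_betw (map0 (Gamma_n :: ('u ent cloven, 'u ent square, 'u ent square2, _, _, _) twofun)) (cells0 NClCoFib) (cells0 (PsAlgn CAT2 CommaMonad))"
  proof (rule bij_betw_imageI)
    show "inj_on (map0 (Gamma_n :: ('u ent cloven, 'u ent square, 'u ent square2, _, _, _) twofun)) (cells0 NClCoFib)"
      by (rule inj_onI) (simp add: Gamma_n_def Gamma_n0_inject)
    show "map0 (Gamma_n :: ('u ent cloven, 'u ent square, 'u ent square2, _, _, _) twofun) ` cells0 NClCoFib = cells0 (PsAlgn CAT2 CommaMonad)"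
      using F.map0_cell normal_pseudoalgebra_cloven
      by (auto simp: Gamma_n_def image_iff elim!: normal_pseudoalgebra_cloven) 
  qed
  show "bij_betw (map1 (Gamma_n :: ('u ent cloven, 'u ent square, 'u ent square2, _, _, _) twofun)) (cells1 NClCoFib) (cells1 (PsAlgn CAT2 CommaMonad))"
  proof (rule bij_betw_imageI)
    show "inj_on (map1 (Gamma_n :: ('u ent cloven, 'u ent square, 'u ent square2, _, _, _) twofun)) (cells1 NClCoFib)"
      by (rule inj_onI) (rule inj1, simp_all add: Gamma_n_def)
    show "map1 (Gamma_n :: ('u ent cloven, 'u ent square, 'u ent square2, _, _, _) twofun) ` cells1 NClCoFib = cells1 (PsAlgn CAT2 CommaMonad)"
      using F.map1_cell(1) 1 by (fastforce simp: Gamma_n_def)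
  qed
  show "bij_betw (map2 (Gamma_n :: ('u ent cloven, 'u ent square, 'u ent square2, _, _, _) twofun)) (cells2 NClCoFib) (cells2 (PsAlgn CAT2 CommaMonad))"
  proof (rule bij_betw_imageI)
    show "inj_on (map2 (Gamma_n :: ('u ent cloven, 'u ent square, 'u ent square2, _, _, _) twofun)) (cells2 NClCoFib)"
    proof (rule inj_onI)
      fix \<alpha> \<beta> :: "'u ent cloven2" assume a: "\<alpha> \<in> cells2 NClCoFib" "\<beta> \<in> cells2 NClCoFib" "map2 Gamma_n \<alpha> = map2 Gamma_n \<beta>"
      have "src \<alpha> = src \<beta>" "tgt \<alpha> = tgt \<beta>"
        by (rule inj1; use a NCl.cell2_ends(1,2)[OF a(1)] NCl.cell2_ends(1,2)[OF a(2)] in \<open>simp add: Gamma_n_def\<close>)+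
      then show "\<alpha> = \<beta>" using a(3) by (intro cell_eqI[of \<alpha> \<beta>]) (simp_all add: Gamma_n_def)
    qed
    have "\<exists>\<alpha>\<in>cells2 NClCoFib. map2 Gamma_n \<alpha> = A" if A: "algebra_transformation CAT2 CommaMonad A" for A :: "(_, 'u ent square2) cell"
    proof -
      note D = Comma.algebra_transformationD[OF A]
      obtain G H where G: "G \<in> cells1 NClCoFib" "Gamma_n1 G = src A" "H \<in> cells1 NClCoFib" "Gamma_n1 H = tgt A"
        using 1[OF D(1)] 1[OF D(2)] by blast
      have n: "ncloven (src G)" "ncloven (tgt G)" "ncloven (src H)" "ncloven (tgt H)"
        using G by (simp_all add: NClCoFib_cells1 ncloven_square_def)
      have "Gamma_n0 (src G) = Gamma_n0 (src H)" "Gamma_n0 (tgt G) = Gamma_n0 (tgt H)" "dat G = fst (dat (src A))" "dat H = fst (dat (tgt A))"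
        using D(3,4) G by (metis Gamma_n1_sel)+
      then have "Cell G H (dat A) \<in> cells2 NClCoFib"
        using G(1,3) D(5-7) Gamma_n0_inject[OF n(1,3)] Gamma_n0_inject[OF n(2,4)] by (simp add: NClCoFib_cells2)
      moreover have "map2 Gamma_n (Cell G H (dat A)) = A" using G by (auto simp: Gamma_n_def intro: cell_eqI)
      ultimately show ?thesis by blast
    qed
    then show "map2 (Gamma_n :: ('u ent cloven, 'u ent square, 'u ent square2, _, _, _) twofun) ` cells2 NClCoFib = cells2 (PsAlgn CAT2 CommaMonad)"
      using F.map2_cell(1) by fastforce
  qed
qed

subsection \<open>Split cleavages and strict algebras\<close>

text \<open>Identity components force the source and target functors to agree on objects, and
  naturality then makes them agree on arrows; so the cell is an identity and not only
  invertible.\<close>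

lemma identity_square2:
  assumes \<sigma>: "\<sigma> \<in> cells2 CAT2" and b: "bot1 \<sigma> = id2 CAT (bot1 (src \<sigma>))"
    and i: "\<And>x. x \<in> obj (src (src (src \<sigma>))) \<Longrightarrow> dat (top1 \<sigma>) x = idn (src (tgt (src \<sigma>))) (fo (top1 (src \<sigma>)) x)"
  shows "\<sigma> = id2 CAT2 (src \<sigma>)"
proof -
  have s: "src \<sigma> \<in> cells1 CAT2" "tgt \<sigma> \<in> cells1 CAT2" and e: "src (tgt \<sigma>) = src (src \<sigma>)" "tgt (tgt \<sigma>) = tgt (src \<sigma>)"
    using \<sigma> by simp_all
  note tr = square2D[OF \<sigma>]
  have x: "fo (top1 (tgt \<sigma>)) x = fo (top1 (src \<sigma>)) x" if "x \<in> obj (src (src (src \<sigma>)))" for x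
    using trans_arr(3)[OF tr(1), of "src (tgt (src \<sigma>))" x] tr(3,4) s i[OF that] that by simp
  have "top1 (tgt \<sigma>) = top1 (src \<sigma>)"
  proof (rule functor_eqI)
    fix f assume "f \<in> arr (src (top1 (tgt \<sigma>)))"
    then have f: "f \<in> arr (src (src (src \<sigma>)))" using s e by simp
    then have d: "dm (src (src (src \<sigma>))) f \<in> obj (src (src (src \<sigma>)))" "cd (src (src (src \<sigma>))) f \<in> obj (src (src (src \<sigma>)))"
      using s(1) by simp_all
    show "fa (top1 (tgt \<sigma>)) f = fa (top1 (src \<sigma>)) f"
      using trans_nat[OF tr(1), of "src (src (src \<sigma>))" "src (tgt (src \<sigma>))" f] tr(3,4) f s e i[OF d(1)] i[OF d(2)] x[OF d(1)]
      by simp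
  qed (use s e x in simp_all)
  moreover have "bot1 (tgt \<sigma>) = bot1 (src \<sigma>)" using tr(6) b by simp
  ultimately have t: "tgt \<sigma> = src \<sigma>" using e by (intro square_eqI) simp_all
  show ?thesis
    by (rule square2_componentI) (use \<sigma> s t b i in simp_all)
qed

text \<open>The comparisons of strict morphisms are identities, so they drop out of the law of an
  algebra transformation and leave the strict law.\<close>

lemma (in tmonad) strict_transformation_if:
  assumes F: "F \<in> cells1 (Algs K M)" and G: "G \<in> cells1 (Algs K M)" and e: "src F = src G" "tgt F = tgt G"
    and t: "algebra_transformation K M (Cell (strict_to_pseudo_mor K M F) (strict_to_pseudo_mor K M G) \<alpha>)"
  shows "Cell F G \<alpha> \<in> cells2 (Algs K M)"
proof -
  note D = algebra_transformationD[OF t, simplified]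
  have A: "strict_algebra K M (src G)" and B: "strict_algebra K M (tgt G)" using G by simp_all
  note [simp] = strict_algebraD[OF A] strict_algebraD[OF B]
  have f: "dat F \<in> cells1 K" "src (dat F) = fst (src G)" "tgt (dat F) = fst (tgt G)" "dat F \<cdot> snd (src G) = snd (tgt G) \<cdot> map1 T (dat F)"
    "dat G \<in> cells1 K" "src (dat G) = fst (src G)" "tgt (dat G) = fst (tgt G)" "dat G \<cdot> snd (src G) = snd (tgt G) \<cdot> map1 T (dat G)"
    using F G e by simp_all
  have a: "\<alpha> \<in> cells2 K" "src \<alpha> = dat F" "tgt \<alpha> = dat G" using D(5-7) by (simp_all add: strict_to_pseudo_mor_def)
  have "(\<alpha> \<lhd> snd (src G)) \<bullet> id2 K (dat F \<cdot> snd (src G)) = id2 K (dat G \<cdot> snd (src G)) \<bullet> (snd (tgt G) \<rhd> map2 T \<alpha>)"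
    using D(8) e by (simp add: strict_to_pseudo_mor_def strict_to_pseudo_alg_def)
  then have "\<alpha> \<lhd> snd (src G) = snd (tgt G) \<rhd> map2 T \<alpha>" using a f by simp
  then show ?thesis using F G e a by (simp only: Algs_cells2 cell.sel)
qed

context ncloven
begin

text \<open>Pushforward of a vertical arrow and the action at \<open>(f, 1)\<close> are
  characterised by the same equation; equations for \<open>push_arr\<close> can therefore be
  obtained from \<open>action_L_eqI\<close>.\<close>

lemma push_arr_action:
  assumes u: "u \<in> arr B" and f: "f \<in> arr E" "fa P f = idn B (dm B u)"
  shows "push_arr \<P> u f = fa (action_L \<P>) (mor (Pr (dm E f) u) (Pr (cd E f) u) f (idn B (cd B u)))"
    "dm B u = fo P (dm E f)" "dm B u = fo P (cd E f)"
    "mor (Pr (dm E f) u) (Pr (cd E f) u) f (idn B (cd B u)) \<in> arr (comma P)"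
proof -
  show d: "dm B u = fo P (dm E f)" "dm B u = fo P (cd E f)"
  proof -
    have o: "dm B u \<in> obj B" using u by simp
    show "dm B u = fo P (dm E f)" "dm B u = fo P (cd E f)"
      using functor_fa(2,3)[OF P_functor refl f(1)] category_idn(2,3)[OF _ o] unfolding f(2) by simp_all
  qed
  show m: "mor (Pr (dm E f) u) (Pr (cd E f) u) f (idn B (cd B u)) \<in> arr (comma P)"
    using u f d(1)[symmetric] d(2)[symmetric] by simp
  note L = action_L_fa[OF m, simplified]
  have x: "dm E f \<in> obj E" using f by simp
  show "push_arr \<P> u f = fa (action_L \<P>) (mor (Pr (dm E f) u) (Pr (cd E f) u) f (idn B (cd B u)))"
    unfolding push_arr_def Let_def
  proof (rule the_equality)
    show "fa (action_L \<P>) (mor (Pr (dm E f) u) (Pr (cd E f) u) f (idn B (cd B u))) \<in> vertical P \<and>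
      fa (action_L \<P>) (mor (Pr (dm E f) u) (Pr (cd E f) u) f (idn B (cd B u))) \<in> hom E (push \<P> u (dm E f)) (push \<P> u (cd E f)) \<and>
      cmp E (fa (action_L \<P>) (mor (Pr (dm E f) u) (Pr (cd E f) u) f (idn B (cd B u)))) (lift \<P> (dm E f) u) = cmp E (lift \<P> (cd E f) u) f"
      using L u d x by (simp add: vertical_iff)
    fix h assume "h \<in> vertical P \<and> h \<in> hom E (push \<P> u (dm E f)) (push \<P> u (cd E f)) \<and> cmp E h (lift \<P> (dm E f) u) = cmp E (lift \<P> (cd E f) u) f"
    with L u d x show "h = fa (action_L \<P>) (mor (Pr (dm E f) u) (Pr (cd E f) u) f (idn B (cd B u)))"
      by - (rule lift_eqI[of "dm E f" u], simp_all add: vertical_iff)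
  qed
qed

text \<open>An identity \<open>chi_comp\<close> makes the composite of two lifts equal to the lift
  over \<open>v u\<close>, targets included. Functoriality of pushforward on vertical arrows is then
  a cancellation.\<close>

lemma split_if_chi:
  assumes c: "\<And>x u v. x \<in> obj E \<Longrightarrow> u \<in> arr B \<Longrightarrow> dm B u = fo P x \<Longrightarrow> v \<in> arr B \<Longrightarrow> dm B v = cd B u \<Longrightarrow>
    chi_comp \<P> v u x = idn E (push \<P> v (push \<P> u x))"
  shows "split_cleavage \<P>"
  unfolding split_cleavage_def Let_def
proof (intro conjI ballI impI allI)
  show "normal_cleavage \<P>" by (rule normal)
  fix u v assume u: "u \<in> arr B" and v: "v \<in> arr B" and e: "cd B u = dm B v"
  have p: "push \<P> (cmp B v u) x = push \<P> v (push \<P> u x)"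
    and l: "lift \<P> x (cmp B v u) = cmp E (lift \<P> (push \<P> u x) v) (lift \<P> x u)" if x: "x \<in> obj E" "dm B u = fo P x" for x
  proof -
    have e': "dm B v = cd B u" using e by simp
    note X = chi_facts[OF x(1) u x(2) v e', unfolded c[OF x(1) u x(2) v e']]
    show "push \<P> (cmp B v u) x = push \<P> v (push \<P> u x)" using X(4) x u v e by simp
    show "lift \<P> x (cmp B v u) = cmp E (lift \<P> (push \<P> u x) v) (lift \<P> x u)" using X(6) x u v e by simp
  qed
  show "push \<P> (cmp B v u) x = push \<P> v (push \<P> u x)"
    "lift \<P> x (cmp B v u) = cmp E (lift \<P> (push \<P> u x) v) (lift \<P> x u)" if "liftable \<P> x u" for x
    using p[of x] l[of x] that by (simp_all add: liftable_iff)
  fix f assume f: "f \<in> arr E" "fa P f = idn B (dm B u)"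
  let ?x = "dm E f" and ?y = "cd E f"
  note 1 = push_arr_action[OF u f]
  note L = action_L_fa[OF 1(4), folded 1(1), simplified]
  have pf: "push_arr \<P> u f \<in> arr E" "fa P (push_arr \<P> u f) = idn B (dm B v)" using L e by simp_all
  note 2 = push_arr_action[OF v pf]
  note L2 = action_L_fa[OF 2(4), folded 2(1), simplified]
  have vu: "cmp B v u \<in> arr B" "fa P f = idn B (dm B (cmp B v u))" using u v e f by simp_all
  note 3 = push_arr_action[OF vu(1) f(1) vu(2)]
  have xy: "?x \<in> obj E" "?y \<in> obj E" using f by simp_all
  \<comment> \<open>The twofold pushforward is shown to satisfy the equation that characterises the
    pushforward along \<open>v u\<close>, the composite lifts being the lifts over
    \<open>v u\<close>.\<close>
  have "cmp E (push_arr \<P> v (push_arr \<P> u f)) (cmp E (lift \<P> (push \<P> u ?x) v) (lift \<P> ?x u)) =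
      cmp E (lift \<P> (push \<P> u ?y) v) (cmp E (push_arr \<P> u f) (lift \<P> ?x u))"
    by (rule category_reassoc) (use L L2 xy u v e 1(2,3) in simp_all)
  also have "\<dots> = cmp E (cmp E (lift \<P> (push \<P> u ?y) v) (lift \<P> ?y u)) f"
    using L xy u v e 1(2,3) f by simp
  finally have eq: "cmp E (push_arr \<P> v (push_arr \<P> u f)) (lift \<P> ?x (cmp B v u)) = cmp E (lift \<P> ?y (cmp B v u)) f"
    using l[of ?x] l[of ?y] xy 1(2,3) by simp
  show "push_arr \<P> (cmp B v u) f = push_arr \<P> v (push_arr \<P> u f)"
    unfolding 3(1)
    by (rule action_L_eqI[OF 3(4)]) (use eq L L2 p[of ?x] p[of ?y] xy 1(2,3) u v e in simp_all)
qed

lemma chi_if_split: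
  assumes s: "split_cleavage \<P>" and x: "x \<in> obj E" "u \<in> arr B" "dm B u = fo P x" "v \<in> arr B" "dm B v = cd B u"
  shows "chi_comp \<P> v u x = idn E (push \<P> v (push \<P> u x))"
proof -
  have "liftable \<P> x u" using x by (simp add: liftable_iff)
  then have "push \<P> (cmp B v u) x = push \<P> v (push \<P> u x) \<and> lift \<P> x (cmp B v u) = cmp E (lift \<P> (push \<P> u x) v) (lift \<P> x u)"
    using s x unfolding split_cleavage_def Let_def by metis
  then show ?thesis using x by (intro chi_eqI[symmetric]) simp_all
qed

lemma split_iff: "split_cleavage \<P> \<longleftrightarrow> Gamma_n0 \<P> = strict_to_pseudo_alg CAT2 CommaMonad (Gamma_s0 \<P>)"
proof
  assume s: "split_cleavage \<P>"
  have "chi_cell \<P> = id2 CAT2 (src (chi_cell \<P>))"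
    by (rule identity_square2) (auto elim!: comma2_objE simp: chi_if_split[OF s])
  \<comment> \<open>An identity 2-cell is also the identity of its target, which is the 1-cell that
    \<open>strict_to_pseudo_alg\<close> uses.\<close>
  then have "chi_cell \<P> = id2 CAT2 (tgt (chi_cell \<P>))" by (metis CAT2_id2_sel(2))
  then show "Gamma_n0 \<P> = strict_to_pseudo_alg CAT2 CommaMonad (Gamma_s0 \<P>)"
    by (simp add: Gamma_n0_def strict_to_pseudo_alg_def Gamma_s0_def)
next
  assume "Gamma_n0 \<P> = strict_to_pseudo_alg CAT2 CommaMonad (Gamma_s0 \<P>)"
  then have c: "chi_cell \<P> = id2 CAT2 (comp1 CAT2 A (mmult CommaMonad P))"
    by (simp add: Gamma_n0_def strict_to_pseudo_alg_def Gamma_s0_def)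
  show "split_cleavage \<P>"
  proof (rule split_if_chi)
    fix x u v assume x: "x \<in> obj E" "u \<in> arr B" "dm B u = fo P x" "v \<in> arr B" "dm B v = cd B u"
    have "chi_comp \<P> v u x = idn E (push \<P> (cmp B v u) x)"
      using arg_cong[OF c, of "\<lambda>\<sigma>. dat (top1 \<sigma>) (Pr (Pr x u) v)"] x by simp
    \<comment> \<open>Comparing domains shows that the identity at the target of
      \<open>chi_comp\<close> is also the one at its source.\<close>
    then show "chi_comp \<P> v u x = idn E (push \<P> v (push \<P> u x))"
      using chi_facts(3)[OF x] x by simp
  qed
qed

text \<open>From strict to split: taken as a pseudoalgebra, the strict algebra comes from some
  cleavage \<open>\<Q>\<close>. The lifts of \<open>\<Q>\<close> are recovered from the same action
  as those of \<open>\<P>\<close>, so the two cleavages coincide and \<open>split_iff\<close>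
  applies.\<close>

lemma strict_algebra_iff: "strict_algebra CAT2 CommaMonad (Gamma_s0 \<P>) \<longleftrightarrow> split_cleavage \<P>"
proof
  assume "split_cleavage \<P>"
  then have "normal_pseudoalgebra CAT2 CommaMonad (strict_to_pseudo_alg CAT2 CommaMonad (Gamma_s0 \<P>))"
    using pseudoalgebra_Gamma by (simp add: split_iff)
  then show "strict_algebra CAT2 CommaMonad (Gamma_s0 \<P>)"
    unfolding strict_to_pseudo_alg_def Gamma_s0_def fst_conv snd_conv
    by (rule Comma.strict_algebra_if_identity) simp
next
  assume s: "strict_algebra CAT2 CommaMonad (Gamma_s0 \<P>)"
  let ?A = "strict_to_pseudo_alg CAT2 CommaMonad (Gamma_s0 \<P>)"
  have "normal_pseudoalgebra CAT2 CommaMonad ?A" using s by (rule Comma.pseudoalgebra_strict)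
  then obtain \<Q> where q: "ncloven \<Q>" "Gamma_n0 \<Q> = ?A" by (rule normal_pseudoalgebra_cloven)
  interpret Q: ncloven \<Q> by fact
  have "prj \<Q> = P" "action_square \<Q> = A"
    using q(2) by (simp_all add: Gamma_n0_def strict_to_pseudo_alg_def Gamma_s0_def)
  then have "lift \<Q> x u = lift \<P> x u" for x u
    using Q.lift_action[of x u] lift_action[of x u] Q.action_square_sel(3) action_square_sel(3) cloven Q.cloven
    unfolding cloven_cofibration_def liftable_def by metis
  then have "\<Q> = \<P>" using \<open>prj \<Q> = P\<close> by (intro cloven.expand) auto
  then show "split_cleavage \<P>" using q(2) by (simp add: split_iff)
qed

end

text \<open>By the equation that characterises \<open>theta_comp\<close>, the comparison is an
  identity exactly when \<open>T\<close> carries lifts to lifts; splitness identifies the two ends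
  with strict algebras.\<close>

lemma (in ncloven_square) strict_mor_iff:
  assumes p: "split_cleavage \<P>" and q: "split_cleavage \<Q>"
  shows "(\<forall>x u. liftable \<P> x u \<longrightarrow> fa T (lift \<P> x u) = lift \<Q> (fo T x) (fa S u)) \<longleftrightarrow>
    Gamma_n1 G = strict_to_pseudo_mor CAT2 CommaMonad (Gamma_s1 G)"
proof
  assume l: "\<forall>x u. liftable \<P> x u \<longrightarrow> fa T (lift \<P> x u) = lift \<Q> (fo T x) (fa S u)"
  have t: "theta_comp G u x = idn Q.E (push \<Q> (fa S u) (fo T x))" if x: "x \<in> obj P.E" "u \<in> arr P.B" "dm P.B u = fo P.P x" for x u
  proof -
    have e: "fa T (lift \<P> x u) = lift \<Q> (fo T x) (fa S u)" using l x by (simp add: liftable_def)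
    have "fo T (push \<P> u x) = push \<Q> (fa S u) (fo T x)"
      using arg_cong[OF e, of "cd Q.E"] x by simp
    then show ?thesis using e x by (intro theta_eqI[symmetric]) simp_all
  qed
  have "theta_cell G = id2 CAT2 (src (theta_cell G))"
    by (rule identity_square2) (auto elim!: comma_objE simp: t)
  then have "theta_cell G = id2 CAT2 (tgt (theta_cell G))" by (metis CAT2_id2_sel(2))
  then show "Gamma_n1 G = strict_to_pseudo_mor CAT2 CommaMonad (Gamma_s1 G)"
    using p q P.split_iff Q.split_iff
    by (intro cell_eqI) (simp_all add: Gamma_n1_def strict_to_pseudo_mor_def Gamma_s1_def, simp add: Gamma_s0_def)
next
  assume "Gamma_n1 G = strict_to_pseudo_mor CAT2 CommaMonad (Gamma_s1 G)"
  then have c: "theta_cell G = id2 CAT2 (comp1 CAT2 s P.A)"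
    by (simp add: Gamma_n1_def strict_to_pseudo_mor_def Gamma_s1_def Gamma_s0_def)
  show "\<forall>x u. liftable \<P> x u \<longrightarrow> fa T (lift \<P> x u) = lift \<Q> (fo T x) (fa S u)"
  proof (intro allI impI)
    fix x u assume "liftable \<P> x u"
    then have x: "x \<in> obj P.E" "u \<in> arr P.B" "dm P.B u = fo P.P x" by (simp_all add: P.liftable_iff)
    have "theta_comp G u x = idn Q.E (fo T (push \<P> u x))"
      using arg_cong[OF c, of "\<lambda>\<sigma>. dat (top1 \<sigma>) (Pr x u)"] x by simp
    then show "fa T (lift \<P> x u) = lift \<Q> (fo T x) (fa S u)"
      using theta_facts(3,6)[OF x] x by simp
  qed
qed

lemma SCoFib_cells0 [simp]: "\<P> \<in> cells0 SCoFib \<longleftrightarrow> ncloven \<P> \<and> split_cleavage \<P>"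
  by (auto simp: SCoFib_def ncloven_def split_cleavage_def)

text \<open>Preservation of cocartesian arrows is not part of the definition of a 1-cell of
  \<open>SCoFib\<close>. It follows because each of them is a chosen lift followed by an
  isomorphism, and chosen lifts go to chosen lifts.\<close>

lemma SCoFib_cells1:
  "G \<in> cells1 SCoFib \<longleftrightarrow> ncloven_square (src G) (tgt G) (dat G) \<and> split_cleavage (src G) \<and> split_cleavage (tgt G) \<and>
     (\<forall>x u. liftable (src G) x u \<longrightarrow> fa (top1 (dat G)) (lift (src G) x u) = lift (tgt G) (fo (top1 (dat G)) x) (fa (bot1 (dat G)) u))"
    (is "?l \<longleftrightarrow> ?r")
proof
  assume ?r
  then show ?l by (auto simp: SCoFib_def ncloven_square_def ncloven_square_axioms_def ncloven_def)
next
  assume l: ?l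
  then have n: "ncloven (src G)" "ncloven (tgt G)" "split_cleavage (src G)" "split_cleavage (tgt G)"
    and s: "dat G \<in> cells1 CAT2" "src (dat G) = prj (src G)" "tgt (dat G) = prj (tgt G)"
    and c: "\<And>x u. liftable (src G) x u \<Longrightarrow>
      fa (top1 (dat G)) (lift (src G) x u) = lift (tgt G) (fo (top1 (dat G)) x) (fa (bot1 (dat G)) u)"
    by (auto simp: SCoFib_def ncloven_def split_cleavage_def)
  interpret P: ncloven "src G" by fact
  interpret Q: ncloven "tgt G" by fact
  have TS: "is_functor (top1 (dat G))" "src (top1 (dat G)) = P.E" "tgt (top1 (dat G)) = Q.E"
    "is_functor (bot1 (dat G))" "src (bot1 (dat G)) = P.B" "tgt (bot1 (dat G)) = Q.B"
    using squareD[OF s(1)] s(2,3) by simp_all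
  have "fa (top1 (dat G)) e \<in> cocart Q.P" if e: "e \<in> cocart P.P" for e
    using e
  proof (rule P.cocart_factor)
    let ?x = "dm P.E e" and ?u = "fa P.P e"
    fix k assume k: "k \<in> isos P.E" "dm P.E k = push (src G) ?u ?x" "cmp P.E k (lift (src G) ?x ?u) = e"
    have x: "?x \<in> obj P.E" "?u \<in> arr P.B" "dm P.B ?u = fo P.P ?x" using cocartD(1)[OF e] by simp_all
    have "fa (top1 (dat G)) e = cmp Q.E (fa (top1 (dat G)) k) (lift (tgt G) (fo (top1 (dat G)) ?x) (fa (bot1 (dat G)) ?u))"
      using arg_cong[OF k(3)[symmetric], of "fa (top1 (dat G))"] functor_cmp[OF TS(1,2), of "lift (src G) ?x ?u" k]
        k(1,2) x c[of ?x ?u] TS by (simp add: P.liftable_iff)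
    also have "\<dots> \<in> cocart Q.P"
    proof (rule cocart_cmp[OF Q.P_functor Q.lift_facts(1) isos_cocart])
      show "fa (top1 (dat G)) k \<in> isos Q.E" using isos_functor[OF TS(1), of k] k TS by simp
      have y: "fo (top1 (dat G)) ?x \<in> obj Q.E" "fa (bot1 (dat G)) ?u \<in> arr Q.B"
        "dm Q.B (fa (bot1 (dat G)) ?u) = fo Q.P (fo (top1 (dat G)) ?x)"
        using x TS square_commute(1)[OF s(1), of ?x] s(2,3) by simp_all
      then show "fo (top1 (dat G)) ?x \<in> obj Q.E" "fa (bot1 (dat G)) ?u \<in> arr Q.B"
        "dm Q.B (fa (bot1 (dat G)) ?u) = fo Q.P (fo (top1 (dat G)) ?x)" .
      have "cd Q.E (lift (tgt G) (fo (top1 (dat G)) ?x) (fa (bot1 (dat G)) ?u)) = fo (top1 (dat G)) (push (src G) ?u ?x)"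
        using c[of ?x ?u] x TS functor_fa(3)[OF TS(1,3), of "lift (src G) ?x ?u"] by (simp add: P.liftable_iff)
      then show "cd Q.E (lift (tgt G) (fo (top1 (dat G)) ?x) (fa (bot1 (dat G)) ?u)) = dm Q.E (fa (top1 (dat G)) k)"
        using k TS by simp
    qed simp
    finally show ?thesis .
  qed
  then show ?r using n s c
    by (auto simp: ncloven_square_def ncloven_square_axioms_def)
qed

lemma SCoFib_cells2:
  "\<alpha> \<in> cells2 SCoFib \<longleftrightarrow> src \<alpha> \<in> cells1 SCoFib \<and> tgt \<alpha> \<in> cells1 SCoFib \<and>
     src (src \<alpha>) = src (tgt \<alpha>) \<and> tgt (src \<alpha>) = tgt (tgt \<alpha>) \<and>
     dat \<alpha> \<in> cells2 CAT2 \<and> src (dat \<alpha>) = dat (src \<alpha>) \<and> tgt (dat \<alpha>) = dat (tgt \<alpha>)"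
  unfolding SCoFib_def structured_cells2 by blast

lemma SCoFib_sel [simp]:
  "id1 SCoFib \<P> = Cell \<P> \<P> (id1 CAT2 (prj \<P>))"
  "comp1 SCoFib H G = Cell (src G) (tgt H) (comp1 CAT2 (dat H) (dat G))"
  "id2 SCoFib G = Cell G G (id2 CAT2 (dat G))"
  "vcomp SCoFib \<beta> \<alpha> = Cell (src \<alpha>) (tgt \<beta>) (vcomp CAT2 (dat \<beta>) (dat \<alpha>))"
  "hcomp SCoFib \<beta> \<alpha> = Cell (comp1 SCoFib (src \<beta>) (src \<alpha>)) (comp1 SCoFib (tgt \<beta>) (tgt \<alpha>))
     (hcomp CAT2 (dat \<beta>) (dat \<alpha>))"
  by (simp_all add: SCoFib_def)

lemma strict_SCoFib: "strict_2_category (SCoFib :: ('u ent cloven, 'u ent square, 'u ent square2) twocat)"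
  unfolding SCoFib_def
proof (rule CAT2.strict_structured, goal_cases)
  case (1 \<P>)
  then show ?case by (simp add: cloven_cofibration_def)
next
  case (2 \<P>)
  then interpret ncloven \<P> by (simp add: ncloven_def split_cleavage_def)
  show ?case by (simp add: liftable_iff)
next
  case (3 \<P> \<Q> \<R> f g)
  then interpret P: ncloven \<P> by (simp add: ncloven_def split_cleavage_def)
  show ?case
  proof (intro allI impI)
    fix x u assume l: "liftable \<P> x u"
    then have x: "x \<in> obj P.E" "u \<in> arr P.B" "dm P.B u = fo P.P x" by (simp_all add: P.liftable_iff)
    have TS: "is_functor (top1 f)" "src (top1 f) = P.E" "tgt (top1 f) = tot \<Q>"
      "is_functor (bot1 f)" "src (bot1 f) = P.B" "tgt (bot1 f) = base \<Q>"
      using squareD[OF 3(4)] 3(6,7) by simp_all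
    have "liftable \<Q> (fo (top1 f) x) (fa (bot1 f) u)"
      using x TS square_commute(1)[OF 3(4), of x] 3(6,7) by (simp add: liftable_def)
    then show "fa (top1 (comp1 CAT2 g f)) (lift \<P> x u) = lift \<R> (fo (top1 (comp1 CAT2 g f)) x) (fa (bot1 (comp1 CAT2 g f)) u)"
      using 3(10,11) l x TS by simp
  qed
qed simp_all

interpretation SC: twocat "SCoFib :: ('u ent cloven, 'u ent square, 'u ent square2) twocat"
  by unfold_locales (rule strict_SCoFib)

interpretation CommaS: twocat "Algs CAT2 CommaMonad"
  by unfold_locales (rule Comma.strict_Algs)

lemma SCoFib_NClCoFib:
  fixes G :: "'u ent cloven1" and \<alpha> :: "'u ent cloven2"
  shows "G \<in> cells1 SCoFib \<Longrightarrow> G \<in> cells1 NClCoFib" "\<alpha> \<in> cells2 SCoFib \<Longrightarrow> \<alpha> \<in> cells2 NClCoFib"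
proof -
  show 1: "G \<in> cells1 SCoFib \<Longrightarrow> G \<in> cells1 NClCoFib" for G :: "'u ent cloven1"
    unfolding SCoFib_cells1 NClCoFib_cells1 by (elim conjE)
  show "\<alpha> \<in> cells2 SCoFib \<Longrightarrow> \<alpha> \<in> cells2 NClCoFib"
    unfolding SCoFib_cells2 NClCoFib_cells2 using 1 by blast
qed

lemma two_functor_inclusion:
  "two_functor SCoFib NClCoFib (twofun_id :: ('u ent cloven, 'u ent square, 'u ent square2, _, _, _) twofun)"
proof (rule two_functorI, goal_cases)
  case (4 G)
  then show ?case by (simp add: twofun_id_def SCoFib_NClCoFib)
next
  case (5 \<alpha>)
  then show ?case by (simp add: twofun_id_def SCoFib_NClCoFib)
qed (simp_all add: strict_SCoFib strict_NClCoFib twofun_id_def)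

lemma Gamma_s1_sel [simp]: "src (Gamma_s1 G) = Gamma_s0 (src G)" "tgt (Gamma_s1 G) = Gamma_s0 (tgt G)" "dat (Gamma_s1 G) = dat G"
  "fst (Gamma_s0 \<P>) = prj \<P>" "snd (Gamma_s0 \<P>) = action_square \<P>"
  by (simp_all add: Gamma_s1_def Gamma_s0_def)

lemma Gamma_strict0:
  assumes "\<P> \<in> cells0 SCoFib"
  shows "strict_algebra CAT2 CommaMonad (Gamma_s0 \<P>)" "Gamma_n0 \<P> = strict_to_pseudo_alg CAT2 CommaMonad (Gamma_s0 \<P>)"
  using assms ncloven.strict_algebra_iff[of \<P>] ncloven.split_iff[of \<P>] by simp_all

text \<open>The comparison is an identity by \<open>strict_mor_iff\<close>, and the law of a strict
  morphism is then read off from its boundary.\<close>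

lemma Gamma_strict1:
  assumes G: "G \<in> cells1 SCoFib"
  shows "Gamma_n1 G = strict_to_pseudo_mor CAT2 CommaMonad (Gamma_s1 G)" "Gamma_s1 G \<in> cells1 (Algs CAT2 CommaMonad)"
proof -
  interpret ncloven_square "src G" "tgt G" "dat G" using G by (simp add: SCoFib_cells1)
  have g: "Cell (src G) (tgt G) (dat G) = G" by simp
  show 1: "Gamma_n1 G = strict_to_pseudo_mor CAT2 CommaMonad (Gamma_s1 G)"
    using G strict_mor_iff by (simp add: SCoFib_cells1)
  have p: "pseudomorphism CAT2 CommaMonad (Cell (strict_to_pseudo_alg CAT2 CommaMonad (Gamma_s0 (src G)))
      (strict_to_pseudo_alg CAT2 CommaMonad (Gamma_s0 (tgt G))) (dat G, id2 CAT2 (comp1 CAT2 (dat G) (action_square (src G)))))"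
    using pseudomorphism_Gamma 1 by (simp add: strict_to_pseudo_mor_def)
  have "Cell (Gamma_s0 (src G)) (Gamma_s0 (tgt G)) (dat G) \<in> cells1 (Algs CAT2 CommaMonad)"
    by (rule Comma.strict_if_identity[OF p]) (use G SC.cell1_ends[OF G] in \<open>simp_all add: Gamma_strict0\<close>)
  then show "Gamma_s1 G \<in> cells1 (Algs CAT2 CommaMonad)" by (simp only: Gamma_s1_def)
qed

lemma Gamma_strict2:
  assumes a: "\<alpha> \<in> cells2 SCoFib"
  shows "Cell (Gamma_s1 (src \<alpha>)) (Gamma_s1 (tgt \<alpha>)) (dat \<alpha>) \<in> cells2 (Algs CAT2 CommaMonad)"
proof (rule Comma.strict_transformation_if)
  note e = SC.cell2_ends[OF a]
  show "Gamma_s1 (src \<alpha>) \<in> cells1 (Algs CAT2 CommaMonad)" "Gamma_s1 (tgt \<alpha>) \<in> cells1 (Algs CAT2 CommaMonad)"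
    using Gamma_strict1(2) e by blast+
  show "algebra_transformation CAT2 CommaMonad (Cell (strict_to_pseudo_mor CAT2 CommaMonad (Gamma_s1 (src \<alpha>)))
      (strict_to_pseudo_mor CAT2 CommaMonad (Gamma_s1 (tgt \<alpha>))) (dat \<alpha>))"
    using transformation_Gamma_n1[OF SCoFib_NClCoFib(2)[OF a]] Gamma_strict1(1)[OF e(1)] Gamma_strict1(1)[OF e(2)] by simp
qed (use SC.cell2_ends[OF a] in simp_all)

lemma two_functor_Gamma_s: "two_functor SCoFib (Algs CAT2 CommaMonad) Gamma_s"
proof (rule two_functorI, goal_cases)
  case (3 \<P>)
  then show ?case using Gamma_strict0(1)[OF 3] by (simp add: Gamma_s_def)
next
  case (4 G)
  then show ?case using Gamma_strict1(2)[OF 4] by (simp add: Gamma_s_def del: Comma.Algs_cells1)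
next
  case (5 \<alpha>)
  then show ?case using Gamma_strict2[OF 5(1)] by (simp add: Gamma_s_def del: Comma.Algs_cells1 Comma.Algs_cells2)
qed (simp_all add: strict_SCoFib Comma.strict_Algs Gamma_s_def Gamma_s1_def Gamma_s0_def)

text \<open>The detour through pseudoalgebras supplies the cleavage; its action is the given strict
  algebra, so it is split by \<open>strict_algebra_iff\<close>.\<close>

lemma strict_algebra_cloven:
  assumes "strict_algebra CAT2 CommaMonad A"
  obtains \<P> where "\<P> \<in> cells0 SCoFib" "Gamma_s0 \<P> = A" "Gamma_n0 \<P> = strict_to_pseudo_alg CAT2 CommaMonad A"
proof -
  obtain \<P> where p: "ncloven \<P>" "Gamma_n0 \<P> = strict_to_pseudo_alg CAT2 CommaMonad A"
    using normal_pseudoalgebra_cloven[OF Comma.pseudoalgebra_strict[OF assms]] by metis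
  then have "Gamma_s0 \<P> = A"
    by (simp add: Gamma_n0_def strict_to_pseudo_alg_def Gamma_s0_def)
  moreover have "\<P> \<in> cells0 SCoFib" using p assms calculation ncloven.strict_algebra_iff by auto
  ultimately show thesis using that p by blast
qed

lemma Gamma_s0_inject:
  assumes "\<P> \<in> cells0 SCoFib" "\<Q> \<in> cells0 SCoFib" "Gamma_s0 \<P> = Gamma_s0 \<Q>" shows "\<P> = \<Q>"
  by (rule Gamma_n0_inject) (use assms Gamma_strict0(2)[OF assms(1)] Gamma_strict0(2)[OF assms(2)] in simp_all)

lemma two_isomorphism_Gamma_s:
  "two_isomorphism SCoFib (Algs CAT2 CommaMonad) (Gamma_s :: ('u ent cloven, 'u ent square, 'u ent square2, _, _, _) twofun)"
    (is "two_isomorphism _ _ ?\<Gamma>")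
  unfolding two_isomorphism_def
proof (intro conjI)
  show "two_functor SCoFib (Algs CAT2 CommaMonad) ?\<Gamma>" by (rule two_functor_Gamma_s)
  interpret F: twofunctor SCoFib "Algs CAT2 CommaMonad" ?\<Gamma>
    by (rule twofunctorI) (rule two_functor_Gamma_s)
  have 1: "\<exists>G\<in>cells1 SCoFib. Gamma_s1 G = F" if F: "F \<in> cells1 (Algs CAT2 CommaMonad)" for F :: "(_, 'u ent square) cell"
  proof -
    have A: "strict_algebra CAT2 CommaMonad (src F)" and B: "strict_algebra CAT2 CommaMonad (tgt F)" using F by simp_all
    obtain \<P> where p: "\<P> \<in> cells0 SCoFib" "Gamma_s0 \<P> = src F" "Gamma_n0 \<P> = strict_to_pseudo_alg CAT2 CommaMonad (src F)"
      by (rule strict_algebra_cloven[OF A])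
    obtain \<Q> where q: "\<Q> \<in> cells0 SCoFib" "Gamma_s0 \<Q> = tgt F" "Gamma_n0 \<Q> = strict_to_pseudo_alg CAT2 CommaMonad (tgt F)"
      by (rule strict_algebra_cloven[OF B])
    let ?F = "strict_to_pseudo_mor CAT2 CommaMonad F" and ?G = "Cell \<P> \<Q> (dat F)"
    have "ncloven \<P>" "ncloven \<Q>" using p q by simp_all
    \<comment> \<open>Viewed as a pseudomorphism, a strict morphism comes from a square that
      preserves cocartesian arrows; its identity comparison then says that lifts are preserved
      strictly.\<close>
    note d = pseudomorphism_determined[OF this Comma.pseudomorphism_strict[OF F]]
    have d: "ncloven_square \<P> \<Q> (dat F)" "?F = Gamma_n1 ?G"
      using d p q by (simp_all add: strict_to_pseudo_mor_def)
    have g: "Gamma_s1 ?G = F" by (rule cell_eqI) (simp_all add: p q)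
    have "?G \<in> cells1 SCoFib"
      using ncloven_square.strict_mor_iff[OF d(1)] p(1) q(1) d g by (simp add: SCoFib_cells1)
    then show ?thesis using g by blast
  qed
  have inj1: "G = H" if "G \<in> cells1 SCoFib" "H \<in> cells1 SCoFib" "Gamma_s1 G = Gamma_s1 H" for G H :: "'u ent cloven1"
  proof (rule cell_eqI)
    have e: "Gamma_s0 (src G) = Gamma_s0 (src H)" "Gamma_s0 (tgt G) = Gamma_s0 (tgt H)" "dat G = dat H"
      using that(3) by (metis Gamma_s1_sel)+
    show "src G = src H" "tgt G = tgt H" "dat G = dat H"
      using Gamma_s0_inject e SC.cell1_ends[OF that(1)] SC.cell1_ends[OF that(2)] by blast+
  qed
  show "bij_betw (map0 ?\<Gamma>) (cells0 SCoFib) (cells0 (Algs CAT2 CommaMonad))"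
  proof (rule bij_betw_imageI)
    show "inj_on (map0 ?\<Gamma>) (cells0 SCoFib)"
      by (rule inj_onI) (rule Gamma_s0_inject, simp_all add: Gamma_s_def)
    show "map0 ?\<Gamma> ` cells0 SCoFib = cells0 (Algs CAT2 CommaMonad)"
    proof
      show "map0 ?\<Gamma> ` cells0 SCoFib \<subseteq> cells0 (Algs CAT2 CommaMonad)" using F.map0_cell by blast
      show "cells0 (Algs CAT2 CommaMonad) \<subseteq> map0 ?\<Gamma> ` cells0 SCoFib"
      proof
        fix A :: "('u ent fctr, 'u ent fctr \<times> 'u ent fctr) alg" assume "A \<in> cells0 (Algs CAT2 CommaMonad)"
        then have "strict_algebra CAT2 CommaMonad A" by simp
        then obtain \<P> where p: "\<P> \<in> cells0 SCoFib" "Gamma_s0 \<P> = A" by (rule strict_algebra_cloven)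
        show "A \<in> map0 ?\<Gamma> ` cells0 SCoFib" by (rule image_eqI[OF _ p(1)]) (simp add: Gamma_s_def p)
      qed
    qed
  qed
  show "bij_betw (map1 ?\<Gamma>) (cells1 SCoFib) (cells1 (Algs CAT2 CommaMonad))"
  proof (rule bij_betw_imageI)
    show "inj_on (map1 ?\<Gamma>) (cells1 SCoFib)"
      by (rule inj_onI) (rule inj1, simp_all add: Gamma_s_def)
    show "map1 ?\<Gamma> ` cells1 SCoFib = cells1 (Algs CAT2 CommaMonad)"
    proof
      show "map1 ?\<Gamma> ` cells1 SCoFib \<subseteq> cells1 (Algs CAT2 CommaMonad)" using F.map1_cell(1) by blast
      show "cells1 (Algs CAT2 CommaMonad) \<subseteq> map1 ?\<Gamma> ` cells1 SCoFib"
      proof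
        fix A :: "(('u ent fctr, 'u ent fctr \<times> 'u ent fctr) alg, 'u ent square) cell" assume "A \<in> cells1 (Algs CAT2 CommaMonad)"
        from 1[OF this] obtain G where p: "G \<in> cells1 SCoFib" "Gamma_s1 G = A" by blast
        show "A \<in> map1 ?\<Gamma> ` cells1 SCoFib" by (rule image_eqI[OF _ p(1)]) (simp add: Gamma_s_def p)
      qed
    qed
  qed
  show "bij_betw (map2 ?\<Gamma>) (cells2 SCoFib) (cells2 (Algs CAT2 CommaMonad))"
  proof (rule bij_betw_imageI)
    show "inj_on (map2 ?\<Gamma>) (cells2 SCoFib)"
    proof (rule inj_onI)
      fix \<alpha> \<beta> :: "'u ent cloven2" assume a: "\<alpha> \<in> cells2 SCoFib" "\<beta> \<in> cells2 SCoFib" "map2 ?\<Gamma> \<alpha> = map2 ?\<Gamma> \<beta>"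
      have "src \<alpha> = src \<beta>" "tgt \<alpha> = tgt \<beta>"
        by (rule inj1; use a SC.cell2_ends(1,2)[OF a(1)] SC.cell2_ends(1,2)[OF a(2)] in \<open>simp add: Gamma_s_def\<close>)+
      then show "\<alpha> = \<beta>" using a(3) by (intro cell_eqI[of \<alpha> \<beta>]) (simp_all add: Gamma_s_def)
    qed
    show "map2 ?\<Gamma> ` cells2 SCoFib = cells2 (Algs CAT2 CommaMonad)"
    proof
      show "map2 ?\<Gamma> ` cells2 SCoFib \<subseteq> cells2 (Algs CAT2 CommaMonad)" using F.map2_cell(1) by blast
      show "cells2 (Algs CAT2 CommaMonad) \<subseteq> map2 ?\<Gamma> ` cells2 SCoFib"
      proof
        fix A :: "((('u ent fctr, 'u ent fctr \<times> 'u ent fctr) alg, 'u ent square) cell, 'u ent square2) cell"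
        assume A: "A \<in> cells2 (Algs CAT2 CommaMonad)"
        have a: "dat A \<in> cells2 CAT2" "src (dat A) = dat (src A)" "tgt (dat A) = dat (tgt A)"
          "src A \<in> cells1 (Algs CAT2 CommaMonad)" "tgt A \<in> cells1 (Algs CAT2 CommaMonad)"
          "src (src A) = src (tgt A)" "tgt (src A) = tgt (tgt A)"
          using A unfolding Comma.Algs_cells2 by (auto simp only:)
        obtain G where g: "G \<in> cells1 SCoFib" "Gamma_s1 G = src A" using 1[OF a(4)] by blast
        obtain H where h: "H \<in> cells1 SCoFib" "Gamma_s1 H = tgt A" using 1[OF a(5)] by blast
        have d: "dat G = dat (src A)" "dat H = dat (tgt A)" "Gamma_s0 (src G) = Gamma_s0 (src H)" "Gamma_s0 (tgt G) = Gamma_s0 (tgt H)"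
          using g(2) h(2) a(6,7) by (metis Gamma_s1_sel)+
        have "src G = src H" "tgt G = tgt H"
          using Gamma_s0_inject d(3,4) SC.cell1_ends[OF g(1)] SC.cell1_ends[OF h(1)] by blast+
        then have c: "Cell G H (dat A) \<in> cells2 SCoFib"
          unfolding SCoFib_cells2 cell.sel using g(1) h(1) d(1,2) a(1-3) by simp
        show "A \<in> map2 ?\<Gamma> ` cells2 SCoFib"
          by (rule image_eqI[OF _ c]) (auto simp: Gamma_s_def g h intro: cell_eqI)
      qed
    qed
  qed
qed

section \<open>The factorization system of a cofibration\<close>

interpretation Sq: tmonad CAT SqMonad
  by unfold_locales (rule two_monad_sq)

interpretation Kappa: colax CAT2 CommaMonad CAT SqMonad Dom kappa
  by unfold_locales (rule two_functor_Dom colax_kappa)+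

lemma Dom_sel [simp]: "map0 Dom P = src P" "map1 Dom s = top1 s" "map2 Dom \<sigma> = top1 \<sigma>"
  by (simp_all add: Dom_def)

lemma Fact_n_sel:
  "map0 Fact_n \<P> = restrict_ps_alg CommaMonad CAT SqMonad Dom kappa (Gamma_n0 \<P>)"
  "map1 Fact_n G = restrict_ps_mor CommaMonad CAT SqMonad Dom kappa (Gamma_n1 G)"
  "map2 Fact_n \<alpha> = Cell (restrict_ps_mor CommaMonad CAT SqMonad Dom kappa (Gamma_n1 (src \<alpha>)))
    (restrict_ps_mor CommaMonad CAT SqMonad Dom kappa (Gamma_n1 (tgt \<alpha>))) (map2 Dom (dat \<alpha>))"
  by (simp_all add: Fact_n_def twofun_comp_def kappa_ps_def restrict_ps_def Gamma_n_def)

lemma Fact_s_sel: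
  "map0 Fact_s \<P> = restrict_s_alg CAT Dom kappa (Gamma_s0 \<P>)"
  "map1 Fact_s G = restrict_s_mor CAT Dom kappa (Gamma_s1 G)"
  "map2 Fact_s \<alpha> = Cell (restrict_s_mor CAT Dom kappa (Gamma_s1 (src \<alpha>))) (restrict_s_mor CAT Dom kappa (Gamma_s1 (tgt \<alpha>)))
    (map2 Dom (dat \<alpha>))"
  by (simp_all add: Fact_s_def twofun_comp_def kappa_s_def restrict_s_def Gamma_s_def)

lemma kappa_fa:
  "z \<in> arr (sq_cat (src P)) \<Longrightarrow> fa (kappa P) z =
    mor (Pr (dm (src P) (mor_src z)) (fa P (mor_src z))) (Pr (dm (src P) (mor_tgt z)) (fa P (mor_tgt z)))
      (mor_fst z) (fa P (mor_snd z))"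
  by (simp add: kappa_def Let_def)

lemma isos_cmp:
  assumes C: "category C" and f: "f \<in> isos C" and g: "g \<in> isos C" and fg: "cd C f = dm C g"
  shows "cmp C g f \<in> isos C"
proof -
  obtain f' where f': "f \<in> arr C" "f' \<in> arr C" "dm C f' = cd C f" "cd C f' = dm C f"
    "cmp C f' f = idn C (dm C f)" "cmp C f f' = idn C (cd C f)" using f by (rule isosE)
  obtain g' where g': "g \<in> arr C" "g' \<in> arr C" "dm C g' = cd C g" "cd C g' = dm C g"
    "cmp C g' g = idn C (dm C g)" "cmp C g g' = idn C (cd C g)" using g by (rule isosE)
  have "cmp C g' (cmp C g f) = cmp C (cmp C g' g) f" "cmp C f (cmp C f' g') = cmp C (cmp C f f') g'"
    by (rule category_assoc[symmetric, OF C]; use f' g' fg in simp)+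
  then show ?thesis
    using C f' g' fg by (intro isosI[where g = "cmp C f' g'"]) simp_all
qed

context ncloven
begin

lemma vert_ex1:
  assumes f: "f \<in> arr E"
  shows "\<exists>!h. h \<in> vertical P \<and> h \<in> hom E (push \<P> (fa P f) (dm E f)) (cd E f) \<and> cmp E h (lift \<P> (dm E f) (fa P f)) = f"
proof -
  have x: "dm E f \<in> obj E" "fa P f \<in> arr B" "dm B (fa P f) = fo P (dm E f)" using f by simp_all
  obtain h where h: "h \<in> arr E" "dm E h = cd E (lift \<P> (dm E f) (fa P f))" "cd E h = cd E f"
    "cmp E h (lift \<P> (dm E f) (fa P f)) = f" "fa P h = idn B (fo P (cd E f))"
    by (rule cocart_lift[OF P_functor lift_facts(1)[OF x], of f "idn B (fo P (cd E f))"]) (use f in simp_all)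
  show ?thesis
  proof (rule ex1I[of _ h])
    fix h' assume "h' \<in> vertical P \<and> h' \<in> hom E (push \<P> (fa P f) (dm E f)) (cd E f) \<and> cmp E h' (lift \<P> (dm E f) (fa P f)) = f"
    with h x f show "h' = h" by - (rule lift_eqI[OF x], simp_all add: vertical_iff)
  qed (use h f in \<open>simp add: vertical_iff\<close>)
qed

lemma vert_part_facts [simp]:
  assumes f: "f \<in> arr E"
  shows "vert_part \<P> f \<in> arr E" "dm E (vert_part \<P> f) = push \<P> (fa P f) (dm E f)" "cd E (vert_part \<P> f) = cd E f"
    "fa P (vert_part \<P> f) = idn B (fo P (cd E f))" "cmp E (vert_part \<P> f) (lift \<P> (dm E f) (fa P f)) = f"
  using theI'[OF vert_ex1[OF f]] f unfolding vert_part_def Let_def by (auto simp: vertical_iff)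

lemma vert_part_eqI:
  assumes f: "f \<in> arr E" and h: "h \<in> arr E" "dm E h = push \<P> (fa P f) (dm E f)" "cd E h = cd E f"
    "fa P h = idn B (fo P (cd E f))" "cmp E h (lift \<P> (dm E f) (fa P f)) = f"
  shows "h = vert_part \<P> f"
  by (rule lift_eqI[of "dm E f" "fa P f"]) (use f h in simp_all)

abbreviation F where "F \<equiv> map0 Fact_n \<P>"

lemma Fact_facts:
  "ps_car F = E" "ps_act F = comp1 CAT (action_L \<P>) (kappa P)"
  by (simp_all add: Fact_n_sel Gamma_n0_def)

lemma Fact_obj: "f \<in> arr E \<Longrightarrow> fo (ps_act F) f = push \<P> (fa P f) (dm E f)"
  by (simp add: Fact_facts)

text \<open>\<open>kappa\<close> sends the square \<open>(1, f) : 1 -> f\<close> to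
  \<open>(1, P f) : (x, 1) -> (x, P f)\<close>, where the action returns the lift by
  \<open>lift_action\<close>.\<close>

lemma Fact_sel_e: "f \<in> arr E \<Longrightarrow> sel_e F f = lift \<P> (dm E f) (fa P f)"
  by (simp add: sel_e_def Fact_facts kappa_fa lift_action Let_def)

text \<open>\<open>kappa\<close> sends the square \<open>(f, 1) : f -> 1\<close> to
  \<open>(f, 1) : (x, P f) -> (y, 1)\<close>. At its target the lift is an identity by normality, so
  the action satisfies the equation that characterises \<open>vert_part\<close>.\<close>

lemma Fact_sel_m:
  assumes f: "f \<in> arr E" shows "sel_m F f = vert_part \<P> f"
proof -
  let ?z = "mor (Pr (dm E f) (fa P f)) (Pr (cd E f) (idn B (fo P (cd E f)))) f (idn B (fo P (cd E f)))"
  have z: "?z \<in> arr (comma P)" using f by simp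
  have "sel_m F f = fa (action_L \<P>) ?z" using f by (simp add: sel_m_def Fact_facts kappa_fa Let_def)
  moreover have "fa (action_L \<P>) ?z = vert_part \<P> f"
    by (rule vert_part_eqI[OF f]) (use action_L_fa[OF z] f in simp_all)
  ultimately show ?thesis by simp
qed

lemma vert_part_iso_iff:
  assumes f: "f \<in> arr E" shows "vert_part \<P> f \<in> isos E \<longleftrightarrow> f \<in> cocart P"
proof
  have x: "dm E f \<in> obj E" "fa P f \<in> arr B" "dm B (fa P f) = fo P (dm E f)" using f by simp_all
  assume i: "vert_part \<P> f \<in> isos E"
  have "cmp E (vert_part \<P> f) (lift \<P> (dm E f) (fa P f)) \<in> cocart P"
    by (rule cocart_cmp[OF P_functor lift_facts(1)[OF x] isos_cocart[OF P_functor i]]) (use f in simp)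
  then show "f \<in> cocart P" using f by simp
next
  assume c: "f \<in> cocart P"
  then show "vert_part \<P> f \<in> isos E"
  proof (rule cocart_factor)
    fix k assume k: "k \<in> isos E" "dm E k = push \<P> (fa P f) (dm E f)" "cd E k = cd E f" "cmp E k (lift \<P> (dm E f) (fa P f)) = f"
    have "dm E f \<in> obj E" "fa P f \<in> arr B" "dm B (fa P f) = fo P (dm E f)" using f by simp_all
    \<comment> \<open>The factor \<open>k\<close> comes without its image in the base, so the
      comparison is taken again together with it; being vertical, it is
      \<open>vert_part\<close>.\<close>
    then obtain h where h: "h \<in> isos E" "dm E h = cd E (lift \<P> (dm E f) (fa P f))" "cd E h = cd E f"
      "cmp E h (lift \<P> (dm E f) (fa P f)) = f" "fa P h = idn B (fo P (cd E (lift \<P> (dm E f) (fa P f))))"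
      using cocart_comparison[OF P_functor lift_facts(1) c, of "dm E f" "fa P f"] f lift_facts by metis
    have "h = vert_part \<P> f" by (rule vert_part_eqI[OF f]) (use h f in simp_all)
    then show ?thesis using h by simp
  qed
qed

lemma lift_iso_iff:
  assumes x: "x \<in> obj E" "u \<in> arr B" "dm B u = fo P x"
  shows "lift \<P> x u \<in> isos E \<longleftrightarrow> u \<in> isos B"
  using isos_functor[OF P_functor, of "lift \<P> x u"] cocart_fa_iso[OF P_functor, of "lift \<P> x u"] x by auto

lemma KT_Fact:
  "KT F = OFS E (cocart P) (inv_image_isos P) (restrict (\<lambda>f. lift \<P> (dm E f) (fa P f)) (arr E)) (restrict (vert_part \<P>) (arr E))"
proof -
  have "{f \<in> arr E. sel_m F f \<in> isos E} = cocart P"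
    by (auto simp: Fact_sel_m vert_part_iso_iff cocartD(1))
  moreover have "{f \<in> arr E. sel_e F f \<in> isos E} = inv_image_isos P"
    by (auto simp: Fact_sel_e inv_image_isos_def lift_iso_iff)
  moreover have "restrict (sel_e F) (arr E) = restrict (\<lambda>f. lift \<P> (dm E f) (fa P f)) (arr E)"
    "restrict (sel_m F) (arr E) = restrict (vert_part \<P>) (arr E)"
    by (auto simp: restrict_def fun_eq_iff Fact_sel_e Fact_sel_m)
  ultimately show ?thesis by (simp add: KT_def Fact_facts Let_def)
qed

text \<open>The image of a diagonal in the base is forced: with \<open>q\<close> the inverse of
  \<open>fa P r\<close> it is \<open>q\<close> after \<open>fa P b\<close>. Cocartesianness of
  \<open>l\<close> then supplies the unique arrow over it that extends \<open>a\<close>.\<close>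

lemma orthogonal_cocart: "orthogonal_fs E (cocart P) (inv_image_isos P)"
  unfolding orthogonal_fs_def
proof (intro conjI ballI impI)
  show "category E" by simp
  show "cocart P \<subseteq> arr E" by (auto simp: cocartD(1))
  show "inv_image_isos P \<subseteq> arr E" by (auto simp: inv_image_isos_def)
next
  fix W f i assume W: "W \<in> {cocart P, inv_image_isos P}" and f: "f \<in> W" and i: "i \<in> isos E"
  have ia: "i \<in> arr E" "fa P i \<in> isos B" using i isos_functor[OF P_functor i] by simp_all
  have fa: "f \<in> arr E" using W f by (auto simp: inv_image_isos_def cocartD(1))
  show "cmp E i f \<in> W" if "cd E f = dm E i"
  proof (cases "W = cocart P")
    case True
    then show ?thesis using cocart_cmp[OF P_functor _ isos_cocart[OF P_functor i] that] f by simp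
  next
    case False
    then have "W = inv_image_isos P" using W by simp
    then show ?thesis using f that ia fa isos_cmp[of B "fa P f" "fa P i"] by (simp add: inv_image_isos_def)
  qed
  show "cmp E f i \<in> W" if "cd E i = dm E f"
  proof (cases "W = cocart P")
    case True
    then show ?thesis using cocart_cmp[OF P_functor isos_cocart[OF P_functor i] _ that] f by simp
  next
    case False
    then have "W = inv_image_isos P" using W by simp
    then show ?thesis using f that ia fa isos_cmp[of B "fa P i" "fa P f"] by (simp add: inv_image_isos_def)
  qed
next
  fix f assume f: "f \<in> arr E"
  show "\<exists>e\<in>cocart P. \<exists>m\<in>inv_image_isos P. cd E e = dm E m \<and> cmp E m e = f"
    by (rule bexI[of _ "lift \<P> (dm E f) (fa P f)"], rule bexI[of _ "vert_part \<P> f"])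
      (use f in \<open>simp_all add: inv_image_isos_def\<close>)
next
  fix l r a b assume l: "l \<in> cocart P" and r: "r \<in> inv_image_isos P" and "a \<in> hom E (dm E l) (dm E r)"
    "b \<in> hom E (cd E l) (cd E r)" and eq: "cmp E r a = cmp E b l"
  then have ab: "a \<in> arr E" "dm E a = dm E l" "cd E a = dm E r" "b \<in> arr E" "dm E b = cd E l" "cd E b = cd E r"
    by simp_all
  have lr: "l \<in> arr E" "r \<in> arr E" "fa P r \<in> isos B" using cocartD(1)[OF l] r by (auto simp: inv_image_isos_def)
  obtain q where q: "q \<in> arr B" "dm B q = cd B (fa P r)" "cd B q = dm B (fa P r)"
    "cmp B q (fa P r) = idn B (dm B (fa P r))" "cmp B (fa P r) q = idn B (cd B (fa P r))"
    using lr(3) by (rule isosE)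
  have Peq: "cmp B (fa P r) (fa P a) = cmp B (fa P b) (fa P l)"
    by (rule functor_commute[OF eq P_functor]) (use ab lr in simp_all)
  have qa: "cmp B (cmp B q (fa P b)) (fa P l) = fa P a"
  proof -
    have "cmp B (cmp B q (fa P b)) (fa P l) = cmp B q (cmp B (fa P b) (fa P l))"
      by (rule category_assoc) (use q ab lr in simp_all)
    also have "\<dots> = cmp B (cmp B q (fa P r)) (fa P a)"
      unfolding Peq[symmetric] by (rule category_assoc[symmetric]) (use q ab lr in simp_all)
    finally show ?thesis unfolding q(4) using ab lr by simp
  qed
  have qb: "cmp B (fa P r) (cmp B q (fa P b)) = fa P b"
  proof -
    have "cmp B (fa P r) (cmp B q (fa P b)) = cmp B (cmp B (fa P r) q) (fa P b)"
      by (rule category_assoc[symmetric]) (use q ab lr in simp_all)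
    then show ?thesis unfolding q(5) using ab lr by simp
  qed
  obtain d where d: "d \<in> arr E" "dm E d = cd E l" "cd E d = cd E a" "cmp E d l = a" "fa P d = cmp B q (fa P b)"
    by (rule cocart_lift[OF P_functor l, of a "cmp B q (fa P b)"]) (use ab lr q qa in simp_all)
  \<comment> \<open>Both arrows have the same image and the same composite with \<open>l\<close>,
    and the cocartesian \<open>l\<close> can be cancelled.\<close>
  have rd: "cmp E r d = b"
  proof (rule cocart_unique[OF P_functor l])
    have "cmp E (cmp E r d) l = cmp E r (cmp E d l)"
      by (rule category_assoc) (use d ab lr in simp_all)
    then show "cmp E (cmp E r d) l = cmp E b l" using d(4) eq by simp
  qed (use d ab lr qb in simp_all)
  show "\<exists>!d. d \<in> hom E (cd E l) (dm E r) \<and> cmp E d l = a \<and> cmp E r d = b"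
  proof (rule ex1I[of _ d])
    show "d \<in> hom E (cd E l) (dm E r) \<and> cmp E d l = a \<and> cmp E r d = b" using d rd ab by simp
    fix d' assume "d' \<in> hom E (cd E l) (dm E r) \<and> cmp E d' l = a \<and> cmp E r d' = b"
    then have d': "d' \<in> arr E" "dm E d' = cd E l" "cd E d' = dm E r" "cmp E d' l = a" "cmp E r d' = b" by simp_all
    \<comment> \<open>Uniqueness: the equation \<open>r d' = b\<close> determines the image of
      \<open>d'\<close>, because \<open>q\<close> cancels \<open>fa P r\<close>.\<close>
    have "fa P d' = cmp B (cmp B q (fa P r)) (fa P d')" unfolding q(4) using d' lr by simp
    also have "\<dots> = cmp B q (cmp B (fa P r) (fa P d'))" by (rule category_assoc) (use q d' lr in simp_all)
    also have "\<dots> = fa P d" using arg_cong[OF d'(5), of "fa P"] d'(1-3) lr d(5) by simp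
    finally show "d' = d" by - (rule cocart_unique[OF P_functor l], use d d' ab in simp_all)
  qed
qed

lemma OFSch0I:
  assumes "orthogonal_fs C L R"
    "\<And>f. f \<in> arr C \<Longrightarrow> e f \<in> L \<and> m f \<in> R \<and> cd C (e f) = dm C (m f) \<and> cmp C (m f) (e f) = f"
    "\<And>x. x \<in> obj C \<Longrightarrow> e (idn C x) = idn C x \<and> m (idn C x) = idn C x"
    "e \<in> extensional (arr C)" "m \<in> extensional (arr C)"
  shows "OFS C L R e m \<in> OFSch0"
  using assms by (simp add: OFSch0_def)

text \<open>The clause that identities are factored as identities is normality of the cleavage: the
  lift over an identity is an identity, and then so is the vertical part.\<close>

lemma KT_Fact_OFS: "KT F \<in> OFSch0"
  unfolding KT_Fact
proof (rule OFSch0I)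
  show "restrict (\<lambda>f. lift \<P> (dm E f) (fa P f)) (arr E) f \<in> cocart P \<and>
     restrict (vert_part \<P>) (arr E) f \<in> inv_image_isos P \<and>
     cd E (restrict (\<lambda>f. lift \<P> (dm E f) (fa P f)) (arr E) f) = dm E (restrict (vert_part \<P>) (arr E) f) \<and>
     cmp E (restrict (vert_part \<P>) (arr E) f) (restrict (\<lambda>f. lift \<P> (dm E f) (fa P f)) (arr E) f) = f"
    if "f \<in> arr E" for f
    using that by (simp add: inv_image_isos_def)
  fix x assume x: "x \<in> obj E"
  have "idn E x = vert_part \<P> (idn E x)" by (rule vert_part_eqI) (use x in simp_all)
  then show "restrict (\<lambda>f. lift \<P> (dm E f) (fa P f)) (arr E) (idn E x) = idn E x \<and>
      restrict (vert_part \<P>) (arr E) (idn E x) = idn E x"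
    using x by simp
qed (simp_all add: orthogonal_cocart)

end

lemma (in ncloven_square) Fact_comparison:
  assumes f: "f \<in> arr P.E"
  shows "dat (snd (dat (map1 Fact_n G))) f = theta_comp G (fa P.P f) (dm P.E f)"
  using f theta_trans by (simp add: Fact_n_sel Gamma_n0_def)

lemma (in ncloven_square) theta_unique:
  assumes x: "x \<in> obj P.E" "u \<in> arr P.B" "dm P.B u = fo P.P x"
  shows "h \<in> vertical Q.P \<and> h \<in> isos Q.E \<and> h \<in> hom Q.E (push \<Q> (fa S u) (fo T x)) (fo T (push \<P> u x)) \<and>
       cmp Q.E h (lift \<Q> (fo T x) (fa S u)) = fa T (lift \<P> x u) \<longleftrightarrow> h = theta_comp G u x"
  using theta_ex1[OF x] theI'[OF theta_ex1[OF x]] unfolding theta_comp_def Let_def by (auto simp del: in_hom)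

text \<open>Being a restriction to split cleavages is expressed in all three dimensions by factoring
  \<open>Fact_n\<close> as \<open>Fact_s\<close> followed by \<open>strict_to_pseudo\<close>: on
  split data the restricted structure cells are identities.\<close>

theorem theorem6p7:
  shows
    "colax_monad_morphism CAT2 CommaMonad CAT SqMonad Dom (kappa :: 'u ent fctr \<Rightarrow> 'u ent fctr) \<and>
     two_isomorphism NClCoFib (PsAlgn CAT2 CommaMonad)
       (Gamma_n :: ('u ent cloven, 'u ent square, 'u ent square2, _, _, _) twofun) \<and>
     two_functor (PsAlgn CAT2 CommaMonad) (PsAlgn CAT SqMonad)
       (kappa_ps :: (_, _, _, 'u sq_psalg, _, _) twofun) \<and>
     two_functor NClCoFib (PsAlgn CAT SqMonad)
       (Fact_n :: (_, _, _, 'u sq_psalg, _, _) twofun) \<and>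
     (\<forall>\<P> :: 'u ent cloven. \<P> \<in> cells0 NClCoFib \<longrightarrow>
       (let P = prj \<P>; E = tot \<P>; A = map0 Fact_n \<P>; F = ps_act A;
            \<delta> = (\<lambda>f. lift \<P> (dm E f) (fa P f)); \<nu> = vert_part \<P>
        in ps_car A = E \<and>
           F = comp1 CAT (action_L \<P>) (kappa P) \<and>
           (\<forall>x y. \<forall>f\<in>hom E x y.
              fo F f = push \<P> (fa P f) x \<and>
              sel_e A f = lift \<P> x (fa P f) \<and> lift \<P> x (fa P f) \<in> hom E x (push \<P> (fa P f) x) \<and>
              sel_m A f = \<nu> f \<and> \<nu> f \<in> hom E (push \<P> (fa P f) x) y \<and>
              f = cmp E (\<nu> f) (lift \<P> x (fa P f))) \<and>
           KT A = OFS E (cocart P) (inv_image_isos P) (restrict \<delta> (arr E)) (restrict \<nu> (arr E)) \<and>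
           KT A \<in> OFSch0)) \<and>
     (\<forall>G :: 'u ent cloven1. G \<in> cells1 NClCoFib \<longrightarrow>
       (let \<P> = src G; \<Q> = tgt G; P = prj \<P>; Q = prj \<Q>; T = top1 (dat G); S = bot1 (dat G);
            E = tot \<P>; E' = tot \<Q>; \<theta> = dat (snd (dat (map1 Fact_n G)))
        in fst (dat (map1 Fact_n G)) = T \<and>
           (\<forall>x y. \<forall>f\<in>hom E x y.
              fa Q (fa T f) = fa S (fa P f) \<and>
              (\<forall>h. h \<in> vertical Q \<and> h \<in> isos E' \<and>
                   h \<in> hom E' (push \<Q> (fa Q (fa T f)) (fo T x)) (fo T (push \<P> (fa P f) x)) \<and>
                   cmp E' h (lift \<Q> (fo T x) (fa Q (fa T f))) = fa T (lift \<P> x (fa P f))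
                 \<longleftrightarrow> h = \<theta> f)))) \<and>
     two_isomorphism SCoFib (Algs CAT2 CommaMonad)
       (Gamma_s :: ('u ent cloven, 'u ent square, 'u ent square2, _, _, _) twofun) \<and>
     two_functor (Algs CAT2 CommaMonad) (Algs CAT SqMonad)
       (kappa_s :: (_, _, _, _, 'u ent fctr, _) twofun) \<and>
     two_functor SCoFib (Algs CAT SqMonad)
       (Fact_s :: (_, _, _, _, 'u ent fctr, _) twofun) \<and>
     two_functor SCoFib NClCoFib
       (twofun_id :: ('u ent cloven, 'u ent square, 'u ent square2, _, _, _) twofun) \<and>
     two_functor (Algs CAT SqMonad) (PsAlgn CAT SqMonad)
       (strict_to_pseudo CAT SqMonad :: (_, _, _, 'u sq_psalg, _, _) twofun) \<and>
     (\<forall>\<P> :: 'u ent cloven. \<P> \<in> cells0 SCoFib \<longrightarrow>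
       map0 Fact_n \<P> = map0 (strict_to_pseudo CAT SqMonad) (map0 Fact_s \<P>)) \<and>
     (\<forall>G :: 'u ent cloven1. G \<in> cells1 SCoFib \<longrightarrow>
       map1 Fact_n G = map1 (strict_to_pseudo CAT SqMonad) (map1 Fact_s G)) \<and>
     (\<forall>\<alpha> :: 'u ent cloven2. \<alpha> \<in> cells2 SCoFib \<longrightarrow>
       map2 Fact_n \<alpha> = map2 (strict_to_pseudo CAT SqMonad) (map2 Fact_s \<alpha>))"
proof (intro conjI allI impI)
  show "colax_monad_morphism CAT2 CommaMonad CAT SqMonad Dom (kappa :: 'u ent fctr \<Rightarrow> 'u ent fctr)"
    by (rule colax_kappa)
  show "two_isomorphism NClCoFib (PsAlgn CAT2 CommaMonad)
       (Gamma_n :: ('u ent cloven, 'u ent square, 'u ent square2, _, _, _) twofun)"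
    by (rule two_isomorphism_Gamma_n)
  show k: "two_functor (PsAlgn CAT2 CommaMonad) (PsAlgn CAT SqMonad)
       (kappa_ps :: (_, _, _, 'u sq_psalg, _, _) twofun)"
    unfolding kappa_ps_def by (rule Kappa.two_functor_restrict_ps)
  show "two_functor NClCoFib (PsAlgn CAT SqMonad) (Fact_n :: (_, _, _, 'u sq_psalg, _, _) twofun)"
    unfolding Fact_n_def by (rule two_functor_comp[OF two_functor_Gamma_n k])
  show "two_isomorphism SCoFib (Algs CAT2 CommaMonad)
       (Gamma_s :: ('u ent cloven, 'u ent square, 'u ent square2, _, _, _) twofun)"
    by (rule two_isomorphism_Gamma_s)
  show s: "two_functor (Algs CAT2 CommaMonad) (Algs CAT SqMonad)
       (kappa_s :: (_, _, _, _, 'u ent fctr, _) twofun)"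
    unfolding kappa_s_def by (rule Kappa.two_functor_restrict_s)
  show "two_functor SCoFib (Algs CAT SqMonad) (Fact_s :: (_, _, _, _, 'u ent fctr, _) twofun)"
    unfolding Fact_s_def by (rule two_functor_comp[OF two_functor_Gamma_s s])
  show "two_functor SCoFib NClCoFib
       (twofun_id :: ('u ent cloven, 'u ent square, 'u ent square2, _, _, _) twofun)"
    by (rule two_functor_inclusion)
  show "two_functor (Algs CAT SqMonad) (PsAlgn CAT SqMonad)
       (strict_to_pseudo CAT SqMonad :: (_, _, _, 'u sq_psalg, _, _) twofun)"
    by (rule Sq.two_functor_strict_to_pseudo)
next
  fix \<P> :: "'u ent cloven" assume "\<P> \<in> cells0 NClCoFib"
  then interpret ncloven \<P> by simp
  show "let P = prj \<P>; E = tot \<P>; A = map0 Fact_n \<P>; F = ps_act A;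
            \<delta> = (\<lambda>f. lift \<P> (dm E f) (fa P f)); \<nu> = vert_part \<P>
        in ps_car A = E \<and>
           F = comp1 CAT (action_L \<P>) (kappa P) \<and>
           (\<forall>x y. \<forall>f\<in>hom E x y.
              fo F f = push \<P> (fa P f) x \<and>
              sel_e A f = lift \<P> x (fa P f) \<and> lift \<P> x (fa P f) \<in> hom E x (push \<P> (fa P f) x) \<and>
              sel_m A f = \<nu> f \<and> \<nu> f \<in> hom E (push \<P> (fa P f) x) y \<and>
              f = cmp E (\<nu> f) (lift \<P> x (fa P f))) \<and>
           KT A = OFS E (cocart P) (inv_image_isos P) (restrict \<delta> (arr E)) (restrict \<nu> (arr E)) \<and>
           KT A \<in> OFSch0"
    unfolding Let_def using Fact_facts KT_Fact KT_Fact_OFS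
    by (auto simp: Fact_obj[simplified Fact_facts] Fact_sel_e Fact_sel_m)
next
  fix G :: "'u ent cloven1" assume G: "G \<in> cells1 NClCoFib"
  then interpret ncloven_square "src G" "tgt G" "dat G" by (simp add: NClCoFib_cells1)
  show "let \<P> = src G; \<Q> = tgt G; P = prj \<P>; Q = prj \<Q>; T = top1 (dat G); S = bot1 (dat G);
            E = tot \<P>; E' = tot \<Q>; \<theta> = dat (snd (dat (map1 Fact_n G)))
        in fst (dat (map1 Fact_n G)) = T \<and>
           (\<forall>x y. \<forall>f\<in>hom E x y.
              fa Q (fa T f) = fa S (fa P f) \<and>
              (\<forall>h. h \<in> vertical Q \<and> h \<in> isos E' \<and>
                   h \<in> hom E' (push \<Q> (fa Q (fa T f)) (fo T x)) (fo T (push \<P> (fa P f) x)) \<and>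
                   cmp E' h (lift \<Q> (fo T x) (fa Q (fa T f))) = fa T (lift \<P> x (fa P f))
                 \<longleftrightarrow> h = \<theta> f))"
    unfolding Let_def
  proof (intro conjI allI ballI)
    show "fst (dat (map1 Fact_n G)) = T" by (simp add: Fact_n_sel)
    fix x y f assume f: "f \<in> hom P.E x y"
    then show e: "fa Q.P (fa T f) = fa S (fa P.P f)" by simp
    have "x \<in> obj P.E" using f category_arr(1)[of P.E f] by simp
    then show "h \<in> vertical Q.P \<and> h \<in> isos Q.E \<and>
         h \<in> hom Q.E (push (tgt G) (fa Q.P (fa T f)) (fo T x)) (fo T (push (src G) (fa P.P f) x)) \<and>
         cmp Q.E h (lift (tgt G) (fo T x) (fa Q.P (fa T f))) = fa T (lift (src G) x (fa P.P f)) \<longleftrightarrow>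
         h = dat (snd (dat (map1 Fact_n G))) f" for h
      unfolding e using theta_unique[of x "fa P.P f" h] Fact_comparison[of f] f by simp
  qed
next
  fix \<P> :: "'u ent cloven" assume p: "\<P> \<in> cells0 SCoFib"
  show "map0 Fact_n \<P> = map0 (strict_to_pseudo CAT SqMonad) (map0 Fact_s \<P>)"
    using Kappa.restrict_strict_alg[OF Gamma_strict0(1)[OF p]] Gamma_strict0(2)[OF p]
    by (simp add: Fact_n_sel Fact_s_sel strict_to_pseudo_def)
next
  fix G :: "'u ent cloven1" assume g: "G \<in> cells1 SCoFib"
  show "map1 Fact_n G = map1 (strict_to_pseudo CAT SqMonad) (map1 Fact_s G)"
    using Kappa.restrict_strict_mor[OF Gamma_strict1(2)[OF g]] Gamma_strict1(1)[OF g]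
    by (simp add: Fact_n_sel Fact_s_sel strict_to_pseudo_def)
next
  fix \<alpha> :: "'u ent cloven2" assume a: "\<alpha> \<in> cells2 SCoFib"
  \<comment> \<open>A 2-cell carries its source and target 1-cells, so agreement on 1-cells is
    needed for both ends.\<close>
  have 1: "restrict_ps_mor CommaMonad CAT SqMonad Dom kappa (Gamma_n1 G) =
      strict_to_pseudo_mor CAT SqMonad (restrict_s_mor CAT Dom kappa (Gamma_s1 G))" if "G \<in> cells1 SCoFib" for G :: "'u ent cloven1"
    using Kappa.restrict_strict_mor[OF Gamma_strict1(2)[OF that]] Gamma_strict1(1)[OF that] by simp
  show "map2 Fact_n \<alpha> = map2 (strict_to_pseudo CAT SqMonad) (map2 Fact_s \<alpha>)"
    using 1[OF SC.cell2_ends(1)[OF a]] 1[OF SC.cell2_ends(2)[OF a]]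
    by (simp add: Fact_n_sel Fact_s_sel strict_to_pseudo_def)
qed

end
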